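(* Let $\mathcal T=(\mathfrak A_1,\mathfrak A_2,\mathfrak A_3,\varphi_0)$ be a trialitarian triple over an arbitrary field $F$, where $\mathfrak A_i=(A_i,\sigma_i,\mathfrak f_i)$ for $i=1,2,3$. If $A_1$, $A_2$ and $A_3$ are split, then there is a composition $\mathcal C$ of quadratic spaces of dimension $8$ over $F$ such that $\mathcal T\simeq\mathrm{End}(\mathcal C)$. The composition $\mathcal C$ is uniquely determined up to similitude.
   Context: Quadratic pairs. A quadratic pair on a central simple $F$-algebra $A$ is a pair $(\sigma,\mathfrak f)$ where $\sigma$ is an $F$-linear involution on $A$, orthogonal if $\mathrm{char} F\neq2$ and symplectic if $\mathrm{char}F=2$, and $\mathfrak f\colon \mathrm{Sym}(\sigma)=\{s\in A\mid\sigma(s)=s\}\to F$ is a linear map (the semitrace) with $\mathfrak f(x+\sigma(x))=\mathrm{Trd}_A(x)$ for all $x\in A$. Write $\mathfrak A=(A,\sigma,\mathfrak f)$. For a finite-dimensional quadratic space $(V,q)$ with nonsingular polar form $b(x,y)=q(x+y)-q(x)-q(y)$, identify $V\otimes V=\mathrm{End}\,V$ by letting $x\otimes y$ be the map $z\mapsto x\,b(y,z)$; then $(\mathrm{End}\,V,\sigma_b,\mathfrak f_q)$ is an algebra with quadratic pair, where $\sigma_b$ is the adjoint involution of $b$ and $\mathfrak f_q(x\otimes x)=q(x)$. Clifford algebras. For $\deg A$ even, the Clifford algebra $C(\mathfrak A)$ is an $F$-algebra with a linear map $c\colon A\to C(\mathfrak A)$ whose image generates it, functorial and compatible with scalar extension,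 such that for $\mathfrak A=(\mathrm{End}\,V,\sigma_b,\mathfrak f_q)$ it is the even Clifford algebra $C_0(V,q)$ with $c(x\otimes y)=x\cdot y$ (this determines $C(\mathfrak A)$ as a quotient of the tensor algebra of $A$, by descent from a splitting field). Its center $Z$ is a quadratic étale $F$-algebra. It has the canonical involution $\underline\sigma$ with $\underline\sigma(c(a))=c(\sigma(a))$. If $\deg A\equiv0\bmod 8$, it has the canonical semitrace $\underline{\mathfrak f}\colon \mathrm{Sym}(\underline\sigma)\to Z$, $\underline{\mathfrak f}(s)=\mathrm{Trd}_{C(\mathfrak A)}(c(a)s)$ for any $a\in A$ with $\mathrm{Trd}_A(a)=1$. Write $\mathfrak C(\mathfrak A)=(C(\mathfrak A),\underline\sigma,\underline{\mathfrak f})$. Isomorphisms of algebras with quadratic pair are algebra isomorphisms commuting with the involutions and the semitraces. An isomorphism $\gamma\colon\mathfrak A\to\tilde{\mathfrak A}$ induces $C(\gamma)\colon C(\mathfrak A)\to C(\tilde{\mathfrak A})$ with $C(\gamma)(c(a))=c(\gamma(a))$. Trialitarian triples. A trialitarian triple over $F$ is a 4-tuple $(\mathfrak A_1,\mathfrak A_2,\mathfrak A_3,\varphi_0)$ where $\mathfrak A_i=(A_i,\sigma_i,\mathfrak f_i)$ is a central simple $F$-algebra of degree 8 with quadratic pair and $\varphi_0\colon\mathfrak C(\mathfrak A_1)\xrightarrow{\sim}\mathfrak A_2\times\mathfrak A_3$ is an isomorphism of algebras with quadratic pair. An isomorphism $(\mathfrak A_1,\mathfrak A_2,\mathfrak A_3,\varphi_0)\to(\tilde{\mathfrak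 A}_1,\tilde{\mathfrak A}_2,\tilde{\mathfrak A}_3,\tilde\varphi_0)$ is a triple of isomorphisms of algebras with quadratic pair $\gamma_i\colon\mathfrak A_i\to\tilde{\mathfrak A}_i$ with $(\gamma_2\times\gamma_3)\circ\varphi_0=\tilde\varphi_0\circ C(\gamma_1)$. Compositions. A composition of quadratic spaces over $F$ is a 4-tuple $\mathcal C=((V_1,q_1),(V_2,q_2),(V_3,q_3),*_3)$ where the $(V_i,q_i)$ are finite-dimensional quadratic spaces of the same dimension ($=\dim\mathcal C$) with nonsingular polar forms $b_i$ and $*_3\colon V_1\times V_2\to V_3$ is bilinear with $q_3(x_1*_3x_2)=q_1(x_1)q_2(x_2)$. Its derived maps $*_1\colon V_2\times V_3\to V_1$ and $*_2\colon V_3\times V_1\to V_2$ are the bilinear maps determined by $b_1(x_1,x_2*_1x_3)=b_2(x_2,x_3*_2x_1)=b_3(x_3,x_1*_3x_2)$. A similitude $\mathcal C\to\tilde{\mathcal C}$ is a triple of similitudes $g_i\colon(V_i,q_i)\to(\tilde V_i,\tilde q_i)$ (linear bijections with $\tilde q_i(g_i(x))=\mu(g_i)q_i(x)$, $\mu(g_i)\in F^\times$) such that for some $\lambda_3\in F^\times$, $\lambda_3g_3(x_1*_3x_2)=g_1(x_1)\,\tilde *_3\,g_2(x_2)$ for all $x_1,x_2$. The triple $\mathrm{End}(\mathcal C)$. If $\dim\mathcal C=8$, for $x_1\in V_1$ let $\ell_{x_1}\colon V_2\to V_3$, $x_2\mapsto x_1*_3x_2$ and $r_{x_1}\colon V_3\to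 V_2$, $x_3\mapsto x_3*_2x_1$. The map $\alpha\colon V_1\to\mathrm{End}(V_2\oplus V_3)$, $x_1\mapsto\begin{pmatrix}0&r_{x_1}\\ \ell_{x_1}&0\end{pmatrix}$, extends to an $F$-algebra homomorphism $C(\alpha)$ on $C(V_1,q_1)$ which restricts to an isomorphism of algebras with quadratic pair $C_0(\alpha)\colon \mathfrak C(\mathrm{End}\,V_1,\sigma_{b_1},\mathfrak f_{q_1})\to(\mathrm{End}\,V_2,\sigma_{b_2},\mathfrak f_{q_2})\times(\mathrm{End}\,V_3,\sigma_{b_3},\mathfrak f_{q_3})$. Then $\mathrm{End}(\mathcal C)=\big((\mathrm{End}\,V_1,\sigma_{b_1},\mathfrak f_{q_1}),(\mathrm{End}\,V_2,\sigma_{b_2},\mathfrak f_{q_2}),(\mathrm{End}\,V_3,\sigma_{b_3},\mathfrak f_{q_3}),C_0(\alpha)\big)$ is a trialitarian triple. *)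

theory Defs
  imports
    "HOL-Analysis.Finite_Cartesian_Product"
    "HOL-Library.Numeral_Type"
    "HOL-Library.Product_Plus"
    "HOL-Library.Poly_Mapping"
    "HOL-Algebra.QuotRing"
    "HOL-Algebra.Algebraic_Closure_Type"
    "Jordan_Normal_Form.VS_Connect"
begin

hide_const (open) Multiset.mult Polynomial.smult Ring_Hom.ring_hom

section \<open>Algebras over a field\<close>

text \<open>
  The base field is a type \<open>'f :: field\<close>; an \<open>F\<close>-algebra is a HOL-Algebra \<open>module\<close> record
  whose ring part is a (not necessarily commutative) ring. Vector spaces carrying quadratic forms
  are types with a scalar multiplication, as in \<open>HOL.Vector_Spaces\<close>.
\<close>

definition is_algebra :: "('f::field, 'a, 'm) module_scheme \<Rightarrow> bool" where
  "is_algebra A \<longleftrightarrow> ring A \<and> vectorspace class_ring A \<and>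
     (\<forall>c. \<forall>x\<in>carrier A. \<forall>y\<in>carrier A.
        (c \<odot>\<^bsub>A\<^esub> x) \<otimes>\<^bsub>A\<^esub> y = c \<odot>\<^bsub>A\<^esub> (x \<otimes>\<^bsub>A\<^esub> y) \<and>
        x \<otimes>\<^bsub>A\<^esub> (c \<odot>\<^bsub>A\<^esub> y) = c \<odot>\<^bsub>A\<^esub> (x \<otimes>\<^bsub>A\<^esub> y))"

definition alg_hom ::
  "('f::field, 'a, 'm) module_scheme \<Rightarrow> ('f, 'b, 'n) module_scheme \<Rightarrow> ('a \<Rightarrow> 'b) set" where
  "alg_hom A B = {h \<in> ring_hom A B. \<forall>c. \<forall>x\<in>carrier A. h (c \<odot>\<^bsub>A\<^esub> x) = c \<odot>\<^bsub>B\<^esub> h x}"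

definition alg_iso ::
  "('f::field, 'a, 'm) module_scheme \<Rightarrow> ('f, 'b, 'n) module_scheme \<Rightarrow> ('a \<Rightarrow> 'b) set" where
  "alg_iso A B = {h \<in> alg_hom A B. bij_betw h (carrier A) (carrier B)}"

definition centre :: "('f::field, 'a, 'm) module_scheme \<Rightarrow> 'a set" where
  "centre A = {z \<in> carrier A. \<forall>x\<in>carrier A. z \<otimes>\<^bsub>A\<^esub> x = x \<otimes>\<^bsub>A\<^esub> z}"

abbreviation alg_dim :: "('f::field, 'a, 'm) module_scheme \<Rightarrow> nat" where
  "alg_dim A \<equiv> vectorspace.dim class_ring A"

text \<open>Central simple \<open>F\<close>-algebras of degree \<open>n\<close>, i.e. of dimension \<open>n\<^sup>2\<close>.\<close>
definition central_simple :: "('f::field, 'a, 'm) module_scheme \<Rightarrow> nat \<Rightarrow> bool" where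
  "central_simple A n \<longleftrightarrow> is_algebra A \<and>
     vectorspace.fin_dim class_ring A \<and> alg_dim A = n\<^sup>2 \<and>
     \<one>\<^bsub>A\<^esub> \<noteq> \<zero>\<^bsub>A\<^esub> \<and>
     (\<forall>I. ideal I A \<longrightarrow> I = {\<zero>\<^bsub>A\<^esub>} \<or> I = carrier A) \<and>
     centre A = {c \<odot>\<^bsub>A\<^esub> \<one>\<^bsub>A\<^esub> | c. True}"

definition split_algebra :: "('f::field, 'a, 'm) module_scheme \<Rightarrow> bool" where
  "split_algebra A \<longleftrightarrow> (\<exists>n h. h \<in> alg_iso A (module_mat TYPE('f) n n))"


section \<open>Reduced trace\<close>

text \<open>
  Let \<open>A\<close> be an algebra which is Azumaya of constant degree \<open>n\<close> over its centre \<open>Z\<close>, where \<open>Z\<close> is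
  etale over \<open>F\<close>. Both cases of interest are of this form: central simple algebras (\<open>Z = F\<close>) and
  Clifford algebras (\<open>Z\<close> quadratic etale). The \<open>F\<close>-algebra homomorphisms from \<open>A\<close> to the
  \<open>n \<times> n\<close> matrices over the algebraic closure \<open>K\<close> of \<open>F\<close> are the splittings
  \<open>A \<otimes>\<^sub>Z K \<cong> M\<^sub>n(K)\<close>, one up to conjugation for each homomorphism \<open>Z \<rightarrow> K\<close>.
  \<open>Trd_centre\<close> takes its values in \<open>Z\<close>; for central simple algebras, \<open>Trd\<close> is the same trace with
  values in \<open>F\<close>.
\<close>

definition degree_over_centre :: "('f::field, 'a, 'm) module_scheme \<Rightarrow> nat" where
  "degree_over_centre A = (THE n. alg_dim A = n\<^sup>2 * alg_dim (A\<lparr>carrier := centre A\<rparr>))"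

definition splittings ::
  "('f::field, 'a, 'm) module_scheme \<Rightarrow> ('a \<Rightarrow> 'f alg_closure mat) set" where
  "splittings A =
     (let n = degree_over_centre A in
      {\<rho> \<in> ring_hom A (module_mat TYPE('f alg_closure) n n).
         \<forall>c. \<forall>x\<in>carrier A. \<rho> (c \<odot>\<^bsub>A\<^esub> x) = to_ac c \<cdot>\<^sub>m \<rho> x})"

definition mat_trace :: "'k::comm_ring_1 mat \<Rightarrow> 'k" where
  "mat_trace M = sum_list (diag_mat M)"

definition Trd_centre :: "('f::field, 'a, 'm) module_scheme \<Rightarrow> 'a \<Rightarrow> 'a" where
  "Trd_centre A a = (THE z. z \<in> centre A \<and>
     (\<forall>\<rho>\<in>splittings A. \<rho> z = mat_trace (\<rho> a) \<cdot>\<^sub>m 1\<^sub>m (degree_over_centre A)))"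

definition Trd :: "('f::field, 'a, 'm) module_scheme \<Rightarrow> 'a \<Rightarrow> 'f" where
  "Trd A a = (THE t. \<forall>\<rho>\<in>splittings A. mat_trace (\<rho> a) = to_ac t)"


section \<open>Involutions and quadratic pairs\<close>

definition involution_on :: "('f::field, 'a, 'm) module_scheme \<Rightarrow> ('a \<Rightarrow> 'a) \<Rightarrow> bool" where
  "involution_on A \<sigma> \<longleftrightarrow> \<sigma> \<in> carrier A \<rightarrow> carrier A \<and>
     (\<forall>x\<in>carrier A. \<sigma> (\<sigma> x) = x) \<and>
     (\<forall>x\<in>carrier A. \<forall>y\<in>carrier A. \<sigma> (x \<oplus>\<^bsub>A\<^esub> y) = \<sigma> x \<oplus>\<^bsub>A\<^esub> \<sigma> y) \<and>
     (\<forall>x\<in>carrier A. \<forall>y\<in>carrier A. \<sigma> (x \<otimes>\<^bsub>A\<^esub> y) = \<sigma> y \<otimes>\<^bsub>A\<^esub> \<sigma> x) \<and>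
     (\<forall>c. \<forall>x\<in>carrier A. \<sigma> (c \<odot>\<^bsub>A\<^esub> x) = c \<odot>\<^bsub>A\<^esub> \<sigma> x)"

definition Sym :: "('f::field, 'a, 'm) module_scheme \<Rightarrow> ('a \<Rightarrow> 'a) \<Rightarrow> 'a set" where
  "Sym A \<sigma> = {s \<in> carrier A. \<sigma> s = s}"

definition alternating_mat :: "'k::comm_ring_1 mat \<Rightarrow> bool" where
  "alternating_mat g \<longleftrightarrow> transpose_mat g = - g \<and> (\<forall>i<dim_row g. g $$ (i, i) = 0)"

text \<open>
  Symplectic means: over a splitting field, adjoint to a nonsingular alternating bilinear form.
  For the form \<open>b(x,y) = x\<^sup>T g y\<close> the matrix equation below says
  \<open>b(x, a y) = b(\<sigma>(a) x, y)\<close>. An \<open>F\<close>-linear involution which is not symplectic is orthogonal.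
\<close>
definition symplectic_involution ::
  "('f::field, 'a, 'm) module_scheme \<Rightarrow> ('a \<Rightarrow> 'a) \<Rightarrow> bool" where
  "symplectic_involution A \<sigma> \<longleftrightarrow> involution_on A \<sigma> \<and>
     (\<exists>\<rho>\<in>splittings A. \<exists>g\<in>carrier_mat (degree_over_centre A) (degree_over_centre A).
        invertible_mat g \<and> alternating_mat g \<and>
        (\<forall>a\<in>carrier A. g * \<rho> a = transpose_mat (\<rho> (\<sigma> a)) * g))"

definition orthogonal_involution ::
  "('f::field, 'a, 'm) module_scheme \<Rightarrow> ('a \<Rightarrow> 'a) \<Rightarrow> bool" where
  "orthogonal_involution A \<sigma> \<longleftrightarrow> involution_on A \<sigma> \<and> \<not> symplectic_involution A \<sigma>"

text \<open>
  An algebra with an involution and a semitrace. The type \<open>'z\<close> of the values of the semitrace is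
  \<open>'f\<close> for quadratic pairs on central simple \<open>F\<close>-algebras. It is \<open>'a\<close> for Clifford algebras and for
  products of two algebras, where the semitrace takes its values in the centre. The semitrace is
  relevant only on the symmetric elements.
\<close>
record ('f, 'a, 'z) qp_algebra = "('f, 'a) module" +
  invol :: "'a \<Rightarrow> 'a"
  semitrace :: "'a \<Rightarrow> 'z"

definition linear_on_Sym ::
  "('f::field, 'a, 'm) module_scheme \<Rightarrow> ('a \<Rightarrow> 'a) \<Rightarrow> ('a \<Rightarrow> 'f) \<Rightarrow> bool" where
  "linear_on_Sym A \<sigma> f \<longleftrightarrow>
     (\<forall>s\<in>Sym A \<sigma>. \<forall>t\<in>Sym A \<sigma>. f (s \<oplus>\<^bsub>A\<^esub> t) = f s + f t) \<and>
     (\<forall>c. \<forall>s\<in>Sym A \<sigma>. f (c \<odot>\<^bsub>A\<^esub> s) = c * f s)"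

definition quadratic_pair :: "('f::field, 'a, 'f) qp_algebra \<Rightarrow> bool" where
  "quadratic_pair A \<longleftrightarrow>
     (if CHAR('f) = 2 then symplectic_involution A (invol A)
      else orthogonal_involution A (invol A)) \<and>
     linear_on_Sym A (invol A) (semitrace A) \<and>
     (\<forall>x\<in>carrier A. semitrace A (x \<oplus>\<^bsub>A\<^esub> invol A x) = Trd A x)"

definition qp_iso ::
  "('f::field, 'a, 'f) qp_algebra \<Rightarrow> ('f, 'b, 'f) qp_algebra \<Rightarrow> ('a \<Rightarrow> 'b) \<Rightarrow> bool" where
  "qp_iso A B \<gamma> \<longleftrightarrow> \<gamma> \<in> alg_iso A B \<and>
     (\<forall>a\<in>carrier A. \<gamma> (invol A a) = invol B (\<gamma> a)) \<and>
     (\<forall>s\<in>Sym A (invol A). semitrace B (\<gamma> s) = semitrace A s)"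

definition qp_iso_centre ::
  "('f::field, 'a, 'a) qp_algebra \<Rightarrow> ('f, 'b, 'b) qp_algebra \<Rightarrow> ('a \<Rightarrow> 'b) \<Rightarrow> bool" where
  "qp_iso_centre A B \<gamma> \<longleftrightarrow> \<gamma> \<in> alg_iso A B \<and>
     (\<forall>a\<in>carrier A. \<gamma> (invol A a) = invol B (\<gamma> a)) \<and>
     (\<forall>s\<in>Sym A (invol A). semitrace B (\<gamma> s) = \<gamma> (semitrace A s))"

text \<open>The centre \<open>F \<times> F\<close> of the product is embedded as \<open>(s, t) \<mapsto> (s \<cdot> 1, t \<cdot> 1)\<close>.\<close>
definition qp_prod ::
  "('f::field, 'a, 'f) qp_algebra \<Rightarrow> ('f, 'b, 'f) qp_algebra \<Rightarrow> ('f, 'a \<times> 'b, 'a \<times> 'b) qp_algebra"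
where
  "qp_prod A B =
     \<lparr>carrier = carrier A \<times> carrier B,
      mult = (\<lambda>(x, y) (x', y'). (x \<otimes>\<^bsub>A\<^esub> x', y \<otimes>\<^bsub>B\<^esub> y')),
      one = (\<one>\<^bsub>A\<^esub>, \<one>\<^bsub>B\<^esub>),
      zero = (\<zero>\<^bsub>A\<^esub>, \<zero>\<^bsub>B\<^esub>),
      add = (\<lambda>(x, y) (x', y'). (x \<oplus>\<^bsub>A\<^esub> x', y \<oplus>\<^bsub>B\<^esub> y')),
      smult = (\<lambda>c (x, y). (c \<odot>\<^bsub>A\<^esub> x, c \<odot>\<^bsub>B\<^esub> y)),
      invol = (\<lambda>(x, y). (invol A x, invol B y)),
      semitrace = (\<lambda>(x, y). (semitrace A x \<odot>\<^bsub>A\<^esub> \<one>\<^bsub>A\<^esub>, semitrace B y \<odot>\<^bsub>B\<^esub> \<one>\<^bsub>B\<^esub>))\<rparr>"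


section \<open>Free algebras and quotients\<close>

text \<open>
  With words as an additive monoid under concatenation, \<open>'x list \<Rightarrow>\<^sub>0 'f\<close> is, with the convolution
  product of \<open>HOL-Library.Poly_Mapping\<close>, the free unital associative algebra on \<open>'x\<close>.
\<close>
instantiation list :: (type) monoid_add
begin

definition zero_list :: "'a list" where "zero_list = []"
definition plus_list :: "'a list \<Rightarrow> 'a list \<Rightarrow> 'a list" where "plus_list = (@)"

instance by standard (simp_all add: zero_list_def plus_list_def)

end

definition free_algebra :: "'x set \<Rightarrow> ('f::field, 'x list \<Rightarrow>\<^sub>0 'f) module" where
  "free_algebra S =
     \<lparr>carrier = {t. Poly_Mapping.keys t \<subseteq> lists S},
      mult = (*), one = 1, zero = 0, add = (+),
      smult = (\<lambda>c t. Poly_Mapping.single [] c * t)\<rparr>"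

abbreviation fgen :: "'x \<Rightarrow> 'x list \<Rightarrow>\<^sub>0 'f::field" where
  "fgen x \<equiv> Poly_Mapping.single [x] 1"

abbreviation fconst :: "'f::field \<Rightarrow> 'x list \<Rightarrow>\<^sub>0 'f" where
  "fconst c \<equiv> Poly_Mapping.single [] c"

definition quot_algebra ::
  "('f::field, 'a, 'm) module_scheme \<Rightarrow> 'a set \<Rightarrow> ('f, 'a set) module" where
  "quot_algebra R I =
     \<lparr>carrier = a_rcosets\<^bsub>R\<^esub> I,
      mult = rcoset_mult R I,
      one = I +>\<^bsub>R\<^esub> \<one>\<^bsub>R\<^esub>,
      zero = I,
      add = set_add R,
      smult = (\<lambda>c U. \<Union>x\<in>U. I +>\<^bsub>R\<^esub> (c \<odot>\<^bsub>R\<^esub> x))\<rparr>"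


section \<open>The Clifford algebra of an algebra with quadratic pair\<close>

text \<open>
  The general definition of \<open>C(A, \<sigma>, f)\<close> as a quotient of the tensor algebra of \<open>A\<close>, following
  Knus, Merkurjev, Rost and Tignol, The Book of Involutions, Section 8.B. The linear relations turn
  the free algebra on the set \<open>A\<close> into the tensor algebra \<open>T(A)\<close>; the other relations are
  \<^item> \<open>s = f(s)\<close> for \<open>s\<close> symmetric;
  \<^item> \<open>u = Sand(u)(l)\<close> for \<open>u = \<Sum>\<^sub>i a\<^sub>i \<otimes> b\<^sub>i\<close> in \<open>A \<otimes> A\<close> fixed under \<open>\<sigma>\<^sub>2\<close>. Here
    \<open>Sand(u)(x) = \<Sum>\<^sub>i a\<^sub>i x b\<^sub>i\<close>, the map \<open>\<sigma>\<^sub>2\<close> is defined by \<open>Sand(\<sigma>\<^sub>2(u)) = Sand(u) \<circ> \<sigma>\<close>, and \<open>l\<close> is any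
    element of \<open>A\<close> with \<open>f(s) = Trd(l s)\<close> for all symmetric \<open>s\<close>.

  For \<open>A = End V\<close>, the symmetric elements are spanned by the \<open>x \<otimes> x\<close> and the \<open>x \<otimes> y + y \<otimes> x\<close>. With
  \<open>c(x \<otimes> y) = x \<cdot> y\<close> the first family of relations reads \<open>x \<cdot> x = q(x)\<close>. Moreover \<open>\<sigma>\<^sub>2\<close> maps
  \<open>(x \<otimes> y) \<otimes> (z \<otimes> w)\<close> to \<open>(x \<otimes> z) \<otimes> (y \<otimes> w)\<close>, and
  \<open>(x \<otimes> y) l (y \<otimes> w) = b(y, l(y)) x \<otimes> w = Trd(l (y \<otimes> y)) x \<otimes> w = q(y) x \<otimes> w\<close>, so the second family
  reads \<open>(x \<cdot> y) \<cdot> (y \<cdot> w) = q(y) x \<cdot> w\<close>. This is the presentation of \<open>C\<^sub>0(V, q)\<close>.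
\<close>
definition clifford_relations :: "('f::field, 'a, 'f) qp_algebra \<Rightarrow> ('a list \<Rightarrow>\<^sub>0 'f) set" where
  "clifford_relations A =
     {fgen (a \<oplus>\<^bsub>A\<^esub> b) - fgen a - fgen b | a b. a \<in> carrier A \<and> b \<in> carrier A} \<union>
     {fgen (c \<odot>\<^bsub>A\<^esub> a) - fconst c * fgen a | c a. a \<in> carrier A} \<union>
     {fgen s - fconst (semitrace A s) | s. s \<in> Sym A (invol A)} \<union>
     {(\<Sum>i<m. fgen (a i) * fgen (b i) - fgen (a i \<otimes>\<^bsub>A\<^esub> l \<otimes>\<^bsub>A\<^esub> b i)) | (m::nat) a b l.
        (\<forall>i<m. a i \<in> carrier A \<and> b i \<in> carrier A) \<and>
        (\<forall>x\<in>carrier A. (\<Oplus>\<^bsub>A\<^esub>i\<in>{..<m}. a i \<otimes>\<^bsub>A\<^esub> invol A x \<otimes>\<^bsub>A\<^esub> b i) =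
                       (\<Oplus>\<^bsub>A\<^esub>i\<in>{..<m}. a i \<otimes>\<^bsub>A\<^esub> x \<otimes>\<^bsub>A\<^esub> b i)) \<and>
        l \<in> carrier A \<and> (\<forall>s\<in>Sym A (invol A). semitrace A s = Trd A (l \<otimes>\<^bsub>A\<^esub> s))}"

definition clifford_ideal :: "('f::field, 'a, 'f) qp_algebra \<Rightarrow> ('a list \<Rightarrow>\<^sub>0 'f) set" where
  "clifford_ideal A = genideal (free_algebra (carrier A)) (clifford_relations A)"

definition clifford_algebra ::
  "('f::field, 'a, 'f) qp_algebra \<Rightarrow> ('f, ('a list \<Rightarrow>\<^sub>0 'f) set) module" where
  "clifford_algebra A = quot_algebra (free_algebra (carrier A)) (clifford_ideal A)"

definition clifford_map :: "('f::field, 'a, 'f) qp_algebra \<Rightarrow> 'a \<Rightarrow> ('a list \<Rightarrow>\<^sub>0 'f) set" where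
  "clifford_map A a =
     clifford_ideal A +>\<^bsub>(free_algebra (carrier A) :: ('f, 'a list \<Rightarrow>\<^sub>0 'f) module)\<^esub> fgen a"

text \<open>
  Maps that are determined by their values on generators are specified by definite description;
  membership in \<open>extensional\<close> only fixes the irrelevant values outside the carrier.
\<close>
definition clifford_invol ::
  "('f::field, 'a, 'f) qp_algebra \<Rightarrow> ('a list \<Rightarrow>\<^sub>0 'f) set \<Rightarrow> ('a list \<Rightarrow>\<^sub>0 'f) set" where
  "clifford_invol A = (THE \<tau>. \<tau> \<in> extensional (carrier (clifford_algebra A)) \<and>
     involution_on (clifford_algebra A) \<tau> \<and>
     (\<forall>a\<in>carrier A. \<tau> (clifford_map A a) = clifford_map A (invol A a)))"

text \<open>The canonical semitrace does not depend on the choice of \<open>a\<close> when the degree is divisible by 8.\<close>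
definition clifford_semitrace ::
  "('f::field, 'a, 'f) qp_algebra \<Rightarrow> ('a list \<Rightarrow>\<^sub>0 'f) set \<Rightarrow> ('a list \<Rightarrow>\<^sub>0 'f) set" where
  "clifford_semitrace A s = (THE z. \<forall>a\<in>carrier A. Trd A a = 1 \<longrightarrow>
     z = Trd_centre (clifford_algebra A) (clifford_map A a \<otimes>\<^bsub>clifford_algebra A\<^esub> s))"

definition clifford_qp ::
  "('f::field, 'a, 'f) qp_algebra \<Rightarrow> ('f, ('a list \<Rightarrow>\<^sub>0 'f) set, ('a list \<Rightarrow>\<^sub>0 'f) set) qp_algebra"
where
  "clifford_qp A = module.extend (clifford_algebra A)
     \<lparr>invol = clifford_invol A, semitrace = clifford_semitrace A\<rparr>"

definition clifford_induced ::
  "('f::field, 'a, 'f) qp_algebra \<Rightarrow> ('f, 'b, 'f) qp_algebra \<Rightarrow> ('a \<Rightarrow> 'b) \<Rightarrow>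
   ('a list \<Rightarrow>\<^sub>0 'f) set \<Rightarrow> ('b list \<Rightarrow>\<^sub>0 'f) set" where
  "clifford_induced A B \<gamma> = (THE h. h \<in> extensional (carrier (clifford_algebra A)) \<and>
     h \<in> alg_hom (clifford_algebra A) (clifford_algebra B) \<and>
     (\<forall>a\<in>carrier A. h (clifford_map A a) = clifford_map B (\<gamma> a)))"


section \<open>Trialitarian triples\<close>

type_synonym ('f, 'a, 'b, 'c) triple =
  "('f, 'a, 'f) qp_algebra \<times> ('f, 'b, 'f) qp_algebra \<times> ('f, 'c, 'f) qp_algebra \<times>
   (('a list \<Rightarrow>\<^sub>0 'f) set \<Rightarrow> 'b \<times> 'c)"

definition trialitarian_triple :: "('f::field, 'a, 'b, 'c) triple \<Rightarrow> bool" where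
  "trialitarian_triple = (\<lambda>(A\<^sub>1, A\<^sub>2, A\<^sub>3, \<phi>\<^sub>0).
     central_simple A\<^sub>1 8 \<and> quadratic_pair A\<^sub>1 \<and>
     central_simple A\<^sub>2 8 \<and> quadratic_pair A\<^sub>2 \<and>
     central_simple A\<^sub>3 8 \<and> quadratic_pair A\<^sub>3 \<and>
     qp_iso_centre (clifford_qp A\<^sub>1) (qp_prod A\<^sub>2 A\<^sub>3) \<phi>\<^sub>0)"

definition triple_isomorphic ::
  "('f::field, 'a, 'b, 'c) triple \<Rightarrow> ('f, 'a2, 'b2, 'c2) triple \<Rightarrow> bool" where
  "triple_isomorphic = (\<lambda>(A\<^sub>1, A\<^sub>2, A\<^sub>3, \<phi>\<^sub>0) (B\<^sub>1, B\<^sub>2, B\<^sub>3, \<psi>\<^sub>0).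
     \<exists>\<gamma>\<^sub>1 \<gamma>\<^sub>2 \<gamma>\<^sub>3. qp_iso A\<^sub>1 B\<^sub>1 \<gamma>\<^sub>1 \<and> qp_iso A\<^sub>2 B\<^sub>2 \<gamma>\<^sub>2 \<and> qp_iso A\<^sub>3 B\<^sub>3 \<gamma>\<^sub>3 \<and>
       (\<forall>\<xi>\<in>carrier (clifford_algebra A\<^sub>1).
          map_prod \<gamma>\<^sub>2 \<gamma>\<^sub>3 (\<phi>\<^sub>0 \<xi>) = \<psi>\<^sub>0 (clifford_induced A\<^sub>1 B\<^sub>1 \<gamma>\<^sub>1 \<xi>)))"


section \<open>Quadratic spaces\<close>

record ('f, 'v) quad_space =
  scal :: "'f \<Rightarrow> 'v \<Rightarrow> 'v"
  form :: "'v \<Rightarrow> 'f"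

definition polar :: "('f::field, 'v::ab_group_add) quad_space \<Rightarrow> 'v \<Rightarrow> 'v \<Rightarrow> 'f" where
  "polar V x y = form V (x + y) - form V x - form V y"

definition quadratic_space :: "('f::field, 'v::ab_group_add) quad_space \<Rightarrow> bool" where
  "quadratic_space V \<longleftrightarrow>
     (\<exists>B. finite_dimensional_vector_space (scal V) B) \<and>
     (\<forall>c x. form V (scal V c x) = c\<^sup>2 * form V x) \<and>
     (\<forall>x. Vector_Spaces.linear (scal V) (*) (polar V x)) \<and>
     (\<forall>x. (\<forall>y. polar V x y = 0) \<longrightarrow> x = 0)"

abbreviation space_dim :: "('f::field, 'v::ab_group_add) quad_space \<Rightarrow> nat" where
  "space_dim V \<equiv> vector_space.dim (scal V) UNIV"

definition similitude ::
  "('f::field, 'v::ab_group_add) quad_space \<Rightarrow> ('f, 'w::ab_group_add) quad_space \<Rightarrow> ('v \<Rightarrow> 'w) \<Rightarrow> bool"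
where
  "similitude V W g \<longleftrightarrow> Vector_Spaces.linear (scal V) (scal W) g \<and> bij g \<and>
     (\<exists>\<mu>. \<mu> \<noteq> 0 \<and> (\<forall>x. form W (g x) = \<mu> * form V x))"

definition End_algebra :: "('f::field \<Rightarrow> 'v::ab_group_add \<Rightarrow> 'v) \<Rightarrow> ('f, 'v \<Rightarrow> 'v) module" where
  "End_algebra s =
     \<lparr>carrier = {h. Vector_Spaces.linear s s h},
      mult = (\<circ>), one = id, zero = (\<lambda>_. 0), add = (\<lambda>h k x. h x + k x),
      smult = (\<lambda>c h x. s c (h x))\<rparr>"

definition tens :: "('f::field, 'v::ab_group_add) quad_space \<Rightarrow> 'v \<Rightarrow> 'v \<Rightarrow> 'v \<Rightarrow> 'v" where
  "tens V x y = (\<lambda>z. scal V (polar V y z) x)"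

definition adjoint_invol ::
  "('f::field, 'v::ab_group_add) quad_space \<Rightarrow> ('v \<Rightarrow> 'v) \<Rightarrow> ('v \<Rightarrow> 'v)" where
  "adjoint_invol V h = (THE k. Vector_Spaces.linear (scal V) (scal V) k \<and>
     (\<forall>x y. polar V x (h y) = polar V (k x) y))"

text \<open>The semitrace \<open>f\<^sub>q\<close>; it is determined by \<open>f\<^sub>q(x \<otimes> x) = q(x)\<close> because these elements span.\<close>
definition form_semitrace ::
  "('f::field, 'v::ab_group_add) quad_space \<Rightarrow> ('v \<Rightarrow> 'v) \<Rightarrow> 'f" where
  "form_semitrace V = (THE f.
     f \<in> extensional (Sym (End_algebra (scal V)) (adjoint_invol V)) \<and>
     linear_on_Sym (End_algebra (scal V)) (adjoint_invol V) f \<and>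
     (\<forall>x. f (tens V x x) = form V x))"

definition End_qp ::
  "('f::field, 'v::ab_group_add) quad_space \<Rightarrow> ('f, 'v \<Rightarrow> 'v, 'f) qp_algebra" where
  "End_qp V = module.extend (End_algebra (scal V))
     \<lparr>invol = adjoint_invol V, semitrace = form_semitrace V\<rparr>"


section \<open>Clifford algebras of quadratic spaces\<close>

definition quad_clifford_ideal ::
  "('f::field, 'v::ab_group_add) quad_space \<Rightarrow> ('v list \<Rightarrow>\<^sub>0 'f) set" where
  "quad_clifford_ideal V = genideal (free_algebra UNIV)
     ({fgen (x + y) - fgen x - fgen y | x y. True} \<union>
      {fgen (scal V c x) - fconst c * fgen x | c x. True} \<union>
      {fgen x * fgen x - fconst (form V x) | x. True})"

definition quad_clifford ::
  "('f::field, 'v::ab_group_add) quad_space \<Rightarrow> ('f, ('v list \<Rightarrow>\<^sub>0 'f) set) module" where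
  "quad_clifford V = quot_algebra (free_algebra UNIV) (quad_clifford_ideal V)"

definition quad_clifford_class ::
  "('f::field, 'v::ab_group_add) quad_space \<Rightarrow> ('v list \<Rightarrow>\<^sub>0 'f) \<Rightarrow> ('v list \<Rightarrow>\<^sub>0 'f) set" where
  "quad_clifford_class V t =
     quad_clifford_ideal V +>\<^bsub>(free_algebra UNIV :: ('f, 'v list \<Rightarrow>\<^sub>0 'f) module)\<^esub> t"

text \<open>\<open>C\<^sub>0(V, q)\<close>, spanned by the products of an even number of vectors\<close>
definition even_clifford ::
  "('f::field, 'v::ab_group_add) quad_space \<Rightarrow> ('f, ('v list \<Rightarrow>\<^sub>0 'f) set) module" where
  "even_clifford V = (quad_clifford V)\<lparr>carrier :=
     {quad_clifford_class V t | t. \<forall>w\<in>Poly_Mapping.keys t. even (length w)}\<rparr>"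

text \<open>The identification \<open>C(End V, \<sigma>\<^sub>b, f\<^sub>q) = C\<^sub>0(V, q)\<close>, \<open>c(x \<otimes> y) = x \<cdot> y\<close>.\<close>
definition clifford_identification ::
  "('f::field, 'v::ab_group_add) quad_space \<Rightarrow>
   (('v \<Rightarrow> 'v) list \<Rightarrow>\<^sub>0 'f) set \<Rightarrow> ('v list \<Rightarrow>\<^sub>0 'f) set" where
  "clifford_identification V = (THE h. h \<in> extensional (carrier (clifford_algebra (End_qp V))) \<and>
     h \<in> alg_hom (clifford_algebra (End_qp V)) (even_clifford V) \<and>
     (\<forall>x y. h (clifford_map (End_qp V) (tens V x y)) = quad_clifford_class V (fgen x * fgen y)))"

definition quad_clifford_extension ::
  "('f::field, 'v::ab_group_add) quad_space \<Rightarrow> ('f, 'b, 'm) module_scheme \<Rightarrow> ('v \<Rightarrow> 'b) \<Rightarrow>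
   ('v list \<Rightarrow>\<^sub>0 'f) set \<Rightarrow> 'b" where
  "quad_clifford_extension V B \<alpha> = (THE h. h \<in> extensional (carrier (quad_clifford V)) \<and>
     h \<in> alg_hom (quad_clifford V) B \<and>
     (\<forall>x. h (quad_clifford_class V (fgen x)) = \<alpha> x))"


section \<open>Compositions\<close>

type_synonym ('f, 'u, 'v, 'w) comp =
  "('f, 'u) quad_space \<times> ('f, 'v) quad_space \<times> ('f, 'w) quad_space \<times> ('u \<Rightarrow> 'v \<Rightarrow> 'w)"

definition composition ::
  "('f::field, 'u::ab_group_add, 'v::ab_group_add, 'w::ab_group_add) comp \<Rightarrow> nat \<Rightarrow> bool" where
  "composition = (\<lambda>(V\<^sub>1, V\<^sub>2, V\<^sub>3, star) n.
     quadratic_space V\<^sub>1 \<and> quadratic_space V\<^sub>2 \<and> quadratic_space V\<^sub>3 \<and>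
     space_dim V\<^sub>1 = n \<and> space_dim V\<^sub>2 = n \<and> space_dim V\<^sub>3 = n \<and>
     (\<forall>x\<^sub>1. Vector_Spaces.linear (scal V\<^sub>2) (scal V\<^sub>3) (star x\<^sub>1)) \<and>
     (\<forall>x\<^sub>2. Vector_Spaces.linear (scal V\<^sub>1) (scal V\<^sub>3) (\<lambda>x\<^sub>1. star x\<^sub>1 x\<^sub>2)) \<and>
     (\<forall>x\<^sub>1 x\<^sub>2. form V\<^sub>3 (star x\<^sub>1 x\<^sub>2) = form V\<^sub>1 x\<^sub>1 * form V\<^sub>2 x\<^sub>2))"

definition composition_similar ::
  "('f::field, 'u::ab_group_add, 'v::ab_group_add, 'w::ab_group_add) comp \<Rightarrow>
   ('f, 'u2::ab_group_add, 'v2::ab_group_add, 'w2::ab_group_add) comp \<Rightarrow> bool" where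
  "composition_similar = (\<lambda>(V\<^sub>1, V\<^sub>2, V\<^sub>3, star) (W\<^sub>1, W\<^sub>2, W\<^sub>3, star').
     \<exists>g\<^sub>1 g\<^sub>2 g\<^sub>3. similitude V\<^sub>1 W\<^sub>1 g\<^sub>1 \<and> similitude V\<^sub>2 W\<^sub>2 g\<^sub>2 \<and> similitude V\<^sub>3 W\<^sub>3 g\<^sub>3 \<and>
       (\<exists>l\<^sub>3. l\<^sub>3 \<noteq> 0 \<and>
          (\<forall>x\<^sub>1 x\<^sub>2. scal W\<^sub>3 l\<^sub>3 (g\<^sub>3 (star x\<^sub>1 x\<^sub>2)) = star' (g\<^sub>1 x\<^sub>1) (g\<^sub>2 x\<^sub>2))))"

text \<open>
  The derived map \<open>*\<^sub>2 : V\<^sub>3 \<times> V\<^sub>1 \<rightarrow> V\<^sub>2\<close>, with \<open>b\<^sub>2(x\<^sub>2, x\<^sub>3 *\<^sub>2 x\<^sub>1) = b\<^sub>3(x\<^sub>3, x\<^sub>1 *\<^sub>3 x\<^sub>2)\<close>. The other derived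
  map does not enter the definition of \<open>End(C)\<close>.
\<close>
definition derived2 ::
  "('f::field, 'u::ab_group_add, 'v::ab_group_add, 'w::ab_group_add) comp \<Rightarrow> 'w \<Rightarrow> 'u \<Rightarrow> 'v" where
  "derived2 = (\<lambda>(V\<^sub>1, V\<^sub>2, V\<^sub>3, star) x\<^sub>3 x\<^sub>1.
     THE y. \<forall>x\<^sub>2. polar V\<^sub>2 x\<^sub>2 y = polar V\<^sub>3 x\<^sub>3 (star x\<^sub>1 x\<^sub>2))"

definition comp_alpha ::
  "('f::field, 'u::ab_group_add, 'v::ab_group_add, 'w::ab_group_add) comp \<Rightarrow>
   'u \<Rightarrow> 'v \<times> 'w \<Rightarrow> 'v \<times> 'w" where
  "comp_alpha C x\<^sub>1 = (case C of (V\<^sub>1, V\<^sub>2, V\<^sub>3, star) \<Rightarrow>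
     \<lambda>(x\<^sub>2, x\<^sub>3). (derived2 C x\<^sub>3 x\<^sub>1, star x\<^sub>1 x\<^sub>2))"

text \<open>
  \<open>C(\<alpha>)\<close> on \<open>C(V\<^sub>1, q\<^sub>1)\<close>, and \<open>C\<^sub>0(\<alpha>)\<close> obtained by restricting it to \<open>C\<^sub>0(V\<^sub>1, q\<^sub>1) = C(End V\<^sub>1)\<close>, where
  its values are block diagonal, and taking the two diagonal blocks.
\<close>
definition comp_C_alpha ::
  "('f::field, 'u::ab_group_add, 'v::ab_group_add, 'w::ab_group_add) comp \<Rightarrow>
   ('u list \<Rightarrow>\<^sub>0 'f) set \<Rightarrow> 'v \<times> 'w \<Rightarrow> 'v \<times> 'w" where
  "comp_C_alpha C = (case C of (V\<^sub>1, V\<^sub>2, V\<^sub>3, star) \<Rightarrow>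
     quad_clifford_extension V\<^sub>1
       (End_algebra (\<lambda>c (x\<^sub>2, x\<^sub>3). (scal V\<^sub>2 c x\<^sub>2, scal V\<^sub>3 c x\<^sub>3))) (comp_alpha C))"

definition comp_C0_alpha ::
  "('f::field, 'u::ab_group_add, 'v::ab_group_add, 'w::ab_group_add) comp \<Rightarrow>
   (('u \<Rightarrow> 'u) list \<Rightarrow>\<^sub>0 'f) set \<Rightarrow> ('v \<Rightarrow> 'v) \<times> ('w \<Rightarrow> 'w)" where
  "comp_C0_alpha C \<xi> =
     (let h = comp_C_alpha C (clifford_identification (fst C) \<xi>)
      in (\<lambda>x\<^sub>2. fst (h (x\<^sub>2, 0)), \<lambda>x\<^sub>3. snd (h (0, x\<^sub>3))))"

definition End_comp ::
  "('f::field, 'u::ab_group_add, 'v::ab_group_add, 'w::ab_group_add) comp \<Rightarrow>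
   ('f, 'u \<Rightarrow> 'u, 'v \<Rightarrow> 'v, 'w \<Rightarrow> 'w) triple" where
  "End_comp C = (case C of (V\<^sub>1, V\<^sub>2, V\<^sub>3, star) \<Rightarrow>
     (End_qp V\<^sub>1, End_qp V\<^sub>2, End_qp V\<^sub>3, comp_C0_alpha C))"

end

theory Submission
  imports Defs "HOL-Analysis.Cartesian_Space"
begin

text \<open>
  For a split quadratic pair \<open>End V\<close>, the Clifford algebra is generated by the elements
  \<open>m(x, y) = c(x \<otimes> y)\<close> subject to \<open>m(x, x) = q(x)\<close> and \<open>m(x, y) m(y, z) = q(y) m(x, z)\<close>. In a composition,
  the operators \<open>l\<^sub>x v = x *\<^sub>3 v\<close> and \<open>r\<^sub>x w = w *\<^sub>2 x\<close> satisfy \<open>r\<^sub>x l\<^sub>x = q(x) = l\<^sub>x r\<^sub>x\<close>, and \<open>C\<^sub>0(\<alpha>)\<close> is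
  \<open>m(x, y) \<mapsto> (r\<^sub>x l\<^sub>y, l\<^sub>x r\<^sub>y)\<close>.

  Uniqueness: isomorphisms of split quadratic pairs are induced by similitudes, by the
  Skolem--Noether theorem. They are compatible with the multiplications up to an operator that
  commutes with all \<open>l\<^sub>x r\<^sub>y\<close>, that is, up to a scalar.

  Existence: the two components of \<open>\<phi>\<^sub>0\<close> are representations \<open>\<mu>\<^sub>2\<close>, \<open>\<mu>\<^sub>3\<close> of the Clifford
  algebra on \<open>V\<^sub>2\<close>, \<open>V\<^sub>3\<close>, and the condition on the semitraces becomes
  \<open>b\<^sub>2(v, \<mu>\<^sub>2(x, y) v) = b\<^sub>1(x, y) q\<^sub>2(v)\<close>. The twist of \<open>\<mu>\<^sub>2\<close> by the reflection at an anisotropic vector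
  \<open>x\<^sub>0\<close> is equivalent to \<open>\<mu>\<^sub>2\<close> or \<open>\<mu>\<^sub>3\<close>. The former is impossible, and an intertwiner for the latter
  provides \<open>l\<^sub>x\<close>, \<open>r\<^sub>x\<close> with \<open>r\<^sub>x l\<^sub>y = \<mu>\<^sub>2(x, y)\<close> and \<open>l\<^sub>x r\<^sub>y = \<mu>\<^sub>3(x, y)\<close>. By Schur's lemma and the
  semitrace identity, \<open>q\<^sub>3(l\<^sub>x v) = \<theta> q\<^sub>1(x) q\<^sub>2(v)\<close> for a constant \<open>\<theta>\<close>, so \<open>l\<close> is a composition once \<open>q\<^sub>3\<close>
  is divided by \<open>\<theta>\<close>.
\<close>


section \<open>Presentations of algebras\<close>

text \<open>No structure theory of Clifford algebras enters. That the Clifford algebra of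
  \<open>A\<^sub>1\<close> is a product of two matrix algebras is read off from
  \<open>\<phi>\<^sub>0\<close>; the rest comes from a universal property and from the
  Skolem-Noether theorem for split algebras. The universal property is the first obstacle. The
  relations run over all symmetric elements and over all sums fixed under the sandwich condition,
  and must be deduced from the two relations for \<open>m\<close>. In coordinates each becomes a
  double sum with symmetric coefficients whose diagonal terms and symmetrized off-diagonal terms
  vanish separately, so that nothing is divided by 2. Characteristic 2 is the second obstacle. There
  a quadratic form is not recovered from its polar form, so the multiplicativity of the forms must
  come from the semitraces. The semitrace of the Clifford algebra is defined by reduced traces over
  the algebraic closure; hence traces are computed for split algebras and for products of two of
  them. A quadratic pair fixes its quadratic form only up to a scalar. This is the freedom that
  absorbs \<open>\<theta>\<close>.\<close>

lemma ring_record_cong: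
  assumes "carrier R = carrier S" "mult R = mult S" "one R = one S" "zero R = zero S" "add R = add S"
    and "ring R"
  shows "ring S"
proof -
  interpret ring R by fact
  show ?thesis
    by (intro ringI abelian_groupI monoidI; unfold assms(1-5)[symmetric])
       (auto simp: m_assoc a_ac l_distr r_distr intro: l_neg)
qed

lemma is_algebraI:
  assumes "ring A"
    and "\<And>c x. x \<in> carrier A \<Longrightarrow> c \<odot>\<^bsub>A\<^esub> x \<in> carrier A"
    and "\<And>c d x. x \<in> carrier A \<Longrightarrow> (c * d) \<odot>\<^bsub>A\<^esub> x = c \<odot>\<^bsub>A\<^esub> (d \<odot>\<^bsub>A\<^esub> x)"
    and "\<And>c d x. x \<in> carrier A \<Longrightarrow> (c + d) \<odot>\<^bsub>A\<^esub> x = c \<odot>\<^bsub>A\<^esub> x \<oplus>\<^bsub>A\<^esub> d \<odot>\<^bsub>A\<^esub> x"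
    and "\<And>c x y. x \<in> carrier A \<Longrightarrow> y \<in> carrier A \<Longrightarrow>
      c \<odot>\<^bsub>A\<^esub> (x \<oplus>\<^bsub>A\<^esub> y) = c \<odot>\<^bsub>A\<^esub> x \<oplus>\<^bsub>A\<^esub> c \<odot>\<^bsub>A\<^esub> y"
    and "\<And>x. x \<in> carrier A \<Longrightarrow> 1 \<odot>\<^bsub>A\<^esub> x = x"
    and "\<And>c x y. x \<in> carrier A \<Longrightarrow> y \<in> carrier A \<Longrightarrow>
      (c \<odot>\<^bsub>A\<^esub> x) \<otimes>\<^bsub>A\<^esub> y = c \<odot>\<^bsub>A\<^esub> (x \<otimes>\<^bsub>A\<^esub> y)"
    and "\<And>c x y. x \<in> carrier A \<Longrightarrow> y \<in> carrier A \<Longrightarrow>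
      x \<otimes>\<^bsub>A\<^esub> (c \<odot>\<^bsub>A\<^esub> y) = c \<odot>\<^bsub>A\<^esub> (x \<otimes>\<^bsub>A\<^esub> y)"
  shows "is_algebra (A :: ('f::field, 'a, 'm) module_scheme)"
proof -
  interpret ring A by fact
  have "vectorspace class_ring A"
    unfolding vectorspace_def module_def module_axioms_def
    using assms class_cring.cring_axioms class_field is_abelian_group by auto
  then show ?thesis using assms by (auto simp: is_algebra_def)
qed

locale falg =
  fixes A :: "('f::field, 'a, 'm) module_scheme" (structure)
  assumes alg: "is_algebra A"
begin

sublocale ring A using alg by (simp add: is_algebra_def)

lemma vs: "vectorspace class_ring A" using alg by (simp add: is_algebra_def)

sublocale V: vectorspace class_ring A by (rule vs)

lemma sm_closed [simp, intro]: "x \<in> carrier A \<Longrightarrow> c \<odot> x \<in> carrier A"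
  using V.smult_closed by simp
lemma sm_mult: "x \<in> carrier A \<Longrightarrow> (c * d) \<odot> x = c \<odot> (d \<odot> x)"
  using V.smult_assoc1[of c d x] by simp
lemma sm_add: "x \<in> carrier A \<Longrightarrow> (c + d) \<odot> x = c \<odot> x \<oplus> d \<odot> x"
  using V.smult_l_distr[of c d x] by simp
lemma sm_addr: "x \<in> carrier A \<Longrightarrow> y \<in> carrier A \<Longrightarrow> c \<odot> (x \<oplus> y) = c \<odot> x \<oplus> c \<odot> y"
  using V.smult_r_distr[of c x y] by simp
lemma sm_one [simp]: "x \<in> carrier A \<Longrightarrow> 1 \<odot> x = x"
  using V.smult_one[of x] by simp
lemma sm_l: "x \<in> carrier A \<Longrightarrow> y \<in> carrier A \<Longrightarrow> (c \<odot> x) \<otimes> y = c \<odot> (x \<otimes> y)"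
  and sm_r: "x \<in> carrier A \<Longrightarrow> y \<in> carrier A \<Longrightarrow> x \<otimes> (c \<odot> y) = c \<odot> (x \<otimes> y)"
  using alg by (auto simp: is_algebra_def)
lemma sm_zero [simp]: "x \<in> carrier A \<Longrightarrow> 0 \<odot> x = \<zero>"
  using V.smult_l_null[of x] by simp
lemma sm_zeror [simp]: "c \<odot> \<zero> = \<zero>"
  using V.smult_r_null[of c] by simp
end

lemma alg_homD:
  assumes "h \<in> alg_hom A B"
  shows "x \<in> carrier A \<Longrightarrow> h x \<in> carrier B"
    and "x \<in> carrier A \<Longrightarrow> y \<in> carrier A \<Longrightarrow> h (x \<oplus>\<^bsub>A\<^esub> y) = h x \<oplus>\<^bsub>B\<^esub> h y"
    and "x \<in> carrier A \<Longrightarrow> y \<in> carrier A \<Longrightarrow> h (x \<otimes>\<^bsub>A\<^esub> y) = h x \<otimes>\<^bsub>B\<^esub> h y"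
    and "h \<one>\<^bsub>A\<^esub> = \<one>\<^bsub>B\<^esub>"
    and "x \<in> carrier A \<Longrightarrow> h (c \<odot>\<^bsub>A\<^esub> x) = c \<odot>\<^bsub>B\<^esub> h x"
  using assms by (auto simp: alg_hom_def Ring.ring_hom_def)

lemma alg_homI:
  assumes "\<And>x. x \<in> carrier A \<Longrightarrow> h x \<in> carrier B"
    and "\<And>x y. x \<in> carrier A \<Longrightarrow> y \<in> carrier A \<Longrightarrow> h (x \<oplus>\<^bsub>A\<^esub> y) = h x \<oplus>\<^bsub>B\<^esub> h y"
    and "\<And>x y. x \<in> carrier A \<Longrightarrow> y \<in> carrier A \<Longrightarrow> h (x \<otimes>\<^bsub>A\<^esub> y) = h x \<otimes>\<^bsub>B\<^esub> h y"
    and "h \<one>\<^bsub>A\<^esub> = \<one>\<^bsub>B\<^esub>"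
    and "\<And>c x. x \<in> carrier A \<Longrightarrow> h (c \<odot>\<^bsub>A\<^esub> x) = c \<odot>\<^bsub>B\<^esub> h x"
  shows "h \<in> alg_hom A B"
  using assms by (auto simp: alg_hom_def Ring.ring_hom_def)

lemma alg_hom_zero:
  assumes "is_algebra A" "is_algebra B" "h \<in> alg_hom A B"
  shows "h \<zero>\<^bsub>A\<^esub> = \<zero>\<^bsub>B\<^esub>"
proof -
  interpret A: falg A by (unfold_locales) fact
  interpret B: falg B by (unfold_locales) fact
  have "h (0 \<odot>\<^bsub>A\<^esub> \<zero>\<^bsub>A\<^esub>) = 0 \<odot>\<^bsub>B\<^esub> h \<zero>\<^bsub>A\<^esub>" by (rule alg_homD(5)[OF assms(3)]) simp
  then show ?thesis using alg_homD(1)[OF assms(3), of "\<zero>\<^bsub>A\<^esub>"] by simp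
qed

lemma alg_hom_comp:
  assumes "g \<in> alg_hom A B" "h \<in> alg_hom B C"
  shows "h \<circ> g \<in> alg_hom A C"
  by (rule alg_homI) (auto simp: alg_homD[OF assms(1)] alg_homD[OF assms(2)])

lemma alg_isoD: "h \<in> alg_iso A B \<Longrightarrow> h \<in> alg_hom A B" "h \<in> alg_iso A B \<Longrightarrow> bij_betw h (carrier A) (carrier B)"
  by (auto simp: alg_iso_def)

lemma alg_iso_comp:
  assumes "g \<in> alg_iso A B" "h \<in> alg_iso B C"
  shows "h \<circ> g \<in> alg_iso A C"
  using assms alg_hom_comp bij_betw_trans by (auto simp: alg_iso_def)

lemma alg_iso_inv:
  assumes A: "is_algebra A" and h: "h \<in> alg_iso A B"
  shows "inv_into (carrier A) h \<in> alg_iso B A"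
proof -
  interpret falg A by unfold_locales fact
  let ?g = "inv_into (carrier A) h"
  note hh = alg_homD[OF alg_isoD(1)[OF h]] and bij = alg_isoD(2)[OF h]
  have g1: "?g y \<in> carrier A" "h (?g y) = y" if "y \<in> carrier B" for y
    using that bij by (auto simp: bij_betw_def inv_into_into f_inv_into_f)
  have g2: "?g (h x) = x" if "x \<in> carrier A" for x
    using that bij by (auto simp: bij_betw_def)
  have eq: "?g y = x" if "x \<in> carrier A" "h x = y" for x y using g2 that by blast
  have "?g \<in> alg_hom B A"
    by (rule alg_homI) (auto intro!: eq simp: g1 hh)
  then show ?thesis using bij by (auto simp: alg_iso_def bij_betw_inv_into)
qed

section \<open>The free algebra on a set\<close>

lemma poly_mapping_sum_singles:
  "t = (\<Sum>w\<in>Poly_Mapping.keys t. Poly_Mapping.single w (Poly_Mapping.lookup t w))"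
proof (rule poly_mapping_eqI)
  fix k
  show "Poly_Mapping.lookup t k = Poly_Mapping.lookup
     (\<Sum>w\<in>Poly_Mapping.keys t. Poly_Mapping.single w (Poly_Mapping.lookup t w)) k"
    by (simp add: lookup_sum lookup_single when_def in_keys_iff sum.delta)
qed

lemma single_list_mult:
  "Poly_Mapping.single v a * Poly_Mapping.single w b = Poly_Mapping.single (v @ w) (a * b :: 'f::field)"
  by (simp add: mult_single plus_list_def)

lemma one_list_poly: "(1 :: 'x list \<Rightarrow>\<^sub>0 'f::field) = Poly_Mapping.single [] 1"
  by (metis single_one zero_list_def)

lemma free_carrier: "t \<in> carrier (free_algebra S) \<longleftrightarrow> Poly_Mapping.keys t \<subseteq> lists S"
  by (simp add: free_algebra_def)

lemma free_induct [consumes 1, case_names zero single add]: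
  assumes t: "t \<in> carrier (free_algebra S :: ('f::field, 'x list \<Rightarrow>\<^sub>0 'f) module)"
    and "P 0"
    and single: "\<And>w c. w \<in> lists S \<Longrightarrow> P (Poly_Mapping.single w c)"
    and add: "\<And>s t. s \<in> carrier (free_algebra S) \<Longrightarrow> t \<in> carrier (free_algebra S) \<Longrightarrow>
       P s \<Longrightarrow> P t \<Longrightarrow> P (s + t)"
  shows "P t"
proof -
  have "finite W \<Longrightarrow> W \<subseteq> lists S \<Longrightarrow>
    P (\<Sum>w\<in>W. Poly_Mapping.single w (Poly_Mapping.lookup t w)) \<and>
    (\<Sum>w\<in>W. Poly_Mapping.single w (Poly_Mapping.lookup t w)) \<in> carrier (free_algebra S)" for W
  proof (induction W rule: finite_induct)
    case empty
    then show ?case using assms(2) by (simp add: free_carrier)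
  next
    case (insert w W)
    have 1: "Poly_Mapping.single w (Poly_Mapping.lookup t w) \<in> carrier (free_algebra S)"
      using insert.prems by (simp add: free_carrier)
    moreover have 2: "(\<Sum>w\<in>W. Poly_Mapping.single w (Poly_Mapping.lookup t w)) \<in> carrier (free_algebra S)"
      using insert by simp
    ultimately have "Poly_Mapping.single w (Poly_Mapping.lookup t w) +
        (\<Sum>w\<in>W. Poly_Mapping.single w (Poly_Mapping.lookup t w)) \<in> carrier (free_algebra S)"
      unfolding free_carrier by (meson keys_add Un_least subset_trans)
    then show ?case using insert 1 2 by (simp add: add single)
  qed
  from this[of "Poly_Mapping.keys t"] t show ?thesis
    by (simp add: free_carrier poly_mapping_sum_singles[symmetric])
qed

lemma fconst_commute: "fconst c * t = t * (fconst c :: 'x list \<Rightarrow>\<^sub>0 'f::field)"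
proof -
  have "t \<in> carrier (free_algebra UNIV)" by (simp add: free_carrier)
  then show ?thesis
    by (induction t rule: free_induct) (auto simp: single_list_mult algebra_simps)
qed

lemma free_simps [simp]:
  "mult (free_algebra S) = (*)" "one (free_algebra S) = 1" "zero (free_algebra S) = 0"
  "add (free_algebra S) = (+)" "smult (free_algebra S) c t = fconst c * t"
  by (simp_all add: free_algebra_def)

lemma free_closed:
  "s \<in> carrier (free_algebra S) \<Longrightarrow> t \<in> carrier (free_algebra S) \<Longrightarrow> s + t \<in> carrier (free_algebra S)"
  "s \<in> carrier (free_algebra S) \<Longrightarrow> t \<in> carrier (free_algebra S) \<Longrightarrow> s - t \<in> carrier (free_algebra S)"
  "s \<in> carrier (free_algebra S) \<Longrightarrow> - s \<in> carrier (free_algebra S)"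
  "s \<in> carrier (free_algebra S) \<Longrightarrow> t \<in> carrier (free_algebra S) \<Longrightarrow> s * t \<in> carrier (free_algebra S)"
  "0 \<in> carrier (free_algebra S)" "1 \<in> carrier (free_algebra S)"
  "x \<in> S \<Longrightarrow> fgen x \<in> carrier (free_algebra S)"
  "fconst c \<in> carrier (free_algebra S)"
  "w \<in> lists S \<Longrightarrow> Poly_Mapping.single w c \<in> carrier (free_algebra S)"
proof -
  show "s + t \<in> carrier (free_algebra S)" if "s \<in> carrier (free_algebra S)" "t \<in> carrier (free_algebra S)"
    using that keys_add[of s t] unfolding free_carrier by blast
  show "s - t \<in> carrier (free_algebra S)" if "s \<in> carrier (free_algebra S)" "t \<in> carrier (free_algebra S)"
    using that keys_diff[of s t] unfolding free_carrier by blast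
  show "- s \<in> carrier (free_algebra S)" if "s \<in> carrier (free_algebra S)"
    using that unfolding free_carrier by simp
  show "s * t \<in> carrier (free_algebra S)" if "s \<in> carrier (free_algebra S)" "t \<in> carrier (free_algebra S)"
    using that keys_mult[of s t] unfolding free_carrier plus_list_def by fastforce
qed (auto simp: free_carrier one_list_poly)

lemma free_is_algebra: "is_algebra (free_algebra S :: ('f::field, 'x list \<Rightarrow>\<^sub>0 'f) module)"
proof (rule is_algebraI)
  show "ring (free_algebra S :: ('f::field, 'x list \<Rightarrow>\<^sub>0 'f) module)"
  proof (intro ringI abelian_groupI monoidI)
    fix x assume "x \<in> carrier (free_algebra S :: ('f::field, 'x list \<Rightarrow>\<^sub>0 'f) module)"
    then show "\<exists>y\<in>carrier (free_algebra S). y \<oplus>\<^bsub>free_algebra S\<^esub> x = \<zero>\<^bsub>free_algebra S\<^esub>"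
      by (intro bexI[of _ "- x"]) (auto simp: free_closed)
  qed (auto simp: free_closed algebra_simps)
next
  fix c d :: 'f and x y assume x: "x \<in> carrier (free_algebra S :: ('f::field, 'x list \<Rightarrow>\<^sub>0 'f) module)"
  show "(c * d) \<odot>\<^bsub>free_algebra S\<^esub> x = c \<odot>\<^bsub>free_algebra S\<^esub> (d \<odot>\<^bsub>free_algebra S\<^esub> x)"
    by (simp add: mult.assoc[symmetric] single_list_mult)
  show "x \<otimes>\<^bsub>free_algebra S\<^esub> (c \<odot>\<^bsub>free_algebra S\<^esub> y) = c \<odot>\<^bsub>free_algebra S\<^esub> (x \<otimes>\<^bsub>free_algebra S\<^esub> y)"
    by (simp add: mult.assoc[symmetric] fconst_commute[of c x])
qed (auto simp: free_closed distrib_left distrib_right single_add mult.assoc simp flip: one_list_poly)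

section \<open>Evaluation of noncommutative polynomials in an algebra\<close>

definition word_prod :: "('f::field, 'b, 'm) module_scheme \<Rightarrow> ('x \<Rightarrow> 'b) \<Rightarrow> 'x list \<Rightarrow> 'b" where
  "word_prod B f w = foldr (\<lambda>x b. f x \<otimes>\<^bsub>B\<^esub> b) w \<one>\<^bsub>B\<^esub>"

definition free_ev :: "('f::field, 'b, 'm) module_scheme \<Rightarrow> ('x \<Rightarrow> 'b) \<Rightarrow> ('x list \<Rightarrow>\<^sub>0 'f) \<Rightarrow> 'b" where
  "free_ev B f t = (\<Oplus>\<^bsub>B\<^esub>w\<in>Poly_Mapping.keys t. Poly_Mapping.lookup t w \<odot>\<^bsub>B\<^esub> word_prod B f w)"

context falg
begin

lemma word_prod_closed: "f \<in> S \<rightarrow> carrier A \<Longrightarrow> w \<in> lists S \<Longrightarrow> word_prod A f w \<in> carrier A"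
  by (induction w) (auto simp: word_prod_def)

lemma word_prod_append:
  "f \<in> S \<rightarrow> carrier A \<Longrightarrow> v \<in> lists S \<Longrightarrow> w \<in> lists S \<Longrightarrow>
    word_prod A f (v @ w) = word_prod A f v \<otimes> word_prod A f w"
proof (induction v)
  case Nil
  then show ?case using word_prod_closed[of f S w] by (simp add: word_prod_def)
next
  case (Cons x v)
  then show ?case using word_prod_closed[of f S w] word_prod_closed[of f S v]
    by (auto simp: word_prod_def m_assoc Pi_iff)
qed

text \<open>The sums defining \<open>free_ev\<close> run over the keys, which differ for
  \<open>s\<close>, \<open>t\<close> and \<open>s + t\<close>. Over a common finite superset they
  become comparable, because the additional coefficients are 0.\<close>

lemma free_ev_superset:
  assumes f: "f \<in> S \<rightarrow> carrier A" and W: "finite W" "Poly_Mapping.keys t \<subseteq> W" "W \<subseteq> lists S"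
  shows "free_ev A f t = (\<Oplus>w\<in>W. Poly_Mapping.lookup t w \<odot> word_prod A f w)"
  unfolding free_ev_def
proof (rule add.finprod_mono_neutral_cong_left)
  have wp: "word_prod A f w \<in> carrier A" if "w \<in> W" for w
    using that W word_prod_closed[OF f] by blast
  show "(\<lambda>w. Poly_Mapping.lookup t w \<odot> word_prod A f w) \<in> W \<rightarrow> carrier A" using wp by auto
  show "Poly_Mapping.lookup t i \<odot> word_prod A f i = \<zero>\<^bsub>A\<^esub>" if "i \<in> W - Poly_Mapping.keys t" for i
    using that wp[of i] by (simp add: in_keys_iff)
qed (use W in auto)

lemma free_ev_closed:
  assumes f: "f \<in> S \<rightarrow> carrier A" and t: "t \<in> carrier (free_algebra S)"
  shows "free_ev A f t \<in> carrier A"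
  unfolding free_ev_def
  by (rule finsum_closed) (use t word_prod_closed[OF f] in \<open>auto simp: free_carrier subset_iff\<close>)

lemma free_ev_add:
  assumes f: "f \<in> S \<rightarrow> carrier A" and s: "s \<in> carrier (free_algebra S)" and t: "t \<in> carrier (free_algebra S)"
  shows "free_ev A f (s + t) = free_ev A f s \<oplus> free_ev A f t"
proof -
  let ?W = "Poly_Mapping.keys s \<union> Poly_Mapping.keys t"
  have W: "finite ?W" "?W \<subseteq> lists S" using s t by (auto simp: free_carrier)
  note sup = free_ev_superset[OF f W(1) _ W(2)]
  have wp: "word_prod A f w \<in> carrier A" if "w \<in> ?W" for w
    using that W word_prod_closed[OF f] by blast
  have "free_ev A f (s + t) = (\<Oplus>w\<in>?W. Poly_Mapping.lookup (s + t) w \<odot> word_prod A f w)"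
    by (rule sup) (rule keys_add)
  also have "\<dots> = (\<Oplus>w\<in>?W. Poly_Mapping.lookup s w \<odot> word_prod A f w \<oplus> Poly_Mapping.lookup t w \<odot> word_prod A f w)"
    by (rule finsum_cong') (use wp in \<open>auto simp: lookup_add sm_add\<close>)
  also have "\<dots> = (\<Oplus>w\<in>?W. Poly_Mapping.lookup s w \<odot> word_prod A f w) \<oplus>
     (\<Oplus>w\<in>?W. Poly_Mapping.lookup t w \<odot> word_prod A f w)"
    by (rule finsum_addf) (use wp in auto)
  also have "\<dots> = free_ev A f s \<oplus> free_ev A f t" by (simp add: sup)
  finally show ?thesis .
qed

lemma free_ev_single:
  assumes f: "f \<in> S \<rightarrow> carrier A" and w: "w \<in> lists S"
  shows "free_ev A f (Poly_Mapping.single w c) = c \<odot> word_prod A f w"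
proof -
  have "free_ev A f (Poly_Mapping.single w c) =
    (\<Oplus>v\<in>{w}. Poly_Mapping.lookup (Poly_Mapping.single w c) v \<odot> word_prod A f v)"
    by (rule free_ev_superset[OF f]) (use w in auto)
  also have "\<dots> = c \<odot> word_prod A f w"
    using word_prod_closed[OF f w] by (simp)
  finally show ?thesis .
qed

lemma free_ev_mult:
  assumes f: "f \<in> S \<rightarrow> carrier A" and s: "s \<in> carrier (free_algebra S)" and t: "t \<in> carrier (free_algebra S)"
  shows "free_ev A f (s * t) = free_ev A f s \<otimes> free_ev A f t"
  using s
proof (induction s rule: free_induct)
  case zero
  then show ?case using free_ev_closed[OF f t] by (simp add: free_ev_def)
next
  case (add s s')
  then show ?case using t free_ev_closed[OF f]
    by (simp add: distrib_right free_ev_add[OF f] free_closed l_distr)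
next
  case (single v c)
  note wp = word_prod_closed[OF f]
  show ?case using t
  proof (induction t rule: free_induct)
    case zero
    then show ?case using free_ev_closed[OF f, of "Poly_Mapping.single v c"] single
      by (simp add: free_ev_def free_closed)
  next
    case (add s s')
    then show ?case using single free_ev_closed[OF f]
      by (simp add: distrib_left free_ev_add[OF f] free_closed r_distr)
  next
    case (single w d)
    then show ?case using \<open>v \<in> lists S\<close> wp
      by (simp add: single_list_mult free_ev_single[OF f] word_prod_append[OF f] sm_l sm_r sm_mult[symmetric] mult.commute)
  qed
qed

lemma free_ev_gen:
  assumes f: "f \<in> S \<rightarrow> carrier A" and "x \<in> S"
  shows "free_ev A f (fgen x) = f x"
proof -
  have "f x \<in> carrier A" using assms by auto
  then show ?thesis using assms by (simp add: free_ev_single[OF f] word_prod_def)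
qed

lemma free_ev_const:
  assumes f: "f \<in> S \<rightarrow> carrier A"
  shows "free_ev A f (fconst c) = c \<odot> \<one>"
  by (simp add: free_ev_single[OF f] word_prod_def)

lemma free_ev_hom:
  assumes f: "f \<in> S \<rightarrow> carrier A"
  shows "free_ev A f \<in> alg_hom (free_algebra S) A"
proof (rule alg_homI)
  show "free_ev A f \<one>\<^bsub>free_algebra S\<^esub> = \<one>" using free_ev_const[OF f, of 1] by (simp add: one_list_poly)
  fix c :: 'f and x assume "x \<in> carrier (free_algebra S :: ('f, 'b list \<Rightarrow>\<^sub>0 'f) module)"
  then show "free_ev A f (c \<odot>\<^bsub>free_algebra S\<^esub> x) = c \<odot> free_ev A f x"
    by (simp add: free_ev_mult[OF f] free_closed free_ev_const[OF f] sm_l free_ev_closed[OF f])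
qed (auto simp: free_ev_closed[OF f] free_ev_add[OF f] free_ev_mult[OF f])

lemma free_ev_zero: "free_ev A f 0 = \<zero>"
  by (simp add: free_ev_def)

lemma free_ev_diff:
  assumes f: "f \<in> S \<rightarrow> carrier A" and s: "s \<in> carrier (free_algebra S)" and t: "t \<in> carrier (free_algebra S)"
  shows "free_ev A f (s - t) = free_ev A f s \<ominus> free_ev A f t"
proof -
  have "free_ev A f (- t) \<oplus> free_ev A f t = \<zero>"
    using free_ev_add[OF f, of "- t" t] t by (simp add: free_closed free_ev_zero)
  then have "free_ev A f (- t) = \<ominus> free_ev A f t"
    using minus_equality[of "free_ev A f (- t)" "free_ev A f t"] free_ev_closed[OF f] t by (simp add: free_closed)
  then show ?thesis
    using free_ev_add[OF f, of s "- t"] s t by (simp only: free_closed a_minus_def diff_conv_add_uminus)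
qed

end

lemma alg_hom_ring_hom_ring:
  assumes "is_algebra A" "is_algebra B" "h \<in> alg_hom A B"
  shows "ring_hom_ring A B h"
proof -
  interpret A: falg A by unfold_locales fact
  interpret B: falg B by unfold_locales fact
  show ?thesis
    by (rule ring_hom_ringI) (auto simp: alg_homD[OF assms(3)] A.ring_axioms B.ring_axioms)
qed

context falg
begin

lemma quot_algebra_carrier: "ideal I A \<Longrightarrow> carrier (quot_algebra A I) = (\<lambda>t. I +> t) ` carrier A"
  by (auto simp: quot_algebra_def A_RCOSETS_def' image_def)

text \<open>A ring ideal is stable under scalars because
  \<open>c \<odot> i = (c \<odot> \<one>) \<otimes> i\<close>. Hence the union that defines the
  scalar action on a coset is a union of copies of one coset.\<close>

lemma quot_smult:
  assumes I: "ideal I A" and t: "t \<in> carrier A"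
  shows "c \<odot>\<^bsub>quot_algebra A I\<^esub> (I +> t) = I +> (c \<odot> t)"
proof -
  interpret I: ideal I A by fact
  have Isub: "I \<subseteq> carrier A" by (rule I.a_subset)
  have "I +> (c \<odot> x) = I +> (c \<odot> t)" if x: "x \<in> I +> t" for x
  proof -
    obtain i where i: "i \<in> I" "x = i \<oplus> t" using x by (auto simp: a_r_coset_def')
    have ic: "i \<in> carrier A" using i Isub by auto
    have "c \<odot> x = c \<odot> i \<oplus> c \<odot> t" using i ic t by (simp add: sm_addr)
    moreover have "c \<odot> i = (c \<odot> \<one>) \<otimes> i" using ic by (simp add: sm_l)
    then have "c \<odot> i \<in> I" using I.I_l_closed[OF i(1), of "c \<odot> \<one>"] by simp
    ultimately have "c \<odot> x \<in> I +> (c \<odot> t)" by (auto simp: a_r_coset_def')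
    then show ?thesis using t
      using a_repr_independence[of "c \<odot> x" I "c \<odot> t"] I.a_subgroup by simp
  qed
  moreover have "t \<in> I +> t" using I.zero_closed t by (force simp: a_r_coset_def')
  ultimately have "(\<Union>x\<in>I +> t. I +> (c \<odot> x)) = I +> (c \<odot> t)" by blast
  then show ?thesis unfolding quot_algebra_def by simp
qed

lemma quot_is_algebra:
  assumes I: "ideal I A"
  shows "is_algebra (quot_algebra A I)" "(+>) I \<in> alg_hom A (quot_algebra A I)"
proof -
  interpret I: ideal I A by fact
  let ?Q = "quot_algebra A I"
  have rQ: "ring ?Q"
    by (rule ring_record_cong[OF _ _ _ _ _ I.quotient_is_ring]) (auto simp: FactRing_def quot_algebra_def)
  then interpret Q: ring ?Q .
  have hom: "(+>) I \<in> Ring.ring_hom A ?Q"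
    using I.rcos_ring_hom by (auto simp: Ring.ring_hom_def FactRing_def quot_algebra_def)
  then show h: "(+>) I \<in> alg_hom A ?Q" by (simp add: alg_hom_def quot_smult[OF I])
  note hh = alg_homD[OF h]
  note C = quot_algebra_carrier[OF I]
  show "is_algebra ?Q"
    apply (rule is_algebraI[OF rQ], unfold C)
    subgoal by (auto simp: quot_smult[OF I])
    subgoal by (auto simp: quot_smult[OF I] sm_mult)
    subgoal by (auto simp: quot_smult[OF I] sm_add hh(2))
    subgoal premises p for c x y
    proof -
      obtain t u where t: "t \<in> carrier A" "x = I +> t" and u: "u \<in> carrier A" "y = I +> u" using p by blast
      have "c \<odot>\<^bsub>?Q\<^esub> (I +> (t \<oplus> u)) = I +> (c \<odot> t \<oplus> c \<odot> u)"
        using t u by (simp add: quot_smult[OF I] sm_addr)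
      then show ?thesis using t u by (simp add: hh(2) quot_smult[OF I])
    qed
    subgoal by (auto simp: quot_smult[OF I])
    subgoal by (auto simp: quot_smult[OF I] sm_l hh(3)[symmetric])
    subgoal by (auto simp: quot_smult[OF I] sm_r hh(3)[symmetric])
    done
qed

end

section \<open>Algebras given by generators and relations\<close>

locale presentation =
  fixes S :: "'x set" and rel :: "('x list \<Rightarrow>\<^sub>0 'f::field) set"
  assumes rels: "rel \<subseteq> carrier (free_algebra S)"
begin

abbreviation "R \<equiv> free_algebra S :: ('f, 'x list \<Rightarrow>\<^sub>0 'f) module"
abbreviation "I \<equiv> genideal R rel"
abbreviation "Q \<equiv> quot_algebra R I"
abbreviation "cls t \<equiv> I +>\<^bsub>R\<^esub> t"

sublocale R: falg R by unfold_locales (rule free_is_algebra)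

lemma I_ideal: "ideal I R" using R.genideal_ideal rels by blast
lemma Q_algebra: "is_algebra Q" by (rule R.quot_is_algebra(1)[OF I_ideal])
lemma cls_hom: "(+>\<^bsub>R\<^esub>) I \<in> alg_hom R Q" by (rule R.quot_is_algebra(2)[OF I_ideal])
lemma Q_carrier: "carrier Q = (\<lambda>t. cls t) ` carrier R" by (rule R.quot_algebra_carrier[OF I_ideal])

sublocale Q: falg Q by unfold_locales (rule Q_algebra)

lemma cls_rel: "t \<in> rel \<Longrightarrow> cls t = \<zero>\<^bsub>Q\<^esub>"
proof -
  assume t: "t \<in> rel"
  interpret ideal I R by (rule I_ideal)
  have "t \<in> I" using R.genideal_self rels t by blast
  then have "cls t = I" using R.a_coset_join2[of t "I"] a_subgroup t rels by blast
  then show ?thesis by (simp add: quot_algebra_def)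
qed

lemma lift_exists:
  fixes B :: "('f, 'b, 'm) module_scheme"
  assumes B: "is_algebra B" and f: "f \<in> S \<rightarrow> carrier B"
    and rel: "\<And>t. t \<in> rel \<Longrightarrow> free_ev B f t = \<zero>\<^bsub>B\<^esub>"
  shows "\<exists>h \<in> alg_hom Q B. \<forall>t \<in> carrier R. h (cls t) = free_ev B f t"
proof -
  interpret B: falg B by unfold_locales fact
  interpret ideal I R by (rule I_ideal)
  note ev = B.free_ev_hom[OF f]
  interpret H: ring_hom_ring R B "free_ev B f"
    by (rule alg_hom_ring_hom_ring[OF free_is_algebra B ev])
  have "rel \<subseteq> a_kernel R B (free_ev B f)" using rel rels unfolding a_kernel_def' by blast
  then have IK: "I \<subseteq> a_kernel R B (free_ev B f)"
    by (rule R.genideal_minimal[OF H.kernel_is_ideal])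
  \<comment> \<open>The evaluation kills the ideal, so it is constant on each coset; the image of a
    coset is a singleton, and no representative has to be chosen.\<close>
  define h where "h U = the_elem (free_ev B f ` U)" for U
  have h: "h (cls t) = free_ev B f t" if t: "t \<in> carrier R" for t
  proof -
    have "free_ev B f u = free_ev B f t" if "u \<in> cls t" for u
    proof -
      obtain i where i: "i \<in> I" "u = i + t" using \<open>u \<in> cls t\<close> unfolding a_r_coset_def' by auto
      then have "i \<in> carrier R" "free_ev B f i = \<zero>\<^bsub>B\<^esub>" using IK unfolding a_kernel_def' by blast+
      then show ?thesis using i(2) t B.free_ev_add[OF f, of i t] B.free_ev_closed[OF f t] by simp
    qed
    moreover have "t \<in> cls t" using zero_closed by (force simp: a_r_coset_def')
    ultimately have "free_ev B f ` cls t = {free_ev B f t}" by blast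
    then show ?thesis by (simp add: h_def)
  qed
  have "h \<in> alg_hom Q B"
  proof (rule alg_homI, unfold Q_carrier)
    note cc = alg_homD[OF cls_hom] and ee = alg_homD[OF ev]
    show "h x \<in> carrier B" if "x \<in> (\<lambda>t. cls t) ` carrier R" for x
      using that h ee(1) by auto
    show "h \<one>\<^bsub>Q\<^esub> = \<one>\<^bsub>B\<^esub>" unfolding cc(4)[symmetric] using h[of "\<one>\<^bsub>R\<^esub>"] ee(4) R.one_closed by (simp only:)
    fix x assume "x \<in> (\<lambda>t. cls t) ` carrier R"
    then obtain t where t: "t \<in> carrier R" "x = cls t" by auto
    show "h (c \<odot>\<^bsub>Q\<^esub> x) = c \<odot>\<^bsub>B\<^esub> h x" for c
      unfolding t(2) cc(5)[OF t(1), symmetric] h[OF t(1)] by (simp only: h R.sm_closed t(1) ee(5))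
    fix y assume "y \<in> (\<lambda>t. cls t) ` carrier R"
    then obtain u where u: "u \<in> carrier R" "y = cls u" by auto
    show "h (x \<oplus>\<^bsub>Q\<^esub> y) = h x \<oplus>\<^bsub>B\<^esub> h y"
      unfolding t(2) u(2) cc(2)[OF t(1) u(1), symmetric] h[OF t(1)] h[OF u(1)]
      by (simp only: h R.a_closed t(1) u(1) ee(2))
    show "h (x \<otimes>\<^bsub>Q\<^esub> y) = h x \<otimes>\<^bsub>B\<^esub> h y"
      unfolding t(2) u(2) cc(3)[OF t(1) u(1), symmetric] h[OF t(1)] h[OF u(1)]
      by (simp only: h R.m_closed t(1) u(1) ee(3))
  qed
  then show ?thesis using h by blast
qed

lemma Q_induct [consumes 1, case_names one gen add mult smult]:
  assumes U: "U \<in> carrier Q" and "P \<one>\<^bsub>Q\<^esub>" and gen: "\<And>x. x \<in> S \<Longrightarrow> P (cls (fgen x))"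
    and add: "\<And>U V. U \<in> carrier Q \<Longrightarrow> V \<in> carrier Q \<Longrightarrow> P U \<Longrightarrow> P V \<Longrightarrow> P (U \<oplus>\<^bsub>Q\<^esub> V)"
    and mult: "\<And>U V. U \<in> carrier Q \<Longrightarrow> V \<in> carrier Q \<Longrightarrow> P U \<Longrightarrow> P V \<Longrightarrow> P (U \<otimes>\<^bsub>Q\<^esub> V)"
    and smult: "\<And>c U. U \<in> carrier Q \<Longrightarrow> P U \<Longrightarrow> P (c \<odot>\<^bsub>Q\<^esub> U)"
  shows "P U"
proof -
  note hh = alg_homD[OF cls_hom]
  obtain t where t: "t \<in> carrier R" "U = cls t" using U Q_carrier by auto
  have w: "P (cls (Poly_Mapping.single w 1))" if "w \<in> lists S" for w
    using that
  proof (induction w)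
    case Nil
    then show ?case using assms(2) hh(4) by (simp add: one_list_poly)
  next
    case (Cons x w)
    then have c: "(fgen x :: 'x list \<Rightarrow>\<^sub>0 'f) \<in> carrier R" "Poly_Mapping.single w (1::'f) \<in> carrier R"
      by (auto simp: free_closed)
    have "P (cls (fgen x) \<otimes>\<^bsub>Q\<^esub> cls (Poly_Mapping.single w 1))"
      using Cons c by (intro mult gen hh(1)) auto
    also have "cls (fgen x) \<otimes>\<^bsub>Q\<^esub> cls (Poly_Mapping.single w 1) = cls (Poly_Mapping.single (x # w) 1)"
      using hh(3)[OF c] by (simp add: single_list_mult)
    finally show ?case .
  qed
  have c: "P (cls (Poly_Mapping.single w c))" if "w \<in> lists S" for w c
  proof -
    have c: "Poly_Mapping.single w (1::'f) \<in> carrier R" using that by (auto simp: free_closed)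
    have "P (c \<odot>\<^bsub>Q\<^esub> cls (Poly_Mapping.single w 1))" by (rule smult[OF hh(1)[OF c] w[OF that]])
    then show ?thesis using hh(5)[OF c, of c] by (simp add: single_list_mult)
  qed
  from t(1) have "P (cls t)"
  proof (induction t rule: free_induct)
    case zero
    then show ?case using c[of "[]" 0] by simp
  next
    case (add s t)
    then have "P (cls s \<oplus>\<^bsub>Q\<^esub> cls t)" by (intro assms(4) hh(1)) auto
    then show ?case using hh(2)[OF add(1,2)] by simp
  qed (rule c)
  then show ?thesis using t by simp
qed

end

section \<open>Linear maps and the Skolem--Noether theorem\<close>

abbreviation lin where "lin \<equiv> Vector_Spaces.linear"

lemma linI:
  assumes "vector_space s" "vector_space s'" "\<And>x y. f (x + y) = f x + f y" "\<And>c x. f (s c x) = s' c (f x)"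
  shows "lin s s' f"
  using assms by (simp add: Vector_Spaces.linear_iff)

lemma lin_add: "lin s s' f \<Longrightarrow> f (x + y) = f x + f y"
  and lin_scale: "lin s s' f \<Longrightarrow> f (s c x) = s' c (f x)"
  and lin_vs: "lin s s' f \<Longrightarrow> vector_space s" "lin s s' f \<Longrightarrow> vector_space s'"
  by (auto simp: Vector_Spaces.linear_iff)

lemma lin_zero: "lin s s' f \<Longrightarrow> f 0 = 0"
  using lin_add[of s s' f 0 0] by simp

lemma lin_minus: "lin s s' f \<Longrightarrow> f (- x) = - f x"
  using lin_add[of s s' f x "- x"] lin_zero[of s s' f] by (simp add: add_eq_0_iff)

lemma lin_diff: "lin s s' f \<Longrightarrow> f (x - y) = f x - f y"
  using lin_add[of s s' f x "- y"] lin_minus[of s s' f y] by simp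

lemma lin_sum: "lin s s' f \<Longrightarrow> f (\<Sum>i\<in>I. g i) = (\<Sum>i\<in>I. f (g i))"
  by (induction I rule: infinite_finite_induct) (auto simp: lin_zero lin_add)

lemma lin_comp: "lin s s' f \<Longrightarrow> lin s' s'' g \<Longrightarrow> lin s s'' (g \<circ> f)"
  by (auto simp: Vector_Spaces.linear_iff)

lemma lin_plus: "lin s s' f \<Longrightarrow> lin s s' g \<Longrightarrow> lin s s' (\<lambda>x. f x + g x)"
  by (auto simp: Vector_Spaces.linear_iff vector_space_def algebra_simps)

lemma lin_smult: "lin s s' f \<Longrightarrow> lin s s' (\<lambda>x. s' c (f x))"
  by (auto simp: Vector_Spaces.linear_iff vector_space_def algebra_simps)

lemma lin_id: "vector_space s \<Longrightarrow> lin s s id"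
  by (auto simp: Vector_Spaces.linear_iff)

lemma lin_0: "vector_space s \<Longrightarrow> vector_space s' \<Longrightarrow> lin s s' (\<lambda>_. 0)"
  by (rule linI) (auto simp: module.scale_zero_right module_iff_vector_space)

lemma lin_inv: "lin s s' f \<Longrightarrow> bij f \<Longrightarrow> lin s' s (inv_into UNIV f)"
  by (rule linI) (auto simp: lin_vs bij_def intro!: inv_f_eq simp: lin_add lin_scale surj_f_inv_f)

lemmas field_vs = vector_space_over_itself.vector_space_axioms

text \<open>The coordinate functionals are part of the data and the indices are natural numbers, so
  that vectors, operators and matrices translate into one another by finite sums.\<close>

locale vbase = vector_space s
  for s :: "'f::field \<Rightarrow> 'v::ab_group_add \<Rightarrow> 'v" +
  fixes n :: nat and e :: "nat \<Rightarrow> 'v" and eps :: "nat \<Rightarrow> 'v \<Rightarrow> 'f"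
  assumes eps_lin: "\<And>k. k < n \<Longrightarrow> lin s (*) (eps k)"
    and eps_e: "\<And>k l. k < n \<Longrightarrow> l < n \<Longrightarrow> eps k (e l) = (if k = l then 1 else 0)"
    and expand: "\<And>x. x = (\<Sum>k<n. s (eps k x) (e k))"
begin

lemma vs: "vector_space s" by unfold_locales

lemma lin_ext: "lin s s' f \<Longrightarrow> lin s s' g \<Longrightarrow> (\<And>k. k < n \<Longrightarrow> f (e k) = g (e k)) \<Longrightarrow> f x = g x"
  by (subst (1 2) expand) (simp add: lin_sum lin_scale)

lemma inj_e: "inj_on e {..<n}"
proof (rule inj_onI)
  fix k l assume *: "k \<in> {..<n}" "l \<in> {..<n}" "e k = e l"
  then show "k = l" using eps_e[of k k] eps_e[of k l] by (auto split: if_splits)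
qed

lemma eps_sum: "k < n \<Longrightarrow> eps k (\<Sum>l<n. s (c l) (e l)) = c k"
proof -
  assume k: "k < n"
  have "eps k (\<Sum>l<n. s (c l) (e l)) = (\<Sum>l<n. c l * eps k (e l))"
    using k by (simp add: lin_sum[OF eps_lin] lin_scale[OF eps_lin])
  also have "\<dots> = (\<Sum>l<n. if l = k then c k else 0)"
    by (rule sum.cong) (use k in \<open>auto simp: eps_e\<close>)
  finally show ?thesis using k by simp
qed

lemma fd: "finite_dimensional_vector_space s (e ` {..<n})"
proof (unfold_locales)
  show "finite (e ` {..<n})" by simp
  show "independent (e ` {..<n})"
  proof (rule independent_if_scalars_zero)
    fix f x assume *: "(\<Sum>x\<in>e ` {..<n}. s (f x) x) = 0" "x \<in> e ` {..<n}"
    then obtain k where k: "k < n" "x = e k" by auto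
    have "eps k (\<Sum>l<n. s (f (e l)) (e l)) = 0"
      using *(1) k by (simp add: sum.reindex[OF inj_e] lin_zero[OF eps_lin])
    then show "f x = 0" using eps_sum[OF k(1)] k by simp
  qed simp
  show "span (e ` {..<n}) = UNIV"
  proof safe
    fix x
    have "(\<Sum>k<n. s (eps k x) (e k)) \<in> span (e ` {..<n})"
      by (intro span_sum span_scale span_base) auto
    then show "x \<in> span (e ` {..<n})" by (simp flip: expand)
  qed auto
qed

lemma dim_n: "dim UNIV = n"
proof -
  interpret finite_dimensional_vector_space s "e ` {..<n}" by (rule fd)
  show ?thesis by (simp add: card_image inj_e)
qed

lemma inj_imp_bij:
  assumes f: "lin s s' f" and ker: "\<And>x. f x = 0 \<Longrightarrow> x = 0" and V': "vbase s' n e' eps'"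
  shows "bij f"
proof -
  interpret V': vbase s' n e' eps' by fact
  interpret finite_dimensional_vector_space_pair s "e ` {..<n}" s' "e' ` {..<n}"
    by (simp add: finite_dimensional_vector_space_pair_def fd V'.fd)
  have "inj f"
    using ker lin_diff[OF f] by (auto simp: inj_on_def) (metis eq_iff_diff_eq_0)
  then show ?thesis
    using linear_injective_imp_surjective[OF f] unfolding dim_n V'.dim_n by (simp add: bij_def)
qed

text \<open>If the common kernel were zero, the \<open>m\<close> functionals, written into the first
  \<open>m\<close> coordinates, would form an injective and hence surjective endomorphism
  \<open>g\<close>. But the \<open>m\<close>-th coordinate of every \<open>g x\<close> is 0, so
  \<open>e m\<close> is not reached.\<close>

lemma common_zero:
  assumes m: "m < n" and f: "\<And>i. i < m \<Longrightarrow> lin s (*) (f i)"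
  shows "\<exists>x. x \<noteq> 0 \<and> (\<forall>i<m. f i x = 0)"
proof (rule ccontr)
  assume *: "\<not> ?thesis"
  define g where "g x = (\<Sum>i<m. s (f i x) (e i))" for x
  have g: "lin s s g"
    unfolding g_def by (rule linI[OF vs vs])
      (auto simp: f lin_add[OF f] lin_scale[OF f] scale_left_distrib sum.distrib scale_sum_right)
  have eg: "eps k (g x) = (if k < m then f k x else 0)" if "k < n" for k x
  proof -
    have "g x = (\<Sum>l<n. s (if l < m then f l x else 0) (e l))"
      unfolding g_def using m by (intro sum.mono_neutral_cong_left) auto
    then show ?thesis using eps_sum[OF that, of "\<lambda>l. if l < m then f l x else 0"] by simp
  qed
  have "bij g"
  proof (rule inj_imp_bij[OF g])
    fix x assume "g x = 0"
    then have "f k x = 0" if "k < m" for k using eg[of k x] m that by (simp add: lin_zero[OF eps_lin])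
    then show "x = 0" using * by blast
  qed unfold_locales
  then obtain x where "g x = e m" using surjD[OF bij_is_surj, of g "e m"] by metis
  then show False using eg[of m x] eps_e[of m m] m by simp
qed

text \<open>Nondegeneracy makes \<open>v \<mapsto> B v\<close> injective; in coordinates it is an
  endomorphism of an \<open>n\<close>-dimensional space, hence onto. The form is not assumed
  symmetric, so that alternating forms are covered as well.\<close>

lemma bilinear_riesz:
  assumes B: "\<And>x. lin s (*) (B x)" "\<And>y. lin s (*) (\<lambda>x. B x y)"
    and nondeg: "\<And>x. (\<And>y. B x y = 0) \<Longrightarrow> x = 0" and f: "lin s (*) f"
  shows "\<exists>v. \<forall>x. B v x = f x"
proof -
  define g where "g v = (\<Sum>k<n. s (B v (e k)) (e k))" for v
  have eg: "k < n \<Longrightarrow> eps k (g v) = B v (e k)" for k v unfolding g_def by (rule eps_sum)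
  have "bij g"
  proof (rule inj_imp_bij)
    show "lin s s g" unfolding g_def
      by (rule linI[OF vs vs])
        (auto simp: lin_add[OF B(2)] lin_scale[OF B(2)] scale_left_distrib sum.distrib scale_sum_right)
    fix v assume "g v = 0"
    then have "B v (e k) = 0" if "k < n" for k using eg[OF that, of v] that by (simp add: lin_zero[OF eps_lin])
    then have "B v x = 0" for x
      by (subst expand) (simp add: lin_sum[OF B(1)] lin_scale[OF B(1)])
    then show "v = 0" by (rule nondeg)
  qed unfold_locales
  then obtain v where "g v = (\<Sum>k<n. s (f (e k)) (e k))" using surjD[OF bij_is_surj] by metis
  then have "B v (e k) = f (e k)" if "k < n" for k using eg[OF that, of v] eps_sum[OF that] by simp
  then have "B v x = f x" for x using lin_ext[OF B(1) f] by blast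
  then show ?thesis by blast
qed

text \<open>The rank-one operator \<open>v \<otimes> f\<close>. For fixed nonzero \<open>f\<close>
  these operators form a minimal left ideal of the endomorphism algebra, and \<open>comp_op1\<close>
  identifies it with the space itself. The Skolem-Noether arguments rest on this.\<close>

definition op1 :: "'v \<Rightarrow> ('v \<Rightarrow> 'f) \<Rightarrow> 'v \<Rightarrow> 'v" where "op1 v f = (\<lambda>z. s (f z) v)"

lemma op1_lin: "lin s (*) f \<Longrightarrow> lin s s (op1 v f)"
  unfolding op1_def by (rule linI[OF vs vs]) (auto simp: lin_add lin_scale scale_left_distrib)

lemma comp_op1: "lin s s h \<Longrightarrow> h \<circ> op1 v f = op1 (h v) f"
  unfolding op1_def by (auto simp: lin_scale)

definition tr :: "('v \<Rightarrow> 'v) \<Rightarrow> 'f" where "tr h = (\<Sum>k<n. eps k (h (e k)))"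

lemma tr_add: "tr (\<lambda>x. h x + k x) = tr h + tr k"
  by (simp add: tr_def lin_add[OF eps_lin] sum.distrib)

lemma tr_smult: "tr (\<lambda>x. s c (h x)) = c * tr h"
  by (simp add: tr_def lin_scale[OF eps_lin] sum_distrib_left)

lemma tr_op1: "lin s (*) f \<Longrightarrow> tr (op1 v f) = f v"
proof -
  assume f: "lin s (*) f"
  have "f v = f (\<Sum>k<n. s (eps k v) (e k))" by (simp flip: expand)
  then show ?thesis by (simp add: tr_def op1_def lin_scale[OF eps_lin] lin_sum[OF f] lin_scale[OF f] mult.commute)
qed

text \<open>Commuting with \<open>op1 v (eps 0)\<close> alone suffices: evaluation at
  \<open>e 0\<close> moves \<open>v\<close> through \<open>T\<close> and yields the same scalar for
  all \<open>v\<close>.\<close>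

lemma scalar_if_commutes:
  assumes T: "lin s s T" and n: "n > 0" and c: "\<And>h. lin s s h \<Longrightarrow> T \<circ> h = h \<circ> T"
  shows "T v = s (eps 0 (T (e 0))) v"
proof -
  have "(T \<circ> op1 v (eps 0)) (e 0) = (op1 v (eps 0) \<circ> T) (e 0)"
    by (subst c) (auto intro!: op1_lin eps_lin n)
  then show ?thesis using n by (simp add: op1_def eps_e)
qed

end

text \<open>The intertwiner of the Skolem--Noether theorem sends \<open>v\<close> to \<open>\<psi>(v \<otimes> \<epsilon>\<^sub>0) w\<close>. Unitality of \<open>\<psi>\<close>
  is not assumed, so that this also covers the restrictions to the factors of a product algebra.\<close>
lemma skolem_noether:
  assumes V: "vbase s n e eps" and W: "vbase s' n e' eps'"
    and lin: "\<And>h. lin s s h \<Longrightarrow> lin s' s' (\<psi> h)"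
    and comp: "\<And>h k. lin s s h \<Longrightarrow> lin s s k \<Longrightarrow> \<psi> (h \<circ> k) = \<psi> h \<circ> \<psi> k"
    and add: "\<And>h k. lin s s h \<Longrightarrow> lin s s k \<Longrightarrow> \<psi> (\<lambda>x. h x + k x) = (\<lambda>x. \<psi> h x + \<psi> k x)"
    and smult: "\<And>c h. lin s s h \<Longrightarrow> \<psi> (\<lambda>x. s c (h x)) = (\<lambda>x. s' c (\<psi> h x))"
    and h0: "lin s s h0" "\<psi> h0 w0 \<noteq> 0"
  shows "\<exists>u. lin s s' u \<and> bij u \<and> (\<forall>h. lin s s h \<longrightarrow> \<psi> h \<circ> u = u \<circ> h)"
proof -
  interpret V: vbase s n e eps by fact
  interpret W: vbase s' n e' eps' by fact
  have n: "n > 0"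
  proof (rule ccontr)
    assume "\<not> n > 0"
    then have "\<psi> h0 w0 = 0" using W.expand[of "\<psi> h0 w0"] by simp
    then show False using h0 by simp
  qed
  have E: "lin s s (V.op1 v (eps k))" if "k < n" for v k by (rule V.op1_lin[OF V.eps_lin[OF that]])
  have zero: "\<psi> (\<lambda>_. 0) = (\<lambda>_. 0)"
    using smult[OF lin_0[OF V.vs V.vs], of 0] by (simp add: V.scale_zero_left W.scale_zero_left)
  have sumchi: "\<psi> (\<lambda>x. \<Sum>i\<in>I. g i x) = (\<lambda>x. \<Sum>i\<in>I. \<psi> (g i) x)" if "finite I" "\<And>i. i \<in> I \<Longrightarrow> lin s s (g i)"
    for I and g :: "nat \<Rightarrow> _"
  proof -
    have "lin s s (\<lambda>x. \<Sum>i\<in>I. g i x) \<and> ?thesis" using that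
      by (induction I rule: finite_induct) (auto simp: zero add intro!: lin_plus lin_0 V.vs)
    then show ?thesis by simp
  qed
  \<comment> \<open>\<open>id\<close> is the sum of the operators \<open>op1 (e k) (eps k)\<close>.
    If \<open>\<psi>\<close> killed all of them it would kill \<open>id\<close>, and with it
    \<open>h0 = h0 \<circ> id\<close>.\<close>
  have "\<exists>k<n. \<psi> (V.op1 (e k) (eps k)) \<noteq> (\<lambda>_. 0)"
  proof (rule ccontr)
    assume "\<not> ?thesis"
    then have z: "\<psi> (V.op1 (e k) (eps k)) = (\<lambda>_. 0)" if "k < n" for k using that by auto
    have "id = (\<lambda>x. \<Sum>k<n. V.op1 (e k) (eps k) x)"
      by (rule ext) (simp add: V.op1_def V.expand[symmetric])
    then have "\<psi> id = (\<lambda>x. \<Sum>k<n. \<psi> (V.op1 (e k) (eps k)) x)"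
      using sumchi[of "{..<n}" "\<lambda>k. V.op1 (e k) (eps k)"] E by simp
    then have "\<psi> id = (\<lambda>_. 0)" by (simp add: z)
    moreover have "\<psi> h0 = \<psi> h0 \<circ> \<psi> id" using comp[OF h0(1) lin_id[OF V.vs]] by simp
    ultimately have "\<psi> h0 w0 = 0" using lin_zero[OF lin[OF h0(1)]] by (simp add: fun_eq_iff)
    then show False using h0 by simp
  qed
  then obtain k where k: "k < n" "\<psi> (V.op1 (e k) (eps k)) \<noteq> (\<lambda>_. 0)" by blast
  have "V.op1 (e k) (eps k) = V.op1 (e k) (eps 0) \<circ> (V.op1 (e 0) (eps 0) \<circ> V.op1 (e 0) (eps k))"
    using k n by (auto simp: V.op1_def V.eps_e fun_eq_iff lin_scale[OF V.eps_lin])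
  then have "\<psi> (V.op1 (e k) (eps k)) =
     \<psi> (V.op1 (e k) (eps 0)) \<circ> (\<psi> (V.op1 (e 0) (eps 0)) \<circ> \<psi> (V.op1 (e 0) (eps k)))"
    using k n E by (simp only: comp lin_comp[of s s _ s])
  then obtain w where w: "\<psi> (V.op1 (e 0) (eps 0)) w \<noteq> 0"
    using k lin_zero[OF lin[OF E[of 0 "e k"]]] n by (fastforce simp: fun_eq_iff)
  define u where "u v = \<psi> (V.op1 v (eps 0)) w" for v
  have ulin: "lin s s' u"
  proof (rule linI[OF V.vs W.vs])
    fix x y c
    have "V.op1 (x + y) (eps 0) = (\<lambda>z. V.op1 x (eps 0) z + V.op1 y (eps 0) z)"
      "V.op1 (s c x) (eps 0) = (\<lambda>z. s c (V.op1 x (eps 0) z))"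
      by (auto simp: V.op1_def V.scale_right_distrib mult.commute)
    then show "u (x + y) = u x + u y" "u (s c x) = s' c (u x)"
      using add[OF E[OF n, of x] E[OF n, of y]] smult[OF E[OF n, of x], of c] by (simp_all add: u_def)
  qed
  have inter: "\<psi> h (u v) = u (h v)" if "lin s s h" for h v
    using comp[OF that E[OF n, of v]] V.comp_op1[OF that] by (simp add: u_def fun_eq_iff)
  have "bij u"
  proof (rule V.inj_imp_bij[OF ulin _ W])
    fix v assume v: "u v = 0"
    show "v = 0"
    proof (rule ccontr)
      assume "v \<noteq> 0"
      moreover have "v = 0" if "\<And>k. k < n \<Longrightarrow> eps k v = 0"
        using V.expand[of v] that by simp
      ultimately obtain k where k: "k < n" "eps k v \<noteq> 0" by blast
      \<comment> \<open>The kernel of \<open>u\<close> is stable under all endomorphisms by the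
        intertwining relation. A nonzero kernel vector could therefore be moved to
        \<open>e 0\<close>, where \<open>u\<close> is nonzero by the choice of
        \<open>w\<close>.\<close>
      define h where "h = V.op1 (s (inverse (eps k v)) (e 0)) (eps k)"
      have h: "lin s s h" unfolding h_def by (rule E[OF k(1)])
      have hv: "h v = e 0" using k by (simp add: h_def V.op1_def)
      have "u (e 0) = 0" using inter[OF h, of v] v hv lin_zero[OF lin[OF h]] by simp
      then show False using w by (simp add: u_def)
    qed
  qed
  then show ?thesis using ulin inter by (intro exI[of _ u]) auto
qed

lemma End_simps [simp]:
  "h \<in> carrier (End_algebra s) \<longleftrightarrow> lin s s h" "mult (End_algebra s) = (\<circ>)" "one (End_algebra s) = id"
  "zero (End_algebra s) = (\<lambda>_. 0)" "add (End_algebra s) = (\<lambda>h k x. h x + k x)"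
  "smult (End_algebra s) = (\<lambda>c h x. s c (h x))"
  by (simp_all add: End_algebra_def)

lemma End_is_algebra:
  assumes "vector_space s"
  shows "is_algebra (End_algebra s)"
proof (rule is_algebraI)
  interpret vector_space s by fact
  show "ring (End_algebra s)"
  proof (intro ringI abelian_groupI monoidI)
    fix x assume "x \<in> carrier (End_algebra s)"
    then show "\<exists>y\<in>carrier (End_algebra s). y \<oplus>\<^bsub>End_algebra s\<^esub> x = \<zero>\<^bsub>End_algebra s\<^esub>"
      by (intro bexI[of _ "\<lambda>v. s (-1) (x v)"]) (use lin_smult[of s s x "- 1"] in auto)
  qed (auto simp: lin_plus lin_comp lin_id lin_0 assms fun_eq_iff algebra_simps lin_add)
qed (auto simp: fun_eq_iff lin_smult lin_scale vector_space.vector_space_assms[OF assms])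

lemma vbase_exists:
  assumes fd: "finite_dimensional_vector_space s B" and n: "vector_space.dim s UNIV = n"
  shows "\<exists>e eps. vbase s n e eps"
proof -
  interpret finite_dimensional_vector_space s B by fact
  have "card B = n" using n by simp
  then obtain e where e: "bij_betw e {..<n} B"
    using ex_bij_betw_nat_finite[OF finite_Basis] by (auto simp: atLeast0LessThan)
  define eps where "eps k v = representation B v (e k)" for k v
  have eB: "e k \<in> B" if "k < n" for k using e that by (auto simp: bij_betw_def)
  have "vbase s n e eps"
  proof (intro vbase.intro vbase_axioms.intro)
    show "vector_space s" by unfold_locales
    fix k assume k: "k < n"
    show "lin s (*) (eps k)"
      unfolding eps_def by (rule linear_representation[OF independent_Basis span_Basis])
    fix l assume l: "l < n"
    have "e l = e k \<longleftrightarrow> l = k" using e k l by (auto simp: bij_betw_def inj_on_def)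
    then show "eps k (e l) = (if k = l then 1 else 0)"
      using representation_basis[OF independent_Basis eB[OF l]] by (auto simp: eps_def)
  next
    fix x
    have "x = (\<Sum>b\<in>B. s (representation B x b) b)"
      using sum_representation_eq[OF independent_Basis _ finite_Basis order_refl, of x] span_Basis by simp
    also have "\<dots> = (\<Sum>k<n. s (eps k x) (e k))"
      unfolding eps_def by (rule sum.reindex_bij_betw[OF e, symmetric])
    finally show "x = (\<Sum>k<n. s (eps k x) (e k))" .
  qed
  then show ?thesis by blast
qed

section \<open>Split algebras and reduced traces\<close>

lemma mat_trace_sum: "M \<in> carrier_mat n n \<Longrightarrow> mat_trace M = (\<Sum>i<n. M $$ (i, i))"
  by (simp add: mat_trace_def diag_mat_def sum_list_distinct_conv_sum_set atLeast0LessThan)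

lemma mat_trace_comm:
  fixes A B :: "'k::comm_ring_1 mat"
  assumes "A \<in> carrier_mat n n" "B \<in> carrier_mat n n"
  shows "mat_trace (A * B) = mat_trace (B * A)"
proof -
  have e: "mat_trace (M * N) = (\<Sum>i<n. \<Sum>j<n. M $$ (i, j) * N $$ (j, i))"
    if "M \<in> carrier_mat n n" "N \<in> carrier_mat n n" for M N :: "'k mat"
    using that by (simp add: mat_trace_sum[of _ n] scalar_prod_def atLeast0LessThan)
  show ?thesis
    unfolding e[OF assms] e[OF assms(2,1)] by (subst sum.swap) (simp add: mult.commute)
qed

context vbase
begin

lemma eps_eqI: "(\<And>k. k < n \<Longrightarrow> eps k x = eps k y) \<Longrightarrow> x = y"
proof -
  assume "\<And>k. k < n \<Longrightarrow> eps k x = eps k y"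
  then have "(\<Sum>k<n. s (eps k x) (e k)) = (\<Sum>k<n. s (eps k y) (e k))" by simp
  then show ?thesis by (simp flip: expand)
qed

text \<open>The counterpart of \<open>skolem_noether\<close> for splittings, which take values in
  matrices over an extension \<open>'k\<close> of the base field. As the two sides live over
  different fields, the intertwiner is a matrix \<open>P\<close> whose columns are the images of the
  basis vectors, and its kernel has to be treated over \<open>'k\<close>.\<close>

lemma skolem_noether_mat:
  fixes \<iota> :: "'f \<Rightarrow> 'k::field"
  assumes io: "\<iota> 0 = 0" "\<iota> 1 = 1" "\<And>a b. \<iota> (a + b) = \<iota> a + \<iota> b"
    and car: "\<And>h. lin s s h \<Longrightarrow> \<rho> h \<in> carrier_mat n n"
    and mul: "\<And>h k. lin s s h \<Longrightarrow> lin s s k \<Longrightarrow> \<rho> (h \<circ> k) = \<rho> h * \<rho> k"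
    and add: "\<And>h k. lin s s h \<Longrightarrow> lin s s k \<Longrightarrow> \<rho> (\<lambda>x. h x + k x) = \<rho> h + \<rho> k"
    and smu: "\<And>c h. lin s s h \<Longrightarrow> \<rho> (\<lambda>x. s c (h x)) = \<iota> c \<cdot>\<^sub>m \<rho> h"
    and nz: "lin s s h0" "\<rho> h0 \<noteq> 0\<^sub>m n n"
  shows "\<exists>P \<in> carrier_mat n n. \<exists>Q \<in> carrier_mat n n. P * Q = 1\<^sub>m n \<and> Q * P = 1\<^sub>m n \<and>
     (\<forall>h. lin s s h \<longrightarrow> \<rho> h * P = P * mat n n (\<lambda>(i, j). \<iota> (eps i (h (e j)))))"
proof -
  have n: "n > 0"
  proof (rule ccontr)
    assume "\<not> n > 0"
    then have "\<rho> h0 = 0\<^sub>m n n" using car[OF nz(1)] by (intro eq_matI) auto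
    then show False using nz by simp
  qed
  have E: "lin s s (op1 v (eps k))" if "k < n" for v k by (rule op1_lin[OF eps_lin[OF that]])
  have zero: "\<rho> (\<lambda>_. 0) = 0\<^sub>m n n"
    using smu[OF nz(1), of 0] car[OF nz(1)] io by auto
  have "\<exists>k<n. \<rho> (op1 (e k) (eps k)) \<noteq> 0\<^sub>m n n"
  proof (rule ccontr)
    assume "\<not> ?thesis"
    then have z: "\<rho> (op1 (e k) (eps k)) = 0\<^sub>m n n" if "k < n" for k using that by auto
    have "m \<le> n \<Longrightarrow> lin s s (\<lambda>x. \<Sum>k<m. op1 (e k) (eps k) x) \<and>
       \<rho> (\<lambda>x. \<Sum>k<m. op1 (e k) (eps k) x) = 0\<^sub>m n n" for m
      by (induction m) (auto simp: zero lin_0 vs z add E intro!: lin_plus)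
    then have "\<rho> (\<lambda>x. \<Sum>k<n. op1 (e k) (eps k) x) = 0\<^sub>m n n" by simp
    moreover have "id = (\<lambda>x. \<Sum>k<n. op1 (e k) (eps k) x)"
      by (rule ext) (simp add: op1_def expand[symmetric])
    ultimately have "\<rho> id = 0\<^sub>m n n" by simp
    moreover have "\<rho> h0 = \<rho> h0 * \<rho> id" using mul[OF nz(1) lin_id[OF vs]] by simp
    ultimately show False using nz car[OF nz(1)] by simp
  qed
  then obtain k where k: "k < n" "\<rho> (op1 (e k) (eps k)) \<noteq> 0\<^sub>m n n" by blast
  have "op1 (e k) (eps k) = op1 (e k) (eps 0) \<circ> (op1 (e 0) (eps 0) \<circ> op1 (e 0) (eps k))"
    using k n by (auto simp: op1_def eps_e fun_eq_iff lin_scale[OF eps_lin])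
  then have "\<rho> (op1 (e k) (eps k)) =
     \<rho> (op1 (e k) (eps 0)) * (\<rho> (op1 (e 0) (eps 0)) * \<rho> (op1 (e 0) (eps k)))"
    using k n E by (simp only: mul lin_comp[of s s _ s])
  then have "\<rho> (op1 (e 0) (eps 0)) \<noteq> 0\<^sub>m n n"
    using k left_mult_zero_mat[OF car[OF E[OF k(1), of "e 0"]]] right_mult_zero_mat[OF car[OF E[OF n, of "e k"]]]
    by auto
  then obtain i0 j0 where ij: "i0 < n" "j0 < n" "\<rho> (op1 (e 0) (eps 0)) $$ (i0, j0) \<noteq> 0"
    using car[OF E[OF n, of "e 0"]] by (metis eq_matI carrier_matD index_zero_mat zero_carrier_mat)
  define w :: "'k vec" where "w = unit_vec n j0"
  have w: "w \<in> carrier_vec n" by (simp add: w_def)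
  define L where "L v i = (\<rho> (op1 v (eps 0)) *\<^sub>v w) $ i" for v i
  have L0: "L (e 0) i0 \<noteq> 0" using ij car[OF E[OF n, of "e 0"]] by (simp add: L_def w_def)
  have Ladd: "L (x + y) i = L x i + L y i" if "i < n" for x y i
  proof -
    have "op1 (x + y) (eps 0) = (\<lambda>z. op1 x (eps 0) z + op1 y (eps 0) z)"
      by (auto simp: op1_def scale_right_distrib)
    then show ?thesis using that car[OF E[OF n]] w carrier_matD(1)[OF car[OF E[OF n]]]
      by (simp add: L_def add[OF E[OF n] E[OF n]] add_mult_distrib_mat_vec[of _ n n])
  qed
  have Lsm: "L (s c x) i = \<iota> c * L x i" if "i < n" for x c i
  proof -
    have "op1 (s c x) (eps 0) = (\<lambda>z. s c (op1 x (eps 0) z))"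
      by (auto simp: op1_def mult.commute)
    then show ?thesis using that car[OF E[OF n, of x]] w
      by (simp add: L_def smu[OF E[OF n]] scalar_prod_def sum_distrib_left mult.assoc)
  qed
  have Lsum: "L (\<Sum>k<m. s (c k) (e k)) i = (\<Sum>k<m. \<iota> (c k) * L (e k) i)" if i: "i < n" for c i and m :: nat
  proof (induction m)
    case 0
    have "L 0 i = 0" using Lsm[OF i, of 0 0] io by simp
    then show ?case by simp
  qed (simp add: Ladd[OF i] Lsm[OF i])
  have Lx: "L v i = (\<Sum>k<n. \<iota> (eps k v) * L (e k) i)" if i: "i < n" for v i
    using Lsum[OF i, of "\<lambda>k. eps k v" n] by (simp flip: expand)
  define P where "P = mat n n (\<lambda>(i, j). L (e j) i)"
  define M where "M h = mat n n (\<lambda>(i, j). \<iota> (eps i (h (e j))))" for h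
  have P: "P \<in> carrier_mat n n" by (simp add: P_def)
  have colP: "col P j = \<rho> (op1 (e j) (eps 0)) *\<^sub>v w" if "j < n" for j
    using that car[OF E[OF n, of "e j"]] by (intro eq_vecI) (auto simp: P_def L_def)
  have inter: "\<rho> h * P = P * M h" if h: "lin s s h" for h
  proof (rule eq_matI)
    fix i j assume ij: "i < dim_row (P * M h)" "j < dim_col (P * M h)"
    then have ij: "i < n" "j < n" by (auto simp: P_def M_def)
    note c = car[OF h] car[OF E[OF n, of "e j"]]
    have "(\<rho> h * P) $$ (i, j) = (\<rho> h *\<^sub>v (\<rho> (op1 (e j) (eps 0)) *\<^sub>v w)) $ i"
      using ij c P by (simp add: colP)
    also have "\<dots> = (\<rho> h * \<rho> (op1 (e j) (eps 0)) *\<^sub>v w) $ i"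
      using assoc_mult_mat_vec[OF c w] by simp
    also have "\<dots> = L (h (e j)) i"
      using mul[OF h E[OF n, of "e j"]] comp_op1[OF h] by (simp add: L_def)
    also have "\<dots> = (P * M h) $$ (i, j)"
      unfolding Lx[OF ij(1), of "h (e j)"] using ij
      by (simp add: P_def M_def scalar_prod_def atLeast0LessThan mult.commute)
    finally show "(\<rho> h * P) $$ (i, j) = (P * M h) $$ (i, j)" .
  qed (use car[OF h] P in \<open>auto simp: M_def\<close>)
  have "det P \<noteq> 0"
  proof
    assume "det P = 0"
    then obtain x where x: "x \<in> carrier_vec n" "x \<noteq> 0\<^sub>v n" "P *\<^sub>v x = 0\<^sub>v n"
      using det_0_iff_vec_prod_zero_field[OF P] by blast
    \<comment> \<open>The matrix unit \<open>M ?h\<close> moves the \<open>k\<close>-th coordinate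
      of \<open>x\<close> to position 0, and the result stays in the kernel of \<open>P\<close> by
      the intertwining relation. Row \<open>i0\<close> of \<open>P\<close> then forces the
      coordinate to vanish, as \<open>L (e 0) i0\<close> is nonzero.\<close>
    have "x $ k = 0" if k: "k < n" for k
    proof -
      let ?h = "op1 (e 0) (eps k)"
      have Mh: "M ?h \<in> carrier_mat n n" by (simp add: M_def)
      have "\<rho> ?h *\<^sub>v 0\<^sub>v n = 0\<^sub>v n"
        using car[OF E[OF k, of "e 0"]] by (intro eq_vecI) auto
      then have "P *\<^sub>v (M ?h *\<^sub>v x) = 0\<^sub>v n"
        using inter[OF E[OF k, of "e 0"]] assoc_mult_mat_vec[OF P Mh x(1)]
          assoc_mult_mat_vec[OF car[OF E[OF k, of "e 0"]] P x(1)] x(3) car[OF E[OF k, of "e 0"]]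
        by simp
      moreover have "M ?h *\<^sub>v x = vec n (\<lambda>i. if i = 0 then x $ k else 0)"
      proof (rule eq_vecI)
        fix i assume "i < dim_vec (vec n (\<lambda>i. if i = 0 then x $ k else 0))"
        then have i: "i < n" by simp
        have "(M ?h *\<^sub>v x) $ i = (\<Sum>j<n. \<iota> (eps i (?h (e j))) * x $ j)"
          using i x(1) by (auto simp: M_def scalar_prod_def atLeast0LessThan)
        also have "\<dots> = (\<Sum>j<n. if k = j then (if i = 0 then x $ j else 0) else 0)"
          using i n k by (intro sum.cong) (auto simp: op1_def lin_scale[OF eps_lin] eps_e io)
        finally have "(M ?h *\<^sub>v x) $ i = (\<Sum>j<n. if k = j then (if i = 0 then x $ j else 0) else 0)" .
        then show "(M ?h *\<^sub>v x) $ i = vec n (\<lambda>i. if i = 0 then x $ k else 0) $ i"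
          using i k by simp
      qed (simp add: M_def)
      ultimately have "(P *\<^sub>v vec n (\<lambda>i. if i = 0 then x $ k else 0)) $ i0 = 0" using ij by simp
      also have "(P *\<^sub>v vec n (\<lambda>i. if i = 0 then x $ k else 0)) $ i0 =
        (\<Sum>j<n. L (e j) i0 * (if j = 0 then x $ k else 0))"
        using ij by (simp add: P_def scalar_prod_def atLeast0LessThan)
      also have "\<dots> = (\<Sum>j<n. if j = 0 then L (e 0) i0 * x $ k else 0)"
        by (rule sum.cong) auto
      also have "\<dots> = L (e 0) i0 * x $ k" using n by simp
      finally show ?thesis using L0 by simp
    qed
    then show False using x(1,2) by (metis carrier_vecD eq_vecI index_zero_vec)
  qed
  then have "P \<in> Units (ring_mat TYPE('k) n ())" by (rule det_non_zero_imp_unit[OF P])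
  then obtain Q where "Q \<in> carrier_mat n n" "P * Q = 1\<^sub>m n" "Q * P = 1\<^sub>m n"
    by (auto simp: Units_def ring_mat_def)
  then show ?thesis using P inter unfolding M_def by blast
qed

text \<open>By \<open>skolem_noether_mat\<close>, \<open>\<rho>\<close> is conjugate to the
  coordinate matrices, and conjugation preserves traces. Unitality is a conclusion here: the
  restriction of a splitting to one factor of a product algebra is at first only known to be
  nonzero.\<close>

lemma split_trace:
  fixes \<rho> :: "('v \<Rightarrow> 'v) \<Rightarrow> 'f alg_closure mat"
  assumes car: "\<And>h. lin s s h \<Longrightarrow> \<rho> h \<in> carrier_mat n n"
    and mul: "\<And>h k. lin s s h \<Longrightarrow> lin s s k \<Longrightarrow> \<rho> (h \<circ> k) = \<rho> h * \<rho> k"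
    and add: "\<And>h k. lin s s h \<Longrightarrow> lin s s k \<Longrightarrow> \<rho> (\<lambda>x. h x + k x) = \<rho> h + \<rho> k"
    and smu: "\<And>c h. lin s s h \<Longrightarrow> \<rho> (\<lambda>x. s c (h x)) = to_ac c \<cdot>\<^sub>m \<rho> h"
    and nz: "lin s s h0" "\<rho> h0 \<noteq> 0\<^sub>m n n"
  shows "\<rho> id = 1\<^sub>m n" "lin s s h \<Longrightarrow> mat_trace (\<rho> h) = to_ac (tr h)"
proof -
  let ?M = "\<lambda>h. mat n n (\<lambda>(i, j). to_ac (eps i (h (e j))))"
  have "\<exists>P \<in> carrier_mat n n. \<exists>Q \<in> carrier_mat n n. P * Q = 1\<^sub>m n \<and> Q * P = 1\<^sub>m n \<and>
     (\<forall>h. lin s s h \<longrightarrow> \<rho> h * P = P * ?M h)"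
    by (rule skolem_noether_mat[where \<iota>=to_ac and \<rho>=\<rho> and ?h0.0=h0,
          OF to_ac_0 to_ac_1 to_ac_add car mul add smu nz])
  then obtain P Q where P: "P \<in> carrier_mat n n" and Q: "Q \<in> carrier_mat n n"
    and PQ: "P * Q = 1\<^sub>m n" "Q * P = 1\<^sub>m n" and inter: "\<And>h. lin s s h \<Longrightarrow> \<rho> h * P = P * ?M h"
    by blast
  have eq: "\<rho> h = P * (?M h * Q)" if h: "lin s s h" for h
  proof -
    have "\<rho> h = \<rho> h * (P * Q)" using car[OF h] PQ by simp
    also have "\<dots> = (\<rho> h * P) * Q" using car[OF h] P Q by simp
    also have "\<dots> = P * (?M h * Q)" using inter[OF h] P Q assoc_mult_mat[of P n n "?M h" n Q n] by simp
    finally show ?thesis .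
  qed
  have "?M id = 1\<^sub>m n" by (rule eq_matI) (auto simp: eps_e)
  then show "\<rho> id = 1\<^sub>m n" using eq[OF lin_id[OF vs]] P Q PQ by simp
  assume h: "lin s s h"
  have "mat_trace (\<rho> h) = mat_trace ((?M h * Q) * P)"
    unfolding eq[OF h] using P Q by (intro mat_trace_comm[of _ n]) auto
  also have "(?M h * Q) * P = ?M h" using P Q PQ by (simp add: assoc_mult_mat[of _ n n _ n _ n])
  also have "mat_trace (?M h) = to_ac (tr h)" by (simp add: mat_trace_sum[of _ n] tr_def to_ac_sum)
  finally show "mat_trace (\<rho> h) = to_ac (tr h)" .
qed

lemma mat_End: "bij_betw (\<lambda>h. mat n n (\<lambda>(i, j). eps i (h (e j)))) {h. lin s s h} (carrier_mat n n)"
proof (rule bij_betwI[where g = "\<lambda>M x. \<Sum>i<n. s (\<Sum>j<n. M $$ (i, j) * eps j x) (e i)"])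
  show "(\<lambda>M x. \<Sum>i<n. s (\<Sum>j<n. M $$ (i, j) * eps j x) (e i)) \<in> carrier_mat n n \<rightarrow> {h. lin s s h}"
    by (auto intro!: linI[OF vs vs] simp: lin_add[OF eps_lin] lin_scale[OF eps_lin] distrib_left
        sum.distrib scale_left_distrib scale_sum_right sum_distrib_left mult_ac)
  show "mat n n (\<lambda>(i, j). eps i (\<Sum>i<n. s (\<Sum>k<n. M $$ (i, k) * eps k (e j)) (e i))) = M"
    if "M \<in> carrier_mat n n" for M
    using that by (intro eq_matI) (auto simp: eps_sum eps_e if_distrib cong: if_cong)
  fix h assume "h \<in> {h. lin s s h}"
  then have h: "lin s s h" by simp
  show "(\<lambda>x. \<Sum>i<n. s (\<Sum>j<n. mat n n (\<lambda>(i, j). eps i (h (e j))) $$ (i, j) * eps j x) (e i)) = h"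
  proof
    fix x
    have "h x = (\<Sum>i<n. s (eps i (h (\<Sum>j<n. s (eps j x) (e j)))) (e i))" by (simp flip: expand)
    also have "\<dots> = (\<Sum>i<n. s (\<Sum>j<n. mat n n (\<lambda>(i, j). eps i (h (e j))) $$ (i, j) * eps j x) (e i))"
      by (rule sum.cong) (auto simp: lin_sum[OF h] lin_scale[OF h] lin_sum[OF eps_lin] lin_scale[OF eps_lin]
          mult.commute)
    finally show "(\<Sum>i<n. s (\<Sum>j<n. mat n n (\<lambda>(i, j). eps i (h (e j))) $$ (i, j) * eps j x) (e i)) = h x"
      by simp
  qed
qed auto

lemma mat_End_iso: "(\<lambda>h. mat n n (\<lambda>(i, j). eps i (h (e j)))) \<in> alg_iso (End_algebra s) (module_mat TYPE('f) n n)"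
proof -
  have "(\<lambda>h. mat n n (\<lambda>(i, j). eps i (h (e j)))) \<in> alg_hom (End_algebra s) (module_mat TYPE('f) n n)"
  proof (rule alg_homI; simp add: module_mat_simps)
    show "mat n n (\<lambda>(i, j). eps i (e j)) = 1\<^sub>m n" by (rule eq_matI) (auto simp: eps_e)
    fix h k assume h: "lin s s h" and k: "lin s s k"
    show "mat n n (\<lambda>(i, j). eps i (h (e j) + k (e j))) =
      mat n n (\<lambda>(i, j). eps i (h (e j))) + mat n n (\<lambda>(i, j). eps i (k (e j)))"
      by (rule eq_matI) (auto simp: lin_add[OF eps_lin])
    show "mat n n (\<lambda>(i, j). eps i (h (k (e j)))) =
      mat n n (\<lambda>(i, j). eps i (h (e j))) * mat n n (\<lambda>(i, j). eps i (k (e j)))"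
    proof (rule eq_matI)
      fix i j assume "i < dim_row (mat n n (\<lambda>(i, j). eps i (h (e j))) * mat n n (\<lambda>(i, j). eps i (k (e j))))"
        "j < dim_col (mat n n (\<lambda>(i, j). eps i (h (e j))) * mat n n (\<lambda>(i, j). eps i (k (e j))))"
      then have ij: "i < n" "j < n" by auto
      have "eps i (h (k (e j))) = eps i (h (\<Sum>l<n. s (eps l (k (e j))) (e l)))" by (simp flip: expand)
      then show "mat n n (\<lambda>(i, j). eps i (h (k (e j)))) $$ (i, j) =
        (mat n n (\<lambda>(i, j). eps i (h (e j))) * mat n n (\<lambda>(i, j). eps i (k (e j)))) $$ (i, j)"
        using ij by (simp add: scalar_prod_def atLeast0LessThan lin_sum[OF h] lin_scale[OF h]
           lin_sum[OF eps_lin] lin_scale[OF eps_lin] mult.commute)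
    qed auto
  next
    fix c h assume h: "lin s s h"
    show "mat n n (\<lambda>(i, j). eps i (s c (h (e j)))) = c \<cdot>\<^sub>m mat n n (\<lambda>(i, j). eps i (h (e j)))"
      by (rule eq_matI) (auto simp: lin_scale[OF eps_lin])
  qed
  moreover have "carrier (End_algebra s) = {h. lin s s h}" by auto
  ultimately show ?thesis using mat_End by (simp add: alg_iso_def module_mat_simps)
qed

end

text \<open>Dimensions of algebra records are obtained by transport: a linear bijection to
  coordinate vectors carries the known dimension over.\<close>

lemma alg_dim_eqI:
  fixes A :: "('f::field, 'a, 'm) module_scheme" and f :: "'a \<Rightarrow> 'f vec"
  assumes vs: "vectorspace class_ring A"
    and bij: "bij_betw f (carrier A) (carrier_vec m)"
    and add: "\<And>x y. x \<in> carrier A \<Longrightarrow> y \<in> carrier A \<Longrightarrow> f (x \<oplus>\<^bsub>A\<^esub> y) = f x + f y"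
    and smult: "\<And>c x. x \<in> carrier A \<Longrightarrow> f (c \<odot>\<^bsub>A\<^esub> x) = c \<cdot>\<^sub>v f x"
  shows "alg_dim A = m"
proof -
  interpret A: vectorspace class_ring A by fact
  interpret W: vec_space "TYPE('f)" m .
  let ?V = "module_vec TYPE('f) m"
  let ?g = "inv_into (carrier A) f"
  have g: "?g w \<in> carrier A" "f (?g w) = w" if "w \<in> carrier_vec m" for w
    using that bij by (auto simp: bij_betw_def inv_into_into f_inv_into_f)
  have eq: "?g w = x" if "x \<in> carrier A" "f x = w" for x w
    using that bij by (auto simp: bij_betw_def)
  have hom: "?g \<in> module_hom class_ring ?V A"
    unfolding module_hom_def
    by (auto simp: module_vec_simps g add smult intro!: eq A.smult_closed A.a_closed)
  have "linear_map class_ring ?V A ?g"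
    using vec_vs[where 'a='f and n=m] vs hom
    by (auto simp: linear_map_def mod_hom_def mod_hom_axioms_def vectorspace_def)
  then interpret T: linear_map class_ring ?V A ?g .
  have "W.dim = A.dim"
  proof (rule T.dim_eq)
    show "W.fin_dim" by simp
    show "inj_on ?g (carrier ?V)" "?g ` carrier ?V = carrier A"
      using bij_betw_inv_into[OF bij] by (auto simp: bij_betw_def module_vec_simps)
  qed
  then show ?thesis using W.dim_is_n by simp
qed

lemma mat_vec_bij:
  "bij_betw (\<lambda>M. Matrix.vec (n * n) (\<lambda>k. M $$ (k div n, k mod n))) (carrier_mat n n :: 'f mat set) (carrier_vec (n * n))"
proof (rule bij_betwI[where g = "\<lambda>v. mat n n (\<lambda>(i, j). Matrix.vec_index v (i * n + j))"])
  fix M :: "'f mat" assume M: "M \<in> carrier_mat n n"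
  have "i * n + j < n * n" if "i < n" "j < n" for i j
  proof -
    have "i * n + j < (i + 1) * n" using that by simp
    also have "\<dots> \<le> n * n" using that by (intro mult_le_mono1) auto
    finally show ?thesis .
  qed
  then show "mat n n (\<lambda>(i, j). Matrix.vec_index (Matrix.vec (n * n) (\<lambda>k. M $$ (k div n, k mod n))) (i * n + j)) = M"
    using M by (intro eq_matI) auto
next
  fix v :: "'f vec" assume v: "v \<in> carrier_vec (n * n)"
  have "k div n < n \<and> k mod n < n" if "k < n * n" for k
    using that by (cases "n = 0") (auto simp: less_mult_imp_div_less)
  then show "Matrix.vec (n * n) (\<lambda>k. mat n n (\<lambda>(i, j). Matrix.vec_index v (i * n + j)) $$ (k div n, k mod n)) = v"
    using v by (intro eq_vecI) auto
qed auto

section \<open>Algebras identified with an endomorphism algebra\<close>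

locale split_alg = falg A + E: vbase s n e eps
  for A :: "('f::field, 'a, 'm) module_scheme" (structure)
    and s :: "'f \<Rightarrow> 'v::ab_group_add \<Rightarrow> 'v" and n e eps +
  fixes \<gamma> :: "'a \<Rightarrow> 'v \<Rightarrow> 'v"
  assumes g_iso: "\<gamma> \<in> alg_iso A (End_algebra s)" and n_pos: "n > 0"
begin

definition dl :: "('v \<Rightarrow> 'v) \<Rightarrow> 'a" where "dl = inv_into (carrier A) \<gamma>"

lemma g_hom: "\<gamma> \<in> alg_hom A (End_algebra s)" using g_iso by (rule alg_isoD)

lemma g_lin [simp, intro]: "a \<in> carrier A \<Longrightarrow> lin s s (\<gamma> a)"
  and g_add: "a \<in> carrier A \<Longrightarrow> b \<in> carrier A \<Longrightarrow> \<gamma> (a \<oplus> b) = (\<lambda>x. \<gamma> a x + \<gamma> b x)"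
  and g_mult: "a \<in> carrier A \<Longrightarrow> b \<in> carrier A \<Longrightarrow> \<gamma> (a \<otimes> b) = \<gamma> a \<circ> \<gamma> b"
  and g_one [simp]: "\<gamma> \<one> = id"
  and g_smult: "a \<in> carrier A \<Longrightarrow> \<gamma> (c \<odot> a) = (\<lambda>x. s c (\<gamma> a x))"
  using alg_homD[OF g_hom] by auto

lemma g_bij: "bij_betw \<gamma> (carrier A) {h. lin s s h}"
proof -
  have "carrier (End_algebra s) = {h. lin s s h}" by auto
  then show ?thesis using alg_isoD(2)[OF g_iso] by simp
qed

lemma dl_closed [simp, intro]: "lin s s h \<Longrightarrow> dl h \<in> carrier A"
  and g_dl [simp]: "lin s s h \<Longrightarrow> \<gamma> (dl h) = h"
  and dl_g [simp]: "a \<in> carrier A \<Longrightarrow> dl (\<gamma> a) = a"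
  using g_bij unfolding dl_def
  by (auto simp: bij_betw_def f_inv_into_f[where A="carrier A" and f=\<gamma>] intro!: inv_into_into) 

lemma g_inj: "a \<in> carrier A \<Longrightarrow> b \<in> carrier A \<Longrightarrow> \<gamma> a = \<gamma> b \<Longrightarrow> a = b"
  by (metis dl_g)

lemma dl_hom: "dl \<in> alg_hom (End_algebra s) A"
  unfolding dl_def using alg_isoD(1)[OF alg_iso_inv[OF alg g_iso]] .

lemma alg_dim_A: "alg_dim A = n * n"
proof (rule alg_dim_eqI[OF vs])
  let ?f = "\<lambda>a. Matrix.vec (n * n) (\<lambda>k. eps (k div n) (\<gamma> a (e (k mod n))))"
  have k: "k div n < n \<and> k mod n < n" if "k < n * n" for k
    using that n_pos by (auto simp: less_mult_imp_div_less)
  from bij_betw_trans[OF bij_betw_trans[OF g_bij E.mat_End] mat_vec_bij]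
  show "bij_betw ?f (carrier A) (carrier_vec (n * n))"
    by (rule bij_betw_cong[THEN iffD1, rotated]) (auto intro!: eq_vecI simp: k)
  fix x y c assume x: "x \<in> carrier A"
  show "?f (c \<odot> x) = c \<cdot>\<^sub>v ?f x"
    using x k by (intro eq_vecI) (auto simp: g_smult lin_scale[OF E.eps_lin])
  assume y: "y \<in> carrier A"
  show "?f (x \<oplus> y) = ?f x + ?f y"
    using x y k by (intro eq_vecI) (auto simp: g_add lin_add[OF E.eps_lin])
qed

lemma in_centre: "z \<in> centre A \<longleftrightarrow> z \<in> carrier A \<and> (\<exists>c. \<gamma> z = s c)"
proof
  assume z: "z \<in> centre A"
  then have zc: "z \<in> carrier A" by (simp add: centre_def)
  have comm: "\<gamma> z \<circ> h = h \<circ> \<gamma> z" if "lin s s h" for h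
  proof -
    have "z \<otimes> dl h = dl h \<otimes> z" using z that by (simp add: centre_def)
    from arg_cong[OF this, of \<gamma>] show ?thesis using that zc by (simp add: g_mult)
  qed
  have "\<gamma> z = s (eps 0 (\<gamma> z (e 0)))"
    by (rule ext, rule E.scalar_if_commutes[OF g_lin[OF zc] n_pos], rule comm)
  then show "z \<in> carrier A \<and> (\<exists>c. \<gamma> z = s c)" using zc by blast
next
  assume "z \<in> carrier A \<and> (\<exists>c. \<gamma> z = s c)"
  then obtain c where z: "z \<in> carrier A" "\<gamma> z = s c" by blast
  have "z \<otimes> x = x \<otimes> z" if "x \<in> carrier A" for x
    using that z by (intro g_inj) (auto simp: g_mult lin_scale[OF g_lin])
  then show "z \<in> centre A" using z by (simp add: centre_def)
qed

lemma scal_lin: "lin s s (s c)"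
  by (rule linI[OF E.vs E.vs]) (auto simp: E.scale_right_distrib mult.commute)

lemma centre_vs: "vectorspace class_ring (A\<lparr>carrier := centre A\<rparr>)"
proof -
  have "submodule class_ring (centre A) A"
  proof
    show "centre A \<subseteq> carrier A" by (auto simp: centre_def)
    show "\<zero> \<in> centre A" by (auto simp: centre_def)
    show "v \<oplus> w \<in> centre A" if "v \<in> centre A" "w \<in> centre A" for v w
      using that by (auto simp: centre_def l_distr r_distr)
    show "c \<odot> v \<in> centre A" if "v \<in> centre A" for c v
      using that by (auto simp: centre_def sm_l sm_r)
  qed
  then have "VectorSpace.subspace class_ring (centre A) A"
    using vs by (simp add: VectorSpace.subspace_def)
  then show ?thesis by (rule V.subspace_is_vs)
qed

end

lemma degree_over_centre_eqI:
  assumes "alg_dim A = n\<^sup>2 * d" "alg_dim (A\<lparr>carrier := centre A\<rparr>) = d" "d > 0"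
  shows "degree_over_centre A = n"
  unfolding degree_over_centre_def
  by (rule the_equality) (use assms in \<open>auto simp: power_eq_iff_eq_base\<close>)

context split_alg
begin

lemma degree_A: "degree_over_centre A = n"
proof (rule degree_over_centre_eqI[where d=1])
  show "alg_dim A = n\<^sup>2 * 1" using alg_dim_A by (simp add: power2_eq_square)
  show "alg_dim (A\<lparr>carrier := centre A\<rparr>) = 1"
  proof (rule alg_dim_eqI[OF centre_vs])
    let ?f = "\<lambda>z. Matrix.vec 1 (\<lambda>_. eps 0 (\<gamma> z (e 0)))"
    have sc: "\<gamma> z = s (eps 0 (\<gamma> z (e 0)))" if z: "z \<in> centre A" for z
    proof -
      obtain c where "\<gamma> z = s c" using z by (auto simp: in_centre)
      moreover from this have "eps 0 (\<gamma> z (e 0)) = c"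
        using n_pos by (simp add: lin_scale[OF E.eps_lin] E.eps_e)
      ultimately show ?thesis by simp
    qed
    show "bij_betw ?f (carrier (A\<lparr>carrier := centre A\<rparr>)) (carrier_vec 1)"
    proof (rule bij_betwI[where g = "\<lambda>v. dl (s (Matrix.vec_index v 0))"])
      show "(\<lambda>v. dl (s (Matrix.vec_index v 0))) \<in> carrier_vec 1 \<rightarrow> carrier (A\<lparr>carrier := centre A\<rparr>)"
        using scal_lin by (auto simp: in_centre)
      show "?f (dl (s (Matrix.vec_index v 0))) = v" if "v \<in> carrier_vec 1" for v
        using that n_pos scal_lin by (intro eq_vecI) (auto simp: lin_scale[OF E.eps_lin] E.eps_e)
      fix z assume "z \<in> carrier (A\<lparr>carrier := centre A\<rparr>)"
      then have z: "z \<in> centre A" by simp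
      then have "z \<in> carrier A" by (simp add: centre_def)
      then show "dl (s (Matrix.vec_index (?f z) 0)) = z" using sc[OF z] by simp
    qed auto
    fix x y c assume "x \<in> carrier (A\<lparr>carrier := centre A\<rparr>)"
    then have x: "x \<in> carrier A" by (simp add: centre_def)
    show "?f (c \<odot>\<^bsub>A\<lparr>carrier := centre A\<rparr>\<^esub> x) = c \<cdot>\<^sub>v ?f x"
      using x n_pos by (intro eq_vecI) (auto simp: g_smult lin_scale[OF E.eps_lin])
    assume "y \<in> carrier (A\<lparr>carrier := centre A\<rparr>)"
    then have y: "y \<in> carrier A" by (simp add: centre_def)
    show "?f (x \<oplus>\<^bsub>A\<lparr>carrier := centre A\<rparr>\<^esub> y) = ?f x + ?f y"
      using x y n_pos by (intro eq_vecI) (auto simp: g_add lin_add[OF E.eps_lin])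
  qed
qed simp

lemma splittingD:
  assumes "\<rho> \<in> splittings A" "a \<in> carrier A"
  shows "mat_trace (\<rho> a) = to_ac (E.tr (\<gamma> a))"
proof -
  have r: "\<rho> \<in> Ring.ring_hom A (module_mat TYPE('f alg_closure) n n)"
    "\<And>c x. x \<in> carrier A \<Longrightarrow> \<rho> (c \<odot> x) = to_ac c \<cdot>\<^sub>m \<rho> x"
    using assms(1) by (auto simp: splittings_def degree_A)
  note rr = r(1)[unfolded Ring.ring_hom_def module_mat_simps, simplified]
  note d = alg_homD[OF dl_hom, simplified]
  have "mat_trace ((\<rho> \<circ> dl) (\<gamma> a)) = to_ac (E.tr (\<gamma> a))"
  proof (rule E.split_trace(2)[where ?h0.0=id])
    have "\<rho> \<one> = 1\<^sub>m n" using rr by auto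
    moreover have "(1\<^sub>m n :: 'f alg_closure mat) \<noteq> 0\<^sub>m n n"
      using n_pos by (metis index_one_mat(1) index_zero_mat(1) zero_neq_one)
    ultimately show "(\<rho> \<circ> dl) id \<noteq> 0\<^sub>m n n" using d(4) by simp
    fix h k c assume h: "lin s s h"
    then show "(\<rho> \<circ> dl) h \<in> carrier_mat n n" "(\<rho> \<circ> dl) (\<lambda>x. s c (h x)) = to_ac c \<cdot>\<^sub>m (\<rho> \<circ> dl) h"
      using rr r(2) by (auto simp: d(5))
    assume k: "lin s s k"
    show "(\<rho> \<circ> dl) (h \<circ> k) = (\<rho> \<circ> dl) h * (\<rho> \<circ> dl) k"
      unfolding comp_apply[of \<rho> dl] d(3)[OF h k] using rr h k by auto
    show "(\<rho> \<circ> dl) (\<lambda>x. h x + k x) = (\<rho> \<circ> dl) h + (\<rho> \<circ> dl) k"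
      unfolding comp_apply[of \<rho> dl] d(2)[OF h k] using rr h k by auto
  qed (use assms(2) in \<open>auto simp: lin_id E.vs\<close>)
  then show ?thesis using assms(2) by simp
qed

text \<open>Without a splitting every \<open>t\<close> would satisfy the description that defines
  \<open>Trd\<close>; this one pins the value down.\<close>

lemma splitting_exists: "(\<lambda>a. mat n n (\<lambda>(i, j). to_ac (eps i (\<gamma> a (e j))))) \<in> splittings A"
proof -
  let ?m = "\<lambda>h. mat n n (\<lambda>(i, j). eps i (h (e j)))"
  note m = alg_homD[OF alg_isoD(1)[OF E.mat_End_iso], simplified module_mat_simps, simplified]
  interpret ac: comm_ring_hom "to_ac :: 'f \<Rightarrow> _" by unfold_locales auto
  have "mat n n (\<lambda>(i, j). to_ac (eps i (\<gamma> a (e j)))) = map_mat to_ac (?m (\<gamma> a))" for a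
    by (rule eq_matI) auto
  moreover have "(\<lambda>a. map_mat to_ac (?m (\<gamma> a))) \<in> splittings A"
  proof -
    have 1: "map_mat to_ac (?m (\<gamma> (c \<odot> x))) = to_ac c \<cdot>\<^sub>m map_mat to_ac (?m (\<gamma> x))" if "x \<in> carrier A" for c x
      using that by (intro eq_matI) (auto simp: g_smult lin_scale[OF E.eps_lin])
    have 2: "map_mat to_ac (?m (\<gamma> (x \<oplus> y))) = map_mat to_ac (?m (\<gamma> x)) + map_mat to_ac (?m (\<gamma> y))"
      if "x \<in> carrier A" "y \<in> carrier A" for x y
      using that by (intro eq_matI) (auto simp: g_add lin_add[OF E.eps_lin])
    have 3: "map_mat to_ac (?m (\<gamma> (x \<otimes> y))) = map_mat to_ac (?m (\<gamma> x)) * map_mat to_ac (?m (\<gamma> y))"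
      if "x \<in> carrier A" "y \<in> carrier A" for x y
    proof -
      have "?m (\<gamma> (x \<otimes> y)) = ?m (\<gamma> x) * ?m (\<gamma> y)"
        using m(3)[of "\<gamma> x" "\<gamma> y"] that by (simp add: g_mult)
      then show ?thesis by (simp add: ac.mat_hom_mult[of _ n n _ n])
    qed
    have "?m (\<gamma> \<one>) = 1\<^sub>m n" by (rule eq_matI) (auto simp: E.eps_e)
    then have 4: "map_mat to_ac (?m (\<gamma> \<one>)) = 1\<^sub>m n" by (simp only: ac.mat_hom_one)
    have 5: "map_mat to_ac (?m h) \<in> carrier_mat n n" for h by simp
    show ?thesis
      unfolding splittings_def degree_A Let_def Ring.ring_hom_def module_mat_simps
      using 1 2 3 4 5 by blast
  qed
  ultimately show ?thesis by simp
qed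

lemma Trd_eq: "a \<in> carrier A \<Longrightarrow> Trd A a = E.tr (\<gamma> a)"
  unfolding Trd_def
proof (rule the_equality)
  assume a: "a \<in> carrier A"
  then show "\<forall>\<rho>\<in>splittings A. mat_trace (\<rho> a) = to_ac (E.tr (\<gamma> a))" using splittingD by blast
  fix t assume "\<forall>\<rho>\<in>splittings A. mat_trace (\<rho> a) = to_ac t"
  then show "t = E.tr (\<gamma> a)" using splittingD[OF splitting_exists a] splitting_exists by fastforce
qed

end

section \<open>Products of two endomorphism algebras of equal degree, the shape of the Clifford
  algebra of a triple\<close>

locale split_pair = falg A + E: vbase s n e eps + E': vbase s' n e' eps'
  for A :: "('f::field, 'a, 'm) module_scheme" (structure)
    and s :: "'f \<Rightarrow> 'v::ab_group_add \<Rightarrow> 'v" and n e eps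
    and s' :: "'f \<Rightarrow> 'w::ab_group_add \<Rightarrow> 'w" and e' eps' +
  fixes p :: "'a \<Rightarrow> 'v \<Rightarrow> 'v" and q :: "'a \<Rightarrow> 'w \<Rightarrow> 'w"
  assumes p_hom: "p \<in> alg_hom A (End_algebra s)" and q_hom: "q \<in> alg_hom A (End_algebra s')"
    and pq_bij: "bij_betw (\<lambda>a. (p a, q a)) (carrier A) ({h. lin s s h} \<times> {h. lin s' s' h})"
    and n_pos: "n > 0"
begin

lemma p_lin [simp, intro]: "a \<in> carrier A \<Longrightarrow> lin s s (p a)"
  and p_add: "a \<in> carrier A \<Longrightarrow> b \<in> carrier A \<Longrightarrow> p (a \<oplus> b) = (\<lambda>x. p a x + p b x)"
  and p_mult: "a \<in> carrier A \<Longrightarrow> b \<in> carrier A \<Longrightarrow> p (a \<otimes> b) = p a \<circ> p b"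
  and p_one [simp]: "p \<one> = id"
  and p_smult: "a \<in> carrier A \<Longrightarrow> p (c \<odot> a) = (\<lambda>x. s c (p a x))"
  using alg_homD[OF p_hom] by auto

lemma q_lin [simp, intro]: "a \<in> carrier A \<Longrightarrow> lin s' s' (q a)"
  and q_add: "a \<in> carrier A \<Longrightarrow> b \<in> carrier A \<Longrightarrow> q (a \<oplus> b) = (\<lambda>x. q a x + q b x)"
  and q_mult: "a \<in> carrier A \<Longrightarrow> b \<in> carrier A \<Longrightarrow> q (a \<otimes> b) = q a \<circ> q b"
  and q_one [simp]: "q \<one> = id"
  and q_smult: "a \<in> carrier A \<Longrightarrow> q (c \<odot> a) = (\<lambda>x. s' c (q a x))"
  using alg_homD[OF q_hom] by auto

definition pr :: "('v \<Rightarrow> 'v) \<Rightarrow> ('w \<Rightarrow> 'w) \<Rightarrow> 'a" where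
  "pr h k = inv_into (carrier A) (\<lambda>a. (p a, q a)) (h, k)"

lemma pr:
  assumes "lin s s h" "lin s' s' k"
  shows "pr h k \<in> carrier A" "p (pr h k) = h" "q (pr h k) = k"
proof -
  have hk: "(h, k) \<in> (\<lambda>a. (p a, q a)) ` carrier A"
    using pq_bij assms by (auto simp: bij_betw_def)
  show "pr h k \<in> carrier A" using inv_into_into[OF hk] by (simp add: pr_def)
  show "p (pr h k) = h" "q (pr h k) = k" using f_inv_into_f[OF hk] by (simp_all add: pr_def)
qed

lemma pq_inj: "a \<in> carrier A \<Longrightarrow> b \<in> carrier A \<Longrightarrow> p a = p b \<Longrightarrow> q a = q b \<Longrightarrow> a = b"
  using pq_bij by (auto simp: bij_betw_def inj_on_def)

lemma pr_eq: "a \<in> carrier A \<Longrightarrow> p a = h \<Longrightarrow> q a = k \<Longrightarrow> pr h k = a"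
  by (rule pq_inj) (use pr[of h k] in auto)

lemma scal_lin: "lin s s (s c)" "lin s' s' (s' c)"
  by (rule linI; auto simp: E.scale_right_distrib mult.commute E'.scale_right_distrib E.vs E'.vs)+

lemma lin0: "lin s s (\<lambda>_. 0)" "lin s' s' (\<lambda>_. 0)" by (simp_all add: lin_0 E.vs E'.vs)
lemma linid: "lin s s id" "lin s' s' id" by (simp_all add: lin_id E.vs E'.vs)

lemma in_centre: "z \<in> centre A \<longleftrightarrow> z \<in> carrier A \<and> (\<exists>c d. p z = s c \<and> q z = s' d)"
proof
  assume z: "z \<in> centre A"
  then have zc: "z \<in> carrier A" by (simp add: centre_def)
  have comm: "p z \<circ> h = h \<circ> p z \<and> q z \<circ> k = k \<circ> q z" if "lin s s h" "lin s' s' k" for h k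
  proof -
    note d = pr[OF that]
    have "z \<otimes> pr h k = pr h k \<otimes> z" using z d by (simp add: centre_def)
    from arg_cong[OF this, of p] arg_cong[OF this, of q] show ?thesis
      using d zc by (simp add: p_mult q_mult)
  qed
  have "p z = s (eps 0 (p z (e 0)))"
    by (rule ext, rule E.scalar_if_commutes[OF p_lin[OF zc] n_pos]) (use comm linid in blast)
  moreover have "q z = s' (eps' 0 (q z (e' 0)))"
    by (rule ext, rule E'.scalar_if_commutes[OF q_lin[OF zc] n_pos]) (use comm linid in blast)
  ultimately show "z \<in> carrier A \<and> (\<exists>c d. p z = s c \<and> q z = s' d)" using zc by blast
next
  assume "z \<in> carrier A \<and> (\<exists>c d. p z = s c \<and> q z = s' d)"
  then obtain c d where z: "z \<in> carrier A" "p z = s c" "q z = s' d" by blast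
  have "z \<otimes> x = x \<otimes> z" if "x \<in> carrier A" for x
    using that z by (intro pq_inj) (auto simp: p_mult q_mult lin_scale[OF p_lin] lin_scale[OF q_lin])
  then show "z \<in> centre A" using z by (simp add: centre_def)
qed

lemma centre_vs: "vectorspace class_ring (A\<lparr>carrier := centre A\<rparr>)"
proof -
  have "submodule class_ring (centre A) A"
  proof
    show "centre A \<subseteq> carrier A" by (auto simp: centre_def)
    show "\<zero> \<in> centre A" by (auto simp: centre_def)
    show "v \<oplus> w \<in> centre A" if "v \<in> centre A" "w \<in> centre A" for v w
      using that by (auto simp: centre_def l_distr r_distr)
    show "c \<odot> v \<in> centre A" if "v \<in> centre A" for c v
      using that by (auto simp: centre_def sm_l sm_r)
  qed
  then have "VectorSpace.subspace class_ring (centre A) A"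
    using vs by (simp add: VectorSpace.subspace_def)
  then show ?thesis by (rule V.subspace_is_vs)
qed

lemma alg_dim_A: "alg_dim A = 2 * (n * n)"
proof (rule alg_dim_eqI[OF vs])
  let ?N = "n * n"
  define f where "f k a = (if k < ?N then eps (k div n) (p a (e (k mod n)))
     else eps' ((k - ?N) div n) (q a (e' ((k - ?N) mod n))))" for k a
  have k: "k div n < n" "k mod n < n" if "k < ?N" for k
    using that n_pos by (auto simp: less_mult_imp_div_less)
  let ?f = "\<lambda>a. Matrix.vec (2 * ?N) (\<lambda>k. f k a)"
  let ?h = "\<lambda>v x. \<Sum>i<n. s (\<Sum>j<n. Matrix.vec_index v (i * n + j) * eps j x) (e i)"
  let ?k = "\<lambda>v x. \<Sum>i<n. s' (\<Sum>j<n. Matrix.vec_index v (?N + (i * n + j)) * eps' j x) (e' i)"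
  have hk: "lin s s (?h v)" "lin s' s' (?k v)" for v
    by (auto intro!: linI[OF E.vs E.vs] linI[OF E'.vs E'.vs] simp: lin_add[OF E.eps_lin]
        lin_scale[OF E.eps_lin] lin_add[OF E'.eps_lin] lin_scale[OF E'.eps_lin] distrib_left sum.distrib
        E.scale_left_distrib E.scale_sum_right E'.scale_left_distrib E'.scale_sum_right sum_distrib_left
        mult_ac distrib_right)
  have inj: "a = b" if a: "a \<in> carrier A" and b: "b \<in> carrier A" and eq: "\<And>k. k < 2 * ?N \<Longrightarrow> f k a = f k b" for a b
  proof (rule pq_inj[OF a b])
    have ij: "i * n + j < ?N \<and> (i * n + j) div n = i \<and> (i * n + j) mod n = j" if "i < n" "j < n" for i j
    proof -
      have "i * n + j < (i + 1) * n" using that by simp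
      also have "\<dots> \<le> ?N" using that by (intro mult_le_mono1) auto
      finally show ?thesis using that by simp
    qed
    have 1: "eps i (p a (e j)) = eps i (p b (e j))" if "i < n" "j < n" for i j
      using eq[of "i * n + j"] ij[OF that] by (simp add: f_def)
    have 2: "eps' i (q a (e' j)) = eps' i (q b (e' j))" if "i < n" "j < n" for i j
      using eq[of "?N + (i * n + j)"] ij[OF that] by (simp add: f_def)
    have "p a (e j) = p b (e j)" if "j < n" for j
      by (rule E.eps_eqI) (rule 1[OF _ that])
    then show "p a = p b" by (rule ext[OF E.lin_ext[OF p_lin[OF a] p_lin[OF b]]])
    have "q a (e' j) = q b (e' j)" if "j < n" for j
      by (rule E'.eps_eqI) (rule 2[OF _ that])
    then show "q a = q b" by (rule ext[OF E'.lin_ext[OF q_lin[OF a] q_lin[OF b]]])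
  qed
  have surj: "\<exists>a\<in>carrier A. ?f a = v" if v: "v \<in> carrier_vec (2 * ?N)" for v
  proof (rule bexI, rule eq_vecI)
    fix i assume "i < dim_vec v"
    then have i: "i < 2 * ?N" using v by simp
    have "(\<Sum>j<n. Matrix.vec_index v (g j) * eps j (e m)) = (\<Sum>j<n. if j = m then Matrix.vec_index v (g m) else 0)"
       "(\<Sum>j<n. Matrix.vec_index v (g j) * eps' j (e' m)) = (\<Sum>j<n. if j = m then Matrix.vec_index v (g m) else 0)"
      if "m < n" for g :: "nat \<Rightarrow> nat" and m
      by (rule sum.cong; use that in \<open>auto simp: E.eps_e E'.eps_e\<close>)+
    then have d': "(\<Sum>j<n. Matrix.vec_index v (g j) * eps j (e m)) = Matrix.vec_index v (g m)"
       "(\<Sum>j<n. Matrix.vec_index v (g j) * eps' j (e' m)) = Matrix.vec_index v (g m)"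
      if "m < n" for g :: "nat \<Rightarrow> nat" and m
      using that by simp_all
    show "Matrix.vec_index (?f (pr (?h v) (?k v))) i = Matrix.vec_index v i"
    proof (cases "i < ?N")
      case True
      then show ?thesis using k[OF True] i pr[OF hk(1)[of v] hk(2)[of v]] by (simp add: f_def E.eps_sum d')
    next
      case False
      then have "i - ?N < ?N" using i by simp
      then show ?thesis using k[of "i - ?N"] i False pr[OF hk(1)[of v] hk(2)[of v]] by (simp add: f_def E'.eps_sum d')
    qed
  qed (use v pr(1)[OF hk(1)[of v] hk(2)[of v]] in simp_all)
  show "bij_betw ?f (carrier A) (carrier_vec (2 * ?N))"
    unfolding bij_betw_def
  proof (intro conjI inj_onI)
    fix a b assume ab: "a \<in> carrier A" "b \<in> carrier A" and eq: "?f a = ?f b"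
    have "f k a = f k b" if "k < 2 * ?N" for k
      using arg_cong[OF eq, of "\<lambda>v. Matrix.vec_index v k"] that by simp
    then show "a = b" by (rule inj[OF ab])
  next
    show "?f ` carrier A = carrier_vec (2 * ?N)" using surj by fastforce
  qed
  fix x y c assume x: "x \<in> carrier A"
  have k': "k < 2 * ?N \<Longrightarrow> \<not> k < ?N \<Longrightarrow> k - ?N < ?N" for k by simp
  show "?f (c \<odot> x) = c \<cdot>\<^sub>v ?f x"
    using x by (intro eq_vecI) (auto simp: f_def p_smult q_smult lin_scale[OF E.eps_lin] lin_scale[OF E'.eps_lin] k k')
  assume y: "y \<in> carrier A"
  show "?f (x \<oplus> y) = ?f x + ?f y"
    using x y by (intro eq_vecI) (auto simp: f_def p_add q_add lin_add[OF E.eps_lin] lin_add[OF E'.eps_lin] k k')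
qed

lemma degree_A: "degree_over_centre A = n"
proof (rule degree_over_centre_eqI[where d=2])
  show "alg_dim A = n\<^sup>2 * 2" using alg_dim_A by (simp add: power2_eq_square)
  show "alg_dim (A\<lparr>carrier := centre A\<rparr>) = 2"
  proof (rule alg_dim_eqI[OF centre_vs])
    let ?f = "\<lambda>z. Matrix.vec 2 (\<lambda>k. if k = 0 then eps 0 (p z (e 0)) else eps' 0 (q z (e' 0)))"
    have sc: "p z = s (eps 0 (p z (e 0)))" "q z = s' (eps' 0 (q z (e' 0)))" if z: "z \<in> centre A" for z
    proof -
      obtain c d where "p z = s c" "q z = s' d" using z by (auto simp: in_centre)
      moreover from this have "eps 0 (p z (e 0)) = c" "eps' 0 (q z (e' 0)) = d"
        using n_pos by (simp_all add: lin_scale[OF E.eps_lin] E.eps_e lin_scale[OF E'.eps_lin] E'.eps_e)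
      ultimately show "p z = s (eps 0 (p z (e 0)))" "q z = s' (eps' 0 (q z (e' 0)))" by simp_all
    qed
    let ?g = "\<lambda>v. pr (s (Matrix.vec_index v 0)) (s' (Matrix.vec_index v 1))"
    show "bij_betw ?f (carrier (A\<lparr>carrier := centre A\<rparr>)) (carrier_vec 2)"
    proof (rule bij_betwI[where g = ?g])
      show "?g \<in> carrier_vec 2 \<rightarrow> carrier (A\<lparr>carrier := centre A\<rparr>)"
        using pr[OF scal_lin] by (auto simp: in_centre)
      show "?f (?g v) = v" if "v \<in> carrier_vec 2" for v
        using that n_pos pr[OF scal_lin]
        by (intro eq_vecI) (auto simp: lin_scale[OF E.eps_lin] E.eps_e lin_scale[OF E'.eps_lin] E'.eps_e less_2_cases_iff)
      fix z assume "z \<in> carrier (A\<lparr>carrier := centre A\<rparr>)"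
      then have z: "z \<in> centre A" by simp
      then have "z \<in> carrier A" by (simp add: centre_def)
      then show "?g (?f z) = z" using sc[OF z] by (intro pr_eq) simp_all
    qed auto
    fix x y c assume "x \<in> carrier (A\<lparr>carrier := centre A\<rparr>)"
    then have x: "x \<in> carrier A" by (simp add: centre_def)
    show "?f (c \<odot>\<^bsub>A\<lparr>carrier := centre A\<rparr>\<^esub> x) = c \<cdot>\<^sub>v ?f x"
      using x n_pos by (intro eq_vecI) (auto simp: p_smult q_smult lin_scale[OF E.eps_lin] lin_scale[OF E'.eps_lin])
    assume "y \<in> carrier (A\<lparr>carrier := centre A\<rparr>)"
    then have y: "y \<in> carrier A" by (simp add: centre_def)
    show "?f (x \<oplus>\<^bsub>A\<lparr>carrier := centre A\<rparr>\<^esub> y) = ?f x + ?f y"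
      using x y n_pos by (intro eq_vecI) (auto simp: p_add q_add lin_add[OF E.eps_lin] lin_add[OF E'.eps_lin])
  qed
qed simp

text \<open>A homomorphism on the product kills one of the two factors.\<close>
lemma splittingD:
  assumes "\<rho> \<in> splittings A"
  shows "(\<forall>a\<in>carrier A. mat_trace (\<rho> a) = to_ac (E.tr (p a)) \<and> (\<forall>c. p a = s c \<longrightarrow> \<rho> a = to_ac c \<cdot>\<^sub>m 1\<^sub>m n)) \<or>
    (\<forall>a\<in>carrier A. mat_trace (\<rho> a) = to_ac (E'.tr (q a)) \<and> (\<forall>c. q a = s' c \<longrightarrow> \<rho> a = to_ac c \<cdot>\<^sub>m 1\<^sub>m n))"
proof -
  have r: "\<rho> \<in> Ring.ring_hom A (module_mat TYPE('f alg_closure) n n)"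
    "\<And>c x. x \<in> carrier A \<Longrightarrow> \<rho> (c \<odot> x) = to_ac c \<cdot>\<^sub>m \<rho> x"
    using assms(1) by (auto simp: splittings_def degree_A)
  have rc: "\<rho> a \<in> carrier_mat n n" if "a \<in> carrier A" for a
    using r(1) that by (auto simp: Ring.ring_hom_def module_mat_simps)
  have rm: "\<rho> (a \<otimes> b) = \<rho> a * \<rho> b" and ra: "\<rho> (a \<oplus> b) = \<rho> a + \<rho> b"
    if "a \<in> carrier A" "b \<in> carrier A" for a b
    using r(1) that by (auto simp: Ring.ring_hom_def module_mat_simps)
  have r1: "\<rho> \<one> = 1\<^sub>m n" using r(1) by (auto simp: Ring.ring_hom_def module_mat_simps)
  let ?p = "\<lambda>h. \<rho> (pr h (\<lambda>_. 0))" and ?q = "\<lambda>k. \<rho> (pr (\<lambda>_. 0) k)"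
  note P = pr[OF _ lin0(2)] and Q = pr[OF lin0(1)]
  have split: "\<rho> a = ?p (p a) + ?q (q a)" if a: "a \<in> carrier A" for a
  proof -
    have "pr (p a) (\<lambda>_. 0) \<oplus> pr (\<lambda>_. 0) (q a) = a"
      using a P Q by (intro pq_inj) (auto simp: p_add q_add)
    then show ?thesis using a ra[OF P(1) Q(1), of "p a" "q a"] by simp
  qed
  have pc: "?p (h \<circ> k) = ?p h * ?p k" "?p (\<lambda>x. h x + k x) = ?p h + ?p k"
    "?p (\<lambda>x. s c (h x)) = to_ac c \<cdot>\<^sub>m ?p h" if "lin s s h" "lin s s k" for h k c
  proof -
    have "pr (h \<circ> k) (\<lambda>_. 0) = pr h (\<lambda>_. 0) \<otimes> pr k (\<lambda>_. 0)"
      "pr (\<lambda>x. h x + k x) (\<lambda>_. 0) = pr h (\<lambda>_. 0) \<oplus> pr k (\<lambda>_. 0)"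
      "pr (\<lambda>x. s c (h x)) (\<lambda>_. 0) = c \<odot> pr h (\<lambda>_. 0)"
      using that P by (auto intro!: pr_eq simp: p_mult q_mult p_add q_add p_smult q_smult fun_eq_iff)
    then show "?p (h \<circ> k) = ?p h * ?p k" "?p (\<lambda>x. h x + k x) = ?p h + ?p k"
      "?p (\<lambda>x. s c (h x)) = to_ac c \<cdot>\<^sub>m ?p h"
      using that P rm ra r(2) by simp_all
  qed
  have qc: "?q (h \<circ> k) = ?q h * ?q k" "?q (\<lambda>x. h x + k x) = ?q h + ?q k"
    "?q (\<lambda>x. s' c (h x)) = to_ac c \<cdot>\<^sub>m ?q h" if "lin s' s' h" "lin s' s' k" for h k c
  proof -
    have "pr (\<lambda>_. 0) (h \<circ> k) = pr (\<lambda>_. 0) h \<otimes> pr (\<lambda>_. 0) k"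
      "pr (\<lambda>_. 0) (\<lambda>x. h x + k x) = pr (\<lambda>_. 0) h \<oplus> pr (\<lambda>_. 0) k"
      "pr (\<lambda>_. 0) (\<lambda>x. s' c (h x)) = c \<odot> pr (\<lambda>_. 0) h"
      using that Q by (auto intro!: pr_eq simp: p_mult q_mult p_add q_add p_smult q_smult fun_eq_iff)
    then show "?q (h \<circ> k) = ?q h * ?q k" "?q (\<lambda>x. h x + k x) = ?q h + ?q k"
      "?q (\<lambda>x. s' c (h x)) = to_ac c \<cdot>\<^sub>m ?q h"
      using that Q rm ra r(2) by simp_all
  qed
  \<comment> \<open>The two factors annihilate each other, hence so do their images. Whichever
    factor acts nontrivially acts unitally by \<open>split_trace\<close>, and the other one then
    acts by 0.\<close>
  have pq0: "?p h * ?q k = 0\<^sub>m n n" "?q k * ?p h = 0\<^sub>m n n" if "lin s s h" "lin s' s' k" for h k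
  proof -
    have "0 \<cdot>\<^sub>m \<rho> \<zero> = 0\<^sub>m n n" using rc[of \<zero>] by (intro eq_matI) auto
    then have z: "\<rho> \<zero> = 0\<^sub>m n n" using r(2)[of \<zero> 0] by simp
    have "pr h (\<lambda>_. 0) \<otimes> pr (\<lambda>_. 0) k = \<zero>" "pr (\<lambda>_. 0) k \<otimes> pr h (\<lambda>_. 0) = \<zero>"
      using that P Q alg_hom_zero[OF alg End_is_algebra[OF E.vs] p_hom]
        alg_hom_zero[OF alg End_is_algebra[OF E'.vs] q_hom]
      by (auto intro!: pq_inj simp: p_mult q_mult fun_eq_iff lin_zero)
    then show "?p h * ?q k = 0\<^sub>m n n" "?q k * ?p h = 0\<^sub>m n n"
      using rm[OF P(1) Q(1)] rm[OF Q(1) P(1)] that z by metis+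
  qed
  have id: "1\<^sub>m n = ?p id + ?q id" using split[of \<one>] r1 by simp
  have nz: "(1\<^sub>m n :: 'f alg_closure mat) \<noteq> 0\<^sub>m n n"
    using n_pos by (metis index_one_mat(1) index_zero_mat(1) zero_neq_one)
  note Pc = rc[OF P(1)] and Qc = rc[OF Q(1)]
  show ?thesis
  proof (cases "?p id = 0\<^sub>m n n")
    case False
    have T: "?p id = 1\<^sub>m n" "\<And>h. lin s s h \<Longrightarrow> mat_trace (?p h) = to_ac (E.tr h)"
      by (rule E.split_trace[where \<rho>="?p" and ?h0.0=id, OF Pc pc(1) pc(2) pc(3) linid(1) False]; assumption)+
    have q0: "?q k = 0\<^sub>m n n" if "lin s' s' k" for k
      using pq0(1)[OF linid(1) that] T(1) Qc[OF that] by simp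
    have "\<rho> a = ?p (p a)" if "a \<in> carrier A" for a using split[OF that] q0 Pc that by simp
    moreover have "?p (s c) = to_ac c \<cdot>\<^sub>m 1\<^sub>m n" for c using pc(3)[OF linid(1) linid(1), of c] T(1) by simp
    ultimately show ?thesis using T by simp
  next
    case True
    then have nq: "?q id \<noteq> 0\<^sub>m n n" using id nz by auto
    have T: "?q id = 1\<^sub>m n" "\<And>h. lin s' s' h \<Longrightarrow> mat_trace (?q h) = to_ac (E'.tr h)"
      by (rule E'.split_trace[where \<rho>="?q" and ?h0.0=id, OF Qc qc(1) qc(2) qc(3) linid(2) nq]; assumption)+
    have p0: "?p k = 0\<^sub>m n n" if "lin s s k" for k
      using pq0(2)[OF that linid(2)] T(1) Pc[OF that] by simp
    have "\<rho> a = ?q (q a)" if "a \<in> carrier A" for a using split[OF that] p0 Qc that by simp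
    moreover have "?q (s' c) = to_ac c \<cdot>\<^sub>m 1\<^sub>m n" for c using qc(3)[OF linid(2) linid(2), of c] T(1) by simp
    ultimately show ?thesis using T by simp
  qed
qed

text \<open>One splitting for each factor. A central element is a pair of scalars, and these two
  splittings read off one scalar each, which gives the uniqueness that \<open>Trd_centre\<close>
  requires; its existence comes from \<open>splittingD\<close>.\<close>

lemma splittings_exist:
  "(\<lambda>a. mat n n (\<lambda>(i, j). to_ac (eps i (p a (e j))))) \<in> splittings A"
  "(\<lambda>a. mat n n (\<lambda>(i, j). to_ac (eps' i (q a (e' j))))) \<in> splittings A"
proof -
  interpret S: split_alg "End_algebra s" s n e eps "\<lambda>h. h"
    by unfold_locales (auto simp: End_is_algebra E.vs n_pos alg_iso_def alg_hom_def Ring.ring_hom_def bij_betw_def)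
  interpret S': split_alg "End_algebra s'" s' n e' eps' "\<lambda>h. h"
    by unfold_locales (auto simp: End_is_algebra E'.vs n_pos alg_iso_def alg_hom_def Ring.ring_hom_def bij_betw_def)
  have pre: "\<rho> \<circ> \<pi> \<in> splittings A" if \<rho>: "\<rho> \<in> splittings B" and B: "degree_over_centre B = n"
    and \<pi>: "\<pi> \<in> alg_hom A B" for B :: "('f, 'b) module" and \<rho> \<pi>
    using \<rho> alg_homD[OF \<pi>] by (auto simp: splittings_def B degree_A Ring.ring_hom_def)
  show "(\<lambda>a. mat n n (\<lambda>(i, j). to_ac (eps i (p a (e j))))) \<in> splittings A"
    using pre[OF S.splitting_exists S.degree_A p_hom] by (simp add: comp_def)
  show "(\<lambda>a. mat n n (\<lambda>(i, j). to_ac (eps' i (q a (e' j))))) \<in> splittings A"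
    using pre[OF S'.splitting_exists S'.degree_A q_hom] by (simp add: comp_def)
qed

lemma Trd_centre_eq:
  assumes a: "a \<in> carrier A"
  shows "Trd_centre A a = pr (s (E.tr (p a))) (s' (E'.tr (q a)))"
  unfolding Trd_centre_def
proof (rule the_equality)
  let ?z = "pr (s (E.tr (p a))) (s' (E'.tr (q a)))"
  note z = pr[OF scal_lin, of "E.tr (p a)" "E'.tr (q a)"]
  show "?z \<in> centre A \<and> (\<forall>\<rho>\<in>splittings A. \<rho> ?z = mat_trace (\<rho> a) \<cdot>\<^sub>m 1\<^sub>m (degree_over_centre A))"
  proof (intro conjI ballI)
    show "?z \<in> centre A" using z by (auto simp: in_centre)
    fix \<rho> assume "\<rho> \<in> splittings A"
    then show "\<rho> ?z = mat_trace (\<rho> a) \<cdot>\<^sub>m 1\<^sub>m (degree_over_centre A)"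
      using splittingD[of \<rho>] z a by (auto simp: degree_A)
  qed
  fix y assume y: "y \<in> centre A \<and> (\<forall>\<rho>\<in>splittings A. \<rho> y = mat_trace (\<rho> a) \<cdot>\<^sub>m 1\<^sub>m (degree_over_centre A))"
  then obtain c d where cd: "p y = s c" "q y = s' d" and yc: "y \<in> carrier A" by (auto simp: in_centre)
  have tr: "mat_trace (mat n n (\<lambda>(i, j). to_ac (eps i (p a (e j))))) = to_ac (E.tr (p a))"
    "mat_trace (mat n n (\<lambda>(i, j). to_ac (eps' i (q a (e' j))))) = to_ac (E'.tr (q a))"
    by (simp_all add: mat_trace_sum[of _ n] E.tr_def E'.tr_def to_ac_sum)
  have "mat n n (\<lambda>(i, j). to_ac (eps i (p y (e j)))) = to_ac (E.tr (p a)) \<cdot>\<^sub>m 1\<^sub>m n"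
    "mat n n (\<lambda>(i, j). to_ac (eps' i (q y (e' j)))) = to_ac (E'.tr (q a)) \<cdot>\<^sub>m 1\<^sub>m n"
    using y[THEN conjunct2, rule_format, OF splittings_exist(1)]
      y[THEN conjunct2, rule_format, OF splittings_exist(2)] unfolding tr degree_A by simp_all
  from arg_cong[OF this(1), of "\<lambda>M. M $$ (0, 0)"] arg_cong[OF this(2), of "\<lambda>M. M $$ (0, 0)"]
  have "c = E.tr (p a)" "d = E'.tr (q a)"
    using n_pos by (auto simp: cd lin_scale[OF E.eps_lin] lin_scale[OF E'.eps_lin] E.eps_e E'.eps_e)
  then show "y = ?z" using cd yc by (intro pr_eq[symmetric]) auto
qed

end

section \<open>Quadratic spaces and split quadratic pairs\<close>

text \<open>Regroups a double sum into its diagonal and its unordered pairs. This replaces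
  symmetrization by averaging, which would divide by 2.\<close>

lemma sum_square_split:
  fixes g :: "nat \<Rightarrow> nat \<Rightarrow> 'x::ab_group_add"
  shows "(\<Sum>k<n. \<Sum>l<n. g k l) = (\<Sum>k<n. g k k + (\<Sum>l<k. g k l + g l k))"
  by (induction n) (simp_all add: sum.distrib algebra_simps)

lemma lin_sumI:
  assumes "vector_space s" "vector_space s'" "\<And>i. i \<in> I \<Longrightarrow> lin s s' (f i)"
  shows "lin s s' (\<lambda>x. \<Sum>i\<in>I. f i x)"
  using assms(3) by (induction I rule: infinite_finite_induct) (auto intro!: lin_plus lin_0 assms(1,2))

locale qspace = vbase "scal V" n e eps
  for V :: "('f::field, 'v::ab_group_add) quad_space" and n e eps +
  assumes qs: "quadratic_space V"
begin

abbreviation "sc \<equiv> scal V"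
abbreviation "b \<equiv> polar V"
abbreviation "q \<equiv> form V"

lemma q_scale: "q (sc c x) = c\<^sup>2 * q x" using qs by (simp add: quadratic_space_def)
lemma q_zero [simp]: "q 0 = 0" using q_scale[of 0 0] by simp
lemma q_add: "q (x + y) = q x + q y + b x y" by (simp add: polar_def)
lemma b_sym: "b x y = b y x" by (simp add: polar_def add.commute)
lemma b_lin: "lin sc (*) (b x)" using qs by (simp add: quadratic_space_def)
lemma b_lin': "lin sc (*) (\<lambda>x. b x y)"
proof -
  have "(\<lambda>x. b x y) = b y" by (rule ext) (rule b_sym)
  then show ?thesis using b_lin[of y] by simp
qed
lemma b_nondeg: "(\<And>y. b x y = 0) \<Longrightarrow> x = 0" using qs by (auto simp: quadratic_space_def)

lemma b_add [simp]: "b x (y + z) = b x y + b x z" "b (y + z) x = b y x + b z x"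
  and b_scale [simp]: "b x (sc c y) = c * b x y" "b (sc c x) y = c * b x y"
  and b_zero [simp]: "b x 0 = 0" "b 0 x = 0"
  and b_diff [simp]: "b x (y - z) = b x y - b x z" "b (y - z) x = b y x - b z x"
  using lin_add[OF b_lin] lin_add[OF b_lin'] lin_scale[OF b_lin] lin_scale[OF b_lin']
    lin_zero[OF b_lin] lin_zero[OF b_lin'] lin_diff[OF b_lin] lin_diff[OF b_lin'] by auto

lemma b_sum: "b x (\<Sum>i\<in>I. g i) = (\<Sum>i\<in>I. b x (g i))" "b (\<Sum>i\<in>I. g i) x = (\<Sum>i\<in>I. b (g i) x)"
  by (rule lin_sum[OF b_lin], rule lin_sum[OF b_lin'])

lemma b_self: "b x x = 2 * q x"
proof -
  have "q (x + x) = 4 * q x" using q_scale[of 2 x] scale_left_distrib[of 1 1 x] by simp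
  then show ?thesis by (simp add: polar_def)
qed

lemma b_eqI: "(\<And>z. b x z = b y z) \<Longrightarrow> x = y"
  using b_nondeg[of "x - y"] by simp

lemma b_eqI': "(\<And>z. b z x = b z y) \<Longrightarrow> x = y"
  by (rule b_eqI) (simp add: b_sym)

lemma riesz: "lin sc (*) f \<Longrightarrow> \<exists>v. \<forall>x. b v x = f x"
  by (rule bilinear_riesz[OF b_lin b_lin' b_nondeg])

definition du :: "nat \<Rightarrow> 'v" where "du k = (SOME v. \<forall>x. b v x = eps k x)"

lemma du: "k < n \<Longrightarrow> b (du k) x = eps k x"
  using someI_ex[OF riesz[OF eps_lin]] by (simp add: du_def)

lemma du': "k < n \<Longrightarrow> b x (du k) = eps k x" using du[of k x] by (simp add: b_sym)

lemma expand_b: "x = (\<Sum>k<n. sc (b (du k) x) (e k))"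
  using expand[of x] by (simp add: du)

lemma expand_du: "x = (\<Sum>k<n. sc (b (e k) x) (du k))"
proof (rule b_eqI')
  fix z
  have "b z (\<Sum>k<n. sc (b (e k) x) (du k)) = b (\<Sum>k<n. sc (eps k z) (e k)) x"
    by (simp add: b_sum du' mult.commute)
  then show "b z x = b z (\<Sum>k<n. sc (b (e k) x) (du k))" by (simp flip: expand)
qed

abbreviation "ad \<equiv> adjoint_invol V"

text \<open>Writing the adjoint in the dual basis proves that the definite description is satisfied.
  The explicit formula is used again for the action of the involution on the Clifford
  generators.\<close>

lemma ad_props:
  assumes h: "lin sc sc h"
  shows "lin sc sc (ad h)" "b x (h y) = b (ad h x) y" "ad h x = (\<Sum>l<n. sc (b x (h (e l))) (du l))"
proof -
  let ?k = "\<lambda>x. \<Sum>l<n. sc (b x (h (e l))) (du l)"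
  have k: "lin sc sc ?k"
    by (rule linI[OF vs vs]) (auto simp: scale_left_distrib sum.distrib scale_sum_right)
  have kb: "b (?k x) y = b x (h y)" for x y
  proof -
    have "b (?k x) y = b x (h (\<Sum>l<n. sc (eps l y) (e l)))"
      by (simp add: b_sum du lin_sum[OF h] lin_scale[OF h] mult.commute)
    then show ?thesis by (simp flip: expand)
  qed
  have "ad h = ?k"
    unfolding adjoint_invol_def
  proof (rule the_equality)
    fix k' assume "lin sc sc k' \<and> (\<forall>x y. b x (h y) = b (k' x) y)"
    then show "k' = ?k" by (intro ext b_eqI) (metis kb)
  qed (use k kb in auto)
  then show "lin sc sc (ad h)" "b x (h y) = b (ad h x) y" "ad h x = (\<Sum>l<n. sc (b x (h (e l))) (du l))"
    using k kb by simp_all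
qed

lemmas ad_lin = ad_props(1) and ad_b = ad_props(2)

lemma ad_b': "lin sc sc h \<Longrightarrow> b (h x) y = b x (ad h y)"
  using ad_b[of h y x] by (simp add: b_sym)

lemma ad_unique: "lin sc sc h \<Longrightarrow> (\<And>x y. b x (h y) = b (k x) y) \<Longrightarrow> ad h = k"
  by (intro ext b_eqI) (simp flip: ad_b)

lemma ad_add: "lin sc sc h \<Longrightarrow> lin sc sc k \<Longrightarrow> ad (\<lambda>x. h x + k x) = (\<lambda>x. ad h x + ad k x)"
  by (rule ad_unique) (auto simp: lin_plus ad_b)

lemma ad_smult: "lin sc sc h \<Longrightarrow> ad (\<lambda>x. sc c (h x)) = (\<lambda>x. sc c (ad h x))"
  by (rule ad_unique) (auto simp: lin_smult ad_b)

lemma ad_zero: "ad (\<lambda>_. 0) = (\<lambda>_. 0)"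
  by (rule ad_unique) (simp_all add: lin_0 vs)

lemma tens_op1: "tens V x y = op1 x (b y)" by (simp add: tens_def op1_def)
lemma tens_apply: "tens V x y z = sc (b y z) x" by (simp add: tens_def)
lemma tens_lin [simp, intro]: "lin sc sc (tens V x y)" unfolding tens_op1 by (rule op1_lin[OF b_lin])
lemma ad_tens: "ad (tens V x y) = tens V y x"
  by (rule ad_unique) (auto simp: tens_apply b_sym)
lemma comp_tens: "lin sc sc h \<Longrightarrow> h \<circ> tens V x y = tens V (h x) y"
  unfolding tens_op1 by (rule comp_op1)
lemma tr_tens: "tr (tens V x y) = b y x" unfolding tens_op1 by (rule tr_op1[OF b_lin])
lemma tens_add: "tens V (x + x') y = (\<lambda>z. tens V x y z + tens V x' y z)"
  "tens V x (y + y') = (\<lambda>z. tens V x y z + tens V x y' z)"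
  "tens V (sc c x) y = (\<lambda>z. sc c (tens V x y z))" "tens V x (sc c y) = (\<lambda>z. sc c (tens V x y z))"
  by (auto simp: tens_apply scale_right_distrib scale_left_distrib mult.commute)

lemma lin_expand: "lin sc sc h \<Longrightarrow> h z = (\<Sum>k<n. tens V (h (e k)) (du k) z)"
proof -
  assume h: "lin sc sc h"
  have "h z = h (\<Sum>k<n. sc (eps k z) (e k))" by (simp flip: expand)
  also have "\<dots> = (\<Sum>k<n. tens V (h (e k)) (du k) z)"
    by (simp add: lin_sum[OF h] lin_scale[OF h] tens_apply du)
  finally show ?thesis .
qed

lemma q_sum: "q (\<Sum>k<m. sc (c k) (e k)) =
   (\<Sum>k<m. (c k)\<^sup>2 * q (e k) + (\<Sum>l<k. c k * c l * b (e k) (e l)))"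
proof (induction m)
  case (Suc m)
  have "b (\<Sum>k<m. sc (c k) (e k)) (sc (c m) (e m)) = (\<Sum>l<m. c m * c l * b (e m) (e l))"
    by (simp add: b_sum sum_distrib_left mult.assoc b_sym[of "e m"])
  then show ?case using Suc
    by (simp add: q_add q_scale algebra_simps b_sym[of "e m" "\<Sum>k<m. sc (c k) (e k)"])
qed simp

text \<open>A bilinear, usually not symmetric, form \<open>\<beta>\<close> with \<open>\<beta>(x, x) = q(x)\<close>, and the operator \<open>l\<close>
  with \<open>\<beta>(x, y) = b(x, l y)\<close>, so that \<open>f\<^sub>q(s) = Tr(l s)\<close>.\<close>
definition bil :: "'v \<Rightarrow> 'v \<Rightarrow> 'f" where
  "bil x y = (\<Sum>k<n. eps k x * eps k y * q (e k) + (\<Sum>l<k. eps k x * eps l y * b (e k) (e l)))"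

definition lop :: "'v \<Rightarrow> 'v" where "lop y = (\<Sum>k<n. sc (bil (e k) y) (du k))"

lemma bil_lin: "lin sc (*) (bil x)" "lin sc (*) (\<lambda>x. bil x y)"
proof -
  have m: "lin sc (*) (\<lambda>y. f y * a)" if "lin sc (*) f" for f a
    using lin_smult[OF that, of a] by (simp add: mult.commute)
  show "lin sc (*) (bil x)" "lin sc (*) (\<lambda>x. bil x y)"
    unfolding bil_def by (intro lin_sumI lin_plus m lin_smult eps_lin vs field_vs; simp)+
qed

lemma bil_self: "bil x x = q x"
proof -
  have "q x = q (\<Sum>k<n. sc (eps k x) (e k))" by (simp flip: expand)
  then show ?thesis by (simp add: q_sum bil_def power2_eq_square)
qed

lemma lop_lin [simp, intro]: "lin sc sc lop"
  unfolding lop_def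
  by (rule linI[OF vs vs])
    (auto simp: lin_add[OF bil_lin(1)] lin_scale[OF bil_lin(1)] scale_left_distrib sum.distrib scale_sum_right)

lemma b_lop: "b x (lop y) = bil x y"
proof -
  have "b x (lop y) = bil (\<Sum>k<n. sc (eps k x) (e k)) y"
    by (simp add: lop_def b_sum du' lin_sum[OF bil_lin(2)] lin_scale[OF bil_lin(2)] mult.commute)
  then show ?thesis by (simp flip: expand)
qed

lemma lop_q: "b x (lop x) = q x" by (simp add: b_lop bil_self)

abbreviation "SymV \<equiv> Sym (End_algebra sc) ad"

lemma SymV: "s \<in> SymV \<longleftrightarrow> lin sc sc s \<and> ad s = s" by (simp add: Sym_def)

lemma Sym_tens: "tens V x x \<in> SymV" by (simp add: SymV ad_tens)

lemma Sym_closed: "s \<in> SymV \<Longrightarrow> t \<in> SymV \<Longrightarrow> (\<lambda>x. s x + t x) \<in> SymV" "s \<in> SymV \<Longrightarrow> (\<lambda>x. sc c (s x)) \<in> SymV"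
  by (auto simp: SymV lin_plus lin_smult ad_add ad_smult)

text \<open>The symmetric elements are spanned by the \<open>x \<otimes> x\<close>.\<close>
lemma Sym_vanish:
  assumes f: "linear_on_Sym (End_algebra sc) ad f" and f0: "\<And>x. f (tens V x x) = 0" and s: "s \<in> SymV"
  shows "f s = 0"
proof -
  have fa: "f (\<lambda>x. s x + t x) = f s + f t" if "s \<in> SymV" "t \<in> SymV" for s t
    using f that unfolding linear_on_Sym_def by simp
  have fs: "f (\<lambda>x. sc c (s x)) = c * f s" if "s \<in> SymV" for s c
    using f that unfolding linear_on_Sym_def by simp
  \<comment> \<open>The polarization of \<open>x \<otimes> x\<close>: it is the tensor square of
    \<open>x + y\<close> minus those of \<open>x\<close> and \<open>y\<close>, so \<open>f\<close>
    vanishes on it too.\<close>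
  define t2 where "t2 x y = (\<lambda>z. tens V x y z + tens V y x z)" for x y
  have t2: "t2 x y \<in> SymV \<and> f (t2 x y) = 0" for x y
  proof -
    have S: "t2 x y \<in> SymV"
      by (auto simp: SymV t2_def lin_plus ad_add ad_tens add.commute)
    have "tens V (x + y) (x + y) = (\<lambda>z. t2 x y z + (tens V x x z + tens V y y z))"
      by (auto simp: t2_def tens_add algebra_simps)
    then have "f (tens V (x + y) (x + y)) = f (t2 x y) + (f (tens V x x) + f (tens V y y))"
      using S by (simp add: fa Sym_closed Sym_tens)
    then show ?thesis using S f0 by simp
  qed
  \<comment> \<open>The matrix of a symmetric element is symmetric, so \<open>s\<close> regroups
    into multiples of the \<open>e\<^sub>k \<otimes> e\<^sub>k\<close> and of the polarizations
    \<open>t2\<close>.\<close>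
  define c where "c k l = b (du k) (s (du l))" for k l
  have slin: "lin sc sc s" "ad s = s" using s by (auto simp: SymV)
  have csym: "c k l = c l k" for k l
    using ad_b[OF slin(1), of "du k" "du l"] slin(2) by (simp add: c_def b_sym)
  have s_eq: "s z = (\<Sum>k<n. \<Sum>l<n. sc (c k l) (tens V (e k) (e l) z))" for z
  proof -
    have "s z = s (\<Sum>l<n. sc (b (e l) z) (du l))" by (simp flip: expand_du)
    also have "\<dots> = (\<Sum>l<n. sc (b (e l) z) (\<Sum>k<n. sc (c k l) (e k)))"
      unfolding c_def by (simp add: lin_sum[OF slin(1)] lin_scale[OF slin(1)] flip: expand_b)
    also have "\<dots> = (\<Sum>l<n. \<Sum>k<n. sc (c k l) (tens V (e k) (e l) z))"
      by (simp add: scale_sum_right tens_apply mult.commute)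
    finally show ?thesis by (subst sum.swap)
  qed
  define T where "T k = (\<lambda>z. sc (c k k) (tens V (e k) (e k) z) + (\<Sum>l<k. sc (c k l) (t2 (e k) (e l) z)))" for k
  have zero: "(\<lambda>_. 0) \<in> SymV \<and> f (\<lambda>_. 0) = 0"
    using Sym_closed(2)[OF s, of 0] fs[OF s, of 0] by simp
  have part: "(\<lambda>z. \<Sum>l<m. sc (c k l) (t2 (e k) (e l) z)) \<in> SymV \<and>
     f (\<lambda>z. \<Sum>l<m. sc (c k l) (t2 (e k) (e l) z)) = 0" for k m
    by (induction m) (use zero t2 in \<open>simp_all add: fa fs Sym_closed\<close>)
  have T: "T k \<in> SymV \<and> f (T k) = 0" for k
    unfolding T_def using part[where m=k and k=k] by (simp add: fa fs Sym_closed Sym_tens f0)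
  have "(\<lambda>z. \<Sum>k<m. T k z) \<in> SymV \<and> f (\<lambda>z. \<Sum>k<m. T k z) = 0" for m
    by (induction m) (use zero T in \<open>simp_all add: fa Sym_closed\<close>)
  moreover have "s = (\<lambda>z. \<Sum>k<n. T k z)"
    unfolding T_def t2_def s_eq sum_square_split
    by (intro ext sum.cong refl arg_cong2[where f=plus]) (auto simp: scale_right_distrib csym[of _ "_ :: nat"] intro: sum.cong)
  ultimately show ?thesis by simp
qed

text \<open>\<open>lop\<close> satisfies \<open>b x (lop x) = q x\<close>, so the trace functional
  has the prescribed values on the tensor squares; \<open>Sym_vanish\<close>, applied to a
  difference, gives uniqueness. The second claim is for functionals obtained from an abstract
  semitrace.\<close>

lemma form_semitrace_eq:
  shows "s \<in> SymV \<Longrightarrow> form_semitrace V s = tr (lop \<circ> s)"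
    and "linear_on_Sym (End_algebra sc) ad f \<Longrightarrow> (\<And>x. f (tens V x x) = q x) \<Longrightarrow> s \<in> SymV \<Longrightarrow> f s = tr (lop \<circ> s)"
proof -
  let ?F = "\<lambda>s. tr (lop \<circ> s)"
  have lin: "linear_on_Sym (End_algebra sc) ad ?F"
    unfolding linear_on_Sym_def
    by (auto simp: comp_def lin_add[OF lop_lin] lin_scale[OF lop_lin] tr_add tr_smult)
  have F: "?F (tens V x x) = q x" for x
    by (simp add: comp_tens[OF lop_lin] tr_tens lop_q)
  show uniq: "f s = ?F s" if f: "linear_on_Sym (End_algebra sc) ad f" "\<And>x. f (tens V x x) = q x" and s: "s \<in> SymV" for f s
  proof -
    have "linear_on_Sym (End_algebra sc) ad (\<lambda>s. f s - ?F s)"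
      using f(1) lin unfolding linear_on_Sym_def by (auto simp: algebra_simps)
    from Sym_vanish[OF this _ s] show ?thesis using F f(2) by simp
  qed
  have "form_semitrace V = restrict ?F SymV"
    unfolding form_semitrace_def
  proof (rule the_equality)
    have "linear_on_Sym (End_algebra sc) ad (restrict ?F SymV)"
      using lin Sym_closed unfolding linear_on_Sym_def by simp
    then show "restrict ?F SymV \<in> extensional SymV \<and> linear_on_Sym (End_algebra sc) ad (restrict ?F SymV) \<and>
      (\<forall>x. restrict ?F SymV (tens V x x) = q x)" using F Sym_tens by simp
    fix f assume "f \<in> extensional SymV \<and> linear_on_Sym (End_algebra sc) ad f \<and> (\<forall>x. f (tens V x x) = q x)"
    then show "f = restrict ?F SymV" using uniq by (intro extensionalityI[of _ SymV]) auto
  qed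
  then show "s \<in> SymV \<Longrightarrow> form_semitrace V s = ?F s" by simp
qed

lemma form_semitrace_tens: "form_semitrace V (tens V x x) = q x"
  using form_semitrace_eq(1)[OF Sym_tens] by (simp add: comp_tens[OF lop_lin] tr_tens lop_q)

end

lemma End_qp_simps [simp]:
  "carrier (End_qp V) = {h. lin (scal V) (scal V) h}" "mult (End_qp V) = (\<circ>)" "one (End_qp V) = id"
  "zero (End_qp V) = (\<lambda>_. 0)" "add (End_qp V) = (\<lambda>h k x. h x + k x)"
  "smult (End_qp V) = (\<lambda>c h x. scal V c (h x))"
  "invol (End_qp V) = adjoint_invol V" "semitrace (End_qp V) = form_semitrace V"
  by (simp_all add: End_qp_def module.defs qp_algebra.defs End_algebra_def)

lemma is_algebra_cong:
  assumes "carrier R = carrier S" "mult R = mult S" "one R = one S" "zero R = zero S" "add R = add S"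
    "smult R = smult S" and A: "is_algebra R"
  shows "is_algebra S"
proof -
  interpret falg R by unfold_locales fact
  have r: "ring S" by (rule ring_record_cong[OF assms(1-5) ring_axioms])
  show ?thesis
    by (rule is_algebraI[OF r]; unfold assms(1-6)[symmetric])
       (auto simp: sm_mult sm_add sm_addr sm_l sm_r)
qed

lemma alg_hom_End_qp: "alg_hom A (End_qp V) = alg_hom A (End_algebra (scal V))"
  "alg_hom (End_qp V) A = alg_hom (End_algebra (scal V)) A"
  "alg_iso A (End_qp V) = alg_iso A (End_algebra (scal V))"
  "alg_iso (End_qp V) A = alg_iso (End_algebra (scal V)) A"
  by (simp_all add: alg_iso_def alg_hom_def Ring.ring_hom_def) (simp_all add: End_algebra_def)

lemma qspace_exists:
  assumes "quadratic_space V" "space_dim V = n"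
  shows "\<exists>e eps. qspace V n e eps"
proof -
  obtain B where "finite_dimensional_vector_space (scal V) B" using assms by (auto simp: quadratic_space_def)
  from vbase_exists[OF this assms(2)] show ?thesis using assms(1) by (auto simp: qspace_def qspace_axioms_def)
qed

section \<open>Split quadratic pairs\<close>

locale qp_split = split_alg A "scal V" n e eps \<gamma> + qspace V n e eps
  for A :: "('f::field, 'a, 'f) qp_algebra" (structure)
    and V :: "('f, 'v::ab_group_add) quad_space" and n e eps \<gamma> +
  assumes invol_closed: "a \<in> carrier A \<Longrightarrow> invol A a \<in> carrier A"
    and g_invol: "a \<in> carrier A \<Longrightarrow> \<gamma> (invol A a) = adjoint_invol V (\<gamma> a)"
    and g_semitrace: "a \<in> Sym A (invol A) \<Longrightarrow> semitrace A a = form_semitrace V (\<gamma> a)"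
begin

lemma Sym_iff: "a \<in> Sym A (invol A) \<longleftrightarrow> a \<in> carrier A \<and> \<gamma> a \<in> SymV"
proof -
  have "invol A a = a \<longleftrightarrow> ad (\<gamma> a) = \<gamma> a" if "a \<in> carrier A"
    using that invol_closed g_invol g_inj by metis
  then show ?thesis by (auto simp: Sym_def)
qed

end

lemma qp_splitI:
  fixes A :: "('f::field, 'a, 'f) qp_algebra"
  assumes "is_algebra A" "qspace V n e eps" "n > 0" "qp_iso A (End_qp V) \<gamma>"
    and inv: "\<And>a. a \<in> carrier A \<Longrightarrow> invol A a \<in> carrier A"
  shows "qp_split A V n e eps \<gamma>"
proof -
  interpret Q: qspace V n e eps by fact
  interpret F: falg A by unfold_locales fact
  have i: "\<gamma> \<in> alg_iso A (End_algebra (scal V))"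
    "\<And>a. a \<in> carrier A \<Longrightarrow> \<gamma> (invol A a) = adjoint_invol V (\<gamma> a)"
    "\<And>s. s \<in> Sym A (invol A) \<Longrightarrow> semitrace A s = form_semitrace V (\<gamma> s)"
    using assms(4) by (auto simp: qp_iso_def alg_hom_End_qp)
  show ?thesis
    by unfold_locales (use assms(3) i inv in auto)
qed

lemma qp_split_End:
  assumes "qspace V n e eps" "n > 0"
  shows "qp_split (End_qp V) V n e eps (\<lambda>h. h)"
proof -
  interpret Q: qspace V n e eps by fact
  have alg: "is_algebra (End_qp V)"
    by (rule is_algebra_cong[OF _ _ _ _ _ _ End_is_algebra[OF Q.vs]]) (auto simp: End_algebra_def)
  show ?thesis
  proof (rule qp_splitI[OF alg assms])
    show "qp_iso (End_qp V) (End_qp V) (\<lambda>h. h)"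
      by (auto simp: qp_iso_def alg_iso_def alg_hom_def Ring.ring_hom_def bij_betw_def)
  qed (auto simp: Q.ad_lin)
qed

section \<open>The universal property of the Clifford algebra\<close>

lemma (in presentation) cls_eqI:
  assumes "s - t \<in> rel" "t \<in> carrier R"
  shows "cls s = cls t"
proof -
  have st: "s - t \<in> carrier R" using assms rels by auto
  have "cls ((s - t) + t) = cls (s - t) \<oplus>\<^bsub>Q\<^esub> cls t"
    using alg_homD(2)[OF cls_hom st assms(2)] by simp
  also have "\<dots> = cls t" using cls_rel[OF assms(1)] alg_homD(1)[OF cls_hom assms(2)] by simp
  finally show ?thesis by simp
qed

context qp_split
begin

abbreviation "C \<equiv> clifford_algebra A"
abbreviation "cm \<equiv> clifford_map A"

lemma rels_carrier: "clifford_relations A \<subseteq> carrier (free_algebra (carrier A))"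
proof -
  have s: "(\<Sum>i<m. g i) \<in> carrier (free_algebra S)" if "\<And>i. i < m \<Longrightarrow> g i \<in> carrier (free_algebra S)"
    for m :: nat and g :: "nat \<Rightarrow> 'a list \<Rightarrow>\<^sub>0 'f" and S
    using that by (induction m) (auto intro: free_closed)
  show ?thesis
    unfolding clifford_relations_def Sym_def by (auto intro!: s free_closed)
qed

sublocale P: presentation "carrier A" "clifford_relations A"
  by unfold_locales (rule rels_carrier)

lemma C_def: "C = P.Q" by (simp add: clifford_algebra_def clifford_ideal_def)
lemma cm_def: "cm a = P.cls (fgen a)" by (simp add: clifford_map_def clifford_ideal_def)

lemma C_algebra: "is_algebra C" unfolding C_def by (rule P.Q_algebra)

sublocale C: falg C by unfold_locales (rule C_algebra)

lemma cm_closed [simp, intro]: "a \<in> carrier A \<Longrightarrow> cm a \<in> carrier C"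
  unfolding C_def cm_def by (rule alg_homD(1)[OF P.cls_hom]) (simp add: free_closed)

lemma cls_const: "P.cls (fconst c) = c \<odot>\<^bsub>C\<^esub> \<one>\<^bsub>C\<^esub>"
proof -
  have "P.cls (c \<odot>\<^bsub>P.R\<^esub> \<one>\<^bsub>P.R\<^esub>) = c \<odot>\<^bsub>C\<^esub> P.cls \<one>\<^bsub>P.R\<^esub>"
    unfolding C_def by (rule alg_homD(5)[OF P.cls_hom]) (simp add: free_closed)
  then show ?thesis using alg_homD(4)[OF P.cls_hom] by (simp add: C_def)
qed

lemma cm_add: "a \<in> carrier A \<Longrightarrow> a' \<in> carrier A \<Longrightarrow> cm (a \<oplus> a') = cm a \<oplus>\<^bsub>C\<^esub> cm a'"
proof -
  assume a: "a \<in> carrier A" and a': "a' \<in> carrier A"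
  have "fgen (a \<oplus> a') - fgen a - fgen a' \<in> clifford_relations A"
    using a a' unfolding clifford_relations_def by blast
  then have "fgen (a \<oplus> a') - (fgen a + fgen a') \<in> clifford_relations A" by (simp only: diff_diff_eq)
  then have "cm (a \<oplus> a') = P.cls (fgen a + fgen a')"
    unfolding cm_def by (rule P.cls_eqI) (use a a' in \<open>auto intro!: free_closed\<close>)
  then show ?thesis using alg_homD(2)[OF P.cls_hom, of "fgen a" "fgen a'"] a a'
    by (simp add: cm_def C_def free_closed)
qed

lemma cm_smult: "a \<in> carrier A \<Longrightarrow> cm (c \<odot> a) = c \<odot>\<^bsub>C\<^esub> cm a"
proof -
  assume a: "a \<in> carrier A"
  have "fgen (c \<odot> a) - fconst c * fgen a \<in> clifford_relations A"
    using a unfolding clifford_relations_def by blast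
  then have "cm (c \<odot> a) = P.cls (fconst c * fgen a)"
    unfolding cm_def by (rule P.cls_eqI) (use a in \<open>auto intro!: free_closed\<close>)
  then show ?thesis using alg_homD(5)[OF P.cls_hom, of "fgen a" c] a
    by (simp add: cm_def C_def free_closed)
qed

lemma cm_sym: "a \<in> Sym A (invol A) \<Longrightarrow> cm a = semitrace A a \<odot>\<^bsub>C\<^esub> \<one>\<^bsub>C\<^esub>"
proof -
  assume a: "a \<in> Sym A (invol A)"
  have "fgen a - fconst (semitrace A a) \<in> clifford_relations A"
    using a unfolding clifford_relations_def by blast
  then have "cm a = P.cls (fconst (semitrace A a))"
    unfolding cm_def by (rule P.cls_eqI) (auto intro!: free_closed)
  then show ?thesis by (simp add: cls_const)
qed

definition m :: "'v \<Rightarrow> 'v \<Rightarrow> ('a list \<Rightarrow>\<^sub>0 'f) set" where "m x y = cm (dl (tens V x y))"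

lemma m_closed [simp, intro]: "m x y \<in> carrier C" by (simp add: m_def)

lemma dl_add: "lin sc sc h \<Longrightarrow> lin sc sc k \<Longrightarrow> dl (\<lambda>x. h x + k x) = dl h \<oplus> dl k"
  and dl_smult: "lin sc sc h \<Longrightarrow> dl (\<lambda>x. sc c (h x)) = c \<odot> dl h"
  and dl_comp: "lin sc sc h \<Longrightarrow> lin sc sc k \<Longrightarrow> dl (h \<circ> k) = dl h \<otimes> dl k"
  using alg_homD[OF dl_hom, simplified] by auto

lemma m_add: "m (x + x') y = m x y \<oplus>\<^bsub>C\<^esub> m x' y" "m x (y + y') = m x y \<oplus>\<^bsub>C\<^esub> m x y'"
  and m_smult: "m (sc c x) y = c \<odot>\<^bsub>C\<^esub> m x y" "m x (sc c y) = c \<odot>\<^bsub>C\<^esub> m x y"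
  by (simp_all add: m_def tens_add dl_add dl_smult cm_add cm_smult)

lemma m_diag: "m x x = q x \<odot>\<^bsub>C\<^esub> \<one>\<^bsub>C\<^esub>"
proof -
  have "dl (tens V x x) \<in> Sym A (invol A)" by (simp add: Sym_iff Sym_tens)
  then show ?thesis unfolding m_def by (simp add: cm_sym g_semitrace form_semitrace_tens)
qed

text \<open>Shows that \<open>dl lop\<close> is an admissible \<open>l\<close> in the sandwich
  relations of the Clifford algebra.\<close>

lemma semitrace_Trd: "a \<in> Sym A (invol A) \<Longrightarrow> semitrace A a = Trd A (dl lop \<otimes> a)"
proof -
  assume a: "a \<in> Sym A (invol A)"
  then have "a \<in> carrier A" "\<gamma> a \<in> SymV" by (auto simp: Sym_iff)
  then show ?thesis using a by (simp add: g_semitrace form_semitrace_eq(1) Trd_eq g_mult)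
qed

text \<open>The sandwich relation with the single summand
  \<open>(x \<otimes> y) \<otimes> (y \<otimes> z)\<close>. The operator
  \<open>(x \<otimes> y) h (y \<otimes> z)\<close> is \<open>b(y, h y)\<close> times
  \<open>x \<otimes> z\<close>, which does not change when \<open>h\<close> is replaced by its
  adjoint; for \<open>h = lop\<close> the factor is \<open>q(y)\<close>.\<close>

lemma m_mult: "m x y \<otimes>\<^bsub>C\<^esub> m y z = q y \<odot>\<^bsub>C\<^esub> m x z"
proof -
  define a0 where "a0 = dl (tens V x y)"
  define b0 where "b0 = dl (tens V y z)"
  have ab: "a0 \<in> carrier A" "b0 \<in> carrier A" by (simp_all add: a0_def b0_def)
  have fs: "(\<Oplus>i\<in>{..<Suc 0}. g i) = g 0" if "g 0 \<in> carrier A" for g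
    using that by (simp add: lessThan_Suc)
  have sand: "a0 \<otimes> invol A t \<otimes> b0 = a0 \<otimes> t \<otimes> b0" if t: "t \<in> carrier A" for t
  proof (rule g_inj)
    show "\<gamma> (a0 \<otimes> invol A t \<otimes> b0) = \<gamma> (a0 \<otimes> t \<otimes> b0)"
      using ab t invol_closed[OF t] g_invol[OF t] lin_scale[OF g_lin[OF t]] lin_scale[OF ad_lin[OF g_lin[OF t]]]
        ad_b'[OF g_lin[OF t], of y y]
      by (auto simp: g_mult a0_def b0_def tens_apply fun_eq_iff b_sym)
  qed (use ab t invol_closed in auto)
  have "(\<Sum>i<Suc 0. fgen a0 * fgen b0 - fgen (a0 \<otimes> dl lop \<otimes> b0)) \<in> clifford_relations A"
    unfolding clifford_relations_def
    by (rule UnI2, rule CollectI, rule exI[of _ "Suc 0"], rule exI[of _ "\<lambda>_. a0"], rule exI[of _ "\<lambda>_. b0"],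
       rule exI[of _ "dl lop"])
     (use ab sand invol_closed semitrace_Trd in \<open>auto simp: fs\<close>)
  then have rel: "fgen a0 * fgen b0 - fgen (a0 \<otimes> dl lop \<otimes> b0) \<in> clifford_relations A" by simp
  have "P.cls (fgen a0 * fgen b0) = cm (a0 \<otimes> dl lop \<otimes> b0)"
    unfolding cm_def by (rule P.cls_eqI[OF rel]) (use ab in \<open>auto intro!: free_closed\<close>)
  moreover have "P.cls (fgen a0 * fgen b0) = cm a0 \<otimes>\<^bsub>C\<^esub> cm b0"
    using alg_homD(3)[OF P.cls_hom, of "fgen a0" "fgen b0"] ab by (simp add: cm_def C_def free_closed)
  moreover have "a0 \<otimes> dl lop \<otimes> b0 = q y \<odot> dl (tens V x z)"
  proof (rule g_inj)
    show "\<gamma> (a0 \<otimes> dl lop \<otimes> b0) = \<gamma> (q y \<odot> dl (tens V x z))"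
      using ab by (auto simp: g_mult g_smult a0_def b0_def tens_apply fun_eq_iff lin_scale[OF lop_lin] lop_q mult.commute)
  qed (use ab in auto)
  ultimately show ?thesis unfolding m_def a0_def b0_def by (simp add: cm_smult)
qed

lemma cm_sum_tens:
  "cm (dl (\<lambda>z. \<Sum>k<(j::nat). tens V (x k) (y k) z)) = (\<Oplus>\<^bsub>C\<^esub>k\<in>{..<j}. m (x k) (y k)) \<and>
    lin sc sc (\<lambda>z. \<Sum>k<j. tens V (x k) (y k) z)"
proof (induction j)
  case 0
  have "dl (\<lambda>_. 0) = \<zero>" using dl_smult[OF lin_id[OF E.vs], of 0] by (simp add: lin_id E.vs)
  moreover have "cm \<zero> = \<zero>\<^bsub>C\<^esub>" using cm_smult[OF zero_closed, of 0] by simp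
  ultimately show ?case by (simp add: lin_0 E.vs)
next
  case (Suc j)
  then show ?case
    by (simp add: lessThan_Suc lin_plus dl_add cm_add C.finsum_insert Pi_iff m_def C.a_comm)
qed

text \<open>An operator is the sum of the tensors of its values on the basis with the dual basis.
  Hence the \<open>m x y\<close> generate the Clifford algebra, which yields \<open>C_induct\<close>
  and \<open>hom_unique\<close>.\<close>

lemma cm_m: "a \<in> carrier A \<Longrightarrow> cm a = (\<Oplus>\<^bsub>C\<^esub>k\<in>{..<n}. m (\<gamma> a (e k)) (du k))"
proof -
  assume a: "a \<in> carrier A"
  have "(\<lambda>z. \<Sum>k<n. tens V (\<gamma> a (e k)) (du k) z) = \<gamma> a"
    by (rule ext) (rule lin_expand[OF g_lin[OF a], symmetric])
  then have "dl (\<lambda>z. \<Sum>k<n. tens V (\<gamma> a (e k)) (du k) z) = a" using a by simp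
  then show ?thesis using cm_sum_tens[where j=n and x="\<lambda>k. \<gamma> a (e k)" and y=du] by simp
qed

lemma finsum_closedI:
  assumes "\<And>k. k < (j::nat) \<Longrightarrow> g k \<in> carrier C \<and> PP (g k)" and "PP \<zero>\<^bsub>C\<^esub>"
    and "\<And>U W. U \<in> carrier C \<Longrightarrow> W \<in> carrier C \<Longrightarrow> PP U \<Longrightarrow> PP W \<Longrightarrow> PP (U \<oplus>\<^bsub>C\<^esub> W)"
  shows "PP (\<Oplus>\<^bsub>C\<^esub>k\<in>{..<j}. g k) \<and> (\<Oplus>\<^bsub>C\<^esub>k\<in>{..<j}. g k) \<in> carrier C"
  using assms(1)
proof (induction j)
  case 0
  then show ?case using assms(2) by simp
next
  case (Suc j)
  then show ?case using assms(3) by (simp add: lessThan_Suc C.finsum_insert Pi_iff)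
qed

lemma C_induct [consumes 1, case_names one gen add mult smult]:
  assumes U: "U \<in> carrier C" and one: "PP \<one>\<^bsub>C\<^esub>" and gen: "\<And>x y. PP (m x y)"
    and add: "\<And>U W. U \<in> carrier C \<Longrightarrow> W \<in> carrier C \<Longrightarrow> PP U \<Longrightarrow> PP W \<Longrightarrow> PP (U \<oplus>\<^bsub>C\<^esub> W)"
    and mult: "\<And>U W. U \<in> carrier C \<Longrightarrow> W \<in> carrier C \<Longrightarrow> PP U \<Longrightarrow> PP W \<Longrightarrow> PP (U \<otimes>\<^bsub>C\<^esub> W)"
    and smult: "\<And>c U. U \<in> carrier C \<Longrightarrow> PP U \<Longrightarrow> PP (c \<odot>\<^bsub>C\<^esub> U)"
  shows "PP U"
proof -
  have zero: "PP \<zero>\<^bsub>C\<^esub>" using smult[OF C.one_closed one, of 0] by simp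
  have cm: "PP (cm a)" if "a \<in> carrier A" for a
    unfolding cm_m[OF that] using finsum_closedI[of n "\<lambda>k. m (\<gamma> a (e k)) (du k)" PP] zero gen add by blast
  show ?thesis using U unfolding C_def
  proof (induction U rule: P.Q_induct)
    case (gen x)
    then show ?case using cm[of x] by (simp add: cm_def)
  qed (use assms in \<open>simp_all add: C_def\<close>)
qed

lemma hom_unique:
  assumes h: "h \<in> alg_hom C B" "k \<in> alg_hom C B" and eq: "\<And>x y. h (m x y) = k (m x y)"
    and U: "U \<in> carrier C"
  shows "h U = k U"
  using U by (induction rule: C_induct) (simp_all add: alg_homD[OF h(1)] alg_homD[OF h(2)] eq)

end

section \<open>Bilinear maps that satisfy the relations of the even Clifford algebra\<close>

locale cliff_rep = qspace V n e eps + B: falg B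
  for V :: "('f::field, 'v::ab_group_add) quad_space" and n e eps
    and B :: "('f, 'b, 'm) module_scheme" +
  fixes M :: "'v \<Rightarrow> 'v \<Rightarrow> 'b"
  assumes M_closed [simp, intro]: "M x y \<in> carrier B"
    and M_add: "M (x + x') y = M x y \<oplus>\<^bsub>B\<^esub> M x' y" "M x (y + y') = M x y \<oplus>\<^bsub>B\<^esub> M x y'"
    and M_smult: "M (scal V c x) y = c \<odot>\<^bsub>B\<^esub> M x y" "M x (scal V c y) = c \<odot>\<^bsub>B\<^esub> M x y"
    and M_diag: "M x x = form V x \<odot>\<^bsub>B\<^esub> \<one>\<^bsub>B\<^esub>"
    and M_mult: "M x y \<otimes>\<^bsub>B\<^esub> M y z = form V y \<odot>\<^bsub>B\<^esub> M x z"
begin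

text \<open>A pair \<open>(x, y)\<close> is a formal symbol for \<open>M x y\<close>. Identities in
  \<open>B\<close> are computed in the free algebra on these symbols, where ordinary ring arithmetic
  and finite sums are available, and are then evaluated.\<close>

definition ev :: "(('v \<times> 'v) list \<Rightarrow>\<^sub>0 'f) \<Rightarrow> 'b" where "ev = free_ev B (\<lambda>(x, y). M x y)"

lemma Mf: "(\<lambda>(x, y). M x y) \<in> UNIV \<rightarrow> carrier B" by auto

lemma U: "t \<in> carrier (free_algebra UNIV)" by (simp add: free_carrier)

lemma ev_simps [simp]: "ev t \<in> carrier B" "ev (s + t) = ev s \<oplus>\<^bsub>B\<^esub> ev t" "ev (s * t) = ev s \<otimes>\<^bsub>B\<^esub> ev t"
  "ev (fgen (x, y)) = M x y" "ev (fconst c) = c \<odot>\<^bsub>B\<^esub> \<one>\<^bsub>B\<^esub>" "ev 0 = \<zero>\<^bsub>B\<^esub>"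
  "ev (s - t) = ev s \<ominus>\<^bsub>B\<^esub> ev t"
  unfolding ev_def
  using B.free_ev_closed[OF Mf U] B.free_ev_add[OF Mf U U] B.free_ev_mult[OF Mf U U]
    B.free_ev_gen[OF Mf, of "(x, y)"] B.free_ev_const[OF Mf] B.free_ev_zero B.free_ev_diff[OF Mf U U]
  by auto

lemma ev_const: "ev (fconst c * t) = c \<odot>\<^bsub>B\<^esub> ev t"
  by (simp add: B.sm_l)

lemma ev_sum_zero: "(\<And>i. i \<in> I \<Longrightarrow> ev (g i) = \<zero>\<^bsub>B\<^esub>) \<Longrightarrow> ev (\<Sum>i\<in>I. g i) = \<zero>\<^bsub>B\<^esub>"
  by (induction I rule: infinite_finite_induct) auto

lemma ev_eq_iff: "ev s = ev t \<longleftrightarrow> ev (s - t) = \<zero>\<^bsub>B\<^esub>"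
  using B.r_right_minus_eq[of "ev s" "ev t"] by simp

lemma ev_zeroI: "ev s = ev t \<Longrightarrow> ev (u * (s - t)) = \<zero>\<^bsub>B\<^esub>"
proof -
  assume "ev s = ev t"
  then have "ev (s - t) = \<zero>\<^bsub>B\<^esub>" by (simp only: ev_eq_iff)
  then show ?thesis by (simp del: ev_simps(7))
qed

lemma fconst_sum: "fconst (\<Sum>i\<in>I. c i) = (\<Sum>i\<in>I. fconst (c i) :: 'x list \<Rightarrow>\<^sub>0 'f)"
  by (induction I rule: infinite_finite_induct) (simp_all add: single_add)

text \<open>The common shape of both verifications below: terms vanish on the diagonal and in pairs,
  and the double sum is regrouped by \<open>sum_square_split\<close>.\<close>

lemma ev_alternating:
  assumes "\<And>k. k < N \<Longrightarrow> ev (g k k) = \<zero>\<^bsub>B\<^esub>" "\<And>k l. k < N \<Longrightarrow> l < N \<Longrightarrow> ev (g k l + g l k) = \<zero>\<^bsub>B\<^esub>"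
  shows "ev (\<Sum>k<(N::nat). \<Sum>l<N. g k l) = \<zero>\<^bsub>B\<^esub>"
proof -
  have "ev (g k k + (\<Sum>l<k. g k l + g l k)) = \<zero>\<^bsub>B\<^esub>" if "k < N" for k
    using that assms ev_sum_zero[of "{..<k}" "\<lambda>l. g k l + g l k"] by (simp del: ev_simps(2) add: ev_simps(2)[of "g k k"])
  then show ?thesis unfolding sum_square_split by (intro ev_sum_zero) simp
qed

definition D :: "nat \<Rightarrow> nat \<Rightarrow> ('v \<times> 'v) list \<Rightarrow>\<^sub>0 'f" where "D j k = fgen (du j, du k)"

text \<open>The formal image of \<open>h\<close> in the Clifford algebra, from the expansion of
  \<open>h\<close> as the sum of the \<open>b(e\<^sub>j, h e\<^sub>k)\<close> times
  \<open>du\<^sub>j \<otimes> du\<^sub>k\<close>. Fixing a basis makes it linear in \<open>h\<close>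
  before any relation is imposed.\<close>

definition ct :: "('v \<Rightarrow> 'v) \<Rightarrow> ('v \<times> 'v) list \<Rightarrow>\<^sub>0 'f" where
  "ct h = (\<Sum>j<n. \<Sum>k<n. fconst (b (e j) (h (e k))) * D j k)"

lemma M_zero: "M 0 y = \<zero>\<^bsub>B\<^esub>" "M x 0 = \<zero>\<^bsub>B\<^esub>"
  using M_smult(1)[of 0 0 y] M_smult(2)[of x 0 0] by auto

lemma M_expand2: "ev (\<Sum>j<N. fconst (c j) * fgen (x, y j)) = M x (\<Sum>j<N. sc (c j) (y j))" for N :: nat
  by (induction N) (auto simp: M_zero M_add M_smult B.sm_l)

lemma M_expand: "ev (\<Sum>j<n. \<Sum>k<n. fconst (b (e j) x * b (e k) y) * D j k) = M x y"
proof -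
  have "ev (\<Sum>j<N. \<Sum>k<n. fconst (b (e j) x * b (e k) y) * D j k) = M (\<Sum>j<N. sc (b (e j) x) (du j)) y" for N
  proof (induction N)
    case (Suc N)
    have "(\<Sum>k<n. fconst (b (e N) x * b (e k) y) * D N k) =
        fconst (b (e N) x) * (\<Sum>k<n. fconst (b (e k) y) * D N k)"
      by (simp add: sum_distrib_left mult.assoc[symmetric] single_list_mult)
    then have "ev (\<Sum>k<n. fconst (b (e N) x * b (e k) y) * D N k) = b (e N) x \<odot>\<^bsub>B\<^esub> M (du N) y"
      using M_expand2[of "\<lambda>k. b (e k) y" "du N" du n]
      by (simp only: ev_const D_def expand_du[symmetric])
    then show ?case using Suc by (simp add: M_add M_smult)
  qed (simp add: M_zero)
  from this[of n] show ?thesis by (simp flip: expand_du)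
qed

lemma ct_tens: "ev (ct (tens V x y)) = M x y"
  using M_expand[of x y] by (simp add: ct_def tens_apply b_sym[of y] mult.commute)

lemma ct_add: "ct (\<lambda>x. h x + k x) = ct h + ct k"
  by (simp add: ct_def single_add distrib_right sum.distrib)

lemma ct_smult: "ct (\<lambda>x. sc c (h x)) = fconst c * ct h"
  by (simp add: ct_def sum_distrib_left mult.assoc[symmetric] single_list_mult)

lemma M_polar: "M x y \<oplus>\<^bsub>B\<^esub> M y x = b x y \<odot>\<^bsub>B\<^esub> \<one>\<^bsub>B\<^esub>"
proof -
  have "M (x + y) (x + y) = (M x x \<oplus>\<^bsub>B\<^esub> M y y) \<oplus>\<^bsub>B\<^esub> (M x y \<oplus>\<^bsub>B\<^esub> M y x)"
    by (simp add: M_add B.a_ac)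
  also have "M (x + y) (x + y) = (M x x \<oplus>\<^bsub>B\<^esub> M y y) \<oplus>\<^bsub>B\<^esub> (b x y \<odot>\<^bsub>B\<^esub> \<one>\<^bsub>B\<^esub>)"
    by (simp add: M_diag q_add B.sm_add)
  finally show ?thesis by (metis B.a_closed B.add.l_cancel B.one_closed B.sm_closed M_closed)
qed

lemma M_mult_polar: "M x y \<otimes>\<^bsub>B\<^esub> M y' z \<oplus>\<^bsub>B\<^esub> M x y' \<otimes>\<^bsub>B\<^esub> M y z = b y y' \<odot>\<^bsub>B\<^esub> M x z"
proof -
  have "M x (y + y') \<otimes>\<^bsub>B\<^esub> M (y + y') z = (M x y \<otimes>\<^bsub>B\<^esub> M y z \<oplus>\<^bsub>B\<^esub> M x y' \<otimes>\<^bsub>B\<^esub> M y' z) \<oplus>\<^bsub>B\<^esub>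
     (M x y \<otimes>\<^bsub>B\<^esub> M y' z \<oplus>\<^bsub>B\<^esub> M x y' \<otimes>\<^bsub>B\<^esub> M y z)"
    unfolding M_add by (simp add: B.l_distr B.r_distr B.a_ac)
  also have "M x (y + y') \<otimes>\<^bsub>B\<^esub> M (y + y') z = (M x y \<otimes>\<^bsub>B\<^esub> M y z \<oplus>\<^bsub>B\<^esub> M x y' \<otimes>\<^bsub>B\<^esub> M y' z) \<oplus>\<^bsub>B\<^esub>
     (b y y' \<odot>\<^bsub>B\<^esub> M x z)"
    by (simp add: M_mult q_add B.sm_add)
  finally show ?thesis by (metis B.a_closed B.add.l_cancel B.m_closed B.sm_closed M_closed)
qed

text \<open>The polarization of \<open>b(x, l x) = q(x)\<close>. It is needed for every such
  \<open>l\<close>, because the sandwich relations admit all of them.\<close>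

lemma lop_like:
  assumes l: "lin sc sc l" and lq: "\<And>x. b x (l x) = q x"
  shows "b x (l y) + b y (l x) = b x y"
  using lq[of "x + y"] by (simp add: lin_add[OF l] lq q_add add.commute)

lemma ct_sym:
  assumes s: "s \<in> SymV"
  shows "ev (ct s) = tr (lop \<circ> s) \<odot>\<^bsub>B\<^esub> \<one>\<^bsub>B\<^esub>"
proof -
  have sl: "lin sc sc s" "ad s = s" using s by (auto simp: SymV)
  define g where "g j k = b (e j) (s (e k))" for j k
  have gs: "g j k = g k j" for j k using ad_b[OF sl(1), of "e j" "e k"] sl(2) by (simp add: g_def b_sym)
  have tr: "tr (lop \<circ> s) = (\<Sum>j<n. \<Sum>k<n. g j k * b (du k) (lop (du j)))"
  proof -
    have "tr (lop \<circ> s) = (\<Sum>k<n. b (du k) (lop (s (e k))))" by (simp add: tr_def du)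
    also have "\<dots> = (\<Sum>k<n. \<Sum>j<n. g j k * b (du k) (lop (du j)))"
    proof (rule sum.cong)
      fix k
      have "b (du k) (lop (s (e k))) = b (du k) (lop (\<Sum>j<n. sc (b (e j) (s (e k))) (du j)))"
        by (simp flip: expand_du)
      then show "b (du k) (lop (s (e k))) = (\<Sum>j<n. g j k * b (du k) (lop (du j)))"
        by (simp add: lin_sum[OF lop_lin] lin_scale[OF lop_lin] b_sum g_def)
    qed simp
    finally show ?thesis by (subst sum.swap)
  qed
  \<comment> \<open>\<open>Y\<close> spreads the difference of \<open>ct s\<close> and the constant
    \<open>tr (lop \<circ> s)\<close> over the index pairs, with symmetric coefficients
    \<open>g\<close>. Diagonal terms vanish by \<open>M_diag\<close> and pairs by
    \<open>M_polar\<close>.\<close>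
  define Y where "Y j k = fconst (g j k) * (D j k - fconst (b (du k) (lop (du j))))" for j k
  have "ev (\<Sum>j<n. \<Sum>k<n. Y j k) = \<zero>\<^bsub>B\<^esub>"
  proof (rule ev_alternating)
    show "ev (Y k k) = \<zero>\<^bsub>B\<^esub>" for k
      unfolding Y_def by (rule ev_zeroI) (simp add: D_def lop_q M_diag)
    fix k l
    have "Y k l + Y l k = fconst (g k l) * ((D k l + D l k) - fconst (b (du k) (du l)))"
      by (simp add: Y_def gs[of l k] single_add algebra_simps
          lop_like[OF lop_lin lop_q, of "du k" "du l", symmetric])
    moreover have "ev (fconst (g k l) * ((D k l + D l k) - fconst (b (du k) (du l)))) = \<zero>\<^bsub>B\<^esub>"
      by (rule ev_zeroI) (simp add: D_def M_polar)
    ultimately show "ev (Y k l + Y l k) = \<zero>\<^bsub>B\<^esub>" by (simp only:)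
  qed
  also have "(\<Sum>j<n. \<Sum>k<n. Y j k) = ct s - fconst (tr (lop \<circ> s))"
    unfolding tr by (simp add: Y_def ct_def g_def right_diff_distrib sum_subtractf single_list_mult fconst_sum)
  finally have "ev (ct s) = ev (fconst (tr (lop \<circ> s)))" by (simp only: ev_eq_iff)
  then show ?thesis by simp
qed

text \<open>Invariance under the sandwich condition means that the coefficients
  \<open>\<tau> j p k r\<close> are symmetric in the inner indices \<open>k\<close>,
  \<open>r\<close>. For fixed outer indices the relation is then a double sum over \<open>k\<close>,
  \<open>r\<close> that vanishes on the diagonal by \<open>M_mult\<close> and in pairs by
  \<open>M_mult_polar\<close>.\<close>

lemma ct_sandwich:
  assumes f: "\<And>i. i < N \<Longrightarrow> lin sc sc (f i)" and g: "\<And>i. i < N \<Longrightarrow> lin sc sc (g i)"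
    and sand: "\<And>h z. lin sc sc h \<Longrightarrow> (\<Sum>i<N. f i (ad h (g i z))) = (\<Sum>i<N. f i (h (g i z)))"
    and l: "lin sc sc l" and lq: "\<And>x. b x (l x) = q x"
  shows "ev (\<Sum>i<(N::nat). ct (f i) * ct (g i) - ct (f i \<circ> l \<circ> g i)) = \<zero>\<^bsub>B\<^esub>"
proof -
  define la where "la k r = b (du k) (l (du r))" for k r
  define W where "W i j p k r = fconst (b (e j) (f i (e k)) * b (e r) (g i (e p))) *
    (D j k * D r p - fconst (la k r) * D j p)" for i j p k r
  have one: "ct (f i) * ct (g i) - ct (f i \<circ> l \<circ> g i) = (\<Sum>j<n. \<Sum>p<n. \<Sum>k<n. \<Sum>r<n. W i j p k r)"
    if i: "i < N" for i
  proof -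
    have fc: "fconst x * s * (fconst y * t) = fconst (x * y) * (s * t)" for x y :: 'f and s t :: "('v \<times> 'v) list \<Rightarrow>\<^sub>0 'f"
      by (metis (no_types, lifting) fconst_commute mult.assoc single_list_mult append_Nil)
    have "fconst (b (e j) (f i (e k))) * D j k * ct (g i) = (\<Sum>r<n. \<Sum>p<n.
       fconst (b (e j) (f i (e k)) * b (e r) (g i (e p))) * (D j k * D r p))" for j k
      by (simp add: ct_def sum_distrib_left fc)
    then have "ct (f i) * ct (g i) = (\<Sum>j<n. \<Sum>k<n. \<Sum>r<n. \<Sum>p<n.
       fconst (b (e j) (f i (e k)) * b (e r) (g i (e p))) * (D j k * D r p))"
      by (simp add: ct_def[of "f i"] sum_distrib_right)
    also have "\<dots> = (\<Sum>j<n. \<Sum>k<n. \<Sum>p<n. \<Sum>r<n.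
       fconst (b (e j) (f i (e k)) * b (e r) (g i (e p))) * (D j k * D r p))"
      by (intro sum.cong refl sum.swap)
    also have "\<dots> = (\<Sum>j<n. \<Sum>p<n. \<Sum>k<n. \<Sum>r<n.
       fconst (b (e j) (f i (e k)) * b (e r) (g i (e p))) * (D j k * D r p))"
      by (intro sum.cong refl sum.swap)
    finally have 1: "ct (f i) * ct (g i) = \<dots>" .
    have "b (e j) (f i (l (g i (e p)))) = (\<Sum>k<n. \<Sum>r<n. b (e j) (f i (e k)) * b (e r) (g i (e p)) * la k r)" for j p
    proof -
      have "l (g i (e p)) = l (\<Sum>r<n. sc (b (e r) (g i (e p))) (du r))" by (simp flip: expand_du)
      also have "\<dots> = (\<Sum>r<n. sc (b (e r) (g i (e p))) (\<Sum>k<n. sc (la k r) (e k)))"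
        unfolding la_def by (simp add: lin_sum[OF l] lin_scale[OF l] flip: expand_b)
      finally have "b (e j) (f i (l (g i (e p)))) =
         (\<Sum>r<n. \<Sum>k<n. b (e j) (f i (e k)) * b (e r) (g i (e p)) * la k r)"
        by (simp add: lin_sum[OF f[OF i]] lin_scale[OF f[OF i]] b_sum scale_sum_right mult_ac)
      then show ?thesis by (subst sum.swap)
    qed
    then have "ct (f i \<circ> l \<circ> g i) = (\<Sum>j<n. \<Sum>p<n. \<Sum>k<n. \<Sum>r<n.
       fconst (b (e j) (f i (e k)) * b (e r) (g i (e p))) * (fconst (la k r) * D j p))"
      by (simp add: ct_def fconst_sum sum_distrib_right single_list_mult mult.assoc[symmetric])
    then show ?thesis unfolding 1 W_def by (simp add: sum_subtractf right_diff_distrib)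
  qed
  define \<tau> where "\<tau> j p k r = (\<Sum>i<N. b (e j) (f i (e k)) * b (e r) (g i (e p)))" for j p k r
  \<comment> \<open>The sandwich condition is tested on
    \<open>e\<^sub>k \<otimes> e\<^sub>r\<close>, whose adjoint is the tensor with the factors
    exchanged.\<close>
  have tau: "\<tau> j p k r = \<tau> j p r k" for j p k r
  proof -
    have "b (e j) (\<Sum>i<N. f i (tens V (e k) (e r) (g i (e p)))) = \<tau> j p k r" for k r
      unfolding \<tau>_def by (simp add: b_sum tens_apply lin_scale[OF f] mult.commute)
    then show ?thesis using sand[OF tens_lin, of "e k" "e r" "e p"] by (metis ad_tens)
  qed
  have "(\<Sum>i<N. ct (f i) * ct (g i) - ct (f i \<circ> l \<circ> g i)) = (\<Sum>i<N. \<Sum>j<n. \<Sum>p<n. \<Sum>k<n. \<Sum>r<n. W i j p k r)"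
    by (rule sum.cong) (simp_all add: one)
  also have "\<dots> = (\<Sum>j<n. \<Sum>i<N. \<Sum>p<n. \<Sum>k<n. \<Sum>r<n. W i j p k r)" by (rule sum.swap)
  also have "\<dots> = (\<Sum>j<n. \<Sum>p<n. \<Sum>i<N. \<Sum>k<n. \<Sum>r<n. W i j p k r)" by (intro sum.cong refl sum.swap)
  also have "\<dots> = (\<Sum>j<n. \<Sum>p<n. \<Sum>k<n. \<Sum>i<N. \<Sum>r<n. W i j p k r)" by (intro sum.cong refl sum.swap)
  also have "\<dots> = (\<Sum>j<n. \<Sum>p<n. \<Sum>k<n. \<Sum>r<n. \<Sum>i<N. W i j p k r)" by (intro sum.cong refl sum.swap)
  also have "\<dots> = (\<Sum>j<n. \<Sum>p<n. \<Sum>k<n. \<Sum>r<n. fconst (\<tau> j p k r) * (D j k * D r p - fconst (la k r) * D j p))"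
    unfolding W_def \<tau>_def by (simp add: fconst_sum sum_distrib_right)
  finally have sum: "(\<Sum>i<N. ct (f i) * ct (g i) - ct (f i \<circ> l \<circ> g i)) = \<dots>" .
  have inner: "ev (\<Sum>k<n. \<Sum>r<n. fconst (\<tau> j p k r) * (D j k * D r p - fconst (la k r) * D j p)) = \<zero>\<^bsub>B\<^esub>" for j p
  proof (rule ev_alternating)
    show "ev (fconst (\<tau> j p k k) * (D j k * D k p - fconst (la k k) * D j p)) = \<zero>\<^bsub>B\<^esub>" for k
      by (rule ev_zeroI) (simp add: D_def la_def lq M_mult B.sm_l)
    fix k r
    have "fconst (\<tau> j p k r) * (D j k * D r p - fconst (la k r) * D j p) +
        fconst (\<tau> j p r k) * (D j r * D k p - fconst (la r k) * D j p) =
      fconst (\<tau> j p k r) * ((D j k * D r p + D j r * D k p) - fconst (b (du k) (du r)) * D j p)"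
      by (simp add: tau[of j p r k] la_def single_add algebra_simps lop_like[OF l lq, of "du k" "du r", symmetric])
    moreover have "ev (fconst (\<tau> j p k r) * ((D j k * D r p + D j r * D k p) - fconst (b (du k) (du r)) * D j p)) = \<zero>\<^bsub>B\<^esub>"
      by (rule ev_zeroI) (simp add: D_def M_mult_polar B.sm_l)
    ultimately show "ev (fconst (\<tau> j p k r) * (D j k * D r p - fconst (la k r) * D j p) +
        fconst (\<tau> j p r k) * (D j r * D k p - fconst (la r k) * D j p)) = \<zero>\<^bsub>B\<^esub>" by (simp only:)
  qed
  show ?thesis unfolding sum by (intro ev_sum_zero inner)
qed

end

context qp_split
begin

lemma g_finsum:
  assumes "\<And>i. i < (N::nat) \<Longrightarrow> g i \<in> carrier A"
  shows "(\<Oplus>i\<in>{..<N}. g i) \<in> carrier A \<and> \<gamma> (\<Oplus>i\<in>{..<N}. g i) = (\<lambda>z. \<Sum>i<N. \<gamma> (g i) z)"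
  using assms
proof (induction N)
  case 0
  have "\<gamma> (0 \<odot> \<one>) = (\<lambda>_. 0)" by (subst g_smult) auto
  then show ?case by simp
next
  case (Suc N)
  then have "finsum A g {..<Suc N} = g N \<oplus> finsum A g {..<N}"
    by (simp add: lessThan_Suc finsum_insert Pi_iff)
  then show ?case using Suc by (simp add: g_add add.commute)
qed

text \<open>Reduces the presentation by all elements of \<open>A\<close> to one by the products
  \<open>m x y\<close>. It is the source of the canonical involution, of the maps induced by
  isomorphisms, of the identification with the even Clifford algebra, and of the representation
  twisted by a reflection.\<close>

theorem clifford_universal:
  assumes rep: "cliff_rep V n e eps B M"
  shows "\<exists>h \<in> alg_hom C B. \<forall>x y. h (m x y) = M x y"
proof -
  interpret R: cliff_rep V n e eps B M by fact
  define f where "f a = R.ev (R.ct (\<gamma> a))" for a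
  have fc: "f \<in> carrier A \<rightarrow> carrier B" by (auto simp: f_def)
  note ev = R.B.free_ev_closed[OF fc] R.B.free_ev_add[OF fc] R.B.free_ev_mult[OF fc] R.B.free_ev_gen[OF fc]
    R.B.free_ev_const[OF fc] R.B.free_ev_diff[OF fc]
  have z: "free_ev B f (s - t) = \<zero>\<^bsub>B\<^esub>" if "free_ev B f s = free_ev B f t"
    "s \<in> carrier P.R" "t \<in> carrier P.R" for s t
    using that R.B.r_right_minus_eq ev by simp
  have rel: "free_ev B f t = \<zero>\<^bsub>B\<^esub>" if t: "t \<in> clifford_relations A" for t
    using t unfolding clifford_relations_def
  proof (elim UnE CollectE exE conjE)
    fix a a' assume t: "t = fgen (a \<oplus> a') - fgen a - fgen a'" and a: "a \<in> carrier A" "a' \<in> carrier A"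
    have "t = fgen (a \<oplus> a') - (fgen a + fgen a')" using t by simp
    then show ?thesis using a
      by (simp only:) (rule z; simp add: ev free_closed; simp add: f_def g_add R.ct_add)
  next
    fix c a assume t: "t = fgen (c \<odot> a) - fconst c * fgen a" and a: "a \<in> carrier A"
    then show ?thesis
      by (simp only:) (rule z; simp add: ev free_closed; simp add: f_def g_smult R.ct_smult)
  next
    fix a assume t: "t = fgen a - fconst (semitrace A a)" and a: "a \<in> Sym A (invol A)"
    then have "a \<in> carrier A" "\<gamma> a \<in> SymV" by (auto simp: Sym_iff)
    then show ?thesis using a t
      by (simp only:) (rule z; simp add: ev free_closed;
        simp add: f_def R.ct_sym g_semitrace form_semitrace_eq(1))
  next
    fix N :: nat and a a' l
    assume t: "t = (\<Sum>i<N. fgen (a i) * fgen (a' i) - fgen (a i \<otimes> l \<otimes> a' i))"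
      and a: "\<forall>i<N. a i \<in> carrier A \<and> a' i \<in> carrier A"
      and sand: "\<forall>x\<in>carrier A. (\<Oplus>i\<in>{..<N}. a i \<otimes> invol A x \<otimes> a' i) = (\<Oplus>i\<in>{..<N}. a i \<otimes> x \<otimes> a' i)"
      and l: "l \<in> carrier A" and ls: "\<forall>s\<in>Sym A (invol A). semitrace A s = Trd A (l \<otimes> s)"
    \<comment> \<open>Testing the condition on \<open>l\<close> against the tensor squares
      \<open>x \<otimes> x\<close> gives the one property of \<open>l\<close> that
      \<open>ct_sandwich\<close> uses.\<close>
    have lq: "b x (\<gamma> l x) = q x" for x
    proof -
      have S: "dl (tens V x x) \<in> Sym A (invol A)" by (simp add: Sym_iff Sym_tens)
      then have "q x = Trd A (l \<otimes> dl (tens V x x))"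
        using ls g_semitrace[OF S] form_semitrace_tens by simp
      also have "\<dots> = b x (\<gamma> l x)"
        using l by (simp add: Trd_eq g_mult comp_tens[OF g_lin[OF l]] tr_tens)
      finally show ?thesis by simp
    qed
    have "free_ev B f (\<Sum>i<j. fgen (a i) * fgen (a' i) - fgen (a i \<otimes> l \<otimes> a' i)) =
       R.ev (\<Sum>i<j. R.ct (\<gamma> (a i)) * R.ct (\<gamma> (a' i)) - R.ct (\<gamma> (a i) \<circ> \<gamma> l \<circ> \<gamma> (a' i))) \<and>
       (\<Sum>i<j. fgen (a i) * fgen (a' i) - fgen (a i \<otimes> l \<otimes> a' i)) \<in> carrier P.R" if "j \<le> N" for j
      using that
    proof (induction j)
      case (Suc j)
      then have aj: "a j \<in> carrier A" "a' j \<in> carrier A" using a by auto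
      have "free_ev B f (fgen (a j) * fgen (a' j) - fgen (a j \<otimes> l \<otimes> a' j)) =
        R.ev (R.ct (\<gamma> (a j)) * R.ct (\<gamma> (a' j)) - R.ct (\<gamma> (a j) \<circ> \<gamma> l \<circ> \<gamma> (a' j)))"
        using aj l by (simp add: ev free_closed) (simp add: f_def g_mult)
      moreover have "fgen (a j) * fgen (a' j) - fgen (a j \<otimes> l \<otimes> a' j) \<in> carrier P.R"
        using aj l by (auto intro!: free_closed)
      ultimately show ?case using Suc by (simp add: ev free_closed comp_def del: R.ev_simps(3,7))
    qed (simp add: R.B.free_ev_zero free_closed)
    from this[of N] have "free_ev B f t =
       R.ev (\<Sum>i<N. R.ct (\<gamma> (a i)) * R.ct (\<gamma> (a' i)) - R.ct (\<gamma> (a i) \<circ> \<gamma> l \<circ> \<gamma> (a' i)))" by (simp add: t)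
    also have "\<dots> = \<zero>\<^bsub>B\<^esub>"
    proof (rule R.ct_sandwich)
      fix h z assume h: "lin sc sc h"
      have c: "a i \<otimes> invol A (dl h) \<otimes> a' i \<in> carrier A" "a i \<otimes> dl h \<otimes> a' i \<in> carrier A" if "i < N" for i
        using that a invol_closed h by auto
      have "\<gamma> (\<Oplus>i\<in>{..<N}. a i \<otimes> invol A (dl h) \<otimes> a' i) z = \<gamma> (\<Oplus>i\<in>{..<N}. a i \<otimes> dl h \<otimes> a' i) z"
        using sand h by simp
      then have "(\<Sum>i<N. \<gamma> (a i \<otimes> invol A (dl h) \<otimes> a' i) z) = (\<Sum>i<N. \<gamma> (a i \<otimes> dl h \<otimes> a' i) z)"
        using g_finsum[of N "\<lambda>i. a i \<otimes> invol A (dl h) \<otimes> a' i"] g_finsum[of N "\<lambda>i. a i \<otimes> dl h \<otimes> a' i"] c by simp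
      then show "(\<Sum>i<N. \<gamma> (a i) (ad h (\<gamma> (a' i) z))) = (\<Sum>i<N. \<gamma> (a i) (h (\<gamma> (a' i) z)))"
        using a h invol_closed by (simp add: g_mult g_invol)
    qed (use a l lq in auto)
    finally show ?thesis .
  qed
  obtain h where h: "h \<in> alg_hom P.Q B" "\<And>t. t \<in> carrier P.R \<Longrightarrow> h (P.cls t) = free_ev B f t"
    using P.lift_exists[OF R.B.alg fc rel] by blast
  have "h (m x y) = M x y" for x y
  proof -
    have "h (m x y) = free_ev B f (fgen (dl (tens V x y)))"
      unfolding m_def cm_def by (rule h(2)) (simp add: free_closed)
    then show ?thesis by (simp add: ev) (simp add: f_def R.ct_tens)
  qed
  then show ?thesis using h(1) by (auto simp: C_def)
qed

end

lemma hom_finsum: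
  assumes A: "is_algebra A" and B: "is_algebra B" and h: "h \<in> alg_hom A B"
    and g: "\<And>k. k < (j::nat) \<Longrightarrow> g k \<in> carrier A"
  shows "(\<Oplus>\<^bsub>A\<^esub>k\<in>{..<j}. g k) \<in> carrier A \<and>
    h (\<Oplus>\<^bsub>A\<^esub>k\<in>{..<j}. g k) = (\<Oplus>\<^bsub>B\<^esub>k\<in>{..<j}. h (g k))"
proof -
  interpret A: falg A by unfold_locales fact
  interpret B: falg B by unfold_locales fact
  show ?thesis using g
  proof (induction j)
    case 0
    then show ?case by (simp add: alg_hom_zero[OF A B h])
  next
    case (Suc j)
    then have "(\<Oplus>\<^bsub>A\<^esub>k\<in>{..<Suc j}. g k) = g j \<oplus>\<^bsub>A\<^esub> (\<Oplus>\<^bsub>A\<^esub>k\<in>{..<j}. g k)"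
      "(\<Oplus>\<^bsub>B\<^esub>k\<in>{..<Suc j}. h (g k)) = h (g j) \<oplus>\<^bsub>B\<^esub> (\<Oplus>\<^bsub>B\<^esub>k\<in>{..<j}. h (g k))"
      by (simp_all add: lessThan_Suc A.finsum_insert B.finsum_insert Pi_iff alg_homD(1)[OF h])
    then show ?case using Suc by (simp add: alg_homD(2)[OF h])
  qed
qed

lemma ext_restrictI: "u \<in> extensional S \<Longrightarrow> (\<And>x. x \<in> S \<Longrightarrow> u x = restrict h S x) \<Longrightarrow> u = restrict h S"
  by (auto simp: fun_eq_iff extensional_def)

text \<open>The opposite algebra. An involution is a homomorphism into it, so the canonical
  involution can be obtained from \<open>clifford_universal\<close>.\<close>

definition op_alg :: "('f::field, 'a) module \<Rightarrow> ('f, 'a) module" where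
  "op_alg A = A\<lparr>mult := \<lambda>x y. y \<otimes>\<^bsub>A\<^esub> x\<rparr>"

lemma op_alg_simps [simp]: "carrier (op_alg A) = carrier A" "mult (op_alg A) = (\<lambda>x y. y \<otimes>\<^bsub>A\<^esub> x)"
  "one (op_alg A) = one A" "zero (op_alg A) = zero A" "add (op_alg A) = add A" "smult (op_alg A) = smult A"
  by (simp_all add: op_alg_def)

lemma op_is_algebra:
  assumes A: "is_algebra A"
  shows "is_algebra (op_alg A)"
proof -
  interpret falg A by unfold_locales fact
  have "ring (op_alg A)"
    by (intro ringI abelian_groupI monoidI)
       (auto simp: m_assoc a_ac l_distr r_distr intro: l_neg)
  then show ?thesis
    by (rule is_algebraI) (auto simp: sm_mult sm_add sm_addr sm_l sm_r)
qed

context qp_split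
begin

lemma m_rep: "cliff_rep V n e eps C m"
  by unfold_locales (auto simp: m_add m_smult m_diag m_mult)

lemma cm_ad: "a \<in> carrier A \<Longrightarrow> cm (invol A a) = (\<Oplus>\<^bsub>C\<^esub>k\<in>{..<n}. m (du k) (\<gamma> a (e k)))"
proof -
  assume a: "a \<in> carrier A"
  have "(\<lambda>z. \<Sum>k<n. tens V (du k) (\<gamma> a (e k)) z) = ad (\<gamma> a)"
    by (rule ext) (simp add: ad_props(3)[OF g_lin[OF a]] tens_apply b_sym)
  then have "dl (\<lambda>z. \<Sum>k<n. tens V (du k) (\<gamma> a (e k)) z) = invol A a"
    using a invol_closed by (simp flip: g_invol)
  then show ?thesis using cm_sum_tens[where j=n and y="\<lambda>k. \<gamma> a (e k)" and x=du] by simp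
qed

text \<open>The Clifford relations are symmetric under reversal of products, so
  \<open>m x y \<mapsto> m y x\<close> defines a homomorphism into the opposite algebra. On the
  generators \<open>cm a\<close> it agrees with \<open>invol\<close>, because passing to the adjoint
  reverses every tensor.\<close>

lemma clifford_invol_props:
  "involution_on C (clifford_invol A)" "a \<in> carrier A \<Longrightarrow> clifford_invol A (cm a) = cm (invol A a)"
proof -
  have "cliff_rep V n e eps (op_alg C) (\<lambda>x y. m y x)"
    by (intro cliff_rep.intro qspace_axioms falg.intro op_is_algebra C_algebra cliff_rep_axioms.intro)
       (simp_all add: m_add m_smult m_diag m_mult)
  from clifford_universal[OF this]
  obtain t where t: "t \<in> alg_hom C (op_alg C)" and tm': "\<forall>x y. t (m x y) = m y x" by (rule bexE)
  have tm: "t (m x y) = m y x" for x y using tm' by blast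
  note tt = alg_homD[OF t, simplified]
  have t2: "t (t U) = U" if "U \<in> carrier C" for U
    using that by (induction rule: C_induct) (auto simp: tt tm)
  have tcm: "t (cm a) = cm (invol A a)" if a: "a \<in> carrier A" for a
  proof -
    have "finsum (op_alg C) g I = finsum C g I" for g and I :: "nat set"
      by (simp add: finsum_def finprod_def)
    then show ?thesis
      using hom_finsum[OF C_algebra op_is_algebra[OF C_algebra] t, of n "\<lambda>k. m (\<gamma> a (e k)) (du k)"]
      by (simp add: cm_m[OF a] cm_ad[OF a] tm)
  qed
  let ?t = "restrict t (carrier C)"
  have "clifford_invol A = ?t"
    unfolding clifford_invol_def
  proof (rule the_equality)
    show "?t \<in> extensional (carrier C) \<and> involution_on C ?t \<and> (\<forall>a\<in>carrier A. ?t (cm a) = cm (invol A a))"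
      by (auto simp: involution_on_def tt t2 tcm invol_closed)
    fix u assume u: "u \<in> extensional (carrier C) \<and> involution_on C u \<and> (\<forall>a\<in>carrier A. u (cm a) = cm (invol A a))"
    have "u U = t U" if "U \<in> carrier C" for U
    proof -
      \<comment> \<open>The induction over generators starts at the unit. That \<open>u\<close>
        fixes it follows by applying \<open>u\<close> to the product of \<open>u 1\<close> and
        \<open>1\<close>.\<close>
      have u1: "u \<one>\<^bsub>C\<^esub> = \<one>\<^bsub>C\<^esub>"
      proof -
        have c: "u \<one>\<^bsub>C\<^esub> \<in> carrier C" using u by (auto simp: involution_on_def)
        have "u (u \<one>\<^bsub>C\<^esub> \<otimes>\<^bsub>C\<^esub> \<one>\<^bsub>C\<^esub>) = u \<one>\<^bsub>C\<^esub> \<otimes>\<^bsub>C\<^esub> u (u \<one>\<^bsub>C\<^esub>)"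
          using u c C.one_closed unfolding involution_on_def by blast
        moreover have "u (u \<one>\<^bsub>C\<^esub>) = \<one>\<^bsub>C\<^esub>" using u C.one_closed unfolding involution_on_def by blast
        ultimately show ?thesis using c by simp
      qed
      show ?thesis using that
      proof (induction rule: C_induct)
        case (gen x y)
        have "u (m x y) = cm (invol A (dl (tens V x y)))" unfolding m_def using u by simp
        also have "\<dots> = t (m x y)" unfolding m_def by (simp add: tcm)
        finally show ?case .
      qed (use u u1 in \<open>auto simp: involution_on_def tt\<close>)
    qed
    then show "u = ?t" using u by (intro ext_restrictI) auto
  qed
  then show "involution_on C (clifford_invol A)" "a \<in> carrier A \<Longrightarrow> clifford_invol A (cm a) = cm (invol A a)"
    by (auto simp: involution_on_def tt t2 tcm)
qed

lemma clifford_invol_m: "clifford_invol A (m x y) = m y x"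
proof -
  have "invol A (dl (tens V x y)) = dl (tens V y x)"
    by (rule g_inj) (auto simp: invol_closed g_invol ad_tens)
  then show ?thesis unfolding m_def by (simp add: clifford_invol_props)
qed

end

lemma End_m:
  assumes "qspace V n e eps" "n > 0"
  shows "qp_split.m (End_qp V) V (\<lambda>h. h) x y = clifford_map (End_qp V) (tens V x y)"
proof -
  interpret S: qp_split "End_qp V" V n e eps "\<lambda>h. h" by (rule qp_split_End[OF assms])
  note S.g_lin [simp del, rule del]
  have "S.dl (tens V x y) = tens V x y" using S.g_dl[of "tens V x y"] by simp
  then show ?thesis by (simp add: S.m_def)
qed

context qp_split
begin

abbreviation "mE x y \<equiv> clifford_map (End_qp V) (tens V x y)"

lemma clifford_induced_props:
  "clifford_induced A (End_qp V) \<gamma> \<in> alg_hom C (clifford_algebra (End_qp V))"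
  "clifford_induced A (End_qp V) \<gamma> (m x y) = mE x y"
proof -
  interpret S: qp_split "End_qp V" V n e eps "\<lambda>h. h" by (rule qp_split_End[OF qspace_axioms n_pos])
  note S.g_lin [simp del, rule del]
  have Sm: "S.m = mE" by (intro ext End_m[OF qspace_axioms n_pos])
  from clifford_universal[OF S.m_rep]
  obtain h where h: "h \<in> alg_hom C S.C" and hm': "\<forall>x y. h (m x y) = S.m x y" by (rule bexE)
  have hm: "h (m x y) = S.m x y" for x y using hm' by blast
  have hcm: "h (cm a) = S.cm (\<gamma> a)" if a: "a \<in> carrier A" for a
  proof -
    have "h (cm a) = (\<Oplus>\<^bsub>S.C\<^esub>k\<in>{..<n}. h (m (\<gamma> a (e k)) (du k)))"
      unfolding cm_m[OF a] by (rule hom_finsum[OF C_algebra S.C_algebra h, THEN conjunct2]) simp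
    also have "\<dots> = S.cm (\<gamma> a)"
      unfolding hm by (rule S.cm_m[of "\<gamma> a", symmetric]) (use g_lin[OF a] in simp)
    finally show ?thesis .
  qed
  let ?h = "restrict h (carrier C)"
  have hh: "?h \<in> alg_hom C S.C"
    by (rule alg_homI) (auto simp: alg_homD[OF h])
  have "clifford_induced A (End_qp V) \<gamma> = ?h"
    unfolding clifford_induced_def
  proof (rule the_equality)
    show "?h \<in> extensional (carrier C) \<and> ?h \<in> alg_hom C S.C \<and> (\<forall>a\<in>carrier A. ?h (cm a) = S.cm (\<gamma> a))"
      using hh hcm by auto
    fix u assume u: "u \<in> extensional (carrier C) \<and> u \<in> alg_hom C S.C \<and> (\<forall>a\<in>carrier A. u (cm a) = S.cm (\<gamma> a))"
    have "u U = ?h U" if "U \<in> carrier C" for U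
    proof (rule hom_unique[OF _ hh _ that])
      show "u \<in> alg_hom C S.C" using u by blast
      fix x y
      have c: "dl (tens V x y) \<in> carrier A" by simp
      have "u (m x y) = S.cm (\<gamma> (dl (tens V x y)))" unfolding m_def using u c by blast
      also have "\<dots> = h (m x y)" unfolding m_def using hcm[OF c] by (rule sym)
      finally show "u (m x y) = ?h (m x y)" by simp
    qed
    then show "u = ?h" using u by (intro ext_restrictI) blast+
  qed
  then show "clifford_induced A (End_qp V) \<gamma> \<in> alg_hom C (clifford_algebra (End_qp V))"
    "clifford_induced A (End_qp V) \<gamma> (m x y) = mE x y"
    using hh hm[of x y] unfolding Sm by simp_all
qed

end

section \<open>The Clifford algebra of a quadratic space\<close>

definition quad_rels :: "('f::field, 'v::ab_group_add) quad_space \<Rightarrow> ('v list \<Rightarrow>\<^sub>0 'f) set" where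
  "quad_rels V = {fgen (x + y) - fgen x - fgen y | x y. True} \<union>
      {fgen (scal V c x) - fconst c * fgen x | c x. True} \<union>
      {fgen x * fgen x - fconst (form V x) | x. True}"

locale quad_cliff = qspace V n e eps
  for V :: "('f::field, 'v::ab_group_add) quad_space" and n e eps
begin

sublocale P: presentation UNIV "quad_rels V"
  by unfold_locales (auto simp: free_carrier)

abbreviation "Q \<equiv> quad_clifford V"
abbreviation "qc \<equiv> quad_clifford_class V"

lemma Q_def: "Q = P.Q" by (simp add: quad_clifford_def quad_clifford_ideal_def quad_rels_def)
lemma qc_def: "qc t = P.cls t" by (simp add: quad_clifford_class_def quad_clifford_ideal_def quad_rels_def)

lemma Q_algebra: "is_algebra Q" unfolding Q_def by (rule P.Q_algebra)

sublocale Q: falg Q by unfold_locales (rule Q_algebra)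

lemma U: "t \<in> carrier (free_algebra UNIV)" by (simp add: free_carrier)

lemma Q_carrier: "U \<in> carrier Q \<longleftrightarrow> (\<exists>t. U = qc t)"
  using P.Q_carrier U by (auto simp: Q_def qc_def)

lemma qc_simps: "qc t \<in> carrier Q" "qc (s + t) = qc s \<oplus>\<^bsub>Q\<^esub> qc t" "qc (s * t) = qc s \<otimes>\<^bsub>Q\<^esub> qc t"
  "qc 1 = \<one>\<^bsub>Q\<^esub>" "qc (fconst c * t) = c \<odot>\<^bsub>Q\<^esub> qc t"
  unfolding Q_def qc_def
  using alg_homD(1)[OF P.cls_hom U] alg_homD(2)[OF P.cls_hom U U] alg_homD(3)[OF P.cls_hom U U]
    alg_homD(4)[OF P.cls_hom] alg_homD(5)[OF P.cls_hom U] by simp_all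

lemma qc_const: "qc (fconst c) = c \<odot>\<^bsub>Q\<^esub> \<one>\<^bsub>Q\<^esub>"
  using qc_simps(5)[of c 1] by (simp add: qc_simps)

lemma qc_eqI: "s - t \<in> quad_rels V \<Longrightarrow> qc s = qc t"
  unfolding qc_def by (rule P.cls_eqI[OF _ U])

lemma qc_gen: "qc (fgen (x + y)) = qc (fgen x) \<oplus>\<^bsub>Q\<^esub> qc (fgen y)"
  "qc (fgen (sc c x)) = c \<odot>\<^bsub>Q\<^esub> qc (fgen x)"
  "qc (fgen x) \<otimes>\<^bsub>Q\<^esub> qc (fgen x) = q x \<odot>\<^bsub>Q\<^esub> \<one>\<^bsub>Q\<^esub>"
proof -
  have "qc (fgen (x + y)) = qc (fgen x + fgen y)"
    by (rule qc_eqI) (unfold diff_diff_eq[symmetric] quad_rels_def, blast)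
  then show "qc (fgen (x + y)) = qc (fgen x) \<oplus>\<^bsub>Q\<^esub> qc (fgen y)" by (simp add: qc_simps)
  have "qc (fgen (sc c x)) = qc (fconst c * fgen x)" by (rule qc_eqI) (unfold quad_rels_def, blast)
  then show "qc (fgen (sc c x)) = c \<odot>\<^bsub>Q\<^esub> qc (fgen x)" by (simp only: qc_simps(5))
  have "qc (fgen x * fgen x) = qc (fconst (q x))" by (rule qc_eqI) (unfold quad_rels_def, blast)
  then show "qc (fgen x) \<otimes>\<^bsub>Q\<^esub> qc (fgen x) = q x \<odot>\<^bsub>Q\<^esub> \<one>\<^bsub>Q\<^esub>" by (simp add: qc_simps qc_const)
qed

abbreviation "MQ x y \<equiv> qc (fgen x * fgen y)"

lemma MQ_rep: "cliff_rep V n e eps Q MQ"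
proof unfold_locales
  fix x y z
  note c = qc_simps(1)[of "fgen x"] qc_simps(1)[of "fgen y"] qc_simps(1)[of "fgen z"]
  have "MQ x y \<otimes>\<^bsub>Q\<^esub> MQ y z = qc (fgen x) \<otimes>\<^bsub>Q\<^esub> (qc (fgen y) \<otimes>\<^bsub>Q\<^esub> qc (fgen y)) \<otimes>\<^bsub>Q\<^esub> qc (fgen z)"
    using c by (simp add: qc_simps(3) Q.m_assoc)
  then show "MQ x y \<otimes>\<^bsub>Q\<^esub> MQ y z = q y \<odot>\<^bsub>Q\<^esub> MQ x z"
    using c by (simp add: qc_gen(3) qc_simps(3) Q.sm_l Q.sm_r)
qed (auto simp: qc_simps qc_gen Q.l_distr Q.r_distr Q.sm_l Q.sm_r)

definition evens :: "('v list \<Rightarrow>\<^sub>0 'f) set set" where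
  "evens = {qc t | t. \<forall>w\<in>Poly_Mapping.keys t. even (length w)}"

lemma even_simps [simp]: "carrier (even_clifford V) = evens" "mult (even_clifford V) = mult Q"
  "one (even_clifford V) = one Q" "zero (even_clifford V) = zero Q" "add (even_clifford V) = add Q"
  "smult (even_clifford V) = smult Q"
  by (auto simp: even_clifford_def evens_def)

lemma evens: "U \<in> evens \<Longrightarrow> U \<in> carrier Q" "\<one>\<^bsub>Q\<^esub> \<in> evens" "MQ x y \<in> evens"
  "U \<in> evens \<Longrightarrow> W \<in> evens \<Longrightarrow> U \<oplus>\<^bsub>Q\<^esub> W \<in> evens"
  "U \<in> evens \<Longrightarrow> W \<in> evens \<Longrightarrow> U \<otimes>\<^bsub>Q\<^esub> W \<in> evens"
  "U \<in> evens \<Longrightarrow> c \<odot>\<^bsub>Q\<^esub> U \<in> evens"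
proof -
  have 1: "qc t \<in> evens" if "\<forall>w\<in>Poly_Mapping.keys t. even (length w)" for t using that by (auto simp: evens_def)
  show "U \<in> evens \<Longrightarrow> U \<in> carrier Q" by (auto simp: evens_def qc_simps)
  show "\<one>\<^bsub>Q\<^esub> \<in> evens" using 1[of 1] by (simp add: one_list_poly) (simp flip: one_list_poly add: qc_simps)
  show "MQ x y \<in> evens" by (rule 1) (simp add: single_list_mult)
  show add: "U \<oplus>\<^bsub>Q\<^esub> W \<in> evens" if UW: "U \<in> evens" "W \<in> evens" for U W
  proof -
    obtain s t where "U = qc s" "W = qc t" "\<forall>w\<in>Poly_Mapping.keys s. even (length w)"
      "\<forall>w\<in>Poly_Mapping.keys t. even (length w)" using UW by (auto simp: evens_def)
    moreover from this have "qc (s + t) \<in> evens" using keys_add[of s t] by (intro 1) blast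
    ultimately show ?thesis by (simp add: qc_simps)
  qed
  show mult: "U \<otimes>\<^bsub>Q\<^esub> W \<in> evens" if UW: "U \<in> evens" "W \<in> evens" for U W
  proof -
    obtain s t where "U = qc s" "W = qc t" "\<forall>w\<in>Poly_Mapping.keys s. even (length w)"
      "\<forall>w\<in>Poly_Mapping.keys t. even (length w)" using UW by (auto simp: evens_def)
    moreover from this have "qc (s * t) \<in> evens" using keys_mult[of s t] unfolding plus_list_def
      by (intro 1 ballI) fastforce
    ultimately show ?thesis by (simp add: qc_simps)
  qed
  show "c \<odot>\<^bsub>Q\<^esub> U \<in> evens" if "U \<in> evens"
  proof -
    have "qc (fconst c) \<in> evens" by (rule 1) simp
    then have "qc (fconst c) \<otimes>\<^bsub>Q\<^esub> U \<in> evens" using that by (rule mult)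
    moreover have "U \<in> carrier Q" using that by (auto simp: evens_def qc_simps)
    ultimately show ?thesis by (simp add: qc_const Q.sm_l)
  qed
qed

text \<open>The definite description asks for values in the even part, which holds by induction over
  the generators. The result is stated with the full Clifford algebra as target, ready for
  composition with \<open>C(\<alpha>)\<close>.\<close>

lemma clifford_identification_props:
  assumes n: "n > 0"
  shows "clifford_identification V \<in> alg_hom (clifford_algebra (End_qp V)) Q"
    "clifford_identification V (clifford_map (End_qp V) (tens V x y)) = MQ x y"
proof -
  interpret S: qp_split "End_qp V" V n e eps "\<lambda>h. h" by (rule qp_split_End[OF qspace_axioms n])
  note S.g_lin [simp del, rule del]
  have Sm: "S.m x y = clifford_map (End_qp V) (tens V x y)" for x y by (rule End_m[OF qspace_axioms n])
  from S.clifford_universal[OF MQ_rep]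
  obtain h where h: "h \<in> alg_hom S.C Q" and hm': "\<forall>x y. h (S.m x y) = MQ x y" by (rule bexE)
  have hm: "h (S.m x y) = MQ x y" for x y using hm' by blast
  have he: "h U \<in> evens" if "U \<in> carrier S.C" for U
    using that by (induction rule: S.C_induct) (auto simp: alg_homD[OF h] hm evens)
  let ?h = "restrict h (carrier S.C)"
  have hh: "?h \<in> alg_hom S.C Q" by (rule alg_homI) (auto simp: alg_homD[OF h])
  have he': "?h \<in> alg_hom S.C (even_clifford V)" by (rule alg_homI) (auto simp: alg_homD[OF h] he)
  have "clifford_identification V = ?h"
    unfolding clifford_identification_def
  proof (rule the_equality)
    show "?h \<in> extensional (carrier S.C) \<and> ?h \<in> alg_hom S.C (even_clifford V) \<and>
      (\<forall>x y. ?h (S.cm (tens V x y)) = MQ x y)"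
      using he' hm unfolding Sm[symmetric] by auto
    fix u assume u: "u \<in> extensional (carrier S.C) \<and> u \<in> alg_hom S.C (even_clifford V) \<and>
      (\<forall>x y. u (S.cm (tens V x y)) = MQ x y)"
    have "u U = ?h U" if "U \<in> carrier S.C" for U
      by (rule S.hom_unique[OF _ he' _ that]) (use u hm in \<open>auto simp: Sm[symmetric]\<close>)
    then show "u = ?h" using u by (intro ext_restrictI) blast+
  qed
  then show "clifford_identification V \<in> alg_hom S.C Q"
    "clifford_identification V (S.cm (tens V x y)) = MQ x y"
    using hh hm[of x y] by (simp_all add: Sm[symmetric])
qed

lemma extension_props:
  assumes B: "is_algebra B" and a: "\<And>x. \<alpha> x \<in> carrier B" "\<And>x y. \<alpha> (x + y) = \<alpha> x \<oplus>\<^bsub>B\<^esub> \<alpha> y"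
    "\<And>c x. \<alpha> (sc c x) = c \<odot>\<^bsub>B\<^esub> \<alpha> x" "\<And>x. \<alpha> x \<otimes>\<^bsub>B\<^esub> \<alpha> x = q x \<odot>\<^bsub>B\<^esub> \<one>\<^bsub>B\<^esub>"
  shows "quad_clifford_extension V B \<alpha> \<in> alg_hom Q B" "quad_clifford_extension V B \<alpha> (qc (fgen x)) = \<alpha> x"
proof -
  interpret B: falg B by unfold_locales fact
  have f: "\<alpha> \<in> UNIV \<rightarrow> carrier B" using a by auto
  note ev = B.free_ev_add[OF f U U] B.free_ev_mult[OF f U U] B.free_ev_gen[OF f UNIV_I]
    B.free_ev_const[OF f] B.free_ev_diff[OF f U U] B.free_ev_closed[OF f U]
  have rel: "free_ev B \<alpha> t = \<zero>\<^bsub>B\<^esub>" if "t \<in> quad_rels V" for t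
  proof -
    have z: "free_ev B \<alpha> (s - t) = \<zero>\<^bsub>B\<^esub>" if "free_ev B \<alpha> s = free_ev B \<alpha> t" for s t
      using that B.r_right_minus_eq ev by simp
    show ?thesis using that unfolding quad_rels_def
    proof (elim UnE CollectE exE conjE)
      fix x y assume t: "t = fgen (x + y) - fgen x - fgen y"
      have "t = fgen (x + y) - (fgen x + fgen y)" using t by simp
      then show ?thesis by (simp only:) (rule z; simp add: ev a)
    next
      fix c x assume "t = fgen (sc c x) - fconst c * fgen x"
      then show ?thesis by (simp only:) (rule z; simp add: ev a B.sm_l)
    next
      fix x assume "t = fgen x * fgen x - fconst (q x)"
      then show ?thesis by (simp only:) (rule z; simp add: ev a)
    qed
  qed
  obtain h where h: "h \<in> alg_hom Q B" "\<And>t. h (qc t) = free_ev B \<alpha> t"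
    using P.lift_exists[OF B f rel] U by (auto simp: Q_def qc_def)
  let ?h = "restrict h (carrier Q)"
  have hh: "?h \<in> alg_hom Q B" by (rule alg_homI) (auto simp: alg_homD[OF h(1)])
  have hg: "?h (qc (fgen x)) = \<alpha> x" for x using h(2) by (simp add: qc_simps ev)
  have "quad_clifford_extension V B \<alpha> = ?h"
    unfolding quad_clifford_extension_def
  proof (rule the_equality)
    fix u assume u: "u \<in> extensional (carrier Q) \<and> u \<in> alg_hom Q B \<and> (\<forall>x. u (qc (fgen x)) = \<alpha> x)"
    then have uh: "u \<in> alg_hom Q B" by blast
    have "u U = ?h U" if "U \<in> carrier Q" for U
      using that unfolding Q_def
    proof (induction rule: P.Q_induct)
      case (gen x)
      have "u (qc (fgen x)) = ?h (qc (fgen x))" using u hg[of x] by metis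
      then show ?case by (simp only: qc_def Q_def)
    qed (use alg_homD[OF uh] alg_homD[OF hh] in \<open>simp_all add: Q_def\<close>)
    then show "u = ?h" using u by (intro ext_restrictI) blast+
  qed (use hh hg in auto)
  then show "quad_clifford_extension V B \<alpha> \<in> alg_hom Q B" "quad_clifford_extension V B \<alpha> (qc (fgen x)) = \<alpha> x"
    using hh hg by simp_all
qed

end

context qspace
begin

lemma anisotropic_exists: "n > 0 \<Longrightarrow> \<exists>z. q z \<noteq> 0"
proof (rule ccontr)
  assume n: "n > 0" and *: "\<not> (\<exists>z. q z \<noteq> 0)"
  then have "b x y = 0" for x y by (simp add: polar_def)
  then have "e 0 = 0" by (rule b_nondeg)
  then show False using eps_e[of 0 0] n by (simp add: lin_zero[OF eps_lin])
qed

text \<open>By nondegeneracy \<open>F x y = b (k x) y\<close> for an operator \<open>k\<close>. The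
  invariance of \<open>F\<close> says that \<open>k\<close> commutes with all endomorphisms, so
  \<open>k\<close> is a scalar.\<close>

lemma form_scalar:
  assumes n: "n > 0" and F: "\<And>x. lin sc (*) (F x)" "\<And>y. lin sc (*) (\<lambda>x. F x y)"
    and inv: "\<And>h x y. lin sc sc h \<Longrightarrow> F (h x) y = F x (ad h y)"
  shows "\<exists>\<mu>. \<forall>x y. F x y = \<mu> * b x y"
proof -
  have "\<exists>k. \<forall>x y. b (k x) y = F x y" using riesz[OF F(1)] by metis
  then obtain k where k: "\<And>x y. b (k x) y = F x y" by blast
  have klin: "lin sc sc k"
  proof (rule linI[OF vs vs])
    fix x y c
    show "k (x + y) = k x + k y" by (rule b_eqI) (simp add: k lin_add[OF F(2)])
    show "k (sc c x) = sc c (k x)" by (rule b_eqI) (simp add: k lin_scale[OF F(2)])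
  qed
  have "k \<circ> h = h \<circ> k" if h: "lin sc sc h" for h
  proof (rule ext, rule b_eqI)
    fix x z
    have "b ((k \<circ> h) x) z = b (k x) (ad h z)" unfolding comp_apply k by (rule inv[OF h])
    also have "\<dots> = b ((h \<circ> k) x) z" unfolding comp_apply by (rule ad_b'[OF h, symmetric])
    finally show "b ((k \<circ> h) x) z = b ((h \<circ> k) x) z" .
  qed
  then have kx: "k x = sc (eps 0 (k (e 0))) x" for x by (rule scalar_if_commutes[OF klin n])
  have "F x y = eps 0 (k (e 0)) * b x y" for x y
  proof -
    have "F x y = b (k x) y" by (simp only: k)
    also have "\<dots> = b (sc (eps 0 (k (e 0))) x) y" by (subst kx) (rule refl)
    finally show ?thesis by simp
  qed
  then show ?thesis by blast
qed

end

text \<open>Skolem-Noether supplies \<open>g\<close>. The polar form of \<open>W\<close> pulled back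
  along \<open>g\<close> has the same adjoint involution as that of \<open>V\<close>, so it is
  \<open>\<mu>\<close> times the latter; comparing semitraces on \<open>x \<otimes> x\<close> lifts
  this to the quadratic forms, which in characteristic 2 the polar forms cannot do. The last
  conjunct tracks the factor \<open>\<mu>\<close> on tensors, for use on the generators of the
  Clifford algebra.\<close>

lemma similitude_from_qp_iso:
  assumes S1: "qp_split A V n e eps \<gamma>" and S2: "qp_split A W n e' eps' \<gamma>'"
  shows "\<exists>g \<mu>. lin (scal V) (scal W) g \<and> bij g \<and> \<mu> \<noteq> 0 \<and> (\<forall>x. form W (g x) = \<mu> * form V x) \<and>
     (\<forall>a\<in>carrier A. \<forall>x. \<gamma>' a (g x) = g (\<gamma> a x)) \<and>
     (\<forall>x y. \<exists>a\<in>carrier A. \<gamma> a = tens V x y \<and> \<gamma>' (\<mu> \<odot>\<^bsub>A\<^esub> a) = tens W (g x) (g y))"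
proof -
  interpret S1: qp_split A V n e eps \<gamma> by fact
  interpret S2: qp_split A W n e' eps' \<gamma>' by fact
  define \<psi> where "\<psi> h = \<gamma>' (S1.dl h)" for h
  have "\<exists>u. lin (scal V) (scal W) u \<and> bij u \<and> (\<forall>h. lin (scal V) (scal V) h \<longrightarrow> \<psi> h \<circ> u = u \<circ> h)"
  proof (rule skolem_noether[OF S1.E.vbase_axioms S2.E.vbase_axioms])
    show "lin (scal V) (scal V) id" by (simp add: lin_id S1.E.vs)
    have "S1.dl id = \<one>\<^bsub>A\<^esub>" using alg_homD(4)[OF S1.dl_hom] by simp
    moreover have "e' 0 \<noteq> 0"
      using S2.E.eps_e[of 0 0] S2.n_pos lin_zero[OF S2.E.eps_lin[of 0]] by auto
    ultimately show "\<psi> id (e' 0) \<noteq> 0" by (simp add: \<psi>_def)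
  qed (simp_all add: \<psi>_def S1.dl_comp S1.dl_add S1.dl_smult S2.g_mult S2.g_add S2.g_smult)
  then obtain g where g: "lin (scal V) (scal W) g" "bij g"
    and gh: "\<And>h. lin (scal V) (scal V) h \<Longrightarrow> \<psi> h \<circ> g = g \<circ> h" by blast
  have ga: "\<gamma>' a (g x) = g (\<gamma> a x)" if "a \<in> carrier A" for a x
    using fun_cong[OF gh[OF S1.g_lin[OF that]], of x] that by (simp add: \<psi>_def)
  have "\<exists>\<mu>. \<forall>x y. polar W (g x) (g y) = \<mu> * polar V x y"
  proof (rule S1.form_scalar[OF S1.n_pos])
    show "lin (scal V) (*) (\<lambda>y. polar W (g x) (g y))" for x
      using lin_comp[OF g(1) S2.b_lin] by (simp add: comp_def)
    show "lin (scal V) (*) (\<lambda>x. polar W (g x) (g y))" for y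
      using lin_comp[OF g(1) S2.b_lin'] by (simp add: comp_def)
    fix h x y assume h: "lin (scal V) (scal V) h"
    have a: "S1.dl h \<in> carrier A" using h by simp
    have "polar W (g (h x)) (g y) = polar W (\<gamma>' (S1.dl h) (g x)) (g y)" using ga[OF a] h by simp
    also have "\<dots> = polar W (g x) (\<gamma>' (invol A (S1.dl h)) (g y))"
      using S2.ad_b'[OF S2.g_lin[OF a]] S2.g_invol[OF a] by simp
    also have "\<dots> = polar W (g x) (g (adjoint_invol V h y))"
      using ga[OF S1.invol_closed[OF a]] S1.g_invol[OF a] h by simp
    finally show "polar W (g (h x)) (g y) = polar W (g x) (g (adjoint_invol V h y))" .
  qed
  then obtain \<mu> where mu: "\<And>x y. polar W (g x) (g y) = \<mu> * polar V x y" by blast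
  have surj: "\<exists>x. w = g x" for w using g(2) by (meson bij_def surj_def)
  have mu0: "\<mu> \<noteq> 0"
  proof
    assume "\<mu> = 0"
    then have "polar W (g x) w = 0" for x w using mu surj[of w] by auto
    then have "g (e 0) = 0" by (rule S2.b_nondeg)
    then have "e 0 = 0" using lin_zero[OF g(1)] g(2) by (metis bij_def injD)
    then show False using S1.E.eps_e[of 0 0] S1.n_pos lin_zero[OF S1.E.eps_lin[of 0]] by simp
  qed
  have tens: "\<gamma>' (\<mu> \<odot>\<^bsub>A\<^esub> S1.dl (tens V x y)) = tens W (g x) (g y)" for x y
  proof
    fix w
    obtain z where w: "w = g z" using surj by blast
    have "\<gamma>' (\<mu> \<odot>\<^bsub>A\<^esub> S1.dl (tens V x y)) w = scal W \<mu> (g (tens V x y z))"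
      using ga[of "S1.dl (tens V x y)" z] by (simp add: S2.g_smult w)
    also have "\<dots> = tens W (g x) (g y) w"
      by (simp add: w S1.tens_apply S2.tens_apply lin_scale[OF g(1)] mu)
    finally show "\<gamma>' (\<mu> \<odot>\<^bsub>A\<^esub> S1.dl (tens V x y)) w = tens W (g x) (g y) w" .
  qed
  have form: "form W (g x) = \<mu> * form V x" for x
  proof -
    define a where "a = S1.dl (tens V x x)"
    have aS: "a \<in> Sym A (invol A)" by (simp add: a_def S1.Sym_iff S1.Sym_tens)
    then have a: "a \<in> carrier A" "\<gamma>' a \<in> S2.SymV" by (auto simp: S2.Sym_iff)
    have e: "tens W (g x) (g x) = (\<lambda>z. scal W \<mu> (\<gamma>' a z))"
      using tens[of x x] a by (simp add: a_def S2.g_smult)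
    have "form W (g x) = form_semitrace W (tens W (g x) (g x))" by (simp add: S2.form_semitrace_tens)
    also have "\<dots> = S2.E.tr (S2.lop \<circ> tens W (g x) (g x))" by (rule S2.form_semitrace_eq(1)[OF S2.Sym_tens])
    also have "\<dots> = \<mu> * S2.E.tr (S2.lop \<circ> \<gamma>' a)"
      unfolding e S2.E.tr_smult[symmetric] by (simp add: comp_def lin_scale[OF S2.lop_lin])
    also have "\<dots> = \<mu> * semitrace A a"
      using S2.form_semitrace_eq(1)[OF a(2)] S2.g_semitrace[OF aS] by simp
    also have "\<dots> = \<mu> * form V x"
      using S1.g_semitrace[OF aS] by (simp add: a_def S1.form_semitrace_tens)
    finally show ?thesis .
  qed
  show ?thesis
    using g mu0 form ga tens by (intro exI[of _ g] exI[of _ \<mu>] conjI allI ballI)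
      (auto intro!: bexI[of _ "S1.dl (tens V _ _)"])
qed

section \<open>The triple of a composition\<close>

locale comp_space = Q1: quad_cliff V1 n e1 eps1 + Q2: qspace V2 n e2 eps2 + Q3: qspace V3 n e3 eps3
  for V1 :: "('f::field, 'u::ab_group_add) quad_space" and n e1 eps1
    and V2 :: "('f, 'v::ab_group_add) quad_space" and e2 eps2
    and V3 :: "('f, 'w::ab_group_add) quad_space" and e3 eps3 +
  fixes l :: "'u \<Rightarrow> 'v \<Rightarrow> 'w"
  assumes l_lin: "lin (scal V2) (scal V3) (l x)" and l_lin': "lin (scal V1) (scal V3) (\<lambda>x. l x v)"
    and l_form: "form V3 (l x v) = form V1 x * form V2 v" and n_pos: "n > 0"
begin

abbreviation "CC \<equiv> (V1, V2, V3, l)"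

definition r :: "'u \<Rightarrow> 'w \<Rightarrow> 'v" where "r x w = derived2 CC w x"

lemma r_b: "polar V2 v (r x w) = polar V3 w (l x v)"
proof -
  have "lin (scal V2) (*) (\<lambda>v. polar V3 w (l x v))"
    using lin_comp[OF l_lin Q3.b_lin] by (simp add: comp_def)
  then obtain y where y: "\<And>v. polar V2 y v = polar V3 w (l x v)" using Q2.riesz by blast
  have "r x w = y"
    unfolding r_def derived2_def prod.case
  proof (rule the_equality)
    show "\<forall>v. polar V2 v y = polar V3 w (l x v)" using y by (simp add: Q2.b_sym)
    fix y' assume "\<forall>v. polar V2 v y' = polar V3 w (l x v)"
    then show "y' = y" using y by (intro Q2.b_eqI) (simp add: Q2.b_sym)
  qed
  then show ?thesis using y by (simp add: Q2.b_sym)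
qed

lemma r_lin: "lin (scal V3) (scal V2) (r x)"
  by (rule linI[OF Q3.vs Q2.vs]; rule Q2.b_eqI') (simp_all add: r_b)

lemma r_lin': "lin (scal V1) (scal V2) (\<lambda>x. r x w)"
  by (rule linI[OF Q1.vs Q2.vs]; rule Q2.b_eqI') (simp_all add: r_b lin_add[OF l_lin'] lin_scale[OF l_lin'])

lemma l_b: "polar V3 (l x v) (l x v') = form V1 x * polar V2 v v'"
  by (simp add: polar_def lin_add[OF l_lin, symmetric] l_form algebra_simps)

lemma rl: "r x (l x v) = scal V2 (form V1 x) v"
  by (rule Q2.b_eqI') (simp add: r_b l_b Q2.b_sym)

lemma rl_polar: "r x (l y v) + r y (l x v) = scal V2 (polar V1 x y) v"
  using rl[of "x + y" v]
  by (simp add: lin_add[OF l_lin'] lin_add[OF r_lin'] lin_add[OF r_lin] rl Q1.q_add Q2.scale_left_distrib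
      algebra_simps)

text \<open>With \<open>z\<close> anisotropic, \<open>l\<^sub>z\<close> and \<open>r\<^sub>z\<close> are invertible, and \<open>r\<^sub>z l\<^sub>x r\<^sub>x l\<^sub>z = q(z) q(x)\<close>
  follows from the polarization of \<open>r\<^sub>x l\<^sub>x = q(x)\<close>.\<close>
lemma lr: "l x (r x w) = scal V3 (form V1 x) w"
proof -
  obtain z where z: "form V1 z \<noteq> 0" using Q1.anisotropic_exists[OF n_pos] by blast
  have "bij (l z)"
  proof (rule Q2.inj_imp_bij[OF l_lin _ Q3.vbase_axioms])
    fix v assume "l z v = 0"
    then have "scal V2 (form V1 z) v = 0" using rl[of z v] lin_zero[OF r_lin] by simp
    then show "v = 0" using z by simp
  qed
  then obtain v where w: "w = l z v" by (meson bij_def surj_def)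
  let ?b = "polar V1 x z" and ?q = "form V1 x" and ?qz = "form V1 z"
  have r1: "r x (l z u) = scal V2 ?b u - r z (l x u)" for u using rl_polar[of x z u] by (simp add: algebra_simps)
  have "r z (l x (r x w)) = scal V2 ?b (r z (l x v)) - r z (l x (r z (l x v)))"
    by (simp add: w r1 lin_diff[OF l_lin] lin_diff[OF r_lin] lin_scale[OF l_lin] lin_scale[OF r_lin])
  also have "r z (l x (r z (l x v))) = scal V2 ?b (r z (l x v)) - r x (l z (r z (l x v)))"
    using rl_polar[of x z "r z (l x v)"] by (simp add: algebra_simps)
  also have "l z (r z (l x v)) = scal V3 ?qz (l x v)"
  proof -
    obtain u where "l x v = l z u" using \<open>bij (l z)\<close> by (meson bij_def surj_def)
    then show ?thesis by (simp add: rl lin_scale[OF l_lin])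
  qed
  finally have "r z (l x (r x w)) = scal V2 (?qz * ?q) v"
    by (simp add: lin_scale[OF r_lin] rl)
  also have "\<dots> = r z (scal V3 ?q w)" by (simp add: w lin_scale[OF r_lin] rl mult.commute)
  finally have 1: "r z (l x (r x w)) = r z (scal V3 ?q w)" .
  have "y = y'" if "r z y = r z y'" for y y'
  proof -
    obtain u u' where "y = l z u" "y' = l z u'" using \<open>bij (l z)\<close> by (meson bij_def surj_def)
    then show ?thesis using that z by (simp add: rl)
  qed
  then show ?thesis using 1 by blast
qed

abbreviation "scp \<equiv> \<lambda>c (x\<^sub>2, x\<^sub>3). (scal V2 c x\<^sub>2, scal V3 c x\<^sub>3)"

lemma scp_vs: "vector_space scp"
  by (simp add: vector_space_def split_paired_all Q2.scale_right_distrib Q2.scale_left_distrib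
      Q3.scale_right_distrib Q3.scale_left_distrib)

lemma alpha_apply: "comp_alpha CC x (v, w) = (r x w, l x v)" by (simp add: comp_alpha_def r_def)

lemma alpha_lin: "lin scp scp (comp_alpha CC x)"
  by (rule linI[OF scp_vs scp_vs])
     (auto simp: alpha_apply lin_add[OF l_lin] lin_add[OF r_lin] lin_scale[OF l_lin] lin_scale[OF r_lin])

lemma C_alpha_props:
  "comp_C_alpha CC \<in> alg_hom Q1.Q (End_algebra scp)"
  "comp_C_alpha CC (Q1.MQ x y) = comp_alpha CC x \<circ> comp_alpha CC y"
proof -
  have eq: "comp_C_alpha CC = quad_clifford_extension V1 (End_algebra scp) (comp_alpha CC)"
    by (simp add: comp_C_alpha_def)
  note ext = Q1.extension_props[OF End_is_algebra[OF scp_vs], of "comp_alpha CC"]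
  have a: "comp_alpha CC x \<in> carrier (End_algebra scp)"
    "comp_alpha CC (x + y) = comp_alpha CC x \<oplus>\<^bsub>End_algebra scp\<^esub> comp_alpha CC y"
    "comp_alpha CC (scal V1 c x) = c \<odot>\<^bsub>End_algebra scp\<^esub> comp_alpha CC x"
    "comp_alpha CC x \<otimes>\<^bsub>End_algebra scp\<^esub> comp_alpha CC x = form V1 x \<odot>\<^bsub>End_algebra scp\<^esub> \<one>\<^bsub>End_algebra scp\<^esub>"
    for x y c
    using alpha_lin by (auto simp: fun_eq_iff alpha_apply lin_add[OF l_lin'] lin_add[OF r_lin']
        lin_scale[OF l_lin'] lin_scale[OF r_lin'] rl lr)
  show h: "comp_C_alpha CC \<in> alg_hom Q1.Q (End_algebra scp)"
    unfolding eq by (rule ext(1)[OF a])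
  have g: "comp_C_alpha CC (Q1.qc (fgen x)) = comp_alpha CC x" for x
    unfolding eq by (rule ext(2)[OF a])
  show "comp_C_alpha CC (Q1.MQ x y) = comp_alpha CC x \<circ> comp_alpha CC y"
    using alg_homD(3)[OF h Q1.qc_simps(1) Q1.qc_simps(1), of "fgen x" "fgen y"] g by (simp add: Q1.qc_simps(3))
qed

text \<open>\<open>C(\<alpha>)\<close> on the even part before the two blocks are cut out. It takes
  values in a single endomorphism algebra and is a homomorphism there, so induction over generators
  applies.\<close>

definition HH :: "(('u \<Rightarrow> 'u) list \<Rightarrow>\<^sub>0 'f) set \<Rightarrow> 'v \<times> 'w \<Rightarrow> 'v \<times> 'w" where
  "HH \<xi> = comp_C_alpha CC (clifford_identification V1 \<xi>)"

lemma HH: "HH \<in> alg_hom (clifford_algebra (End_qp V1)) (End_algebra scp)"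
  "HH (clifford_map (End_qp V1) (tens V1 x y)) (v, w) = (r x (l y v), l x (r y w))"
proof -
  show "HH \<in> alg_hom (clifford_algebra (End_qp V1)) (End_algebra scp)"
    using alg_hom_comp[OF Q1.clifford_identification_props(1)[OF n_pos] C_alpha_props(1)]
    by (simp add: HH_def[abs_def] comp_def)
  show "HH (clifford_map (End_qp V1) (tens V1 x y)) (v, w) = (r x (l y v), l x (r y w))"
    by (simp add: HH_def Q1.clifford_identification_props(2)[OF n_pos] C_alpha_props(2) alpha_apply)
qed

lemma C0_alpha: "comp_C0_alpha CC \<xi> = (\<lambda>x\<^sub>2. fst (HH \<xi> (x\<^sub>2, 0)), \<lambda>x\<^sub>3. snd (HH \<xi> (0, x\<^sub>3)))"
  by (simp add: comp_C0_alpha_def HH_def Let_def)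

lemma C0_alpha_m:
  "comp_C0_alpha CC (clifford_map (End_qp V1) (tens V1 x y)) = (\<lambda>v. r x (l y v), \<lambda>w. l x (r y w))"
  by (simp add: C0_alpha HH(2))

text \<open>Since the values of \<open>HH\<close> are block diagonal, the two blocks are determined on generators.\<close>
lemma C0_alpha_eqI:
  assumes S: "qp_split A V1 n e1 eps1 \<gamma>"
    and P: "P \<in> alg_hom (clifford_algebra A) (End_algebra (scal V2))"
      "R \<in> alg_hom (clifford_algebra A) (End_algebra (scal V3))"
    and gen: "\<And>a x y v. a \<in> carrier A \<Longrightarrow> \<gamma> a = tens V1 x y \<Longrightarrow> P (clifford_map A a) v = r x (l y v)"
      "\<And>a x y w. a \<in> carrier A \<Longrightarrow> \<gamma> a = tens V1 x y \<Longrightarrow> R (clifford_map A a) w = l x (r y w)"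
    and xi: "\<xi> \<in> carrier (clifford_algebra A)"
  shows "comp_C0_alpha CC (clifford_induced A (End_qp V1) \<gamma> \<xi>) = (P \<xi>, R \<xi>)"
proof -
  interpret S: qp_split A V1 n e1 eps1 \<gamma> by fact
  let ?i = "clifford_induced A (End_qp V1) \<gamma>"
  have K: "HH \<circ> ?i \<in> alg_hom S.C (End_algebra scp)"
    by (rule alg_hom_comp[OF S.clifford_induced_props(1) HH(1)])
  note k = alg_homD[OF K] and p = alg_homD[OF P(1)] and rr = alg_homD[OF P(2)]
  have "\<forall>v w. (HH \<circ> ?i) \<xi> (v, w) = (P \<xi> v, R \<xi> w)"
    using xi
  proof (induction rule: S.C_induct)
    case one
    show ?case unfolding k(4) p(4) rr(4) by simp
  next
    case (gen x y)
    show ?case using assms(4,5)[of "S.dl (tens V1 x y)" x y]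
      by (simp add: S.clifford_induced_props(2) HH(2)) (simp add: S.m_def)
  next
    case (add U W)
    then show ?case unfolding k(2)[OF add(1,2)] p(2)[OF add(1,2)] rr(2)[OF add(1,2)] by (simp del: comp_apply)
  next
    case (mult U W)
    then show ?case unfolding k(3)[OF mult(1,2)] p(3)[OF mult(1,2)] rr(3)[OF mult(1,2)]
      by (simp del: comp_apply add: comp_apply[of "(HH \<circ> ?i) U"] comp_apply[of "P U"] comp_apply[of "R U"])
  next
    case (smult c U)
    then show ?case unfolding k(5)[OF smult(1)] p(5)[OF smult(1)] rr(5)[OF smult(1)] by (simp del: comp_apply)
  qed
  then show ?thesis by (simp add: C0_alpha)
qed

end

lemma comp_space_exists:
  assumes "composition (V1, V2, V3, star) n" "n > 0"
  shows "\<exists>e1 eps1 e2 eps2 e3 eps3. comp_space V1 n e1 eps1 V2 e2 eps2 V3 e3 eps3 star"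
proof -
  have c: "quadratic_space V1" "quadratic_space V2" "quadratic_space V3"
    "space_dim V1 = n" "space_dim V2 = n" "space_dim V3 = n"
    using assms(1) by (auto simp: composition_def)
  obtain e1 eps1 e2 eps2 e3 eps3 where "qspace V1 n e1 eps1" "qspace V2 n e2 eps2" "qspace V3 n e3 eps3"
    using qspace_exists[OF c(1,4)] qspace_exists[OF c(2,5)] qspace_exists[OF c(3,6)] by blast
  then have "comp_space V1 n e1 eps1 V2 e2 eps2 V3 e3 eps3 star"
    using assms by (simp add: comp_space_def comp_space_axioms_def quad_cliff_def composition_def)
  then show ?thesis by blast
qed

section \<open>Uniqueness of the composition\<close>

text \<open>With \<open>h w = l'\<^bsub>g x\<^sub>0\<^esub> (g\<^sub>2 (r\<^bsub>x\<^sub>0\<^esub> w))\<close>, the map \<open>g\<^sub>3\<^sup>-\<^sup>1 h\<close> commutes with all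
  \<open>l\<^sub>x r\<^sub>y\<close>, hence it is a scalar.\<close>
lemma similar_of_intertwiners:
  assumes C: "comp_space V1 n e1 eps1 V2 e2 eps2 V3 e3 eps3 l"
    and D: "comp_space W1 n e1' eps1' W2 e2' eps2' W3 e3' eps3' l'"
    and g1: "lin (scal V1) (scal W1) g1" "bij g1" "\<mu>1 \<noteq> 0" "\<And>x. form W1 (g1 x) = \<mu>1 * form V1 x"
    and g2: "lin (scal V2) (scal W2) g2" "bij g2" "\<mu>2 \<noteq> 0" "\<And>x. form W2 (g2 x) = \<mu>2 * form V2 x"
    and g3: "lin (scal V3) (scal W3) g3" "bij g3" "\<mu>3 \<noteq> 0" "\<And>x. form W3 (g3 x) = \<mu>3 * form V3 x"
    and i2: "\<And>x y v. comp_space.r W1 W2 W3 l' (g1 x) (l' (g1 y) (g2 v)) =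
        scal W2 \<mu>1 (g2 (comp_space.r V1 V2 V3 l x (l y v)))"
    and i3: "\<And>x y w. l' (g1 x) (comp_space.r W1 W2 W3 l' (g1 y) (g3 w)) =
        scal W3 \<mu>1 (g3 (l x (comp_space.r V1 V2 V3 l y w)))"
    and schur: "\<And>T. lin (scal V3) (scal V3) T \<Longrightarrow>
        (\<And>x y w. T (l x (comp_space.r V1 V2 V3 l y w)) = l x (comp_space.r V1 V2 V3 l y (T w))) \<Longrightarrow>
        \<exists>c. \<forall>w. T w = scal V3 c w"
  shows "composition_similar (V1, V2, V3, l) (W1, W2, W3, l')"
proof -
  interpret C: comp_space V1 n e1 eps1 V2 e2 eps2 V3 e3 eps3 l by fact
  interpret D: comp_space W1 n e1' eps1' W2 e2' eps2' W3 e3' eps3' l' by fact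
  obtain x0 where x0: "form V1 x0 \<noteq> 0" using C.Q1.anisotropic_exists[OF C.n_pos] by blast
  let ?q = "form V1 x0"
  define h where "h w = l' (g1 x0) (g2 (C.r x0 w))" for w
  \<comment> \<open>By \<open>i2\<close> and \<open>lr\<close>, composing \<open>h\<close> with
    \<open>l x\<close> gives back the second multiplication up to the factor
    \<open>q(x\<^sub>0)\<close>. Once \<open>h\<close> is known to be a multiple of
    \<open>g3\<close>, this relates the two multiplications.\<close>
  have hl: "h (l x u) = scal W3 ?q (l' (g1 x) (g2 u))" for x u
  proof -
    have "scal W3 \<mu>1 (h (l x u)) = l' (g1 x0) (D.r (g1 x0) (l' (g1 x) (g2 u)))"
      by (simp add: h_def i2 lin_scale[OF D.l_lin])
    also have "\<dots> = scal W3 (\<mu>1 * ?q) (l' (g1 x) (g2 u))" by (simp add: D.lr g1(4))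
    finally have "scal W3 (inverse \<mu>1) (scal W3 \<mu>1 (h (l x u))) =
      scal W3 (inverse \<mu>1) (scal W3 (\<mu>1 * ?q) (l' (g1 x) (g2 u)))" by simp
    then show ?thesis using g1(3) by (simp flip: mult.assoc)
  qed
  define T where "T w = inv_into UNIV g3 (h w)" for w
  have g3i: "g3 (inv_into UNIV g3 w) = w" "inv_into UNIV g3 (g3 v) = v" for v w
    using g3(2) by (simp_all add: bij_def surj_f_inv_f)
  have gT: "g3 (T w) = h w" for w by (simp add: T_def g3i)
  have hlin: "lin (scal V3) (scal W3) h"
    using lin_comp[OF lin_comp[OF C.r_lin g2(1)] D.l_lin] by (simp add: h_def[abs_def] comp_def)
  have Tlin: "lin (scal V3) (scal V3) T"
    using lin_comp[OF hlin lin_inv[OF g3(1,2)]] by (simp add: T_def[abs_def] comp_def)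
  have "T (l x (C.r y w)) = l x (C.r y (T w))" for x y w
  proof -
    have "scal W3 \<mu>1 (g3 (l x (C.r y (T w)))) = l' (g1 x) (D.r (g1 y) (h w))"
      using i3[of x y "T w"] by (simp add: gT)
    also have "\<dots> = scal W3 \<mu>1 (scal W3 ?q (l' (g1 x) (g2 (C.r y w))))"
      unfolding h_def i2 by (simp add: C.lr lin_scale[OF D.l_lin] lin_scale[OF g2(1)] lin_scale[OF C.r_lin])
    also have "\<dots> = scal W3 \<mu>1 (g3 (T (l x (C.r y w))))" by (simp add: gT hl)
    finally have "scal W3 (inverse \<mu>1) (scal W3 \<mu>1 (g3 (l x (C.r y (T w))))) =
       scal W3 (inverse \<mu>1) (scal W3 \<mu>1 (g3 (T (l x (C.r y w)))))" by simp
    then have "g3 (l x (C.r y (T w))) = g3 (T (l x (C.r y w)))" using g1(3) by simp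
    then show ?thesis by (metis g3i(2))
  qed
  then obtain c where c: "\<And>w. T w = scal V3 c w" using schur[OF Tlin] by blast
  have star: "scal W3 (c / ?q) (g3 (l x u)) = l' (g1 x) (g2 u)" for x u
  proof -
    have "scal W3 c (g3 (l x u)) = scal W3 ?q (l' (g1 x) (g2 u))"
      using gT[of "l x u"] by (simp add: c hl lin_scale[OF g3(1)])
    then have "scal W3 (inverse ?q) (scal W3 c (g3 (l x u))) = scal W3 (inverse ?q) (scal W3 ?q (l' (g1 x) (g2 u)))"
      by simp
    then show ?thesis using x0 by (simp add: divide_inverse mult.commute)
  qed
  \<comment> \<open>With anisotropic \<open>x0\<close> and \<open>u\<close>, a vanishing factor
    would give \<open>l' (g1 x0) (g2 u) = 0\<close>, against the multiplicativity of the
    forms.\<close>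
  have "c / ?q \<noteq> 0"
  proof
    assume c0: "c / ?q = 0"
    obtain u where u: "form V2 u \<noteq> 0" using C.Q2.anisotropic_exists[OF C.n_pos] by blast
    have "l' (g1 x0) (g2 u) = 0" using star[of x0 u] unfolding c0 by simp
    then have "form W1 (g1 x0) * form W2 (g2 u) = 0" using D.l_form[of "g1 x0" "g2 u"] by simp
    then show False using x0 u g1(3,4) g2(3,4) by simp
  qed
  moreover have "similitude V1 W1 g1" "similitude V2 W2 g2" "similitude V3 W3 g3"
    using g1 g2 g3 by (auto simp: similitude_def)
  ultimately show ?thesis using star unfolding composition_similar_def prod.case by blast
qed

lemma triple_action:
  assumes C: "comp_space V1 n e1 eps1 V2 e2 eps2 V3 e3 eps3 l"
    and S: "qp_split A1 V1 n e1 eps1 \<gamma>1"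
    and eq: "\<forall>\<xi>\<in>carrier (clifford_algebra A1).
          map_prod \<gamma>2 \<gamma>3 (\<phi>0 \<xi>) = comp_C0_alpha (V1, V2, V3, l) (clifford_induced A1 (End_qp V1) \<gamma>1 \<xi>)"
    and a: "a \<in> carrier A1" "\<gamma>1 a = tens V1 x y"
  shows "\<gamma>2 (fst (\<phi>0 (clifford_map A1 a))) v = comp_space.r V1 V2 V3 l x (l y v)"
    "\<gamma>3 (snd (\<phi>0 (clifford_map A1 a))) w = l x (comp_space.r V1 V2 V3 l y w)"
proof -
  interpret C: comp_space V1 n e1 eps1 V2 e2 eps2 V3 e3 eps3 l by fact
  interpret S: qp_split A1 V1 n e1 eps1 \<gamma>1 by fact
  have "a = S.dl (tens V1 x y)" using a by (metis S.dl_g)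
  then have "clifford_map A1 a = S.m x y" by (simp add: S.m_def)
  moreover have "map_prod \<gamma>2 \<gamma>3 (\<phi>0 (S.m x y)) = (\<lambda>v. C.r x (l y v), \<lambda>w. l x (C.r y w))"
    using eq[rule_format, OF S.m_closed[of x y]] S.clifford_induced_props(2)[of x y] C.C0_alpha_m[of x y] by simp
  ultimately show "\<gamma>2 (fst (\<phi>0 (clifford_map A1 a))) v = C.r x (l y v)"
    "\<gamma>3 (snd (\<phi>0 (clifford_map A1 a))) w = l x (C.r y w)"
    by (cases "\<phi>0 (S.m x y)"; simp)+
qed

lemma commutes_all:
  assumes S: "qp_split A V n e eps \<gamma>"
    and P: "P \<in> alg_hom (clifford_algebra A) (End_algebra s)"
    and T: "lin s s T"
    and gen: "\<And>a x y v. a \<in> carrier A \<Longrightarrow> \<gamma> a = tens V x y \<Longrightarrow> T (P (clifford_map A a) v) = P (clifford_map A a) (T v)"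
    and xi: "\<xi> \<in> carrier (clifford_algebra A)"
  shows "T (P \<xi> v) = P \<xi> (T v)"
proof -
  interpret S: qp_split A V n e eps \<gamma> by fact
  note p = alg_homD[OF P]
  have "\<forall>v. T (P \<xi> v) = P \<xi> (T v)"
    using xi
  proof (induction rule: S.C_induct)
    case (gen x y)
    show ?case using assms(4)[of "S.dl (tens V x y)" x y] by (simp add: S.m_def)
  next
    case (add U W)
    then show ?case unfolding p(2)[OF add(1,2)] by (simp add: lin_add[OF T])
  next
    case (mult U W)
    then show ?case unfolding p(3)[OF mult(1,2)] by simp
  next
    case (smult c U)
    then show ?case unfolding p(5)[OF smult(1)] by (simp add: lin_scale[OF T])
  qed (simp add: p(4))
  then show ?thesis by blast
qed

lemma qp_prod_simps [simp]:
  "carrier (qp_prod A B) = carrier A \<times> carrier B"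
  "mult (qp_prod A B) = (\<lambda>(x, y) (x', y'). (x \<otimes>\<^bsub>A\<^esub> x', y \<otimes>\<^bsub>B\<^esub> y'))"
  "one (qp_prod A B) = (\<one>\<^bsub>A\<^esub>, \<one>\<^bsub>B\<^esub>)" "zero (qp_prod A B) = (\<zero>\<^bsub>A\<^esub>, \<zero>\<^bsub>B\<^esub>)"
  "add (qp_prod A B) = (\<lambda>(x, y) (x', y'). (x \<oplus>\<^bsub>A\<^esub> x', y \<oplus>\<^bsub>B\<^esub> y'))"
  "smult (qp_prod A B) = (\<lambda>c (x, y). (c \<odot>\<^bsub>A\<^esub> x, c \<odot>\<^bsub>B\<^esub> y))"
  "invol (qp_prod A B) = (\<lambda>(x, y). (invol A x, invol B y))"
  "semitrace (qp_prod A B) = (\<lambda>(x, y). (semitrace A x \<odot>\<^bsub>A\<^esub> \<one>\<^bsub>A\<^esub>, semitrace B y \<odot>\<^bsub>B\<^esub> \<one>\<^bsub>B\<^esub>))"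
  by (simp_all add: qp_prod_def)

lemma clifford_qp_simps [simp]:
  "carrier (clifford_qp A) = carrier (clifford_algebra A)" "mult (clifford_qp A) = mult (clifford_algebra A)"
  "one (clifford_qp A) = one (clifford_algebra A)" "zero (clifford_qp A) = zero (clifford_algebra A)"
  "add (clifford_qp A) = add (clifford_algebra A)" "smult (clifford_qp A) = smult (clifford_algebra A)"
  "invol (clifford_qp A) = clifford_invol A" "semitrace (clifford_qp A) = clifford_semitrace A"
  by (simp_all add: clifford_qp_def module.defs qp_algebra.defs)

lemma alg_hom_qp_prod:
  assumes "\<phi> \<in> alg_hom (clifford_qp A) (qp_prod B D)"
  shows "fst \<circ> \<phi> \<in> alg_hom (clifford_algebra A) B" "snd \<circ> \<phi> \<in> alg_hom (clifford_algebra A) D"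
  by (rule alg_homI; use alg_homD[OF assms] in \<open>force simp: split_beta\<close>)+

lemma trialitarianD:
  assumes "trialitarian_triple (A1, A2, A3, \<phi>0)"
  shows "is_algebra A1" "is_algebra A2" "is_algebra A3"
    "\<And>a. a \<in> carrier A1 \<Longrightarrow> invol A1 a \<in> carrier A1" "\<And>a. a \<in> carrier A2 \<Longrightarrow> invol A2 a \<in> carrier A2"
    "\<And>a. a \<in> carrier A3 \<Longrightarrow> invol A3 a \<in> carrier A3"
    "fst \<circ> \<phi>0 \<in> alg_hom (clifford_algebra A1) A2" "snd \<circ> \<phi>0 \<in> alg_hom (clifford_algebra A1) A3"
    "bij_betw \<phi>0 (carrier (clifford_algebra A1)) (carrier A2 \<times> carrier A3)"
proof -
  have inv: "a \<in> carrier A \<Longrightarrow> invol A a \<in> carrier A" if "quadratic_pair A" for A :: "('f::field, 'x, 'f) qp_algebra" and a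
    using that by (auto simp: quadratic_pair_def orthogonal_involution_def symplectic_involution_def
        involution_on_def Pi_iff split: if_splits)
  note t = assms[unfolded trialitarian_triple_def prod.case]
  show "is_algebra A1" "is_algebra A2" "is_algebra A3" using t by (auto simp: central_simple_def)
  show "\<And>a. a \<in> carrier A1 \<Longrightarrow> invol A1 a \<in> carrier A1" "\<And>a. a \<in> carrier A2 \<Longrightarrow> invol A2 a \<in> carrier A2"
    "\<And>a. a \<in> carrier A3 \<Longrightarrow> invol A3 a \<in> carrier A3" by (erule inv[rotated], use t in simp)+
  have i: "\<phi>0 \<in> alg_iso (clifford_qp A1) (qp_prod A2 A3)" using t by (auto simp: qp_iso_centre_def)
  show "fst \<circ> \<phi>0 \<in> alg_hom (clifford_algebra A1) A2" "snd \<circ> \<phi>0 \<in> alg_hom (clifford_algebra A1) A3"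
    using alg_hom_qp_prod[OF alg_isoD(1)[OF i]] by auto
  show "bij_betw \<phi>0 (carrier (clifford_algebra A1)) (carrier A2 \<times> carrier A3)"
    using alg_isoD(2)[OF i] by simp
qed

theorem composition_unique:
  assumes T: "trialitarian_triple (A1, A2, A3, \<phi>0)"
    and C: "composition (V1, V2, V3, l) 8" "triple_isomorphic (A1, A2, A3, \<phi>0) (End_comp (V1, V2, V3, l))"
    and D: "composition (W1, W2, W3, l') 8" "triple_isomorphic (A1, A2, A3, \<phi>0) (End_comp (W1, W2, W3, l'))"
  shows "composition_similar (V1, V2, V3, l) (W1, W2, W3, l')"
proof -
  note t = trialitarianD[OF T]
  obtain e1 eps1 e2 eps2 e3 eps3 where cC: "comp_space V1 8 e1 eps1 V2 e2 eps2 V3 e3 eps3 l"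
    using comp_space_exists[OF C(1)] by auto
  obtain e1' eps1' e2' eps2' e3' eps3' where cD: "comp_space W1 8 e1' eps1' W2 e2' eps2' W3 e3' eps3' l'"
    using comp_space_exists[OF D(1)] by auto
  have qC: "qspace V1 8 e1 eps1" "qspace V2 8 e2 eps2" "qspace V3 8 e3 eps3"
    using cC by (auto simp: comp_space_def quad_cliff_def)
  have qD: "qspace W1 8 e1' eps1'" "qspace W2 8 e2' eps2'" "qspace W3 8 e3' eps3'"
    using cD by (auto simp: comp_space_def quad_cliff_def)
  obtain c1 c2 c3 where ci: "qp_iso A1 (End_qp V1) c1" "qp_iso A2 (End_qp V2) c2" "qp_iso A3 (End_qp V3) c3"
    and cact: "\<forall>\<xi>\<in>carrier (clifford_algebra A1).
      map_prod c2 c3 (\<phi>0 \<xi>) = comp_C0_alpha (V1, V2, V3, l) (clifford_induced A1 (End_qp V1) c1 \<xi>)"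
    using C(2) by (auto simp: triple_isomorphic_def End_comp_def)
  obtain d1 d2 d3 where di: "qp_iso A1 (End_qp W1) d1" "qp_iso A2 (End_qp W2) d2" "qp_iso A3 (End_qp W3) d3"
    and dact: "\<forall>\<xi>\<in>carrier (clifford_algebra A1).
      map_prod d2 d3 (\<phi>0 \<xi>) = comp_C0_alpha (W1, W2, W3, l') (clifford_induced A1 (End_qp W1) d1 \<xi>)"
    using D(2) by (auto simp: triple_isomorphic_def End_comp_def)
  have n: "(8::nat) > 0" by simp
  have Sc: "qp_split A1 V1 8 e1 eps1 c1" "qp_split A2 V2 8 e2 eps2 c2" "qp_split A3 V3 8 e3 eps3 c3"
    by (rule qp_splitI[OF t(1) qC(1) n ci(1)], erule t(4))
       (rule qp_splitI[OF t(2) qC(2) n ci(2)], erule t(5), rule qp_splitI[OF t(3) qC(3) n ci(3)], erule t(6))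
  have Sd: "qp_split A1 W1 8 e1' eps1' d1" "qp_split A2 W2 8 e2' eps2' d2" "qp_split A3 W3 8 e3' eps3' d3"
    by (rule qp_splitI[OF t(1) qD(1) n di(1)], erule t(4))
       (rule qp_splitI[OF t(2) qD(2) n di(2)], erule t(5), rule qp_splitI[OF t(3) qD(3) n di(3)], erule t(6))
  obtain g1 \<mu>1 where g1: "lin (scal V1) (scal W1) g1" "bij g1" "\<mu>1 \<noteq> 0" "\<forall>x. form W1 (g1 x) = \<mu>1 * form V1 x"
    and t1: "\<forall>x y. \<exists>a\<in>carrier A1. c1 a = tens V1 x y \<and> d1 (\<mu>1 \<odot>\<^bsub>A1\<^esub> a) = tens W1 (g1 x) (g1 y)"
    using similitude_from_qp_iso[OF Sc(1) Sd(1)] by blast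
  obtain g2 \<mu>2 where g2: "lin (scal V2) (scal W2) g2" "bij g2" "\<mu>2 \<noteq> 0" "\<forall>x. form W2 (g2 x) = \<mu>2 * form V2 x"
    and g2a: "\<forall>a\<in>carrier A2. \<forall>x. d2 a (g2 x) = g2 (c2 a x)"
    using similitude_from_qp_iso[OF Sc(2) Sd(2)] by blast
  obtain g3 \<mu>3 where g3: "lin (scal V3) (scal W3) g3" "bij g3" "\<mu>3 \<noteq> 0" "\<forall>x. form W3 (g3 x) = \<mu>3 * form V3 x"
    and g3a: "\<forall>a\<in>carrier A3. \<forall>x. d3 a (g3 x) = g3 (c3 a x)"
    using similitude_from_qp_iso[OF Sc(3) Sd(3)] by blast
  interpret A1: falg A1 by unfold_locales (rule t(1))
  interpret A2: falg A2 by unfold_locales (rule t(2))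
  interpret A3: falg A3 by unfold_locales (rule t(3))
  have cmc: "clifford_map A1 a \<in> carrier (clifford_algebra A1)" if "a \<in> carrier A1" for a
    by (rule qp_split.cm_closed[OF Sc(1) that])
  have cms: "clifford_map A1 (c \<odot>\<^bsub>A1\<^esub> a) = c \<odot>\<^bsub>clifford_algebra A1\<^esub> clifford_map A1 a" if "a \<in> carrier A1" for a c
    by (rule qp_split.cm_smult[OF Sc(1) that])
  note p2 = alg_homD[OF t(7)] and p3 = alg_homD[OF t(8)]
  note dh2 = alg_homD(5)[OF alg_isoD(1)[OF split_alg.g_iso[OF qp_split.axioms(1)[OF Sd(2)]]]]
  note dh3 = alg_homD(5)[OF alg_isoD(1)[OF split_alg.g_iso[OF qp_split.axioms(1)[OF Sd(3)]]]]
  have ch3: "c3 \<in> alg_hom A3 (End_algebra (scal V3))"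
    by (rule alg_isoD(1)[OF split_alg.g_iso[OF qp_split.axioms(1)[OF Sc(3)]]])
  show ?thesis
  proof (rule similar_of_intertwiners[OF cC cD g1(1-3) _ g2(1-3) _ g3(1-3)])
    show "form W1 (g1 x) = \<mu>1 * form V1 x" for x using g1(4) by blast
    show "form W2 (g2 x) = \<mu>2 * form V2 x" for x using g2(4) by blast
    show "form W3 (g3 x) = \<mu>3 * form V3 x" for x using g3(4) by blast
    fix x y
    \<comment> \<open>The same \<open>a\<close> represents \<open>x \<otimes> y\<close> in the first
      realization and, after scaling by \<open>\<mu>1\<close>, the tensor of \<open>g1 x\<close> and
      \<open>g1 y\<close> in the second. This is where the factor \<open>\<mu>1\<close> of the
      intertwining relations comes from.\<close>
    obtain a where a: "a \<in> carrier A1" "c1 a = tens V1 x y" "d1 (\<mu>1 \<odot>\<^bsub>A1\<^esub> a) = tens W1 (g1 x) (g1 y)"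
      using t1 by blast
    let ?xi = "clifford_map A1 a"
    note xi = cmc[OF a(1)]
    note ca = triple_action[OF cC Sc(1) cact a(1,2)]
    note da = triple_action[OF cD Sd(1) dact A1.sm_closed[OF a(1)] a(3)]
    show "comp_space.r W1 W2 W3 l' (g1 x) (l' (g1 y) (g2 v)) =
        scal W2 \<mu>1 (g2 (comp_space.r V1 V2 V3 l x (l y v)))" for v
    proof -
      have "comp_space.r W1 W2 W3 l' (g1 x) (l' (g1 y) (g2 v)) =
         d2 (fst (\<phi>0 (\<mu>1 \<odot>\<^bsub>clifford_algebra A1\<^esub> ?xi))) (g2 v)"
        unfolding da(1)[symmetric] cms[OF a(1)] ..
      also have "\<dots> = scal W2 \<mu>1 (d2 (fst (\<phi>0 ?xi)) (g2 v))"
        using p2(5)[OF xi, of \<mu>1] dh2[OF p2(1)[OF xi], of \<mu>1] by simp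
      also have "d2 (fst (\<phi>0 ?xi)) (g2 v) = g2 (c2 (fst (\<phi>0 ?xi)) v)" using g2a p2(1)[OF xi] by simp
      finally show ?thesis by (simp only: ca(1))
    qed
    show "l' (g1 x) (comp_space.r W1 W2 W3 l' (g1 y) (g3 w)) =
        scal W3 \<mu>1 (g3 (l x (comp_space.r V1 V2 V3 l y w)))" for w
    proof -
      have "l' (g1 x) (comp_space.r W1 W2 W3 l' (g1 y) (g3 w)) =
         d3 (snd (\<phi>0 (\<mu>1 \<odot>\<^bsub>clifford_algebra A1\<^esub> ?xi))) (g3 w)"
        unfolding da(2)[symmetric] cms[OF a(1)] ..
      also have "\<dots> = scal W3 \<mu>1 (d3 (snd (\<phi>0 ?xi)) (g3 w))"
        using p3(5)[OF xi, of \<mu>1] dh3[OF p3(1)[OF xi], of \<mu>1] by simp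
      also have "d3 (snd (\<phi>0 ?xi)) (g3 w) = g3 (c3 (snd (\<phi>0 ?xi)) w)" using g3a p3(1)[OF xi] by simp
      finally show ?thesis by (simp only: ca(2))
    qed
  next
    fix S assume S: "lin (scal V3) (scal V3) S"
      and comm: "\<And>x y w. S (l x (comp_space.r V1 V2 V3 l y w)) = l x (comp_space.r V1 V2 V3 l y (S w))"
    have P: "c3 \<circ> (snd \<circ> \<phi>0) \<in> alg_hom (clifford_algebra A1) (End_algebra (scal V3))"
      by (rule alg_hom_comp[OF t(8) ch3])
    have all: "S ((c3 \<circ> (snd \<circ> \<phi>0)) \<xi> v) = (c3 \<circ> (snd \<circ> \<phi>0)) \<xi> (S v)"
      if "\<xi> \<in> carrier (clifford_algebra A1)" for \<xi> v
    proof (rule commutes_all[OF Sc(1) P S _ that])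
      fix a x y v assume "a \<in> carrier A1" "c1 a = tens V1 x y"
      note ca = triple_action[OF cC Sc(1) cact this]
      show "S ((c3 \<circ> (snd \<circ> \<phi>0)) (clifford_map A1 a) v) = (c3 \<circ> (snd \<circ> \<phi>0)) (clifford_map A1 a) (S v)"
        using ca(2)[of v] ca(2)[of "S v"] by (simp add: comm)
    qed
    interpret V3: vbase "scal V3" 8 e3 eps3 using qC(3) by (simp add: qspace_def)
    \<comment> \<open>The second component of \<open>\<phi>0\<close> is onto \<open>A3\<close>, so
      commuting with the action of the Clifford algebra means commuting with every
      endomorphism.\<close>
    have "S \<circ> h = h \<circ> S" if h: "lin (scal V3) (scal V3) h" for h
    proof -
      obtain a3 where a3: "a3 \<in> carrier A3" "c3 a3 = h"
        using split_alg.dl_closed[OF qp_split.axioms(1)[OF Sc(3)] h] split_alg.g_dl[OF qp_split.axioms(1)[OF Sc(3)] h] by blast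
      have "(\<zero>\<^bsub>A2\<^esub>, a3) \<in> \<phi>0 ` carrier (clifford_algebra A1)"
        using t(9) a3(1) by (auto simp: bij_betw_def)
      then obtain \<xi> where "\<xi> \<in> carrier (clifford_algebra A1)" "snd (\<phi>0 \<xi>) = a3" by (metis imageE snd_conv)
      then show ?thesis using all[of \<xi>] a3(2) by (auto simp: fun_eq_iff)
    qed
    then have "S w = scal V3 (eps3 0 (S (e3 0))) w" for w by (rule V3.scalar_if_commutes[OF S n])
    then show "\<exists>c. \<forall>w. S w = scal V3 c w" by blast
  qed
qed

section \<open>Half-spin representations\<close>

context qspace
begin

text \<open>The plane of \<open>x\<close> and \<open>y\<close> may be degenerate, so projecting away
  from it is not possible. Instead \<open>p1\<close> and \<open>p2\<close> are vectors whose
  subtraction makes a given \<open>z\<close> orthogonal to \<open>x\<close> and \<open>y\<close>.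
  Choosing \<open>w\<close> orthogonal to \<open>x\<close>, \<open>y\<close>, \<open>p1\<close>,
  \<open>p2\<close>, which is four conditions, keeps \<open>b w z\<close> unchanged by this
  correction.\<close>

lemma orth_pair:
  assumes n: "4 < n"
  shows "\<exists>w w'. b x w = 0 \<and> b y w = 0 \<and> b x w' = 0 \<and> b y w' = 0 \<and> b w w' = 1"
proof -
  have "\<exists>p. \<forall>z. \<exists>c. b x (z - sc c p) = 0"
  proof (cases "\<exists>p. b x p \<noteq> 0")
    case True
    then obtain p where p: "b x p \<noteq> 0" by blast
    have "b x (z - sc (b x z / b x p) p) = 0" for z using p by simp
    then show ?thesis by blast
  next
    case False
    then show ?thesis by (metis)
  qed
  then obtain p1 where p1: "\<And>z. \<exists>c. b x (z - sc c p1) = 0" by blast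
  have "\<exists>p. \<forall>z. b x z = 0 \<longrightarrow> (\<exists>c. b x (z - sc c p) = 0 \<and> b y (z - sc c p) = 0)"
  proof (cases "\<exists>p. b x p = 0 \<and> b y p \<noteq> 0")
    case True
    then obtain p where p: "b x p = 0" "b y p \<noteq> 0" by blast
    have "b x z = 0 \<Longrightarrow> b x (z - sc (b y z / b y p) p) = 0 \<and> b y (z - sc (b y z / b y p) p) = 0" for z
      using p by simp
    then show ?thesis by blast
  next
    case False
    have "b x (z - sc 0 0) = 0 \<and> b y (z - sc 0 0) = 0" if "b x z = 0" for z using False that by simp
    then show ?thesis by blast
  qed
  then obtain p2 where p2: "\<And>z. b x z = 0 \<Longrightarrow> \<exists>c. b x (z - sc c p2) = 0 \<and> b y (z - sc c p2) = 0" by blast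
  define f where "f i = (if i = 0 then b x else if i = 1 then b y else if i = 2 then b p1 else b p2)" for i :: nat
  have "lin sc (*) (f i)" for i by (simp add: f_def b_lin)
  then obtain w where w: "w \<noteq> 0" and fw: "\<And>i. i < 4 \<Longrightarrow> f i w = 0"
    using common_zero[OF n, of f] by blast
  have w0: "b x w = 0" "b y w = 0" "b w p1 = 0" "b w p2 = 0"
    using fw[of 0] fw[of 1] fw[of 2] fw[of 3] by (auto simp: f_def b_sym)
  obtain z where z: "b w z \<noteq> 0" using w b_nondeg by blast
  obtain c1 where c1: "b x (z - sc c1 p1) = 0" using p1 by blast
  obtain c2 where c2: "b x (z - sc c1 p1 - sc c2 p2) = 0" "b y (z - sc c1 p1 - sc c2 p2) = 0" using p2[OF c1] by blast
  define w' where "w' = sc (1 / b w z) (z - sc c1 p1 - sc c2 p2)"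
  have "b w w' = 1" using z w0 by (simp add: w'_def)
  moreover have "b x w' = 0" "b y w' = 0" using c2 unfolding w'_def b_scale by simp_all
  ultimately show ?thesis using w0 by blast
qed

text \<open>For each \<open>x\<close> the kernel of \<open>b x\<close> lies in that of
  \<open>G x\<close>, so the two functionals are proportional; the same holds in the other variable.
  Comparing \<open>x\<close> with a fixed \<open>x0\<close> at a vector \<open>z\<close> where
  neither \<open>b x\<close> nor \<open>b x0\<close> vanishes makes the factor independent of
  \<open>x\<close>.\<close>

lemma proportional_form:
  assumes G: "\<And>x. lin sc (*) (G x)" "\<And>y. lin sc (*) (\<lambda>x. G x y)"
    and orth: "\<And>x y. b x y = 0 \<Longrightarrow> G x y = 0"
  shows "\<exists>\<kappa>. \<forall>x y. G x y = \<kappa> * b x y"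
proof -
  have Gd: "G x (y - z) = G x y - G x z" "G (y - z) x = G y x - G z x" "G x (sc c y) = c * G x y"
    "G (sc c y) x = c * G y x" for x y z c
    using lin_diff[OF G(1)] lin_diff[OF G(2)] lin_scale[OF G(1)] lin_scale[OF G(2)] by auto
  have r: "G x y * b x z = G x z * b x y" for x y z
  proof -
    have "G x (sc (b x z) y - sc (b x y) z) = 0" by (rule orth) (simp add: mult.commute)
    then show ?thesis by (simp add: Gd mult.commute)
  qed
  have l: "G y x * b z x = G z x * b y x" for x y z
  proof -
    have "G (sc (b z x) y - sc (b y x) z) x = 0" by (rule orth) (simp add: mult.commute)
    then show ?thesis by (simp add: Gd mult.commute)
  qed
  show ?thesis
  proof (cases "\<exists>x0 y0. b x0 y0 \<noteq> 0")
    case False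
    then show ?thesis using orth by auto
  next
    case True
    then obtain x0 y0 where 0: "b x0 y0 \<noteq> 0" by blast
    define \<kappa> where "\<kappa> = G x0 y0 / b x0 y0"
    have x0: "G x0 y = \<kappa> * b x0 y" for y using r[of x0 y y0] 0 by (simp add: \<kappa>_def field_simps)
    have "G x y = \<kappa> * b x y" for x y
    proof (cases "\<exists>z. b x z \<noteq> 0 \<and> b x0 z \<noteq> 0")
      case True
      then obtain z where z: "b x z \<noteq> 0" "b x0 z \<noteq> 0" by blast
      have "G x z = \<kappa> * b x z" using l[of x z x0] x0[of z] z by (simp add: field_simps)
      then show ?thesis using r[of x y z] z by (simp add: field_simps)
    next
      case False
      \<comment> \<open>A space is not the union of two proper subspaces: with \<open>b x z\<close>
        nonzero, the vector \<open>z + y0\<close> would lie outside both kernels.\<close>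
      have "b x z = 0" for z
      proof (rule ccontr)
        assume "b x z \<noteq> 0"
        then have "b x0 z = 0" "b x y0 = 0" using False 0 by blast+
        then show False using False 0 \<open>b x z \<noteq> 0\<close> by (metis b_add(1) add.left_neutral add.right_neutral)
      qed
      then show ?thesis using orth by simp
    qed
    then show ?thesis by blast
  qed
qed

end

text \<open>Here \<open>mu x y\<close> is the action of \<open>x \<cdot> y \<in> C\<^sub>0(V)\<close>. The identity \<open>key\<close> below is what the
  compatibility with the semitraces amounts to.\<close>
locale half_spin = Q: qspace V n e eps + W: qspace W n' e' eps'
  for V :: "('f::field, 'v::ab_group_add) quad_space" and n e eps
    and W :: "('f, 'w::ab_group_add) quad_space" and n' e' eps' +
  fixes mu :: "'v \<Rightarrow> 'v \<Rightarrow> 'w \<Rightarrow> 'w"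
  assumes mu_lin: "lin (scal W) (scal W) (mu x y)"
    and mu_add: "mu (x + x') y v = mu x y v + mu x' y v" "mu x (y + y') v = mu x y v + mu x y' v"
    and mu_scale: "mu (scal V c x) y v = scal W c (mu x y v)" "mu x (scal V c y) v = scal W c (mu x y v)"
    and mu_diag: "mu x x v = scal W (form V x) v"
    and mu_mult: "mu x y (mu y z v) = scal W (form V y) (mu x z v)"
    and mu_ad: "polar W (mu x y v) w = polar W v (mu y x w)"
    and schur: "lin (scal W) (scal W) T \<Longrightarrow> (\<And>x y v. T (mu x y v) = mu x y (T v)) \<Longrightarrow> \<exists>c. \<forall>v. T v = scal W c v"
    and n_pos: "n > 0"
begin

lemma mu_polar: "mu x y v + mu y x v = scal W (polar V x y) v"
proof -
  have "mu (x + y) (x + y) v = scal W (form V x) v + scal W (form V y) v + (mu x y v + mu y x v)"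
    by (simp only: mu_add) (simp add: mu_diag algebra_simps)
  note this[unfolded mu_diag[of "x + y"]]
  then have "mu x y v + mu y x v = scal W (form V (x + y)) v - scal W (form V x) v - scal W (form V y) v"
    by (metis add_diff_cancel_left' diff_diff_add)
  then show ?thesis unfolding polar_def by (simp add: W.scale_left_diff_distrib)
qed

lemma mu_mult_polar: "mu x y (mu y' z v) + mu x y' (mu y z v) = scal W (polar V y y') (mu x z v)"
proof -
  have "mu x (y + y') (mu (y + y') z v) =
    scal W (form V y) (mu x z v) + scal W (form V y') (mu x z v) + (mu x y (mu y' z v) + mu x y' (mu y z v))"
    unfolding mu_add lin_add[OF mu_lin] mu_mult by (simp add: algebra_simps)
  then show ?thesis by (simp add: mu_mult Q.q_add W.scale_left_distrib)
qed

text \<open>For \<open>x \<bottom> y\<close> choose \<open>w, w'\<close> orthogonal to both with \<open>b(w, w') = 1\<close>. Then \<open>t = \<mu>(x, y) \<mu>(w, w')\<close>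
  satisfies \<open>\<sigma>(t) = t - \<mu>(x, y)\<close>, while \<open>b(v, t v) = b(v, \<sigma>(t) v)\<close>. This avoids dividing by 2.\<close>
lemma mu_orth:
  assumes n: "4 < n" and xy: "polar V x y = 0"
  shows "polar W v (mu x y v) = 0"
proof -
  obtain w w' where w: "polar V x w = 0" "polar V y w = 0" "polar V x w' = 0" "polar V y w' = 0" "polar V w w' = 1"
    using Q.orth_pair[OF n] by blast
  have anti: "mu p r u = - mu r p u" if "polar V p r = 0" for p r u
    using mu_polar[of p r u] that by (simp add: add_eq_0_iff2)
  have skew: "mu p r (mu r' s u) = - mu p r' (mu r s u)" if "polar V r r' = 0" for p r r' s u
    using mu_mult_polar[of p r r' s u] that by (simp add: add_eq_0_iff2)
  have neg: "mu p r (- u) = - mu p r u" for p r u by (rule lin_minus[OF mu_lin])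
  \<comment> \<open>Moving \<open>w' w\<close> past \<open>y x\<close> takes four exchanges of
    orthogonal vectors, so the signs cancel. The order of \<open>w'\<close> and \<open>w\<close> is
    kept, since these two do not anticommute.\<close>
  have "mu w' w (mu y x v) = mu y x (mu w' w v)"
  proof -
    have "mu w' w (mu y x v) = - mu w' y (mu w x v)" by (rule skew) (use w in \<open>simp add: Q.b_sym\<close>)
    also have "\<dots> = mu y w' (mu w x v)" using anti[of w' y] w by (simp add: Q.b_sym)
    also have "\<dots> = - mu y w' (mu x w v)" using anti[of w x v] w by (simp add: Q.b_sym neg)
    also have "\<dots> = mu y x (mu w' w v)" using skew[of w' x y w v] w by (simp add: Q.b_sym)
    finally show ?thesis .
  qed
  also have "\<dots> = - mu x y (mu w' w v)" using anti[of y x] xy by (simp add: Q.b_sym)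
  also have "mu w' w v = v - mu w w' v" using mu_polar[of w w' v] w by (simp add: algebra_simps)
  finally have sig: "mu w' w (mu y x v) = mu x y (mu w w' v) - mu x y v"
    by (simp add: lin_diff[OF mu_lin])
  have "polar W v (mu x y (mu w w' v)) = polar W (mu w' w (mu y x v)) v"
    by (simp add: mu_ad)
  also have "\<dots> = polar W v (mu x y (mu w w' v)) - polar W v (mu x y v)"
    unfolding sig by (simp add: W.b_sym)
  finally show ?thesis by simp
qed

lemma mu_proportional:
  assumes n: "4 < n"
  shows "\<exists>\<kappa>. \<forall>x y. polar W v (mu x y v) = \<kappa> * polar V x y"
proof (rule Q.proportional_form)
  show "lin (scal V) (*) (\<lambda>y. polar W v (mu x y v))" for x
    by (rule linI[OF Q.vs field_vs]) (simp_all add: mu_add mu_scale)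
  show "lin (scal V) (*) (\<lambda>x. polar W v (mu x y v))" for y
    by (rule linI[OF Q.vs field_vs]) (simp_all add: mu_add mu_scale)
qed (rule mu_orth[OF n])

end

locale half_spin_key = half_spin +
  assumes key: "polar W v (mu x y v) = polar V x y * form W v"

text \<open>\<open>l x\<close> and \<open>r x\<close> are the two blocks of the action of a single
  vector \<open>x\<close>, of which \<open>mu2\<close> and \<open>mu3\<close> only know the products
  of two. Adjointness between the blocks is derived, up to a scalar, in \<open>multiplier\<close>.
  The case of equal spaces and equal representations is formed only to be refuted.\<close>

locale spin_pair = H2: half_spin_key V n e eps W2 n e2 eps2 mu2 + H3: half_spin_key V n e eps W3 n e3 eps3 mu3
  for V :: "('f::field, 'v::ab_group_add) quad_space" and n e eps
    and W2 :: "('f, 'w2::ab_group_add) quad_space" and e2 eps2 mu2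
    and W3 :: "('f, 'w3::ab_group_add) quad_space" and e3 eps3 mu3 +
  fixes l :: "'v \<Rightarrow> 'w2 \<Rightarrow> 'w3" and r :: "'v \<Rightarrow> 'w3 \<Rightarrow> 'w2"
  assumes l_lin: "lin (scal W2) (scal W3) (l x)" and r_lin: "lin (scal W3) (scal W2) (r x)"
    and l_lin': "lin (scal V) (scal W3) (\<lambda>x. l x v)"
    and rl: "r x (l y v) = mu2 x y v" and lr: "l x (r y w) = mu3 x y w"
begin

text \<open>The polar form of \<open>W2\<close> pulled back along \<open>r x0\<close> is compatible
  with the adjoints of \<open>mu3\<close>, hence by Schur's lemma is \<open>\<kappa>\<close> times
  that of \<open>W3\<close>; this makes \<open>l x\<close> and \<open>r x\<close> adjoint up to
  \<open>\<theta> = q(x\<^sub>0) / \<kappa>\<close>. For the quadratic forms, \<open>key\<close>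
  with \<open>b(y, z) = 1\<close> expresses \<open>q\<^sub>3\<close> of \<open>l x v\<close> by
  polar forms, and adjointness carries the expression back to \<open>W2\<close>.\<close>

lemma multiplier:
  shows "\<exists>\<theta>. \<theta> \<noteq> 0 \<and> (\<forall>x v w. polar W3 (l x v) w = \<theta> * polar W2 v (r x w)) \<and>
    (\<forall>x v. form W3 (l x v) = \<theta> * (form V x * form W2 v))"
proof -
  obtain x0 where x0: "form V x0 \<noteq> 0" using H2.Q.anisotropic_exists[OF H2.n_pos] by blast
  let ?q = "form V x0"
  have "\<exists>k. \<forall>w w'. polar W3 (k w) w' = polar W2 (r x0 w) (r x0 w')"
  proof -
    have "\<exists>u. \<forall>w'. polar W3 u w' = polar W2 (r x0 w) (r x0 w')" for w
      using H3.W.riesz[OF lin_comp[OF r_lin H2.W.b_lin]] by (simp add: comp_def)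
    then show ?thesis by metis
  qed
  then obtain k where k: "\<And>w w'. polar W3 (k w) w' = polar W2 (r x0 w) (r x0 w')" by blast
  have klin: "lin (scal W3) (scal W3) k"
  proof (rule linI[OF H3.W.vs H3.W.vs])
    show "k (x + y) = k x + k y" for x y by (rule H3.W.b_eqI) (simp add: k lin_add[OF r_lin])
    show "k (scal W3 c x) = scal W3 c (k x)" for x c by (rule H3.W.b_eqI) (simp add: k lin_scale[OF r_lin])
  qed
  have "k (mu3 x y w) = mu3 x y (k w)" for x y w
  proof (rule H3.W.b_eqI)
    fix w'
    have "polar W3 (k (mu3 x y w)) w' = polar W2 (mu2 x0 x (r y w)) (r x0 w')"
      unfolding k lr[symmetric] rl ..
    also have "\<dots> = polar W2 (r y w) (r x (l x0 (r x0 w')))" unfolding H2.mu_ad rl ..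
    also have "\<dots> = ?q * polar W2 (r y w) (r x w')" by (simp add: lr H3.mu_diag lin_scale[OF r_lin])
    also have "\<dots> = polar W2 (r y (l x0 (r x0 w))) (r x w')" by (simp add: lr H3.mu_diag lin_scale[OF r_lin])
    also have "\<dots> = polar W2 (r x0 w) (r x0 (mu3 y x w'))" unfolding rl H2.mu_ad lr[symmetric] ..
    also have "\<dots> = polar W3 (mu3 x y (k w)) w'" unfolding H3.mu_ad k ..
    finally show "polar W3 (k (mu3 x y w)) w' = polar W3 (mu3 x y (k w)) w'" .
  qed
  then obtain \<kappa> where ks: "\<And>w. k w = scal W3 \<kappa> w" using H3.schur[OF klin] by blast
  have b23: "polar W2 (r x0 w) (r x0 w') = \<kappa> * polar W3 w w'" for w w' unfolding k[symmetric] ks by simp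
  have k0: "\<kappa> \<noteq> 0"
  proof
    assume "\<kappa> = 0"
    then have "polar W2 (scal W2 ?q v) (scal W2 ?q v') = 0" for v v'
      using b23[of "l x0 v" "l x0 v'"] by (simp add: rl H2.mu_diag)
    then have "polar W2 v v' = 0" for v v' using x0 by simp
    moreover obtain v where "form W2 v \<noteq> 0" using H2.W.anisotropic_exists[OF H2.n_pos] by blast
    ultimately show False by (simp add: polar_def) (metis H2.W.b_nondeg H2.W.q_zero \<open>\<And>v' v. polar W2 v v' = 0\<close>)
  qed
  define \<theta> where "\<theta> = ?q / \<kappa>"
  have lam: "polar W3 (l x v) w = \<theta> * polar W2 v (r x w)" for x v w
  proof -
    have "scal W3 ?q (l x v) = mu3 x x0 (l x0 v)"
      by (simp add: lr[symmetric] rl H2.mu_diag lin_scale[OF l_lin])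
    then have "?q * polar W3 (l x v) w = polar W3 (l x0 v) (mu3 x0 x w)"
      using H3.mu_ad[of x x0 "l x0 v" w] by (metis H3.W.b_scale(2))
    also have "\<kappa> * \<dots> = polar W2 (r x0 (l x0 v)) (r x0 (l x0 (r x w)))" unfolding b23 lr ..
    also have "\<dots> = ?q * ?q * polar W2 v (r x w)" by (simp add: rl H2.mu_diag)
    finally show ?thesis using x0 k0 by (simp add: \<theta>_def field_simps)
  qed
  have "form W3 (l x v) = \<theta> * (form V x * form W2 v)" for x v
  proof -
    obtain y z where yz: "polar V y z = 1" by (metis H2.Q.b_scale(1) H2.Q.b_self H2.Q.anisotropic_exists H2.n_pos
      H2.Q.b_nondeg H2.Q.q_zero left_inverse)
    \<comment> \<open>Anticommuting the product \<open>x y z x\<close> reduces it to products of two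
      vectors, on which \<open>key\<close> can be evaluated. The first two terms then cancel and
      \<open>q(x)\<close> remains.\<close>
    have m: "mu2 x y (mu2 z x v) = scal W2 (polar V x y) (mu2 z x v) -
       scal W2 (polar V z x) (mu2 y x v) + scal W2 (form V x) (mu2 y z v)"
    proof -
      have "mu2 x y (mu2 z x v) = scal W2 (polar V x y) (mu2 z x v) - mu2 y x (mu2 z x v)"
        using H2.mu_polar[of x y "mu2 z x v"] by (simp add: algebra_simps)
      also have "mu2 y x (mu2 z x v) = mu2 y x (scal W2 (polar V z x) v - mu2 x z v)"
        using H2.mu_polar[of z x v] by (metis add_diff_cancel_right' add.commute)
      also have "\<dots> = scal W2 (polar V z x) (mu2 y x v) - scal W2 (form V x) (mu2 y z v)"
        by (simp add: lin_diff[OF H2.mu_lin] lin_scale[OF H2.mu_lin] H2.mu_mult)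
      finally show ?thesis by simp
    qed
    have "form W3 (l x v) = polar W3 (l x v) (l y (r z (l x v)))"
      using H3.key[of "l x v" y z] by (simp add: yz lr)
    also have "\<dots> = \<theta> * polar W2 v (mu2 x y (mu2 z x v))" by (simp add: lam rl)
    also have "\<dots> = \<theta> * (form V x * form W2 v)"
      unfolding m by (simp add: H2.key yz H2.Q.b_sym[of x y])
    finally show ?thesis .
  qed
  then show ?thesis using lam k0 x0 by (intro exI[of _ \<theta>]) (simp add: \<theta>_def)
qed

end

text \<open>The two half-spin representations are not equivalent to their own twist by a reflection: if
  \<open>r\<close> and \<open>l\<close> act on one space, then \<open>r = \<nu> l\<close>, so \<open>l\<close> represents the full Clifford algebra. For
  \<open>l\<^sub>x v = v\<close> with \<open>v\<close> anisotropic, \<open>l\<^sub>x + 1\<close> has rank one, and its anticommutators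
  with the \<open>l\<^sub>y\<close> are \<open>\<nu>\<^sup>-\<^sup>1 b(x, y) + 2 l\<^sub>y\<close>, which is impossible.\<close>
lemma no_self_pairing:
  fixes V :: "('f::field, 'v::ab_group_add) quad_space" and W :: "('f, 'w::ab_group_add) quad_space"
  assumes P: "spin_pair V n e eps W e2 eps2 mu W e2 eps2 mu l r" and n: "2 < n"
  shows False
proof -
  interpret spin_pair V n e eps W e2 eps2 mu W e2 eps2 mu l r by fact
  obtain x0 where x0: "form V x0 \<noteq> 0" using H2.Q.anisotropic_exists[OF H2.n_pos] by blast
  let ?q = "form V x0" and ?b = "polar V" and ?s = "scal W"
  \<comment> \<open>Since \<open>r x0\<close> divided by \<open>q(x\<^sub>0)\<close> inverts
    \<open>l x0\<close>, this is the inverse of \<open>l x0\<close> composed with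
    \<open>r x0\<close>, the candidate for the ratio of \<open>r\<close> and
    \<open>l\<close>.\<close>
  define N0 where "N0 w = ?s (inverse ?q) (r x0 (r x0 w))" for w
  have N0lin: "lin ?s ?s N0"
    using lin_smult[OF lin_comp[OF r_lin r_lin], where c="inverse ?q"] by (simp add: N0_def[abs_def] comp_def)
  have can: "?s (inverse ?q) (?s ?q w) = w" for w using x0 by simp
  have rN: "r x w = l x (N0 w)" for x w
  proof -
    have "l x (r x0 (r x0 w)) = r x (l x0 (r x0 w))" using lr[of x x0 "r x0 w"] rl[of x x0 "r x0 w"] by simp
    also have "\<dots> = ?s ?q (r x w)" by (simp add: lr H2.mu_diag lin_scale[OF r_lin])
    finally show ?thesis using can[of "r x w"] by (simp add: N0_def lin_scale[OF l_lin])
  qed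
  have linj: "v = v'" if "l x0 v = l x0 v'" for v v'
    using rl[of x0 x0 v] rl[of x0 x0 v'] that by (metis H2.mu_diag can)
  have Nl: "N0 (l y w) = l y (N0 w)" for y w
  proof (rule linj)
    have "l x0 (N0 (l y w)) = mu x0 y w" using rl[of x0 y w] unfolding rN .
    also have "\<dots> = l x0 (l y (N0 w))" using lr[of x0 y w] unfolding rN ..
    finally show "l x0 (N0 (l y w)) = l x0 (l y (N0 w))" .
  qed
  have "N0 (mu x y v) = mu x y (N0 v)" for x y v
    unfolding lr[symmetric] by (simp add: rN Nl)
  then obtain \<nu> where nu: "\<And>w. N0 w = ?s \<nu> w" using H2.schur[OF N0lin] by blast
  have ll: "?s \<nu> (l x (l y v)) = mu x y v" for x y v
    using rl[of x y v] by (simp add: rN nu lin_scale[OF l_lin])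
  obtain v where v: "form W v \<noteq> 0" using H2.W.anisotropic_exists[OF H2.n_pos] by blast
  have v0: "v \<noteq> 0" using v by auto
  have nu0: "\<nu> \<noteq> 0"
    using ll[of x0 x0 v] x0 v0 by (auto simp: H2.mu_diag)
  define c where "c = inverse \<nu>"
  have c0: "c \<noteq> 0" using nu0 by (simp add: c_def)
  have ll': "l x (l y w) = ?s c (mu x y w)" for x y w
  proof -
    have "?s c (?s \<nu> (l x (l y w))) = ?s c (mu x y w)" by (simp only: ll)
    then show ?thesis using nu0 by (simp add: c_def)
  qed
  have lpol: "l x (l y w) + l y (l x w) = ?s (c * ?b x y) w" for x y w
    unfolding ll' by (simp add: H2.mu_polar flip: H2.W.scale_right_distrib)
  obtain \<theta> where lam: "\<theta> \<noteq> 0" "\<And>x v. form W (l x v) = \<theta> * (form V x * form W v)"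
    using multiplier by blast
  \<comment> \<open>The map multiplies the form by the nonzero factor \<open>\<theta> q(v)\<close>,
    so a kernel vector would lie in the radical of the polar form. Equality of the dimensions gives
    surjectivity.\<close>
  have "bij (\<lambda>x. l x v)"
  proof (rule H2.Q.inj_imp_bij[OF l_lin' _ H2.W.vbase_axioms])
    fix x assume x: "l x v = 0"
    have "polar V x y = 0" for y
    proof -
      have "form W (l (x + y) v) = form W (l y v)" using lin_add[OF l_lin', of x y v] x by simp
      then have "\<theta> * (form V (x + y) * form W v) = \<theta> * (form V y * form W v)" by (simp only: lam(2))
      then have "form V (x + y) = form V y" using lam(1) v by simp
      moreover have "form W (l x v) = 0" using x by simp
      then have "\<theta> * (form V x * form W v) = 0" by (simp only: lam(2))
      then have "form V x = 0" using lam(1) v by simp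
      ultimately show ?thesis by (simp add: polar_def)
    qed
    then show "x = 0" by (rule H2.Q.b_nondeg)
  qed
  note surjD[OF bij_is_surj[OF this]]
  then have surj: "\<exists>x. l x v = w" for w by (metis (no_types))
  obtain x where x: "l x v = v" using surj by blast
  have sq: "(?b x y)\<^sup>2 * c = 4 * form V y" for y
  proof -
    \<comment> \<open>With \<open>w = l z v\<close> and \<open>v = l x v\<close>, the vector
      \<open>l x w + w\<close> is the anticommutator of \<open>l x\<close> and \<open>l z\<close>
      applied to \<open>v\<close>.\<close>
    have "\<exists>t. l x w + w = ?s t v" for w
    proof -
      obtain z where z: "l z v = w" using surj by blast
      have "l x w + w = ?s (c * ?b x z) v" using lpol[of x z v] by (simp add: z x)
      then show ?thesis by blast
    qed
    then obtain \<eta> where eta: "\<And>w. l x w + w = ?s (\<eta> w) v" by metis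
    have etalin: "lin ?s (*) \<eta>"
    proof (rule linI[OF H2.W.vs field_vs])
      fix w w' a
      have "?s (\<eta> (w + w')) v = ?s (\<eta> w + \<eta> w') v"
        unfolding H2.W.scale_left_distrib eta[symmetric] by (simp add: lin_add[OF l_lin])
      then show "\<eta> (w + w') = \<eta> w + \<eta> w'" using v0 by simp
      have "?s (\<eta> (?s a w)) v = ?s (a * \<eta> w) v"
        unfolding H2.W.scale_scale[symmetric] eta[symmetric]
        by (simp add: lin_scale[OF l_lin] H2.W.scale_right_distrib)
      then show "\<eta> (?s a w) = a * \<eta> w" using v0 by simp
    qed
    \<comment> \<open>Two linear conditions, solvable because \<open>2 < n\<close>: they make
      \<open>l x\<close> act as -1 on both \<open>w\<close> and \<open>l y w\<close>. The
      anticommutator becomes \<open>c b(x, y) w = -2 l y w\<close>, and using it twice yields the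
      relation \<open>sq\<close>.\<close>
    define f where "f i = (if i = 0 then \<eta> else (\<lambda>w. \<eta> (l y w)))" for i :: nat
    have "lin ?s (*) (f i)" for i using etalin lin_comp[OF l_lin etalin] by (simp add: f_def comp_def)
    then obtain w where w: "w \<noteq> 0" "\<And>i. i < 2 \<Longrightarrow> f i w = 0" using H2.W.common_zero[OF n, of f] by blast
    have e0: "\<eta> w = 0" "\<eta> (l y w) = 0" using w(2)[of 0] w(2)[of 1] by (simp_all add: f_def)
    have xw: "l x w = - w" "l x (l y w) = - l y w" using eta[of w] eta[of "l y w"] e0 by (simp_all add: add_eq_0_iff2)
    have cw: "?s (c * ?b x y) w = ?s (- 2) (l y w)"
      using lpol[of x y w] xw H2.W.scale_left_distrib[of "-1" "-1" "l y w"] by (simp add: lin_minus[OF l_lin])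
    have "?s ((c * ?b x y)\<^sup>2) w = ?s (c * ?b x y) (?s (c * ?b x y) w)" by (simp add: power2_eq_square)
    also have "\<dots> = ?s (c * ?b x y) (?s (- 2) (l y w))" by (simp only: cw)
    also have "\<dots> = ?s (- 2) (l y (?s (c * ?b x y) w))"
      unfolding lin_scale[OF l_lin] H2.W.scale_scale by (simp only: mult.commute)
    also have "\<dots> = ?s (- 2) (l y (?s (- 2) (l y w)))" by (simp only: cw)
    also have "\<dots> = ?s (4 * (c * form V y)) w"
      unfolding lin_scale[OF l_lin] ll' H2.mu_diag H2.W.scale_scale by simp
    finally have "(c * ?b x y)\<^sup>2 = 4 * (c * form V y)" using w(1) by (metis H2.W.scale_right_imp_eq)
    then have "c * ((?b x y)\<^sup>2 * c) = c * (4 * form V y)" by (simp add: power2_eq_square algebra_simps)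
    then show ?thesis using c0 by simp
  qed
  have x0': "x \<noteq> 0" using x v0 lin_zero[OF l_lin', of v] by auto
  show False
  \<comment> \<open>In characteristic 2, \<open>sq\<close> says that \<open>b x\<close> vanishes.
    Otherwise it says that \<open>q\<close> is a multiple of the square of the functional
    \<open>b x\<close>, and any nonzero \<open>y\<close> orthogonal to \<open>x\<close> lies in the
    radical.\<close>
  proof (cases "(2::'f) = 0")
    case True
    then have "(4::'f) = 0" by (metis mult_2 add_cancel_right_left numeral_Bit0 add_numeral_special(2))
    then have "?b x y = 0" for y using sq[of y] c0 by simp
    then show False using x0' H2.Q.b_nondeg by blast
  next
    case False
    obtain y where y: "y \<noteq> 0" "?b x y = 0"
      using H2.Q.common_zero[of 1 "\<lambda>_. ?b x"] n H2.Q.b_lin by auto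
    have "?b y z = 0" for z
    proof -
      have "?b x (y + z) = ?b x z" using y by simp
      then have "4 * form V (y + z) = 4 * form V z" using sq[of "y + z"] sq[of z] by metis
      moreover have "4 * form V y = 0" using sq[of y] y by simp
      moreover have "(4::'f) \<noteq> 0" using False by (metis mult_2_right mult_eq_0_iff numeral_Bit0 numeral_times_numeral semiring_norm(12))
      ultimately show ?thesis by (simp add: polar_def)
    qed
    then show False using y(1) H2.Q.b_nondeg by blast
  qed
qed

section \<open>Existence of the composition\<close>

context split_alg
begin

lemma e_nonzero: "e 0 \<noteq> 0"
  using E.eps_e[of 0 0] n_pos lin_zero[OF E.eps_lin[of 0]] by auto

text \<open>For a primitive idempotent \<open>p = e\<^sub>0 \<otimes> \<epsilon>\<^sub>0\<close>, the element \<open>\<tau>(p)\<close> has rank one, say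
  with image spanned by \<open>e'\<close>, and \<open>\<tau>(x \<otimes> \<epsilon>\<^sub>0)\<close> has the form \<open>y \<mapsto> b(x, y) e'\<close>.\<close>
lemma adjoint_form:
  assumes inv: "involution_on A \<tau>"
  shows "\<exists>b. (\<forall>x. lin s (*) (b x)) \<and> (\<forall>y. lin s (*) (\<lambda>x. b x y)) \<and> (\<forall>x. (\<forall>y. b x y = 0) \<longrightarrow> x = 0) \<and>
     (\<forall>h x y. lin s s h \<longrightarrow> b (h x) y = b x (\<gamma> (\<tau> (dl h)) y)) \<and> (\<exists>c. \<forall>x y. b y x = c * b x y)"
proof -
  define S where "S h = \<gamma> (\<tau> (dl h))" for h
  note d = alg_homD[OF dl_hom, simplified]
  have sc: "\<tau> a \<in> carrier A" and ss: "\<tau> (\<tau> a) = a" if "a \<in> carrier A" for a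
    using inv that by (auto simp: involution_on_def Pi_iff)
  have sm: "\<tau> (x \<otimes> y) = \<tau> y \<otimes> \<tau> x" "\<tau> (x \<oplus> y) = \<tau> x \<oplus> \<tau> y" "\<tau> (c \<odot> x) = c \<odot> \<tau> x"
    if "x \<in> carrier A" "y \<in> carrier A" for x y c
    using inv that by (auto simp: involution_on_def)
  note sm = sm(1,2) sm(3)[OF _ zero_closed]
  have Slin: "lin s s (S h)" and SS: "S (S h) = h" if "lin s s h" for h
    using that sc ss by (auto simp: S_def)
  have Sc: "S (h \<circ> k) = S k \<circ> S h" "S (\<lambda>x. h x + k x) = (\<lambda>x. S h x + S k x)" "S (\<lambda>x. s c (h x)) = (\<lambda>x. s c (S h x))"
    if "lin s s h" "lin s s k" for h k c
    using that sc sm by (simp_all add: S_def d g_mult g_add g_smult)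
  let ?o = "\<lambda>x. E.op1 x (eps 0)"
  have o: "lin s s (?o x)" for x by (rule E.op1_lin[OF E.eps_lin[OF n_pos]])
  let ?G = "S (?o (e 0))"
  have Gnz: "?G \<noteq> (\<lambda>_. 0)"
  proof
    assume "?G = (\<lambda>_. 0)"
    moreover have "S (\<lambda>_. 0) = (\<lambda>_. 0)" using Sc(3)[OF o o, of 0 "e 0"] by simp
    ultimately have "?o (e 0) = (\<lambda>_. 0)" using SS[OF o, of "e 0"] by simp
    then have "?o (e 0) (e 0) = 0" by simp
    then show False using e_nonzero n_pos by (simp add: E.op1_def E.eps_e)
  qed
  then obtain v0 where v0: "?G v0 \<noteq> 0" by auto
  define e' where "e' = ?G v0"
  \<comment> \<open>For the rank-one idempotent \<open>p\<close>, every \<open>p k p\<close> is a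
    multiple of \<open>p\<close>. Taking \<open>k = S h\<close> and applying the anti-automorphism
    \<open>S\<close> shows that \<open>?G \<circ> h \<circ> ?G\<close> is a multiple of
    \<open>?G\<close>; \<open>h\<close> is chosen to send \<open>e'\<close> to
    \<open>w\<close>.\<close>
  have rank: "\<exists>c. ?G w = s c e'" for w
  proof -
    obtain k where k: "k < n" "eps k e' \<noteq> 0"
      using v0 E.eps_eqI[of e' 0] lin_zero[OF E.eps_lin] unfolding e'_def by metis
    define h where "h = E.op1 (s (inverse (eps k e')) w) (eps k)"
    have h: "lin s s h" unfolding h_def by (rule E.op1_lin[OF E.eps_lin[OF k(1)]])
    have hw: "h e' = w" using k by (simp add: h_def E.op1_def)
    have "?o (e 0) \<circ> (S h \<circ> ?o (e 0)) = (\<lambda>x. s (eps 0 (S h (e 0))) (?o (e 0) x))"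
      using lin_scale[OF Slin[OF h]] lin_scale[OF E.eps_lin[OF n_pos]]
      by (auto simp: E.op1_def mult.commute)
    then have "S (?o (e 0) \<circ> (S h \<circ> ?o (e 0))) = (\<lambda>x. s (eps 0 (S h (e 0))) (?G x))"
      using Sc(3)[OF o o] by simp
    then have "?G \<circ> h \<circ> ?G = (\<lambda>x. s (eps 0 (S h (e 0))) (?G x))"
      by (simp add: Sc(1) lin_comp[OF o Slin[OF h]] o Slin[OF h] SS[OF h])
    from fun_cong[OF this, of v0] show ?thesis using hw by (auto simp: e'_def)
  qed
  have "\<exists>c. S (?o x) y = s c e'" for x y
  proof -
    define h where "h = E.op1 x (eps 0)"
    have "?o x = h \<circ> ?o (e 0)" using n_pos by (auto simp: h_def E.op1_def E.eps_e lin_scale[OF E.eps_lin])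
    moreover have "S (h \<circ> ?o (e 0)) = ?G \<circ> S h" by (rule Sc(1)) (simp_all add: h_def o)
    ultimately have "S (?o x) y = ?G (S h y)" by (metis comp_apply)
    then show ?thesis using rank by simp
  qed
  then obtain b where b: "\<And>x y. S (?o x) y = s (b x y) e'" by metis
  have e'0: "e' \<noteq> 0" using v0 by (simp add: e'_def)
  have b_eq: "b x y = c" if "S (?o x) y = s c e'" for x y c using b[of x y] that e'0 by simp
  have h1: "b (h x) y = b x (S h y)" if h: "lin s s h" for h x y
  proof (rule b_eq)
    have "S (?o (h x)) = S (?o x) \<circ> S h" using Sc(1)[OF h o, of x] E.comp_op1[OF h] by simp
    then show "S (?o (h x)) y = s (b x (S h y)) e'" by (simp add: b)
  qed
  have l1: "lin s (*) (b x)" for x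
  proof (rule linI[OF E.vs field_vs]; rule b_eq)
    show "S (?o x) (y + y') = s (b x y + b x y') e'" for y y'
      unfolding lin_add[OF Slin[OF o]] E.scale_left_distrib unfolding b ..
    show "S (?o x) (s c y) = s (c * b x y) e'" for y c
      unfolding lin_scale[OF Slin[OF o]] E.scale_scale[symmetric] unfolding b ..
  qed
  have l2: "lin s (*) (\<lambda>x. b x y)" for y
  proof (rule linI[OF E.vs field_vs]; rule b_eq)
    show "S (?o (x + x')) y = s (b x y + b x' y) e'" for x x'
    proof -
      have "?o (x + x') = (\<lambda>z. ?o x z + ?o x' z)" by (auto simp: E.op1_def E.scale_right_distrib)
      then show ?thesis by (simp add: Sc(2)[OF o o] b E.scale_left_distrib)
    qed
    show "S (?o (s c x)) y = s (c * b x y) e'" for x c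
    proof -
      have "?o (s c x) = (\<lambda>z. s c (?o x z))" by (auto simp: E.op1_def mult.commute)
      then show ?thesis by (simp add: Sc(3)[OF o o] b)
    qed
  qed
  have nd: "x = 0" if "\<And>y. b x y = 0" for x
  proof -
    have "S (?o x) = (\<lambda>_. 0)" using that b by auto
    moreover have "S (\<lambda>_. 0) = (\<lambda>_. 0)" using Sc(3)[OF o o, of 0 "e 0"] by simp
    ultimately have "?o x = (\<lambda>_. 0)" using SS[OF o, of x] by simp
    then have "?o x (e 0) = 0" by simp
    then show ?thesis using n_pos by (simp add: E.op1_def E.eps_e)
  qed
  \<comment> \<open>Adjointness is applied to the operator \<open>S (?o x)\<close>, which sends
    \<open>y\<close> to \<open>b x y\<close> times \<open>e'\<close> and whose own image under
    \<open>S\<close> is \<open>?o x\<close>, sending \<open>e 0\<close> to \<open>x\<close>.\<close>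
  have "b y x = b e' (e 0) * b x y" for x y
  proof -
    have "b (S (?o x) y) (e 0) = b y (?o x (e 0))" using h1[OF Slin[OF o], of x y "e 0"] SS[OF o] by simp
    moreover have "?o x (e 0) = x" using n_pos by (simp add: E.op1_def E.eps_e)
    ultimately show ?thesis unfolding b lin_scale[OF l2] by (simp add: mult.commute)
  qed
  then show ?thesis using l1 l2 nd h1 unfolding S_def by (intro exI[of _ b]) blast
qed

text \<open>The Gram matrix of \<open>b\<close> is the required alternating matrix, and the
  coordinates of the \<open>b\<close>-dual basis form its inverse. Since orthogonal means not
  symplectic, this is what excludes skew forms for quadratic pairs in characteristic other than
  2.\<close>

lemma alternating_imp_symplectic:
  assumes inv: "involution_on A \<tau>"
    and B: "\<And>x. lin s (*) (b x)" "\<And>y. lin s (*) (\<lambda>x. b x y)"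
    and nondeg: "\<And>x. (\<And>y. b x y = 0) \<Longrightarrow> x = 0"
    and adj: "\<And>a x y. a \<in> carrier A \<Longrightarrow> b x (\<gamma> a y) = b (\<gamma> (\<tau> a) x) y"
    and alt: "\<And>x. b x x = 0"
  shows "symplectic_involution A \<tau>"
  unfolding symplectic_involution_def degree_A
proof (intro conjI inv bexI[OF _ splitting_exists] bexI)
  let ?g = "mat n n (\<lambda>(i, j). to_ac (b (e i) (e j)))"
  let ?\<rho> = "\<lambda>a. mat n n (\<lambda>(i, j). to_ac (eps i (\<gamma> a (e j))))"
  have "\<exists>d. \<forall>k<n. \<forall>x. b (d k) x = eps k x" using E.bilinear_riesz[OF B nondeg E.eps_lin] by metis
  then obtain d where d: "\<And>k x. k < n \<Longrightarrow> b (d k) x = eps k x" by blast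
  have ex1: "(\<Sum>k<n. b x (e k) * eps k y) = b x y" for x y
  proof -
    have "b x y = b x (\<Sum>k<n. s (eps k y) (e k))" by (simp flip: E.expand)
    then show ?thesis by (simp add: lin_sum[OF B(1)] lin_scale[OF B(1)] mult.commute)
  qed
  have ex2: "(\<Sum>k<n. eps k x * b (e k) y) = b x y" for x y
  proof -
    have "b x y = b (\<Sum>k<n. s (eps k x) (e k)) y" by (simp flip: E.expand)
    then show ?thesis by (simp add: lin_sum[OF B(2)] lin_scale[OF B(2)])
  qed
  show "?g \<in> carrier_mat n n" by simp
  have anti: "b y x = - b x y" for x y
    using alt[of "x + y"] alt[of x] alt[of y]
    by (simp add: lin_add[OF B(1)] lin_add[OF B(2)] add_eq_0_iff)
  show "alternating_mat ?g"
    unfolding alternating_mat_def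
  proof (intro conjI allI impI)
    have "to_ac (b (e j) (e i)) = - to_ac (b (e i) (e j))" for i j
      by (subst anti) (rule to_ac_minus)
    note ac = this
    show "transpose_mat ?g = - ?g"
    proof (rule eq_matI)
      fix i j assume "i < dim_row (- ?g)" "j < dim_col (- ?g)"
      then have "transpose_mat ?g $$ (i, j) = to_ac (b (e j) (e i))" "(- ?g) $$ (i, j) = - to_ac (b (e i) (e j))"
        by simp_all
      note this
      show "transpose_mat ?g $$ (i, j) = (- ?g) $$ (i, j)" unfolding \<open>transpose_mat ?g $$ (i, j) = _\<close> \<open>(- ?g) $$ (i, j) = _\<close> by (rule ac)
    qed simp_all
  qed (auto simp: alt)
  let ?N = "mat n n (\<lambda>(i, j). to_ac (eps j (d i)))"
  have "?N * ?g = 1\<^sub>m n"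
    by (rule eq_matI)
       (auto simp: scalar_prod_def atLeast0LessThan ex2 d E.eps_e simp flip: to_ac_mult to_ac_sum)
  then have "?g * ?N = 1\<^sub>m n" by (rule mat_mult_left_right_inverse[rotated 2]) auto
  then show "invertible_mat ?g"
    using \<open>?N * ?g = 1\<^sub>m n\<close> unfolding invertible_mat_def inverts_mat_def square_mat.simps by auto
  show "\<forall>a\<in>carrier A. ?g * ?\<rho> a = transpose_mat (?\<rho> (\<tau> a)) * ?g"
  proof (intro ballI eq_matI)
    fix a i j assume a: "a \<in> carrier A" and "i < dim_row (transpose_mat (?\<rho> (\<tau> a)) * ?g)"
      "j < dim_col (transpose_mat (?\<rho> (\<tau> a)) * ?g)"
    then have ij: "i < n" "j < n" by auto
    show "(?g * ?\<rho> a) $$ (i, j) = (transpose_mat (?\<rho> (\<tau> a)) * ?g) $$ (i, j)"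
      using ij adj[OF a, of "e i" "e j"]
      by (simp add: scalar_prod_def atLeast0LessThan ex1 ex2 flip: to_ac_mult to_ac_sum)
  qed auto
qed

end

text \<open>The form belonging to the involution satisfies \<open>b(y, x) = c b(x, y)\<close> with
  \<open>c * c = 1\<close>. If \<open>c\<close> were not 1, the form would be alternating in
  characteristic other than 2, against orthogonality. The quadratic form must be the semitrace of
  the tensor squares, and the trace condition says precisely that \<open>b\<close> is its polar
  form.\<close>

lemma quadratic_pair_realize:
  fixes A :: "('f::field, 'a, 'f) qp_algebra" and s :: "'f \<Rightarrow> 'v::ab_group_add \<Rightarrow> 'v"
  assumes S: "split_alg A s n e eps \<gamma>" and Q: "quadratic_pair A"
  shows "\<exists>V. scal V = s \<and> qp_split A V n e eps \<gamma>"
proof -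
  interpret S: split_alg A s n e eps \<gamma> by fact
  let ?\<tau> = "invol A"
  note d = alg_homD[OF S.dl_hom, simplified]
  have inv: "involution_on A ?\<tau>"
    using Q by (auto simp: quadratic_pair_def orthogonal_involution_def symplectic_involution_def split: if_splits)
  then have sc: "?\<tau> a \<in> carrier A" and ss: "?\<tau> (?\<tau> a) = a" if "a \<in> carrier A" for a
    using that by (auto simp: involution_on_def Pi_iff)
  obtain b c where B: "\<And>x. lin s (*) (b x)" "\<And>y. lin s (*) (\<lambda>x. b x y)"
    and nd: "\<And>x. (\<And>y. b x y = 0) \<Longrightarrow> x = 0"
    and adj: "\<And>h x y. lin s s h \<Longrightarrow> b (h x) y = b x (\<gamma> (?\<tau> (S.dl h)) y)" and c: "\<And>x y. b y x = c * b x y"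
    using S.adjoint_form[OF inv] by metis
  have adj1: "b (\<gamma> a x) y = b x (\<gamma> (?\<tau> a) y)" if "a \<in> carrier A" for a x y
    using adj[OF S.g_lin[OF that]] that by simp
  have adj2: "b x (\<gamma> a y) = b (\<gamma> (?\<tau> a) x) y" if "a \<in> carrier A" for a x y
    using adj1[OF sc[OF that]] ss that by simp
  have "c = 1"
  proof (rule ccontr)
    assume c1: "c \<noteq> 1"
    obtain x y where xy: "b x y \<noteq> 0" using nd S.e_nonzero by blast
    have "b x y = c * (c * b x y)" using c[of y x] c[of x y] by metis
    then have "c * c = 1" using xy by simp
    then have cm: "c = -1" using c1 by (simp add: square_eq_1_iff)
    then have two: "(2::'f) \<noteq> 0" using c1 by (metis add_eq_0_iff2 one_add_one)
    have "CHAR('f) \<noteq> 2" using two of_nat_CHAR[where 'a='f] by (metis of_nat_numeral)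
    moreover have "symplectic_involution A ?\<tau>"
    proof (rule S.alternating_imp_symplectic[OF inv B nd adj2])
      show "b x x = 0" for x using c[of x x] two cm by simp
    qed
    ultimately show False using Q by (simp add: quadratic_pair_def orthogonal_involution_def)
  qed
  then have sym: "b y x = b x y" for x y using c by simp
  define T where "T x y = S.E.op1 x (b y)" for x y
  have T: "lin s s (T x y)" for x y unfolding T_def by (rule S.E.op1_lin[OF B(1)])
  have Tadd: "T (x + x') y = (\<lambda>z. T x y z + T x' y z)" "T x (y + y') = (\<lambda>z. T x y z + T x y' z)"
    "T (s c x) y = (\<lambda>z. s c (T x y z))" "T x (s c y) = (\<lambda>z. s c (T x y z))" for x x' y y' c
    by (auto simp: T_def S.E.op1_def S.E.scale_right_distrib S.E.scale_left_distrib
        lin_add[OF B(2)] lin_scale[OF B(2)] mult.commute)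
  have invT: "?\<tau> (S.dl (T x y)) = S.dl (T y x)" for x y
  proof (rule S.g_inj)
    have "\<gamma> (?\<tau> (S.dl (T x y))) u = T y x u" for u
    proof -
      have "b (\<gamma> (?\<tau> (S.dl (T x y))) u - T y x u) z = 0" for z
      proof -
        have "b (\<gamma> (?\<tau> (S.dl (T x y))) u) z = b u (T x y z)"
          using adj2[of "S.dl (T x y)" u z] T by simp
        also have "\<dots> = b (T y x u) z"
          unfolding T_def S.E.op1_def lin_scale[OF B(1)] lin_scale[OF B(2)] sym[of u] by (rule mult.commute)
        finally show ?thesis by (simp add: lin_diff[OF B(2)])
      qed
      from nd[OF this] show ?thesis by simp
    qed
    then show "\<gamma> (?\<tau> (S.dl (T x y))) = \<gamma> (S.dl (T y x))" using T by auto
  qed (use T sc in auto)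
  define q where "q x = semitrace A (S.dl (T x x))" for x
  have lin: "linear_on_Sym A ?\<tau> (semitrace A)" and trd: "\<And>a. a \<in> carrier A \<Longrightarrow> semitrace A (a \<oplus>\<^bsub>A\<^esub> ?\<tau> a) = Trd A a"
    using Q by (auto simp: quadratic_pair_def)
  have SymT: "S.dl (T x x) \<in> Sym A ?\<tau>" for x using invT T by (simp add: Sym_def)
  define V where "V = \<lparr>scal = s, form = q\<rparr>"
  have V: "scal V = s" "form V = q" by (simp_all add: V_def)
  have polar: "polar V x y = b x y" for x y
  proof -
    let ?m = "S.dl (T x y) \<oplus>\<^bsub>A\<^esub> S.dl (T y x)"
    have m: "?m \<in> Sym A ?\<tau>"
      using inv T sc by (simp add: Sym_def involution_on_def invT S.a_comm)
    have "T (x + y) (x + y) = (\<lambda>z. (T x x z + T y y z) + (T x y z + T y x z))"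
      by (auto simp: Tadd)
    then have "S.dl (T (x + y) (x + y)) = (S.dl (T x x) \<oplus>\<^bsub>A\<^esub> S.dl (T y y)) \<oplus>\<^bsub>A\<^esub> ?m"
      using T by (simp add: d lin_plus)
    moreover have "S.dl (T x x) \<oplus>\<^bsub>A\<^esub> S.dl (T y y) \<in> Sym A ?\<tau>"
      using inv T by (simp add: Sym_def involution_on_def invT)
    ultimately have "q (x + y) = q x + q y + semitrace A ?m"
      using lin m SymT unfolding linear_on_Sym_def q_def by simp
    also have "semitrace A ?m = b x y"
    proof -
      have "semitrace A ?m = Trd A (S.dl (T x y))" using trd[of "S.dl (T x y)"] T by (simp add: invT)
      also have "\<dots> = S.E.tr (T x y)" using S.Trd_eq[of "S.dl (T x y)"] T by simp
      also have "\<dots> = b y x" unfolding T_def by (rule S.E.tr_op1[OF B(1)])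
      finally show ?thesis by (simp only: sym[of x y])
    qed
    finally show ?thesis by (simp add: polar_def V)
  qed
  have "quadratic_space V"
    unfolding quadratic_space_def V
  proof (intro conjI allI impI)
    show "\<exists>B. finite_dimensional_vector_space s B" using S.E.fd by blast
    show "q (s c x) = c\<^sup>2 * q x" for c x
    proof -
      have "T (s c x) (s c x) = (\<lambda>z. s (c\<^sup>2) (T x x z))" by (auto simp: Tadd power2_eq_square)
      then have "S.dl (T (s c x) (s c x)) = c\<^sup>2 \<odot>\<^bsub>A\<^esub> S.dl (T x x)" using T by (simp add: d)
      then show ?thesis using lin SymT unfolding linear_on_Sym_def q_def by simp
    qed
    show "lin s (*) (polar V x)" for x using B(1)[of x] by (simp add: polar[abs_def])
    show "x = 0" if "\<forall>y. polar V x y = 0" for x using that nd by (simp add: polar)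
  qed
  then interpret V: qspace V n e eps
    by (auto simp: qspace_def qspace_axioms_def V S.E.vbase_axioms)
  have ad: "\<gamma> (?\<tau> a) = adjoint_invol V (\<gamma> a)" if "a \<in> carrier A" for a
    by (rule V.ad_unique[symmetric]) (use that adj2 in \<open>auto simp: polar V\<close>)
  have tens: "tens V x y = T x y" for x y by (auto simp: tens_def T_def S.E.op1_def polar V)
  have symV: "S.dl h \<in> Sym A ?\<tau>" if "h \<in> V.SymV" for h
  proof -
    have h: "lin s s h" "adjoint_invol V h = h" using that unfolding V.SymV by (simp_all add: V)
    have "?\<tau> (S.dl h) = S.dl h" by (rule S.g_inj) (use h sc ad in auto)
    then show ?thesis using h by (simp add: Sym_def)
  qed
  have st: "semitrace A a = form_semitrace V (\<gamma> a)" if a: "a \<in> Sym A ?\<tau>" for a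
  proof -
    have ac: "a \<in> carrier A" "?\<tau> a = a" using a by (auto simp: Sym_def)
    have g: "\<gamma> a \<in> V.SymV" unfolding V.SymV using ad[OF ac(1)] ac by (simp add: V)
    have "semitrace A (S.dl (\<gamma> a)) = V.tr (V.lop \<circ> \<gamma> a)"
    proof (rule V.form_semitrace_eq(2)[OF _ _ g, where f="\<lambda>h. semitrace A (S.dl h)"])
      have l: "lin s s h" if "h \<in> V.SymV" for h using that unfolding V.SymV by (simp add: V)
      show "linear_on_Sym (End_algebra (scal V)) (adjoint_invol V) (\<lambda>h. semitrace A (S.dl h))"
        using lin symV l unfolding linear_on_Sym_def by (simp add: d V)
      show "semitrace A (S.dl (tens V x x)) = form V x" for x by (simp add: tens V q_def)
    qed
    then show ?thesis using V.form_semitrace_eq(1)[OF g] ac by simp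
  qed
  have "qp_split A V n e eps \<gamma>"
    unfolding qp_split_def qp_split_axioms_def using S V.qspace_axioms sc ad st by (simp add: V)
  then show ?thesis using V(1) by blast
qed

text \<open>\<open>split_algebra\<close> leaves the matrix size open; comparing dimensions
  identifies it with the degree \<open>n\<close>.\<close>

lemma split_alg_exists:
  fixes A :: "('f::field, 'a, 'm) module_scheme"
  assumes A: "is_algebra A" "alg_dim A = n\<^sup>2" and sp: "split_algebra A" and n: "CARD('n::finite) = n"
  shows "\<exists>e eps \<gamma>. split_alg A ((*s) :: 'f \<Rightarrow> 'f ^ 'n \<Rightarrow> 'f ^ 'n) n e eps \<gamma>"
proof -
  interpret falg A by unfold_locales fact
  obtain k h where h: "h \<in> alg_iso A (module_mat TYPE('f) k k)" using sp by (auto simp: split_algebra_def)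
  note hh = alg_homD[OF alg_isoD(1)[OF h], unfolded module_mat_simps]
  have "alg_dim A = k * k"
  proof (rule alg_dim_eqI[OF vs])
    let ?f = "\<lambda>M. Matrix.vec (k * k) (\<lambda>i. M $$ (i div k, i mod k))"
    have "bij_betw h (carrier A) (carrier_mat k k)" using alg_isoD(2)[OF h] by (simp add: module_mat_simps)
    from bij_betw_trans[OF this mat_vec_bij]
    show "bij_betw (?f \<circ> h) (carrier A) (carrier_vec (k * k))" .
    have d: "i div k < k \<and> i mod k < k" if "i < k * k" for i
      using that by (cases "k = 0") (auto simp: less_mult_imp_div_less)
    fix x y c assume x: "x \<in> carrier A"
    show "(?f \<circ> h) (c \<odot>\<^bsub>A\<^esub> x) = c \<cdot>\<^sub>v (?f \<circ> h) x"
      using hh(1)[OF x] hh(5)[OF x] d by (intro eq_vecI) auto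
    assume y: "y \<in> carrier A"
    show "(?f \<circ> h) (x \<oplus>\<^bsub>A\<^esub> y) = (?f \<circ> h) x + (?f \<circ> h) y"
      using hh(1)[OF x] hh(1)[OF y] hh(2)[OF x y] d by (intro eq_vecI) auto
  qed
  then have "k = n" using A(2) by (simp add: power2_eq_square[symmetric] power_eq_iff_eq_base)
  have "n > 0" using n by auto
  obtain e eps where "vbase ((*s) :: 'f \<Rightarrow> 'f ^ 'n \<Rightarrow> 'f ^ 'n) n e eps"
    using vbase_exists[OF vec.finite_dimensional_vector_space_axioms vec_dim_card[where 'a='f and 'n='n]] n by blast
  then interpret E: vbase "(*s) :: 'f \<Rightarrow> 'f ^ 'n \<Rightarrow> 'f ^ 'n" n e eps .
  have "inv_into (carrier (End_algebra (*s))) (\<lambda>h. mat n n (\<lambda>(i, j). eps i (h (e j)))) \<circ> h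
    \<in> alg_iso A (End_algebra ((*s) :: 'f \<Rightarrow> 'f ^ 'n \<Rightarrow> 'f ^ 'n))"
    using alg_iso_comp[OF h[unfolded \<open>k = n\<close>] alg_iso_inv[OF End_is_algebra[OF E.vs] E.mat_End_iso]] .
  then have "split_alg A ((*s) :: 'f \<Rightarrow> 'f ^ 'n \<Rightarrow> 'f ^ 'n) n e eps
    (inv_into (carrier (End_algebra (*s))) (\<lambda>h. mat n n (\<lambda>(i, j). eps i (h (e j)))) \<circ> h)"
    using \<open>n > 0\<close> by unfold_locales
  then show ?thesis by blast
qed

section \<open>Representations of a product of two endomorphism algebras\<close>

lemma split_pair_swap:
  assumes "split_pair A s n e eps s' e' eps' p q"
  shows "split_pair A s' n e' eps' s e eps q p"
proof -
  interpret split_pair A s n e eps s' e' eps' p q by fact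
  have "bij_betw prod.swap ({h. lin s s h} \<times> {h. lin s' s' h}) ({h. lin s' s' h} \<times> {h. lin s s h})"
    by (rule bij_betwI[where g = prod.swap]) auto
  from bij_betw_trans[OF pq_bij this]
  show ?thesis by unfold_locales (simp_all add: comp_def q_hom p_hom n_pos)
qed

context split_pair
begin

text \<open>On the ideal formed by the first factor \<open>skolem_noether\<close> applies, even
  though the restriction is not known to be unital. The idempotent \<open>(id, 0)\<close> then fixes
  every \<open>u v\<close>, so \<open>a\<close> may be replaced by its product with this idempotent,
  which lies in the ideal.\<close>

lemma hom_factor_first:
  assumes W: "vbase t n e'' eps''" and \<Psi>: "\<Psi> \<in> alg_hom A (End_algebra t)"
    and w: "\<Psi> (pr id (\<lambda>_. 0)) w \<noteq> 0"
  shows "\<exists>u. lin s t u \<and> bij u \<and> (\<forall>a\<in>carrier A. \<forall>v. \<Psi> a (u v) = u (p a v))"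
proof -
  note psi = alg_homD[OF \<Psi>, simplified]
  note P = pr[OF _ lin0(2)]
  have "\<exists>u. lin s t u \<and> bij u \<and> (\<forall>h. lin s s h \<longrightarrow> \<Psi> (pr h (\<lambda>_. 0)) \<circ> u = u \<circ> h)"
  proof (rule skolem_noether[where \<psi>="\<lambda>h. \<Psi> (pr h (\<lambda>_. 0))", OF E.vbase_axioms W _ _ _ _ linid(1) w])
    fix h k c assume h: "lin s s h"
    show "lin t t (\<Psi> (pr h (\<lambda>_. 0)))" using psi(1)[OF P(1)[OF h]] .
    have "pr (\<lambda>x. s c (h x)) (\<lambda>_. 0) = c \<odot> pr h (\<lambda>_. 0)"
      using h P by (intro pr_eq) (auto simp: p_smult q_smult fun_eq_iff)
    then show "\<Psi> (pr (\<lambda>x. s c (h x)) (\<lambda>_. 0)) = (\<lambda>x. t c (\<Psi> (pr h (\<lambda>_. 0)) x))"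
      using psi(5)[OF P(1)[OF h]] by simp
    assume k: "lin s s k"
    have "pr (h \<circ> k) (\<lambda>_. 0) = pr h (\<lambda>_. 0) \<otimes> pr k (\<lambda>_. 0)"
      "pr (\<lambda>x. h x + k x) (\<lambda>_. 0) = pr h (\<lambda>_. 0) \<oplus> pr k (\<lambda>_. 0)"
      using h k P by (auto intro!: pr_eq simp: p_mult q_mult p_add q_add fun_eq_iff)
    then show "\<Psi> (pr (h \<circ> k) (\<lambda>_. 0)) = \<Psi> (pr h (\<lambda>_. 0)) \<circ> \<Psi> (pr k (\<lambda>_. 0))"
      "\<Psi> (pr (\<lambda>x. h x + k x) (\<lambda>_. 0)) = (\<lambda>x. \<Psi> (pr h (\<lambda>_. 0)) x + \<Psi> (pr k (\<lambda>_. 0)) x)"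
      using psi(2,3)[OF P(1)[OF h] P(1)[OF k]] by simp_all
  qed
  then obtain u where u: "lin s t u" "bij u" "\<And>h v. lin s s h \<Longrightarrow> \<Psi> (pr h (\<lambda>_. 0)) (u v) = u (h v)"
    by (metis comp_apply)
  have "\<Psi> a (u v) = u (p a v)" if a: "a \<in> carrier A" for a v
  proof -
    have "\<Psi> a (u v) = \<Psi> a (\<Psi> (pr id (\<lambda>_. 0)) (u v))" using u(3)[OF linid(1)] by simp
    also have "\<dots> = \<Psi> (a \<otimes> pr id (\<lambda>_. 0)) (u v)" using psi(3)[OF a P(1)[OF linid(1)]] by simp
    also have "a \<otimes> pr id (\<lambda>_. 0) = pr (p a) (\<lambda>_. 0)"
      using a P[OF linid(1)] lin_zero[OF q_lin[OF a]] by (intro pr_eq[symmetric]) (auto simp: p_mult q_mult)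
    also have "\<Psi> (pr (p a) (\<lambda>_. 0)) (u v) = u (p a v)" using u(3) a by simp
    finally show ?thesis .
  qed
  then show ?thesis using u(1,2) by blast
qed

text \<open>The idempotents \<open>(id, 0)\<close> and \<open>(0, id)\<close> add up to the unit, so
  one of them acts nontrivially. The target has the dimension \<open>n\<close> of a simple module of
  either factor, so that factor already determines the whole representation.\<close>

lemma hom_factor:
  assumes W: "vbase t n e'' eps''" and \<Psi>: "\<Psi> \<in> alg_hom A (End_algebra t)"
  shows "(\<exists>u. lin s t u \<and> bij u \<and> (\<forall>a\<in>carrier A. \<forall>v. \<Psi> a (u v) = u (p a v))) \<or>
    (\<exists>u. lin s' t u \<and> bij u \<and> (\<forall>a\<in>carrier A. \<forall>v. \<Psi> a (u v) = u (q a v)))"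
proof -
  interpret W: vbase t n e'' eps'' by fact
  interpret T: split_pair A s' n e' eps' s e eps q p by (rule split_pair_swap) unfold_locales
  note psi = alg_homD[OF \<Psi>, simplified]
  have T: "T.pr id (\<lambda>_. 0) = pr (\<lambda>_. 0) id"
    by (rule T.pr_eq) (simp_all add: pr[OF lin0(1) linid(2)])
  have "e'' 0 \<noteq> 0" using W.eps_e[of 0 0] n_pos lin_zero[OF W.eps_lin[of 0]] by auto
  moreover have "pr id (\<lambda>_. 0) \<oplus> pr (\<lambda>_. 0) id = \<one>"
    using pr[OF lin0(1) linid(2)] pr[OF linid(1) lin0(2)]
    by (intro pq_inj) (auto simp: p_add q_add)
  then have "id = (\<lambda>x. \<Psi> (pr id (\<lambda>_. 0)) x + \<Psi> (pr (\<lambda>_. 0) id) x)"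
    using psi(2)[OF pr(1)[OF linid(1) lin0(2)] pr(1)[OF lin0(1) linid(2)]] psi(4) by simp
  note fun_cong[OF this, of "e'' 0"]
  ultimately consider "\<Psi> (pr id (\<lambda>_. 0)) (e'' 0) \<noteq> 0" | "\<Psi> (pr (\<lambda>_. 0) id) (e'' 0) \<noteq> 0" by fastforce
  then show ?thesis
  proof cases
    case 1
    then show ?thesis using hom_factor_first[OF W \<Psi>] by blast
  next
    case 2
    then show ?thesis using T.hom_factor_first[OF W \<Psi>, unfolded T] by blast
  qed
qed

end

text \<open>In a module over the full Clifford algebra \<open>x0\<close> would map \<open>W3\<close>
  to \<open>W2\<close>; \<open>u\<close> takes over this role. Writing a vector \<open>x\<close> as
  the inverse of \<open>x0\<close> times \<open>x0 x\<close>, or as \<open>(x x0) x0\<close> divided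
  by \<open>q(x\<^sub>0)\<close>, dictates the formulas for \<open>l\<close> and
  \<open>r\<close>.\<close>

lemma spin_pair_from_intertwiner:
  assumes H2: "half_spin_key V n e eps W2 n e2 eps2 mu2" and H3: "half_spin_key V n e eps W3 n e3 eps3 mu3"
    and x0: "form V x0 \<noteq> 0" and u: "lin (scal W3) (scal W2) u" "bij u"
    and inter: "\<And>x y w. scal W2 (inverse (form V x0)) (mu2 x0 x (mu2 y x0 (u w))) = u (mu3 x y w)"
  shows "\<exists>l r. spin_pair V n e eps W2 e2 eps2 mu2 W3 e3 eps3 mu3 l r"
proof -
  interpret H2: half_spin_key V n e eps W2 n e2 eps2 mu2 by fact
  interpret H3: half_spin_key V n e eps W3 n e3 eps3 mu3 by fact
  let ?q = "form V x0"
  define u' where "u' = inv_into UNIV u"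
  have u': "lin (scal W2) (scal W3) u'" unfolding u'_def by (rule lin_inv[OF u])
  have uu: "u (u' v) = v" "u' (u w) = w" for v w
    using u(2) by (simp_all add: u'_def bij_def surj_f_inv_f)
  define l where "l x v = u' (mu2 x0 x v)" for x v
  define r where "r x w = scal W2 (inverse ?q) (mu2 x x0 (u w))" for x w
  have "spin_pair V n e eps W2 e2 eps2 mu2 W3 e3 eps3 mu3 l r"
  proof (intro spin_pair.intro spin_pair_axioms.intro H2 H3)
    show "lin (scal W2) (scal W3) (l x)" for x
      using lin_comp[OF H2.mu_lin u', of x0 x] by (simp add: l_def[abs_def] comp_def)
    show "lin (scal W3) (scal W2) (r x)" for x
      using lin_smult[OF lin_comp[OF u(1) H2.mu_lin], of "inverse ?q" x x0] by (simp add: r_def[abs_def] comp_def)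
    show "lin (scal V) (scal W3) (\<lambda>x. l x v)" for v
      by (rule linI[OF H2.Q.vs H3.W.vs])
         (simp_all add: l_def H2.mu_add H2.mu_scale lin_add[OF u'] lin_scale[OF u'])
    show "r x (l y v) = mu2 x y v" for x y v
      using x0 by (simp add: l_def r_def uu H2.mu_mult)
    show "l x (r y w) = mu3 x y w" for x y w
      using inter[of x y w] by (simp add: l_def r_def lin_scale[OF H2.mu_lin] uu)
  qed
  then show ?thesis by blast
qed

text \<open>The polar form scales by \<open>c\<close>, which does not affect adjoints. The tensor
  \<open>x \<otimes> x\<close> scales together with the form, so the semitrace stays the same as
  well.\<close>

lemma qp_split_rescale:
  assumes S: "qp_split A V n e eps \<gamma>" and c: "c \<noteq> 0"
  shows "qp_split A (V\<lparr>form := \<lambda>x. c * form V x\<rparr>) n e eps \<gamma>"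
proof -
  interpret S: qp_split A V n e eps \<gamma> by fact
  let ?V = "V\<lparr>form := \<lambda>x. c * form V x\<rparr>"
  have pol: "polar ?V x y = c * polar V x y" for x y by (simp add: polar_def algebra_simps)
  have "quadratic_space ?V"
    unfolding quadratic_space_def
  proof (intro conjI allI impI)
    show "\<exists>B. finite_dimensional_vector_space (scal ?V) B" using S.E.fd by auto
    show "form ?V (scal ?V d x) = d\<^sup>2 * form ?V x" for d x by (simp add: S.q_scale)
    show "lin (scal ?V) (*) (polar ?V x)" for x using lin_smult[OF S.b_lin] by (simp add: pol[abs_def])
    show "x = 0" if "\<forall>y. polar ?V x y = 0" for x using that c by (simp add: pol S.b_nondeg)
  qed
  then interpret V: qspace ?V n e eps
    using S.E.vbase_axioms by (simp add: qspace_def qspace_axioms_def)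
  have ad: "adjoint_invol ?V h = adjoint_invol V h" if "lin (scal V) (scal V) h" for h
    by (rule V.ad_unique) (use that in \<open>simp_all add: pol S.ad_b\<close>)
  have Sym: "s \<in> V.SymV \<longleftrightarrow> s \<in> S.SymV" for s unfolding V.SymV S.SymV using ad by auto
  have st: "form_semitrace ?V s = form_semitrace V s" if s: "s \<in> S.SymV" for s
  proof -
    have lin: "linear_on_Sym (End_algebra (scal ?V)) (adjoint_invol ?V) (form_semitrace V)"
      unfolding linear_on_Sym_def
      using S.Sym_closed Sym S.form_semitrace_eq(1)
      by (auto simp: comp_def lin_add[OF S.lop_lin] lin_scale[OF S.lop_lin] S.E.tr_add S.E.tr_smult)
    have t: "form_semitrace V (tens ?V x x) = form ?V x" for x
    proof -
      have "tens ?V x x = (\<lambda>z. scal V c (tens V x x z))" by (auto simp: tens_def pol)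
      then show ?thesis
        using S.form_semitrace_eq(1)[OF S.Sym_closed(2)[OF S.Sym_tens]] S.form_semitrace_eq(1)[OF S.Sym_tens, of x]
          S.form_semitrace_tens[of x]
        by (simp add: comp_def lin_scale[OF S.lop_lin] S.E.tr_smult)
    qed
    show ?thesis
      using V.form_semitrace_eq(2)[OF lin t] V.form_semitrace_eq(1) s Sym by simp
  qed
  show ?thesis
  proof (unfold_locales)
    fix a
    show "a \<in> carrier A \<Longrightarrow> invol A a \<in> carrier A" by (rule S.invol_closed)
    show "a \<in> carrier A \<Longrightarrow> \<gamma> (invol A a) = adjoint_invol ?V (\<gamma> a)" by (simp add: S.g_invol ad)
    show "a \<in> Sym A (invol A) \<Longrightarrow> semitrace A a = form_semitrace ?V (\<gamma> a)"
      using st by (simp add: S.g_semitrace S.Sym_iff)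
  qed (use S.g_iso S.n_pos in simp_all)
qed

lemma qp_split_iso:
  assumes "qp_split A V n e eps \<gamma>"
  shows "qp_iso A (End_qp V) \<gamma>"
proof -
  interpret S: qp_split A V n e eps \<gamma> by fact
  show ?thesis using S.g_iso S.g_invol S.g_semitrace by (simp add: qp_iso_def alg_hom_End_qp)
qed

text \<open>The semitrace condition is evaluated at the element \<open>s\<close> with components
  \<open>v \<otimes> v\<close> and 0. By \<open>mu_proportional\<close> the reduced trace of
  \<open>c(a) s\<close> is \<open>\<kappa>\<close> on the first factor whenever \<open>a\<close> has
  reduced trace 1, while the semitrace of \<open>v \<otimes> v\<close> is the form at
  \<open>v\<close>; so the factor \<open>\<kappa>\<close>, which depends on \<open>v\<close>, is
  that value.\<close>

lemma half_spin_key_of_factor: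
  assumes S: "qp_split A V n e eps \<gamma>" and W: "qspace W n e' eps'"
    and SP: "split_pair (clifford_algebra A) (scal W) n e' eps' t e'' eps'' P R"
    and invP: "\<And>\<xi>. \<xi> \<in> carrier (clifford_algebra A) \<Longrightarrow> P (clifford_invol A \<xi>) = adjoint_invol W (P \<xi>)"
    and invR: "\<And>\<xi>. \<xi> \<in> carrier (clifford_algebra A) \<Longrightarrow> R \<xi> = (\<lambda>_. 0) \<Longrightarrow> R (clifford_invol A \<xi>) = (\<lambda>_. 0)"
    and st: "\<And>\<xi>. \<xi> \<in> Sym (clifford_algebra A) (clifford_invol A) \<Longrightarrow>
      P (clifford_semitrace A \<xi>) = scal W (form_semitrace W (P \<xi>))"
    and n: "4 < n"
  shows "half_spin_key V n e eps W n e' eps' (\<lambda>x y. P (qp_split.m A V \<gamma> x y))"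
proof -
  interpret S: qp_split A V n e eps \<gamma> by fact
  interpret W: qspace W n e' eps' by fact
  interpret SP: split_pair S.C "scal W" n e' eps' t e'' eps'' P R by fact
  define mu where "mu x y = P (S.m x y)" for x y
  interpret H: half_spin V n e eps W n e' eps' mu
  proof (intro half_spin.intro half_spin_axioms.intro S.qspace_axioms W.qspace_axioms S.n_pos)
    show "lin (scal W) (scal W) (mu x y)" for x y by (simp add: mu_def)
    show "mu (x + x') y v = mu x y v + mu x' y v" "mu x (y + y') v = mu x y v + mu x y' v" for x x' y y' v
      by (simp_all add: mu_def S.m_add SP.p_add)
    show "mu (scal V c x) y v = scal W c (mu x y v)" "mu x (scal V c y) v = scal W c (mu x y v)" for c x y v
      by (simp_all add: mu_def S.m_smult SP.p_smult)
    show "mu x x v = scal W (form V x) v" for x v by (simp add: mu_def S.m_diag SP.p_smult)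
    show "mu x y (mu y z v) = scal W (form V y) (mu x z v)" for x y z v
    proof -
      have "P (S.m x y) (P (S.m y z) v) = P (S.m x y \<otimes>\<^bsub>S.C\<^esub> S.m y z) v" by (simp add: SP.p_mult)
      then show ?thesis by (simp add: mu_def S.m_mult SP.p_smult)
    qed
    show "polar W (mu x y v) w = polar W v (mu y x w)" for x y v w
      using W.ad_b'[OF SP.p_lin[OF S.m_closed], of x y v w] invP[OF S.m_closed, of x y]
      by (simp add: mu_def S.clifford_invol_m)
    fix T assume T: "lin (scal W) (scal W) T" and comm: "\<And>x y v. T (mu x y v) = mu x y (T v)"
    have all: "T (P \<xi> v) = P \<xi> (T v)" if "\<xi> \<in> carrier S.C" for \<xi> v
    proof (rule commutes_all[OF S SP.p_hom T _ that])
      fix a x y v assume a: "a \<in> carrier A" "\<gamma> a = tens V x y"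
      then have "a = S.dl (tens V x y)" by (metis S.dl_g)
      then show "T (P (clifford_map A a) v) = P (clifford_map A a) (T v)"
        using comm[of x y v] by (simp add: mu_def S.m_def)
    qed
    have "T \<circ> h = h \<circ> T" if h: "lin (scal W) (scal W) h" for h
      using all[OF SP.pr(1)[OF h SP.lin0(2)]] SP.pr(2)[OF h SP.lin0(2)] by (auto simp: fun_eq_iff)
    then have "T w = scal W (eps' 0 (T (e' 0))) w" for w by (rule W.scalar_if_commutes[OF T S.n_pos])
    then show "\<exists>c. \<forall>v. T v = scal W c v" by blast
  qed
  have key: "polar W v (mu x y v) = polar V x y * form W v" for x y v
  proof -
    obtain \<kappa> where kappa: "\<And>x y. polar W v (mu x y v) = \<kappa> * polar V x y" using H.mu_proportional[OF n] by blast
    have part: "polar W v (P (clifford_map A (S.dl (\<lambda>z. \<Sum>k<(j::nat). tens V (f k) (g k) z))) v) =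
        (\<Sum>k<j. \<kappa> * polar V (f k) (g k)) \<and> lin (scal V) (scal V) (\<lambda>z. \<Sum>k<j. tens V (f k) (g k) z)" for j f g
    proof (induction j)
      case 0
      have eq: "S.dl (\<lambda>z. 0) = 0 \<odot>\<^bsub>A\<^esub> S.dl (tens V 0 0)"
        using S.dl_smult[of "tens V 0 0" 0] by simp
      have "P (clifford_map A (S.dl (\<lambda>z. 0))) = (\<lambda>x. scal W 0 (P (clifford_map A (S.dl (tens V 0 0))) x))"
        unfolding eq S.cm_smult[OF S.dl_closed[OF S.tens_lin]]
          SP.p_smult[OF S.cm_closed[OF S.dl_closed[OF S.tens_lin]]] ..
      then show ?case by (simp add: lin_0 S.E.vs)
    next
      case (Suc j)
      then have l: "lin (scal V) (scal V) (\<lambda>z. \<Sum>k<j. tens V (f k) (g k) z)" by blast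
      show ?case using Suc l kappa[of "f j" "g j"]
        by (simp add: S.dl_add S.cm_add SP.p_add lin_plus mu_def S.m_def)
    qed
    \<comment> \<open>Both sides are linear in \<open>a\<close>, and on \<open>x \<otimes> y\<close>
      they agree because its reduced trace is \<open>b(x, y)\<close>.\<close>
    have tr: "polar W v (P (clifford_map A a) v) = \<kappa> * Trd A a" if a: "a \<in> carrier A" for a
    proof -
      have "\<gamma> a = (\<lambda>z. \<Sum>k<n. tens V (\<gamma> a (e k)) (S.du k) z)"
        by (rule ext) (rule S.lin_expand[OF S.g_lin[OF a]])
      then have "a = S.dl (\<lambda>z. \<Sum>k<n. tens V (\<gamma> a (e k)) (S.du k) z)" using a by (metis S.dl_g)
      moreover have "polar W v (P (clifford_map A (S.dl (\<lambda>z. \<Sum>k<n. tens V (\<gamma> a (e k)) (S.du k) z))) v)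
          = (\<Sum>k<n. \<kappa> * polar V (\<gamma> a (e k)) (S.du k))"
        by (rule conjunct1[OF part])
      ultimately have "polar W v (P (clifford_map A a) v) = (\<Sum>k<n. \<kappa> * polar V (\<gamma> a (e k)) (S.du k))"
        by simp
      then show ?thesis using a by (simp add: S.du' S.Trd_eq S.E.tr_def sum_distrib_left)
    qed
    define s where "s = SP.pr (tens W v v) (\<lambda>_. 0)"
    note s = SP.pr[OF W.tens_lin SP.lin0(2), of v v, folded s_def]
    have ic: "clifford_invol A s \<in> carrier S.C"
      using S.clifford_invol_props(1) s(1) by (auto simp: involution_on_def)
    have "clifford_invol A s = s"
      by (rule SP.pq_inj[OF ic s(1)]) (simp_all add: invP[OF s(1)] invR[OF s(1) s(3)] s W.ad_tens)
    then have sS: "s \<in> Sym S.C (clifford_invol A)" using s(1) by (simp add: Sym_def)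
    have t0: "SP.E'.tr (\<lambda>_. 0) = 0" unfolding SP.E'.tr_def by (simp add: lin_zero[OF SP.E'.eps_lin])
    let ?z = "SP.pr (scal W \<kappa>) (t 0)"
    have z: "Trd_centre S.C (clifford_map A a \<otimes>\<^bsub>S.C\<^esub> s) = ?z" if a: "a \<in> carrier A" "Trd A a = 1" for a
    proof -
      have "P (clifford_map A a \<otimes>\<^bsub>S.C\<^esub> s) = tens W (P (clifford_map A a) v) v"
        using a s W.comp_tens[OF SP.p_lin[OF S.cm_closed[OF a(1)]]] by (simp add: SP.p_mult)
      moreover have "R (clifford_map A a \<otimes>\<^bsub>S.C\<^esub> s) = (\<lambda>_. 0)"
        using a s lin_zero[OF SP.q_lin[OF S.cm_closed[OF a(1)]]] by (auto simp: SP.q_mult)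
      ultimately show ?thesis
        using SP.Trd_centre_eq[of "clifford_map A a \<otimes>\<^bsub>S.C\<^esub> s"] a s tr[OF a(1)]
        by (simp add: t0 W.tr_tens)
    qed
    have "clifford_semitrace A s = ?z"
      unfolding clifford_semitrace_def
    proof (rule the_equality)
      show "\<forall>a\<in>carrier A. Trd A a = 1 \<longrightarrow> ?z = Trd_centre S.C (clifford_map A a \<otimes>\<^bsub>S.C\<^esub> s)" using z by simp
      \<comment> \<open>An element of reduced trace 1 has to exist, since otherwise the description
        of the semitrace would hold for every value.\<close>
      define a where "a = S.dl (S.E.op1 (e 0) (eps 0))"
      have "lin (scal V) (scal V) (S.E.op1 (e 0) (eps 0))" by (rule S.E.op1_lin[OF S.E.eps_lin[OF S.n_pos]])
      then have a: "a \<in> carrier A" "Trd A a = 1"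
        using S.n_pos by (simp_all add: a_def S.Trd_eq S.E.tr_op1[OF S.E.eps_lin] S.E.eps_e)
      fix y assume "\<forall>a\<in>carrier A. Trd A a = 1 \<longrightarrow> y = Trd_centre S.C (clifford_map A a \<otimes>\<^bsub>S.C\<^esub> s)"
      then show "y = ?z" using a z by metis
    qed
    then have "scal W \<kappa> = scal W (form W v)"
      using st[OF sS] s(2) SP.pr(2)[OF SP.scal_lin] by (simp add: W.form_semitrace_tens)
    from fun_cong[OF this, of "e' 0"] have "\<kappa> = form W v"
      using W.eps_e[of 0 0] S.n_pos lin_zero[OF W.eps_lin[of 0]] by auto
    then show ?thesis using kappa by simp
  qed
  have "half_spin_key V n e eps W n e' eps' mu"
    by (intro half_spin_key.intro half_spin_key_axioms.intro H.half_spin_axioms key)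
  then show ?thesis by (simp add: mu_def[abs_def])
qed

lemma clifford_factors:
  assumes C: "is_algebra (clifford_algebra A)" and n: "n > 0"
    and iso: "qp_iso_centre (clifford_qp A) (qp_prod B D) \<phi>"
    and i2: "qp_iso B (End_qp V2) g2" and i3: "qp_iso D (End_qp V3) g3"
    and V: "qspace V2 n e2 eps2" "qspace V3 n e3 eps3"
  defines "P \<equiv> \<lambda>\<xi>. g2 (fst (\<phi> \<xi>))" and "R \<equiv> \<lambda>\<xi>. g3 (snd (\<phi> \<xi>))"
  shows "split_pair (clifford_algebra A) (scal V2) n e2 eps2 (scal V3) e3 eps3 P R"
    "\<And>\<xi>. \<xi> \<in> carrier (clifford_algebra A) \<Longrightarrow> P (clifford_invol A \<xi>) = adjoint_invol V2 (P \<xi>)"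
    "\<And>\<xi>. \<xi> \<in> carrier (clifford_algebra A) \<Longrightarrow> R (clifford_invol A \<xi>) = adjoint_invol V3 (R \<xi>)"
    "\<And>\<xi>. \<xi> \<in> Sym (clifford_algebra A) (clifford_invol A) \<Longrightarrow>
      P (clifford_semitrace A \<xi>) = scal V2 (form_semitrace V2 (P \<xi>))"
    "\<And>\<xi>. \<xi> \<in> Sym (clifford_algebra A) (clifford_invol A) \<Longrightarrow>
      R (clifford_semitrace A \<xi>) = scal V3 (form_semitrace V3 (R \<xi>))"
proof -
  let ?C = "clifford_algebra A"
  have phi: "\<phi> \<in> alg_iso (clifford_qp A) (qp_prod B D)"
    and inv: "\<And>\<xi>. \<xi> \<in> carrier ?C \<Longrightarrow> \<phi> (clifford_invol A \<xi>) = (invol B (fst (\<phi> \<xi>)), invol D (snd (\<phi> \<xi>)))"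
    and sem: "\<And>\<xi>. \<xi> \<in> Sym ?C (clifford_invol A) \<Longrightarrow> \<phi> (clifford_semitrace A \<xi>) =
      (semitrace B (fst (\<phi> \<xi>)) \<odot>\<^bsub>B\<^esub> \<one>\<^bsub>B\<^esub>, semitrace D (snd (\<phi> \<xi>)) \<odot>\<^bsub>D\<^esub> \<one>\<^bsub>D\<^esub>)"
    using iso by (auto simp: qp_iso_centre_def split_beta Sym_def)
  note h = alg_hom_qp_prod[OF alg_isoD(1)[OF phi]]
  have g2: "g2 \<in> alg_iso B (End_algebra (scal V2))" and g3: "g3 \<in> alg_iso D (End_algebra (scal V3))"
    using i2 i3 by (simp_all add: qp_iso_def alg_hom_End_qp)
  have P: "P \<in> alg_hom ?C (End_algebra (scal V2))" and R: "R \<in> alg_hom ?C (End_algebra (scal V3))"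
    using alg_hom_comp[OF h(1) alg_isoD(1)[OF g2]] alg_hom_comp[OF h(2) alg_isoD(1)[OF g3]]
    by (simp_all add: P_def R_def comp_def)
  have car: "carrier (End_algebra s) = {h. lin s s h}" for s :: "'x::field \<Rightarrow> 'y::ab_group_add \<Rightarrow> 'y" by auto
  have "bij_betw \<phi> (carrier ?C) (carrier B \<times> carrier D)" using alg_isoD(2)[OF phi] by simp
  from bij_betw_trans[OF this bij_betw_map_prod[OF alg_isoD(2)[OF g2] alg_isoD(2)[OF g3]]]
  have bij: "bij_betw (\<lambda>\<xi>. (P \<xi>, R \<xi>)) (carrier ?C) ({h. lin (scal V2) (scal V2) h} \<times> {h. lin (scal V3) (scal V3) h})"
    unfolding car by (rule bij_betw_cong[THEN iffD1, rotated]) (simp add: P_def R_def map_prod_def split_beta)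
  show "split_pair ?C (scal V2) n e2 eps2 (scal V3) e3 eps3 P R"
    using C V P R bij n by (simp add: split_pair_def split_pair_axioms_def falg_def qspace_def)
  have c: "fst (\<phi> \<xi>) \<in> carrier B" "snd (\<phi> \<xi>) \<in> carrier D" if "\<xi> \<in> carrier ?C" for \<xi>
    using alg_homD(1)[OF h(1) that] alg_homD(1)[OF h(2) that] by simp_all
  show "\<xi> \<in> carrier ?C \<Longrightarrow> P (clifford_invol A \<xi>) = adjoint_invol V2 (P \<xi>)"
    "\<xi> \<in> carrier ?C \<Longrightarrow> R (clifford_invol A \<xi>) = adjoint_invol V3 (R \<xi>)" for \<xi>
    using i2 i3 inv c by (simp_all add: qp_iso_def P_def R_def)
  have sym: "fst (\<phi> \<xi>) \<in> Sym B (invol B)" "snd (\<phi> \<xi>) \<in> Sym D (invol D)" if "\<xi> \<in> Sym ?C (clifford_invol A)" for \<xi>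
    using inv[of \<xi>] c[of \<xi>] that by (auto simp: Sym_def) (metis fst_conv, metis snd_conv)
  have one: "\<one>\<^bsub>B\<^esub> \<in> carrier B" "\<one>\<^bsub>D\<^esub> \<in> carrier D"
    using alg_homD(1,4)[OF h(1)] alg_homD(1,4)[OF h(2)] C by (metis falg.intro falg_def is_algebra_def monoid.one_closed ring.is_monoid)+
  have sc: "g2 (c \<odot>\<^bsub>B\<^esub> \<one>\<^bsub>B\<^esub>) = scal V2 c" "g3 (c \<odot>\<^bsub>D\<^esub> \<one>\<^bsub>D\<^esub>) = scal V3 c" for c
    using alg_homD(4,5)[OF alg_isoD(1)[OF g2]] alg_homD(4,5)[OF alg_isoD(1)[OF g3]] one by auto
  show "\<xi> \<in> Sym ?C (clifford_invol A) \<Longrightarrow> P (clifford_semitrace A \<xi>) = scal V2 (form_semitrace V2 (P \<xi>))"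
    "\<xi> \<in> Sym ?C (clifford_invol A) \<Longrightarrow> R (clifford_semitrace A \<xi>) = scal V3 (form_semitrace V3 (R \<xi>))" for \<xi>
    using i2 i3 sem sym by (simp_all add: qp_iso_def P_def R_def sc)
qed

text \<open>The intertwiner \<open>u\<close> comes from twisting the representation \<open>P\<close> on \<open>V2\<close> by the reflection at
  \<open>x\<^sub>0\<close>: it factors through one of the two factors of the Clifford algebra, and through the first
  one only if \<open>P\<close> were paired with itself.\<close>
lemma half_spin_pairing:
  assumes S: "qp_split A V n e eps \<gamma>" and W: "vbase (scal W) n e2 eps2" 
    and SP: "split_pair (clifford_algebra A) (scal W) n e2 eps2 (scal W') e3 eps3 P R"
    and H2: "half_spin_key V n e eps W n e2 eps2 (\<lambda>x y. P (qp_split.m A V \<gamma> x y))"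
    and H3: "half_spin_key V n e eps W' n e3 eps3 (\<lambda>x y. R (qp_split.m A V \<gamma> x y))"
    and n: "2 < n"
  shows "\<exists>l r. spin_pair V n e eps W e2 eps2 (\<lambda>x y. P (qp_split.m A V \<gamma> x y))
    W' e3 eps3 (\<lambda>x y. R (qp_split.m A V \<gamma> x y)) l r"
proof -
  interpret S: qp_split A V n e eps \<gamma> by fact
  let ?mu = "\<lambda>x y. P (S.m x y)"
  interpret H: half_spin_key V n e eps W n e2 eps2 ?mu by fact
  obtain x0 where x0: "form V x0 \<noteq> 0" using S.anisotropic_exists[OF S.n_pos] by blast
  let ?q = "form V x0"
  \<comment> \<open>The conjugate of \<open>x y\<close> by \<open>x0\<close>, whose inverse is
    \<open>x0\<close> divided by its form value, grouped into products of two vectors so that it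
    acts through \<open>P\<close>.\<close>
  define M where "M x y = (\<lambda>v. scal W (inverse ?q) (?mu x0 x (?mu y x0 v)))" for x y
  have Mlin: "lin (scal W) (scal W) (M x y)" for x y
    using lin_smult[OF lin_comp[OF H.mu_lin H.mu_lin]] by (simp add: M_def comp_def)
  interpret E: falg "End_algebra (scal W)" by unfold_locales (rule End_is_algebra[OF H.W.vs])
  have rep: "cliff_rep V n e eps (End_algebra (scal W)) M"
  proof (intro cliff_rep.intro cliff_rep_axioms.intro S.qspace_axioms E.falg_axioms)
    show "M x y \<in> carrier (End_algebra (scal W))" for x y using Mlin by simp
    show "M (x + x') y = M x y \<oplus>\<^bsub>End_algebra (scal W)\<^esub> M x' y"
      "M x (y + y') = M x y \<oplus>\<^bsub>End_algebra (scal W)\<^esub> M x y'" for x x' y y'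
      by (auto simp: M_def H.mu_add lin_add[OF H.mu_lin] H.W.scale_right_distrib)
    show "M (scal V c x) y = c \<odot>\<^bsub>End_algebra (scal W)\<^esub> M x y"
      "M x (scal V c y) = c \<odot>\<^bsub>End_algebra (scal W)\<^esub> M x y" for c x y
      by (auto simp: M_def H.mu_scale lin_scale[OF H.mu_lin] mult.commute)
    show "M x x = form V x \<odot>\<^bsub>End_algebra (scal W)\<^esub> \<one>\<^bsub>End_algebra (scal W)\<^esub>" for x
      using x0 by (auto simp: M_def H.mu_mult H.mu_diag mult.commute)
    show "M x y \<otimes>\<^bsub>End_algebra (scal W)\<^esub> M y z = form V y \<odot>\<^bsub>End_algebra (scal W)\<^esub> M x z" for x y z
    proof
      fix v
      have "?mu x0 x (?mu y x0 (?mu x0 y (?mu z x0 v))) = scal W (?q * form V y) (?mu x0 x (?mu z x0 v))"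
        by (simp add: H.mu_mult H.mu_diag lin_scale[OF H.mu_lin])
      then show "(M x y \<otimes>\<^bsub>End_algebra (scal W)\<^esub> M y z) v = (form V y \<odot>\<^bsub>End_algebra (scal W)\<^esub> M x z) v"
        using x0 by (simp add: M_def lin_scale[OF H.mu_lin])
    qed
  qed
  obtain \<Psi> where Psi: "\<Psi> \<in> alg_hom S.C (End_algebra (scal W))" and PM: "\<And>x y. \<Psi> (S.m x y) = M x y"
    using S.clifford_universal[OF rep] by blast
  consider u where "lin (scal W) (scal W) u" "bij u" "\<forall>\<xi>\<in>carrier S.C. \<forall>v. \<Psi> \<xi> (u v) = u (P \<xi> v)"
    | u where "lin (scal W') (scal W) u" "bij u" "\<forall>\<xi>\<in>carrier S.C. \<forall>v. \<Psi> \<xi> (u v) = u (R \<xi> v)"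
    using split_pair.hom_factor[OF SP W Psi] by blast
  then show ?thesis
  proof cases
    case 1
    have "scal W (inverse ?q) (?mu x0 x (?mu y x0 (u w))) = u (?mu x y w)" for x y w
      using 1(3) PM[of x y] by (metis M_def S.m_closed)
    then show ?thesis using spin_pair_from_intertwiner[OF H2 H2 x0 1(1,2)] no_self_pairing[OF _ n] by blast
  next
    case 2
    have "scal W (inverse ?q) (?mu x0 x (?mu y x0 (u w))) = u (R (S.m x y) w)" for x y w
      using 2(3) PM[of x y] by (metis M_def S.m_closed)
    then show ?thesis using spin_pair_from_intertwiner[OF H2 H3 x0 2(1,2)] by blast
  qed
qed

lemma split_triple_realize:
  assumes S1: "qp_split A1 V1 n e1 eps1 g1" and S2: "qp_split A2 V2 n e2 eps2 g2" and S3: "qp_split A3 V3 n e3 eps3 g3"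
    and iso: "qp_iso_centre (clifford_qp A1) (qp_prod A2 A3) \<phi>" and n: "4 < n"
  shows "\<exists>c l. composition (V1, V2, V3\<lparr>form := \<lambda>x. c * form V3 x\<rparr>, l) n \<and>
    triple_isomorphic (A1, A2, A3, \<phi>) (End_comp (V1, V2, V3\<lparr>form := \<lambda>x. c * form V3 x\<rparr>, l))"
proof -
  interpret S1: qp_split A1 V1 n e1 eps1 g1 by fact
  have Q: "qspace V2 n e2 eps2" "qspace V3 n e3 eps3" using S2 S3 by (simp_all add: qp_split_def)
  define P where "P \<xi> = g2 (fst (\<phi> \<xi>))" for \<xi>
  define R where "R \<xi> = g3 (snd (\<phi> \<xi>))" for \<xi>
  note cf = clifford_factors[OF S1.C_algebra S1.n_pos iso qp_split_iso[OF S2] qp_split_iso[OF S3] Q,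
      folded P_def R_def]
  have H2: "half_spin_key V1 n e1 eps1 V2 n e2 eps2 (\<lambda>x y. P (S1.m x y))"
    by (rule half_spin_key_of_factor[OF S1 Q(1) cf(1,2) _ cf(4) n]; simp add: cf(3) qspace.ad_zero[OF Q(2)])
  have H3: "half_spin_key V1 n e1 eps1 V3 n e3 eps3 (\<lambda>x y. R (S1.m x y))"
    by (rule half_spin_key_of_factor[OF S1 Q(2) split_pair_swap[OF cf(1)] cf(3) _ cf(5) n];
        simp add: cf(2) qspace.ad_zero[OF Q(1)])
  have B2: "vbase (scal V2) n e2 eps2" using Q(1) by (simp add: qspace_def)
  obtain l r where SP: "spin_pair V1 n e1 eps1 V2 e2 eps2 (\<lambda>x y. P (S1.m x y)) V3 e3 eps3 (\<lambda>x y. R (S1.m x y)) l r"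
    using half_spin_pairing[OF S1 B2 cf(1) H2 H3] n by auto
  interpret SP: spin_pair V1 n e1 eps1 V2 e2 eps2 "\<lambda>x y. P (S1.m x y)" V3 e3 eps3 "\<lambda>x y. R (S1.m x y)" l r by fact
  obtain \<theta> where theta: "\<theta> \<noteq> 0" "\<And>x v w. polar V3 (l x v) w = \<theta> * polar V2 v (r x w)"
    "\<And>x v. form V3 (l x v) = \<theta> * (form V1 x * form V2 v)"
    using SP.multiplier by blast
  \<comment> \<open>Dividing the form by \<open>\<theta>\<close> keeps \<open>g3\<close> an
    isomorphism of quadratic pairs by \<open>qp_split_rescale\<close> and turns \<open>l\<close>
    into a composition.\<close>
  define V3' where "V3' = V3\<lparr>form := \<lambda>x. inverse \<theta> * form V3 x\<rparr>"
  have V3': "scal V3' = scal V3" "form V3' x = inverse \<theta> * form V3 x" for x by (simp_all add: V3'_def)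
  have pol: "polar V3' x y = inverse \<theta> * polar V3 x y" for x y by (simp add: polar_def V3' algebra_simps)
  have S3': "qp_split A3 V3' n e3 eps3 g3"
    unfolding V3'_def by (rule qp_split_rescale[OF S3]) (use theta(1) in simp)
  have Q3: "qspace V3' n e3 eps3" using S3' by (simp add: qp_split_def)
  have form: "form V3' (l x v) = form V1 x * form V2 v" for x v using theta by (simp add: V3')
  have CC: "comp_space V1 n e1 eps1 V2 e2 eps2 V3' e3 eps3 l"
    using S1.qspace_axioms Q(1) Q3 form SP.l_lin SP.l_lin' S1.n_pos
    by (simp add: comp_space_def comp_space_axioms_def quad_cliff_def V3')
  interpret CC: comp_space V1 n e1 eps1 V2 e2 eps2 V3' e3 eps3 l by fact
  have comp: "composition (V1, V2, V3', l) n"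
    using S1.qs qspace.qs[OF Q(1)] qspace.qs[OF Q3] S1.E.dim_n vbase.dim_n[OF B2]
      vbase.dim_n[OF qspace.axioms(1)[OF Q3]] form SP.l_lin SP.l_lin'
    by (simp add: composition_def V3')
  \<comment> \<open>Adjointness up to \<open>\<theta>\<close> becomes exact adjointness for the
    rescaled form, so the \<open>r\<close> of the spin pair is the derived map
    \<open>*\<^sub>2\<close> of the composition.\<close>
  have r: "CC.r x w = r x w" for x w
  proof (rule qspace.b_eqI'[OF Q(1)])
    fix v
    show "polar V2 v (CC.r x w) = polar V2 v (r x w)"
      using CC.r_b[of v x w] theta by (simp add: pol SP.H3.W.b_sym[of w])
  qed
  have P: "P \<in> alg_hom (clifford_algebra A1) (End_algebra (scal V2))"
    "R \<in> alg_hom (clifford_algebra A1) (End_algebra (scal V3'))"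
    using split_pair.p_hom[OF cf(1)] split_pair.q_hom[OF cf(1)] by (simp_all add: V3')
  have eq: "map_prod g2 g3 (\<phi> \<xi>) = comp_C0_alpha (V1, V2, V3', l) (clifford_induced A1 (End_qp V1) g1 \<xi>)"
    if xi: "\<xi> \<in> carrier (clifford_algebra A1)" for \<xi>
  proof -
    have m: "clifford_map A1 a = S1.m x y" if "a \<in> carrier A1" "g1 a = tens V1 x y" for a x y
      using that by (metis S1.dl_g S1.m_def)
    have "comp_C0_alpha (V1, V2, V3', l) (clifford_induced A1 (End_qp V1) g1 \<xi>) = (P \<xi>, R \<xi>)"
      by (rule CC.C0_alpha_eqI[OF S1 P _ _ xi]) (simp_all add: m r SP.rl SP.lr)
    then show ?thesis by (simp add: P_def R_def map_prod_def split_beta)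
  qed
  have "triple_isomorphic (A1, A2, A3, \<phi>) (End_comp (V1, V2, V3', l))"
    unfolding triple_isomorphic_def End_comp_def prod.case
    using qp_split_iso[OF S1] qp_split_iso[OF S2] qp_split_iso[OF S3'] eq by blast
  with comp show ?thesis unfolding V3'_def by blast
qed

theorem composition_exists:
  fixes A1 :: "('f::field, 'a1, 'f) qp_algebra"
  assumes T: "trialitarian_triple (A1, A2, A3, \<phi>)"
    and sp: "split_algebra A1" "split_algebra A2" "split_algebra A3"
  shows "\<exists>C :: ('f, 'f ^ 8, 'f ^ 8, 'f ^ 8) comp.
            composition C 8 \<and> triple_isomorphic (A1, A2, A3, \<phi>) (End_comp C)"
proof -
  have ex: "\<exists>(V :: ('f, 'f ^ 8) quad_space) e eps \<gamma>. qp_split A V 8 e eps \<gamma>"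
    if A: "central_simple A 8" "quadratic_pair A" "split_algebra A" for A :: "('f, 'x, 'f) qp_algebra"
  proof -
    obtain e eps \<gamma> where "split_alg A ((*s) :: 'f \<Rightarrow> 'f ^ 8 \<Rightarrow> 'f ^ 8) 8 e eps \<gamma>"
      using split_alg_exists[where 'n=8, of A 8] A by (auto simp: central_simple_def)
    from quadratic_pair_realize[OF this A(2)] show ?thesis by blast
  qed
  note t = T[unfolded trialitarian_triple_def prod.case]
  obtain V1 :: "('f, 'f ^ 8) quad_space" and e1 eps1 g1 where "qp_split A1 V1 8 e1 eps1 g1" using ex t sp by blast
  moreover obtain V2 :: "('f, 'f ^ 8) quad_space" and e2 eps2 g2 where "qp_split A2 V2 8 e2 eps2 g2" using ex t sp by blast
  moreover obtain V3 :: "('f, 'f ^ 8) quad_space" and e3 eps3 g3 where "qp_split A3 V3 8 e3 eps3 g3" using ex t sp by blast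
  ultimately show ?thesis using split_triple_realize[of A1 V1 8 e1 eps1 g1 A2 V2 e2 eps2 g2 A3 V3 e3 eps3 g3 \<phi>] t
    by fastforce
qed

theorem theorem3p2:
  fixes A\<^sub>1 :: "('f::field, 'a\<^sub>1, 'f) qp_algebra"
    and A\<^sub>2 :: "('f, 'a\<^sub>2, 'f) qp_algebra"
    and A\<^sub>3 :: "('f, 'a\<^sub>3, 'f) qp_algebra"
    and \<phi>\<^sub>0 :: "('a\<^sub>1 list \<Rightarrow>\<^sub>0 'f) set \<Rightarrow> 'a\<^sub>2 \<times> 'a\<^sub>3"
  assumes "trialitarian_triple (A\<^sub>1, A\<^sub>2, A\<^sub>3, \<phi>\<^sub>0)"
    and "split_algebra A\<^sub>1" "split_algebra A\<^sub>2" "split_algebra A\<^sub>3"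
  shows "(\<exists>C :: ('f, 'f ^ 8, 'f ^ 8, 'f ^ 8) comp.
            composition C 8 \<and> triple_isomorphic (A\<^sub>1, A\<^sub>2, A\<^sub>3, \<phi>\<^sub>0) (End_comp C)) \<and>
         (\<forall>(C :: ('f, 'u\<^sub>1::ab_group_add, 'u\<^sub>2::ab_group_add, 'u\<^sub>3::ab_group_add) comp)
           (D :: ('f, 'v\<^sub>1::ab_group_add, 'v\<^sub>2::ab_group_add, 'v\<^sub>3::ab_group_add) comp).
            composition C 8 \<and> triple_isomorphic (A\<^sub>1, A\<^sub>2, A\<^sub>3, \<phi>\<^sub>0) (End_comp C) \<and>
            composition D 8 \<and> triple_isomorphic (A\<^sub>1, A\<^sub>2, A\<^sub>3, \<phi>\<^sub>0) (End_comp D) \<longrightarrow>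
            composition_similar C D)"
proof (intro conjI allI impI)
  show "\<exists>C :: ('f, 'f ^ 8, 'f ^ 8, 'f ^ 8) comp.
      composition C 8 \<and> triple_isomorphic (A\<^sub>1, A\<^sub>2, A\<^sub>3, \<phi>\<^sub>0) (End_comp C)"
    by (rule composition_exists[OF assms])
  fix C :: "('f, 'u\<^sub>1, 'u\<^sub>2, 'u\<^sub>3) comp" and D :: "('f, 'v\<^sub>1, 'v\<^sub>2, 'v\<^sub>3) comp"
  assume "composition C 8 \<and> triple_isomorphic (A\<^sub>1, A\<^sub>2, A\<^sub>3, \<phi>\<^sub>0) (End_comp C) \<and>
    composition D 8 \<and> triple_isomorphic (A\<^sub>1, A\<^sub>2, A\<^sub>3, \<phi>\<^sub>0) (End_comp D)"
  then show "composition_similar C D"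
    using composition_unique[OF assms(1)] by (cases C, cases D) blast
qed

end
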